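(* (1) Let $\lambda=(\lambda_1^{m_1},\ldots,\lambda_r^{m_r})$ be a partition, where $0<\lambda_1<\cdots<\lambda_r$ are integers and $m_1,\ldots,m_r$ are positive integers. The Cartan matrix $C=(c_{ij})$ of $M_\lambda(E)$, where $c_{ij}=[P_i:D_j]$, is the $r\times r$ matrix given by $$c_{ij}=\min\{\lambda_i,\lambda_j\}\quad\text{for all }1\le i,j\le r.$$ In particular, $M_\lambda(E)$ has a single block. (2) Let $K$ be a perfect field, let $T$ be an $n\times n$ matrix with entries in $K$, and let $\mathcal{A}$ be the centralizer algebra of $T$. Then $\mathcal{A}$ has one block $\mathcal{A}_p$ for each irreducible factor $p$ of the characteristic polynomial of $T$. The Cartan matrix of $\mathcal{A}$ is the direct sum (block diagonal matrix) of the Cartan matrices of the algebras $\mathcal{A}_p$, and the Cartan matrix of $\mathcal{A}_p$ is the matrix of part (1) for the partition $\lambda$ associated with $p$.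
   Context: $K$ is a perfect field. Modules are left modules. For a finite dimensional algebra with a complete set of representatives $P_1,\ldots,P_l$ of the isomorphism classes of principal indecomposable modules (indecomposable direct summands of the algebra as a left module over itself), let $D_i=P_i/\mathrm{rad}(P_i)$, so that $D_1,\ldots,D_l$ represent the isomorphism classes of simple modules. $[M:D]$ denotes the number of composition factors isomorphic to $D$ in a composition series of $M$, and the Cartan matrix is the $l\times l$ matrix $([P_i:D_j])$; for an unspecified ordering of the $P_i$ it is understood up to simultaneous permutation of rows and columns. In part (1), $E=K[t]/p(t)$ for an irreducible polynomial $p(t)\in K[t]$. The notation $\lambda=(\lambda_1^{m_1},\ldots,\lambda_r^{m_r})$ means the part $\lambda_i$ occurs $m_i$ times, $E_\lambda=E[t]/(t^{\lambda_1})^{\oplus m_1}\oplus\cdots\oplus E[t]/(t^{\lambda_r})^{\oplus m_r}$ as an $E[t]$-module, and $M_\lambda(E)=\mathrm{End}_{E[t]}(E_\lambda)$. The principal indecomposable $M_\lambda(E)$-modules are represented by $P_i=M_\lambda(E)e_{i1}$, $1\le i\le r$, where $e_{i1}\in M_\lambda(E)$ is the idempotent projecting $E_\lambda$ onto the first of the $m_i$ summands $E[t]/(t^{\lambda_i})$ along all the other summands. In part (2), the centralizer algebra of $T$ is the $K$-algebra $\mathcal{A}$ of all matrices $B$ with $TB=BT$. The matrix $T$ is similar to a block diagonal matrix $\bigoplus_p T_p$, with $p$ ranging over the distinct irreducible factors of the characteristic polynomial of $T$ and the characteristic polynomial of $T_p$ a power of $p$. Correspondingly $\mathcal{A}=\bigoplus_p\mathcal{A}_p$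 as a direct sum of two-sided ideals, where $\mathcal{A}_p$ is the ring of matrices commuting with $T_p$. Since $K$ is perfect, for each $p$ there is a unique partition $\lambda$ with $\mathcal{A}_p\cong M_\lambda(E)$, where $E=K[t]/p(t)$; this is the partition associated with $p$. A block is an indecomposable two-sided direct factor of the algebra. *)

theory Defs
  imports
    "Jordan_Normal_Form.Char_Poly"
    "HOL-Algebra.Algebraic_Closure_Type"
begin

definition perfect_field :: "'k::field itself \<Rightarrow> bool" where
  "perfect_field _ \<longleftrightarrow> CHAR('k) = 0 \<or> (\<forall>x::'k. \<exists>y. y ^ CHAR('k) = x)"


section \<open>Left modules\<close>

text \<open>
  The locale \<^locale>\<open>module\<close> requires a commutative ring of scalars. The records of the type
  \<^type>\<open>module\<close> and the predicate \<^const>\<open>submodule\<close> do not, and are used below for left modules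
  over arbitrary rings. As in \<^const>\<open>module_vec\<close>, the ring multiplication and unit of such a
  record play no role.
\<close>

definition regular_module :: "('a, 'x) ring_scheme \<Rightarrow> ('a, 'a) module" where
  "regular_module R =
    \<lparr>carrier = carrier R, mult = mult R, one = \<one>\<^bsub>R\<^esub>, zero = \<zero>\<^bsub>R\<^esub>, add = add R, smult = mult R\<rparr>"

definition quotient_module :: "('a, 'b, 'y) module_scheme \<Rightarrow> 'b set \<Rightarrow> ('a, 'b set) module" where
  "quotient_module M N =
    \<lparr>carrier = a_rcosets\<^bsub>M\<^esub> N, mult = undefined, one = undefined, zero = N, add = set_add M,
     smult = (\<lambda>a U. \<Union>x\<in>U. N +>\<^bsub>M\<^esub> (a \<odot>\<^bsub>M\<^esub> x))\<rparr>"

text \<open>This is the direct sum only for finite index sets.\<close>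

definition direct_sum_module :: "'i set \<Rightarrow> ('i \<Rightarrow> ('a, 'b, 'y) module_scheme) \<Rightarrow> ('a, 'i \<Rightarrow> 'b) module" where
  "direct_sum_module I F =
    \<lparr>carrier = (\<Pi>\<^sub>E i\<in>I. carrier (F i)), mult = undefined, one = undefined,
     zero = (\<lambda>i\<in>I. \<zero>\<^bsub>F i\<^esub>), add = (\<lambda>x y. \<lambda>i\<in>I. x i \<oplus>\<^bsub>F i\<^esub> y i),
     smult = (\<lambda>a x. \<lambda>i\<in>I. a \<odot>\<^bsub>F i\<^esub> x i)\<rparr>"

definition lmod_hom ::
  "('a, 'x) ring_scheme \<Rightarrow> ('a, 'b, 'y) module_scheme \<Rightarrow> ('a, 'c, 'z) module_scheme \<Rightarrow> ('b \<Rightarrow> 'c) set" where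
  "lmod_hom R M N =
    {f \<in> carrier M \<rightarrow> carrier N.
      (\<forall>x\<in>carrier M. \<forall>y\<in>carrier M. f (x \<oplus>\<^bsub>M\<^esub> y) = f x \<oplus>\<^bsub>N\<^esub> f y) \<and>
      (\<forall>a\<in>carrier R. \<forall>x\<in>carrier M. f (a \<odot>\<^bsub>M\<^esub> x) = a \<odot>\<^bsub>N\<^esub> f x)}"

definition lmod_isomorphic ::
  "('a, 'x) ring_scheme \<Rightarrow> ('a, 'b, 'y) module_scheme \<Rightarrow> ('a, 'c, 'z) module_scheme \<Rightarrow> bool" where
  "lmod_isomorphic R M N \<longleftrightarrow> (\<exists>f\<in>lmod_hom R M N. bij_betw f (carrier M) (carrier N))"

definition simple_module :: "('a, 'x) ring_scheme \<Rightarrow> ('a, 'b, 'y) module_scheme \<Rightarrow> bool" where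
  "simple_module R M \<longleftrightarrow>
    carrier M \<noteq> {\<zero>\<^bsub>M\<^esub>} \<and> (\<forall>N. submodule N R M \<longrightarrow> N = {\<zero>\<^bsub>M\<^esub>} \<or> N = carrier M)"

definition indecomposable_module :: "('a, 'x) ring_scheme \<Rightarrow> ('a, 'b, 'y) module_scheme \<Rightarrow> bool" where
  "indecomposable_module R M \<longleftrightarrow>
    carrier M \<noteq> {\<zero>\<^bsub>M\<^esub>} \<and>
    \<not> (\<exists>N N'. submodule N R M \<and> submodule N' R M \<and> N \<noteq> {\<zero>\<^bsub>M\<^esub>} \<and> N' \<noteq> {\<zero>\<^bsub>M\<^esub>} \<and>
         N \<inter> N' = {\<zero>\<^bsub>M\<^esub>} \<and> N <+>\<^bsub>M\<^esub> N' = carrier M)"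

definition maximal_submodule :: "'b set \<Rightarrow> ('a, 'x) ring_scheme \<Rightarrow> ('a, 'b, 'y) module_scheme \<Rightarrow> bool" where
  "maximal_submodule N R M \<longleftrightarrow>
    submodule N R M \<and> N \<noteq> carrier M \<and>
    (\<forall>N'. submodule N' R M \<and> N \<subseteq> N' \<longrightarrow> N' = N \<or> N' = carrier M)"

definition module_radical :: "('a, 'x) ring_scheme \<Rightarrow> ('a, 'b, 'y) module_scheme \<Rightarrow> 'b set" where
  "module_radical R M = carrier M \<inter> \<Inter> {N. maximal_submodule N R M}"

text \<open>The factors of a series \<open>Ns ! 0 \<subseteq> Ns ! 1 \<subseteq> \<dots>\<close> of submodules of \<open>M\<close>.\<close>

definition series_factor :: "('a, 'b, 'y) module_scheme \<Rightarrow> 'b set list \<Rightarrow> nat \<Rightarrow> ('a, 'b set) module" where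
  "series_factor M Ns i = quotient_module (M\<lparr>carrier := Ns ! Suc i\<rparr>) (Ns ! i)"

definition composition_series ::
  "('a, 'x) ring_scheme \<Rightarrow> ('a, 'b, 'y) module_scheme \<Rightarrow> 'b set list \<Rightarrow> bool" where
  "composition_series R M Ns \<longleftrightarrow>
    Ns \<noteq> [] \<and> hd Ns = {\<zero>\<^bsub>M\<^esub>} \<and> last Ns = carrier M \<and>
    (\<forall>N\<in>set Ns. submodule N R M) \<and>
    (\<forall>i. Suc i < length Ns \<longrightarrow> Ns ! i \<subseteq> Ns ! Suc i \<and> simple_module R (series_factor M Ns i))"

text \<open>The multiplicity \<open>[M : D]\<close>; it does not depend on the series by Jordan--Hoelder.\<close>

definition composition_multiplicity ::
  "('a, 'x) ring_scheme \<Rightarrow> ('a, 'b, 'y) module_scheme \<Rightarrow> ('a, 'c, 'z) module_scheme \<Rightarrow> nat" where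
  "composition_multiplicity R M D =
    (THE c. \<exists>Ns. composition_series R M Ns \<and>
       c = card {i. Suc i < length Ns \<and> lmod_isomorphic R (series_factor M Ns i) D})"


section \<open>Principal indecomposable modules, Cartan matrices and blocks\<close>

text \<open>A principal indecomposable module is represented by its carrier, a left ideal.\<close>

definition left_ideal_module :: "('a, 'x) ring_scheme \<Rightarrow> 'a set \<Rightarrow> ('a, 'a) module" where
  "left_ideal_module R P = (regular_module R)\<lparr>carrier := P\<rparr>"

definition principal_indecomposable :: "('a, 'x) ring_scheme \<Rightarrow> 'a set \<Rightarrow> bool" where
  "principal_indecomposable R P \<longleftrightarrow>
    submodule P R (regular_module R) \<and>
    (\<exists>Q. submodule Q R (regular_module R) \<and> P \<inter> Q = {\<zero>\<^bsub>R\<^esub>} \<and> P <+>\<^bsub>R\<^esub> Q = carrier R) \<and>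
    indecomposable_module R (left_ideal_module R P)"

definition pim_representatives :: "('a, 'x) ring_scheme \<Rightarrow> 'a set list \<Rightarrow> bool" where
  "pim_representatives R Ps \<longleftrightarrow>
    (\<forall>P\<in>set Ps. principal_indecomposable R P) \<and>
    (\<forall>i<length Ps. \<forall>j<length Ps. i \<noteq> j \<longrightarrow>
       \<not> lmod_isomorphic R (left_ideal_module R (Ps ! i)) (left_ideal_module R (Ps ! j))) \<and>
    (\<forall>P. principal_indecomposable R P \<longrightarrow>
       (\<exists>P'\<in>set Ps. lmod_isomorphic R (left_ideal_module R P) (left_ideal_module R P')))"

definition pim_head :: "('a, 'x) ring_scheme \<Rightarrow> 'a set \<Rightarrow> ('a, 'a set) module" where
  "pim_head R P =
    quotient_module (left_ideal_module R P) (module_radical R (left_ideal_module R P))"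

definition cartan_matrix :: "('a, 'x) ring_scheme \<Rightarrow> 'a set list \<Rightarrow> nat mat" where
  "cartan_matrix R Ps = mat (length Ps) (length Ps)
    (\<lambda>(i, j). composition_multiplicity R (left_ideal_module R (Ps ! i)) (pim_head R (Ps ! j)))"

text \<open>
  The Cartan matrix of a ring is determined up to simultaneous permutation of rows and columns;
  the following holds for all matrices obtained from the different orderings.
\<close>

definition is_cartan_matrix :: "('a, 'x) ring_scheme \<Rightarrow> nat mat \<Rightarrow> bool" where
  "is_cartan_matrix R C \<longleftrightarrow> (\<exists>Ps. pim_representatives R Ps \<and> C = cartan_matrix R Ps)"

text \<open>
  For a direct factor \<open>B\<close> of \<open>R\<close>, the two-sided ideals of the ring \<open>B\<close> are those of \<open>R\<close>
  contained in \<open>B\<close>.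
\<close>

definition is_block :: "('a, 'x) ring_scheme \<Rightarrow> 'a set \<Rightarrow> bool" where
  "is_block R B \<longleftrightarrow>
    ideal B R \<and> B \<noteq> {\<zero>\<^bsub>R\<^esub>} \<and>
    (\<exists>B'. ideal B' R \<and> B \<inter> B' = {\<zero>\<^bsub>R\<^esub>} \<and> B <+>\<^bsub>R\<^esub> B' = carrier R) \<and>
    \<not> (\<exists>I J. ideal I R \<and> ideal J R \<and> I \<noteq> {\<zero>\<^bsub>R\<^esub>} \<and> J \<noteq> {\<zero>\<^bsub>R\<^esub>} \<and>
         I \<inter> J = {\<zero>\<^bsub>R\<^esub>} \<and> I <+>\<^bsub>R\<^esub> J = B)"


section \<open>The algebras \<open>M\<^sub>\<lambda>(E)\<close>\<close>

text \<open>A partition \<open>(\<lambda>\<^sub>1^m\<^sub>1, \<dots>, \<lambda>\<^sub>r^m\<^sub>r)\<close> with \<open>r \<ge> 1\<close> is the list of the pairs \<open>(\<lambda>\<^sub>i, m\<^sub>i)\<close>.\<close>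

definition exp_partition :: "(nat \<times> nat) list \<Rightarrow> bool" where
  "exp_partition lam \<longleftrightarrow>
    lam \<noteq> [] \<and> (\<forall>(l, m)\<in>set lam. 0 < l \<and> 0 < m) \<and> sorted_wrt (<) (map fst lam)"

abbreviation Poly_Ring :: "('e, 'x) ring_scheme \<Rightarrow> 'e list ring" where
  "Poly_Ring E \<equiv> univ_poly E (carrier E)"

text \<open>\<open>E[t]/(t^l)\<close> as an \<open>E[t]\<close>-module\<close>

definition truncated_module :: "('e, 'x) ring_scheme \<Rightarrow> nat \<Rightarrow> ('e list, 'e list set) module" where
  "truncated_module E l =
    quotient_module (regular_module (Poly_Ring E))
      (PIdl\<^bsub>Poly_Ring E\<^esub> (X\<^bsub>E\<^esub> [^]\<^bsub>Poly_Ring E\<^esub> l))"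

text \<open>The pair \<open>(i, k)\<close> stands for the \<open>k\<close>-th copy of \<open>E[t]/(t^\<lambda>\<^sub>i)\<close>, counting from 0.\<close>

definition summands :: "(nat \<times> nat) list \<Rightarrow> (nat \<times> nat) set" where
  "summands lam = {(i, k). i < length lam \<and> k < snd (lam ! i)}"

definition E_lam ::
  "('e, 'x) ring_scheme \<Rightarrow> (nat \<times> nat) list \<Rightarrow> ('e list, nat \<times> nat \<Rightarrow> 'e list set) module" where
  "E_lam E lam =
    direct_sum_module (summands lam) (\<lambda>(i, k). truncated_module E (fst (lam ! i)))"

text \<open>
  The ring \<open>End\<^bsub>E[t]\<^esub>(E\<^sub>\<lambda>)\<close>, with composition of maps as multiplication, and its structure of
  an \<open>E\<close>-algebra. Maps are extensional, so that equality of maps on \<open>E\<^sub>\<lambda>\<close> is equality.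
\<close>

definition M_lam ::
  "('e, 'x) ring_scheme \<Rightarrow> (nat \<times> nat) list \<Rightarrow>
    ('e, (nat \<times> nat \<Rightarrow> 'e list set) \<Rightarrow> (nat \<times> nat \<Rightarrow> 'e list set)) module" where
  "M_lam E lam = (let V = E_lam E lam in
    \<lparr>carrier = lmod_hom (Poly_Ring E) V V \<inter> extensional (carrier V),
     mult = (\<lambda>f g. compose (carrier V) f g),
     one = (\<lambda>v\<in>carrier V. v),
     zero = (\<lambda>v\<in>carrier V. \<zero>\<^bsub>V\<^esub>),
     add = (\<lambda>f g. \<lambda>v\<in>carrier V. f v \<oplus>\<^bsub>V\<^esub> g v),
     smult = (\<lambda>c f. \<lambda>v\<in>carrier V. ring.poly_of_const E c \<odot>\<^bsub>V\<^esub> f v)\<rparr>)"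

text \<open>The idempotent projecting \<open>E\<^sub>\<lambda>\<close> onto the first copy of \<open>E[t]/(t^\<lambda>\<^sub>i)\<close>\<close>

definition proj_lam ::
  "('e, 'x) ring_scheme \<Rightarrow> (nat \<times> nat) list \<Rightarrow> nat \<Rightarrow>
    (nat \<times> nat \<Rightarrow> 'e list set) \<Rightarrow> (nat \<times> nat \<Rightarrow> 'e list set)" where
  "proj_lam E lam i = (\<lambda>v\<in>carrier (E_lam E lam). \<lambda>x\<in>summands lam.
     if x = (i, 0) then v x else \<zero>\<^bsub>E_lam E lam\<^esub> x)"

text \<open>For a noncommutative ring, \<^const>\<open>cgenideal\<close> is the left ideal generated by an element.\<close>

definition pim_lam ::
  "('e, 'x) ring_scheme \<Rightarrow> (nat \<times> nat) list \<Rightarrow> nat \<Rightarrow>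
    ((nat \<times> nat \<Rightarrow> 'e list set) \<Rightarrow> (nat \<times> nat \<Rightarrow> 'e list set)) set" where
  "pim_lam E lam i = PIdl\<^bsub>M_lam E lam\<^esub> (proj_lam E lam i)"

definition min_matrix :: "(nat \<times> nat) list \<Rightarrow> nat mat" where
  "min_matrix lam =
    mat (length lam) (length lam) (\<lambda>(i, j). min (fst (lam ! i)) (fst (lam ! j)))"


section \<open>Centralizer algebras of matrices\<close>

definition residue_field :: "'k::field poly \<Rightarrow> 'k poly set ring" where
  "residue_field p = ring_of_type_algebra Quot (PIdl\<^bsub>ring_of_type_algebra\<^esub> p)"

definition centralizer_algebra :: "'k::field mat \<Rightarrow> ('k, 'k mat) module" where
  "centralizer_algebra T = (module_mat TYPE('k) (dim_row T) (dim_row T))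
     \<lparr>carrier := {B \<in> carrier_mat (dim_row T) (dim_row T). T * B = B * T}\<rparr>"

definition irreducible_factors :: "'k::field poly \<Rightarrow> 'k poly set" where
  "irreducible_factors f =
    {p. Factorial_Ring.irreducible p \<and> Polynomial.lead_coeff p = 1 \<and> p dvd f}"

text \<open>
  \<open>T = P * diag(T\<^sub>p) * Q\<close> with \<open>Q\<close> the inverse of \<open>P\<close>, where \<open>p\<close> ranges over the list \<open>ps\<close> of the
  distinct monic irreducible factors of the characteristic polynomial of \<open>T\<close>, and \<open>Ts\<close> is the
  list of the \<open>T\<^sub>p\<close>.
\<close>

definition primary_decomposition ::
  "'k::field mat \<Rightarrow> 'k poly list \<Rightarrow> 'k mat list \<Rightarrow> 'k mat \<Rightarrow> 'k mat \<Rightarrow> bool" where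
  "primary_decomposition T ps Ts P Q \<longleftrightarrow>
    distinct ps \<and> set ps = irreducible_factors (char_poly T) \<and>
    length Ts = length ps \<and>
    (\<forall>k<length ps. square_mat (Ts ! k) \<and> (\<exists>e. char_poly (Ts ! k) = (ps ! k) ^ e)) \<and>
    similar_mat_wit T (diag_block_mat Ts) P Q"

text \<open>
  The two-sided ideal of the centralizer algebra of \<open>T\<close> corresponding to the centralizer algebra
  of \<open>Ts ! k\<close>
\<close>

definition primary_ideal :: "'k::field mat list \<Rightarrow> 'k mat \<Rightarrow> 'k mat \<Rightarrow> nat \<Rightarrow> 'k mat set" where
  "primary_ideal Ts P Q k =
    {P * diag_block_mat (map (\<lambda>j. if j = k then B else 0\<^sub>m (dim_row (Ts ! j)) (dim_row (Ts ! j)))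
           [0..<length Ts]) * Q | B. B \<in> carrier (centralizer_algebra (Ts ! k))}"

text \<open>
  \<open>lam\<close> is a partition for which the centralizer algebra of \<open>S\<close> and \<open>M\<^sub>\<lambda>(K[t]/p)\<close> are isomorphic
  as \<open>K\<close>-algebras, \<open>K\<close> being embedded in \<open>K[t]/p\<close> by the constant polynomials.
\<close>

definition associated_partition :: "'k::field poly \<Rightarrow> 'k mat \<Rightarrow> (nat \<times> nat) list \<Rightarrow> bool" where
  "associated_partition p S lam \<longleftrightarrow>
    exp_partition lam \<and>
    (\<exists>h \<in> ring_iso (centralizer_algebra S) (M_lam (residue_field p) lam).
       \<forall>c. \<forall>B\<in>carrier (centralizer_algebra S).
         h (c \<cdot>\<^sub>m B) =
           ((PIdl\<^bsub>ring_of_type_algebra\<^esub> p) +>\<^bsub>ring_of_type_algebra\<^esub> [:c:])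
             \<odot>\<^bsub>M_lam (residue_field p) lam\<^esub> h B)"

end

theory Submission
  imports Defs "HOL-Library.Function_Algebras"
begin

text \<open>
  For a family of exponents \<open>L\<close> let \<open>V\<close> be the direct sum of the modules \<open>K[t]/(p\<^bsup>L x\<^esup>)\<close>.
  Evaluation at the generator of the summand \<open>x\<close> identifies the principal indecomposable
  \<open>End(V) e\<^sub>x\<close> with the kernel of \<open>p\<^bsup>L x\<^esup>\<close> on \<open>V\<close>. For a submodule \<open>N\<close> of \<open>V\<close> over \<open>End(V)\<close>
  let \<open>h\<^sub>x N\<close> be the least \<open>h\<close> such that \<open>p\<^bsup>h\<^esup>\<close> kills \<open>e\<^sub>x N\<close>. In a simple factor \<open>N' / N\<close> this number grows
  by one if the factor is the head of \<open>End(V) e\<^sub>x\<close>, and is constant otherwise; hence the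
  multiplicity of this head in the kernel of \<open>p\<^bsup>l\<^esup>\<close> is \<open>min l (L x)\<close>.

  As \<open>p\<close> is separable, \<open>t \<mapsto> \<theta> + u\<close> with \<open>\<theta>\<close> the class of \<open>t\<close> in \<open>E = K[t]/p\<close> induces isomorphisms
  \<open>K[t]/p\<^bsup>l\<^esup> \<cong> E[u]/u\<^bsup>l\<^esup>\<close>, by which \<open>M\<^sub>\<lambda>(E)\<close> becomes \<open>End(V)\<close>. The centralizer of a matrix \<open>T\<close> is the
  endomorphism ring of the \<open>K[t]\<close>-module defined by \<open>T\<close>. Matrices that intertwine the primary parts
  of \<open>T\<close> for different primes vanish, so this centralizer is the product of the centralizers of
  the \<open>T\<^sub>p\<close>, and each of these is some \<open>M\<^sub>\<lambda>(E)\<close> by the structure theorem for modules over \<open>K[t]\<close>.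
\<close>

section \<open>Groups with operators\<close>

text \<open>Each summand K[t]/(p^l) is uniserial. So the single number \<open>hh x N\<close> fixes
  \<open>e_x N\<close>, and an endomorphism carries \<open>w\<close> to \<open>e_x g\<close>
  whenever the order of \<open>g x\<close> is at most that of \<open>w x\<close> (lemma
  \<open>transport\<close>). A simple factor \<open>N' / N\<close> is killed by \<open>p\<close>,
  because \<open>N + p N'\<close> lies between \<open>N\<close> and \<open>N'\<close> and
  \<open>p\<close> is nilpotent; this is why the number grows by at most one. The count holds along
  every composition series, which gives the uniqueness asked for by the definite description of the
  multiplicity; existence of a series comes from the strict growth of the sum of the
  \<open>hh x N\<close>. That every principal indecomposable is some End(V) e_x rests on an element
  \<open>y\<close> fixed by its idempotent, killed by \<open>p ^ L x\<close> and with coordinate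
  \<open>x\<close> prime to \<open>p\<close>: evaluation at \<open>y\<close> then splits.
  Perfectness enters as coprimality of \<open>p\<close> and its derivative, the linear coefficient
  of the Taylor expansion of \<open>p\<close> at \<open>\<theta>\<close>. Rings are compared through
  one notion of finite product, a ring isomorphism being a product with one factor. For matrices,
  division by \<open>t - A\<close> gives both Cayley-Hamilton and the shape of the characteristic
  polynomial of a block, without leaving K.\<close>

text \<open>Only the closure and distributivity of the operators is needed for submodules, quotients and
  composition series; neither a ring structure on \<open>R\<close> nor unitality is assumed.\<close>

locale lmod = abelian_group M for R :: "('a, 'x) ring_scheme" and M :: "('a, 'b, 'y) module_scheme" (structure) +
  assumes smult_closed: "\<lbrakk>a \<in> carrier R; x \<in> carrier M\<rbrakk> \<Longrightarrow> a \<odot> x \<in> carrier M"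
    and smult_r_distr: "\<lbrakk>a \<in> carrier R; x \<in> carrier M; y \<in> carrier M\<rbrakk> \<Longrightarrow> a \<odot> (x \<oplus> y) = a \<odot> x \<oplus> a \<odot> y"
begin

lemma smult_zero: "a \<in> carrier R \<Longrightarrow> a \<odot> \<zero> = \<zero>"
  by (metis add.r_cancel_one' r_zero smult_closed smult_r_distr zero_closed)

lemma smult_minus:
  assumes "a \<in> carrier R" "x \<in> carrier M"
  shows "a \<odot> (\<ominus> x) = \<ominus> (a \<odot> x)"
  by (metis assms a_inv_closed minus_equality r_neg l_neg smult_closed smult_r_distr smult_zero)

lemma submodule_iff:
  "submodule N R M \<longleftrightarrow> N \<subseteq> carrier M \<and> \<zero> \<in> N \<and> (\<forall>x\<in>N. \<forall>y\<in>N. x \<oplus> y \<in> N) \<and>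
     (\<forall>x\<in>N. \<ominus> x \<in> N) \<and> (\<forall>a\<in>carrier R. \<forall>x\<in>N. a \<odot> x \<in> N)"
  unfolding submodule_def submodule_axioms_def subgroup_def a_inv_def by auto

lemma submoduleD:
  assumes "submodule N R M"
  shows "N \<subseteq> carrier M" "\<zero> \<in> N" "\<And>x y. x \<in> N \<Longrightarrow> y \<in> N \<Longrightarrow> x \<oplus> y \<in> N"
    "\<And>x. x \<in> N \<Longrightarrow> \<ominus> x \<in> N" "\<And>a x. a \<in> carrier R \<Longrightarrow> x \<in> N \<Longrightarrow> a \<odot> x \<in> N"
    "\<And>x y. x \<in> N \<Longrightarrow> y \<in> N \<Longrightarrow> x \<ominus> y \<in> N"
  using assms unfolding submodule_iff a_minus_def by blast+

lemma submodule_carrier: "submodule (carrier M) R M"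
  unfolding submodule_iff by (auto simp: smult_closed)

lemma submodule_zero: "submodule {\<zero>} R M"
  unfolding submodule_iff by (auto simp: smult_zero)

lemma submodule_Inter:
  assumes "\<And>N. N \<in> \<N> \<Longrightarrow> submodule N R M"
  shows "submodule (carrier M \<inter> \<Inter>\<N>) R M"
  using assms unfolding submodule_iff by (fastforce simp: smult_closed)

lemma lmod_restrict:
  assumes "submodule N R M"
  shows "lmod R (M\<lparr>carrier := N\<rparr>)"
proof -
  note d = submoduleD[OF assms]
  have "abelian_group (M\<lparr>carrier := N\<rparr>)"
  proof (rule abelian_groupI, simp_all add: d)
    fix x assume "x \<in> N" then show "\<exists>y\<in>N. y \<oplus> x = \<zero>" using d(1,4) l_neg by blast
  qed (use d(1) in \<open>auto simp: a_ac subset_iff\<close>)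
  then show ?thesis
    by (auto simp: lmod_def lmod_axioms_def d intro!: smult_r_distr subsetD[OF d(1)])
qed

text \<open>\<open>a_inv\<close> is a definite description over the carrier, so its value has to be
  recomputed when the carrier shrinks.\<close>

lemma minus_restrict:
  assumes "submodule N R M" "x \<in> N"
  shows "a_inv (M\<lparr>carrier := N\<rparr>) x = \<ominus> x"
proof -
  interpret N: lmod R "M\<lparr>carrier := N\<rparr>" by (rule lmod_restrict[OF assms(1)])
  note d = submoduleD[OF assms(1)]
  show ?thesis
    by (rule N.minus_equality) (use assms(2) d in \<open>auto intro!: l_neg\<close>)
qed

lemma submodule_restrict_iff:
  assumes "submodule N R M"
  shows "submodule N' R (M\<lparr>carrier := N\<rparr>) \<longleftrightarrow> submodule N' R M \<and> N' \<subseteq> N"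
proof -
  interpret N: lmod R "M\<lparr>carrier := N\<rparr>" by (rule lmod_restrict[OF assms(1)])
  note d = submoduleD[OF assms(1)]
  show ?thesis
    unfolding N.submodule_iff submodule_iff
    using d(1) minus_restrict[OF assms(1)] by (auto simp: subset_iff)
qed

context fixes N assumes N: "submodule N R M"
begin

lemma abelian_subgroup_submodule: "abelian_subgroup N M"
  using N unfolding submodule_def
  by (intro abelian_subgroupI3) (auto simp: additive_subgroup_def abelian_group_axioms)

lemma coset_eq_iff:
  assumes "x \<in> carrier M" "y \<in> carrier M"
  shows "N +> x = N +> y \<longleftrightarrow> x \<ominus> y \<in> N"
proof -
  interpret N: abelian_subgroup N M by (rule abelian_subgroup_submodule)
  show ?thesis
    using N.a_rcos_module[of y x] a_repr_independence[of x N y] N.a_rcos_self[of x] N.a_subgroup assms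
    unfolding a_minus_def by metis
qed

lemma coset_self: "x \<in> carrier M \<Longrightarrow> x \<in> N +> x"
  using abelian_subgroup_submodule by (rule abelian_subgroup.a_rcos_self)

lemma coset_zero_iff: "x \<in> carrier M \<Longrightarrow> N +> x = N \<longleftrightarrow> x \<in> N"
  using coset_eq_iff[of x \<zero>] a_coset_add_zero[of N] submoduleD(1)[OF N]
  by (simp add: minus_eq add.inv_one a_inv_def)

lemma mem_cosetD:
  assumes "y \<in> N +> x" "x \<in> carrier M"
  shows "y \<in> carrier M" "N +> y = N +> x"
proof -
  obtain n where n: "n \<in> N" "y = n \<oplus> x" using assms(1) unfolding a_r_coset_def' by blast
  have nM: "n \<in> carrier M" using n submoduleD(1)[OF N] by auto
  show "y \<in> carrier M" using n assms(2) nM by auto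
  then show "N +> y = N +> x"
    using n nM assms(2) by (subst coset_eq_iff) (auto simp: a_minus_def a_assoc r_neg)
qed

lemma coset_add:
  assumes "x \<in> carrier M" "y \<in> carrier M"
  shows "(N +> x) <+>\<^bsub>M\<^esub> (N +> y) = N +> (x \<oplus> y)"
  using abelian_subgroup.a_rcos_sum[OF abelian_subgroup_submodule] assms by auto

lemma quotient_simps:
  "carrier (quotient_module M N) = (\<lambda>x. N +> x) ` carrier M"
  "zero (quotient_module M N) = N"
  "add (quotient_module M N) = set_add M"
  unfolding quotient_module_def A_RCOSETS_def' by auto

text \<open>The union that defines the scalar action has all its members equal, because the scalar
  sends differences of representatives into \<open>N\<close>.\<close>

lemma quotient_smult:
  assumes "a \<in> carrier R" "x \<in> carrier M"
  shows "a \<odot>\<^bsub>quotient_module M N\<^esub> (N +> x) = N +> (a \<odot> x)"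
proof -
  have "N +> (a \<odot> y) = N +> (a \<odot> x)" if "y \<in> N +> x" for y
  proof -
    note y = mem_cosetD[OF that assms(2)]
    have "y \<ominus> x \<in> N" using y assms coset_eq_iff by blast
    then have "a \<odot> (y \<ominus> x) \<in> N" using submoduleD(5)[OF N] assms by auto
    then have "a \<odot> y \<ominus> a \<odot> x \<in> N"
      using y assms by (simp add: a_minus_def smult_r_distr smult_minus)
    then show ?thesis using y assms by (simp add: coset_eq_iff smult_closed)
  qed
  then have "(\<Union>y\<in>N +> x. N +> (a \<odot> y)) = N +> (a \<odot> x)"
    using coset_self[OF assms(2)] by blast
  then show ?thesis unfolding quotient_module_def by simp
qed

lemma lmod_quotient: "lmod R (quotient_module M N)"
proof -
  have z: "N = N +> \<zero>" using coset_zero_iff submoduleD(2)[OF N] by blast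
  have "abelian_group (quotient_module M N)"
  proof (rule abelian_groupI, unfold quotient_simps)
    show "N \<in> (+>) N ` carrier M" using z by blast
    fix U assume "U \<in> (+>) N ` carrier M"
    then obtain x where x: "x \<in> carrier M" "U = N +> x" by blast
    show "N <+>\<^bsub>M\<^esub> U = U" using x coset_add[of \<zero> x] z by simp
    show "\<exists>y\<in>(+>) N ` carrier M. y <+>\<^bsub>M\<^esub> U = N"
      using x coset_add[of "\<ominus> x" x] z l_neg by (intro bexI[of _ "N +> (\<ominus> x)"]) auto
    fix Y assume "Y \<in> (+>) N ` carrier M"
    then obtain y where y: "y \<in> carrier M" "Y = N +> y" by blast
    show "U <+>\<^bsub>M\<^esub> Y \<in> (+>) N ` carrier M" using x y coset_add by auto
    show "U <+>\<^bsub>M\<^esub> Y = Y <+>\<^bsub>M\<^esub> U" using x y coset_add by (simp add: a_comm)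
    fix Z assume "Z \<in> (+>) N ` carrier M"
    then obtain z where "z \<in> carrier M" "Z = N +> z" by blast
    then show "U <+>\<^bsub>M\<^esub> Y <+>\<^bsub>M\<^esub> Z = U <+>\<^bsub>M\<^esub> (Y <+>\<^bsub>M\<^esub> Z)"
      using x y by (simp add: coset_add a_assoc)
  qed
  then show ?thesis
    by (auto simp: lmod_def lmod_axioms_def quotient_simps quotient_smult smult_closed coset_add smult_r_distr)
qed

lemma submodule_quotient_preimage:
  assumes "submodule Q R (quotient_module M N)"
  defines "N' \<equiv> {x \<in> carrier M. N +> x \<in> Q}"
  shows "submodule N' R M" "N \<subseteq> N'" "Q = (\<lambda>x. N +> x) ` N'"
proof -
  interpret Q: lmod R "quotient_module M N" by (rule lmod_quotient)
  note d = Q.submoduleD[OF assms(1), unfolded quotient_simps]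
  have z: "N = N +> \<zero>" using coset_zero_iff submoduleD(2)[OF N] by blast
  have inv: "N +> (\<ominus> x) \<in> Q" if "x \<in> carrier M" "N +> x \<in> Q" for x
  proof -
    have "\<ominus>\<^bsub>quotient_module M N\<^esub> (N +> x) = N +> (\<ominus> x)"
      by (rule Q.minus_equality) (use that z l_neg in \<open>auto simp: quotient_simps coset_add\<close>)
    then show ?thesis using d(4)[OF that(2)] by simp
  qed
  show "submodule N' R M"
    unfolding submodule_iff
  proof (intro conjI ballI)
    show "N' \<subseteq> carrier M" unfolding N'_def by blast
    show "\<zero> \<in> N'" unfolding N'_def using d(2) z by simp
  next
    fix x y assume "x \<in> N'" "y \<in> N'"
    then show "x \<oplus> y \<in> N'" unfolding N'_def using d(3)[of "N +> x" "N +> y"] by (simp add: coset_add)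
  next
    fix x assume "x \<in> N'"
    then show "\<ominus> x \<in> N'" unfolding N'_def using inv by simp
  next
    fix a x assume "a \<in> carrier R" "x \<in> N'"
    then show "a \<odot> x \<in> N'" unfolding N'_def using d(5)[of a "N +> x"] by (simp add: quotient_smult smult_closed)
  qed
  show "N \<subseteq> N'"
  proof
    fix x assume x: "x \<in> N"
    then have "x \<in> carrier M" using submoduleD(1)[OF N] by blast
    then show "x \<in> N'" using x coset_zero_iff[of x] d(2) unfolding N'_def by simp
  qed
  show "Q = (\<lambda>x. N +> x) ` N'" unfolding N'_def using d(1) by auto
qed

lemma submodule_quotient_image:
  assumes "submodule N' R M" "N \<subseteq> N'"
  shows "submodule ((\<lambda>x. N +> x) ` N') R (quotient_module M N)"
proof -
  interpret Q: lmod R "quotient_module M N" by (rule lmod_quotient)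
  note d = submoduleD[OF assms(1)]
  have z: "N = N +> \<zero>" using coset_zero_iff submoduleD(2)[OF N] by blast
  have inv: "\<ominus>\<^bsub>quotient_module M N\<^esub> (N +> x) = N +> (\<ominus> x)" if "x \<in> carrier M" for x
    by (rule Q.minus_equality) (use that z l_neg in \<open>auto simp: quotient_simps coset_add\<close>)
  show ?thesis
    unfolding Q.submodule_iff quotient_simps
  proof (intro conjI ballI)
    show "(+>) N ` N' \<subseteq> (+>) N ` carrier M" using d(1) by blast
    show "N \<in> (+>) N ` N'" using z d(2) by blast
  next
    fix U Y assume "U \<in> (+>) N ` N'" "Y \<in> (+>) N ` N'"
    then show "U <+>\<^bsub>M\<^esub> Y \<in> (+>) N ` N'" using d(1,3) coset_add by (auto simp: subset_iff)
  next
    fix U assume U: "U \<in> (+>) N ` N'"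
    then show "\<ominus>\<^bsub>quotient_module M N\<^esub> U \<in> (+>) N ` N'" using d(1,4) inv by (auto simp: subset_iff)
    fix a assume "a \<in> carrier R"
    then show "a \<odot>\<^bsub>quotient_module M N\<^esub> U \<in> (+>) N ` N'"
      using U d(1,5) quotient_smult by (auto simp: subset_iff)
  qed
qed

lemma simple_quotient_iff: "simple_module R (quotient_module M N) \<longleftrightarrow> maximal_submodule N R M"
proof
  assume s: "simple_module R (quotient_module M N)"
  show "maximal_submodule N R M"
    unfolding maximal_submodule_def
  proof (intro conjI allI impI N)
    show "N \<noteq> carrier M"
    proof
      assume "N = carrier M"
      then have "N +> x = N" if "x \<in> carrier M" for x using coset_zero_iff[OF that] that by simp
      then have "(+>) N ` carrier M = {N}" using zero_closed by blast
      then show False using s unfolding simple_module_def quotient_simps by simp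
    qed
    fix N' assume N': "submodule N' R M \<and> N \<subseteq> N'"
    then have "submodule ((+>) N ` N') R (quotient_module M N)" using submodule_quotient_image by simp
    then consider "(+>) N ` N' = {N}" | "(+>) N ` N' = (+>) N ` carrier M"
      using s unfolding simple_module_def quotient_simps by blast
    then show "N' = N \<or> N' = carrier M"
    proof cases
      case 1
      have "x \<in> N" if "x \<in> N'" for x
        using 1 that coset_zero_iff[of x] submoduleD(1)[OF conjunct1[OF N']] by blast
      then show ?thesis using N' by blast
    next
      case 2
      have "carrier M \<subseteq> N'"
      proof
        fix x assume x: "x \<in> carrier M"
        then obtain y where y: "y \<in> N'" "N +> x = N +> y" using 2 by blast
        then have yM: "y \<in> carrier M" using submoduleD(1)[OF conjunct1[OF N']] by blast
        have "x \<ominus> y \<in> N" using coset_eq_iff[OF x yM] y by simp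
        then have "(x \<ominus> y) \<oplus> y \<in> N'" using y N' submoduleD(3)[OF conjunct1[OF N']] by blast
        then show "x \<in> N'" using x yM by (simp add: a_minus_def a_assoc l_neg)
      qed
      then show ?thesis using submoduleD(1)[OF conjunct1[OF N']] by blast
    qed
  qed
next
  assume m: "maximal_submodule N R M"
  show "simple_module R (quotient_module M N)"
    unfolding simple_module_def quotient_simps
  proof (intro conjI allI impI)
    obtain x where "x \<in> carrier M" "x \<notin> N" 
      using m submoduleD(1)[OF N] unfolding maximal_submodule_def by blast
    then show "(+>) N ` carrier M \<noteq> {N}" using coset_zero_iff[of x] by blast
    fix Q assume Q: "submodule Q R (quotient_module M N)"
    define N' where "N' = {x \<in> carrier M. N +> x \<in> Q}"
    note N' = submodule_quotient_preimage[OF Q, folded N'_def]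
    consider "N' = N" | "N' = carrier M" using m N' unfolding maximal_submodule_def by blast
    then show "Q = {N} \<or> Q = (+>) N ` carrier M"
    proof cases
      case 1
      have "N +> x = N" if "x \<in> N" for x
        using coset_zero_iff[of x] that submoduleD(1)[OF N] by blast
      then have "Q = {N}" unfolding N'(3) 1 using submoduleD(2)[OF N] by blast
      then show ?thesis ..
    qed (use N'(3) in auto)
  qed
qed

end

lemma submodule_radical: "submodule (module_radical R M) R M"
  unfolding module_radical_def
  by (rule submodule_Inter) (auto simp: maximal_submodule_def)

end

section \<open>Composition series and the first isomorphism theorem\<close>

lemma simple_series_factor_iff:
  assumes "lmod R M" "submodule (Ns ! i) R M" "submodule (Ns ! Suc i) R M" "Ns ! i \<subseteq> Ns ! Suc i"
  shows "simple_module R (series_factor M Ns i) \<longleftrightarrow> maximal_submodule (Ns ! i) R (M\<lparr>carrier := Ns ! Suc i\<rparr>)"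
proof -
  interpret lmod R M by fact
  interpret N: lmod R "M\<lparr>carrier := Ns ! Suc i\<rparr>" by (rule lmod_restrict) fact
  show ?thesis unfolding series_factor_def
    by (rule N.simple_quotient_iff) (use submodule_restrict_iff assms in auto)
qed

lemma lmod_series_factor:
  assumes "lmod R M" "submodule (Ns ! i) R M" "submodule (Ns ! Suc i) R M" "Ns ! i \<subseteq> Ns ! Suc i"
  shows "lmod R (series_factor M Ns i)"
proof -
  interpret lmod R M by fact
  interpret N: lmod R "M\<lparr>carrier := Ns ! Suc i\<rparr>" by (rule lmod_restrict) fact
  show ?thesis unfolding series_factor_def
    by (rule N.lmod_quotient) (use submodule_restrict_iff assms in auto)
qed

text \<open>The strictly monotone function \<open>\<mu>\<close> stands in for the length. Below
  \<open>N\<close>, a proper submodule with the largest value of \<open>\<mu>\<close> is maximal,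
  and induction on \<open>\<mu>\<close> supplies a series for it.\<close>

lemma (in lmod) composition_series_exists:
  fixes \<mu> :: "'b set \<Rightarrow> nat"
  assumes strict: "\<And>N N'. submodule N R M \<Longrightarrow> submodule N' R M \<Longrightarrow> N \<subset> N' \<Longrightarrow> \<mu> N < \<mu> N'"
  shows "\<exists>Ns. composition_series R M Ns"
proof -
  define chain where "chain N Ns \<longleftrightarrow> Ns \<noteq> [] \<and> hd Ns = {\<zero>} \<and> last Ns = N \<and> (\<forall>N\<in>set Ns. submodule N R M) \<and>
    (\<forall>i. Suc i < length Ns \<longrightarrow> Ns ! i \<subseteq> Ns ! Suc i \<and> simple_module R (series_factor M Ns i))" for N Ns
  have "\<exists>Ns. chain N Ns" if "submodule N R M" for N
    using that
  proof (induction "\<mu> N" arbitrary: N rule: less_induct)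
    case less
    show ?case
    proof (cases "N = {\<zero>}")
      case True
      then have "chain N [{\<zero>}]" unfolding chain_def using submodule_zero by simp
      then show ?thesis ..
    next
      case False
      let ?P = "\<lambda>N'. submodule N' R M \<and> N' \<subset> N"
      have "?P {\<zero>}" using submodule_zero False submoduleD(2)[OF less.prems] by blast
      moreover have "\<forall>N'. ?P N' \<longrightarrow> \<mu> N' < \<mu> N"
        using strict[OF _ less.prems] by blast
      ultimately have "\<exists>N'. ?P N' \<and> (\<forall>N''. ?P N'' \<longrightarrow> \<mu> N'' \<le> \<mu> N')"
        by (rule ex_has_greatest_nat)
      then obtain N' where N': "?P N'" and max': "\<forall>N''. ?P N'' \<longrightarrow> \<mu> N'' \<le> \<mu> N'"
        by (rule exE) (rule that, erule conjunct1, erule conjunct2)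
      have max: "\<mu> N'' \<le> \<mu> N'" if "?P N''" for N''
        by (rule mp[OF spec[OF max'] that])
      have N'2: "submodule N' R M" "N' \<subset> N" using N' by blast+
      obtain Ns where Ns: "chain N' Ns" using less.hyps[OF strict[OF N'2(1) less.prems N'2(2)] N'2(1)] by blast
      have m: "maximal_submodule N' R (M\<lparr>carrier := N\<rparr>)"
        unfolding maximal_submodule_def submodule_restrict_iff[OF less.prems]
      proof (intro conjI allI impI)
        show "submodule N' R M" "N' \<subseteq> N" "N' \<noteq> carrier (M\<lparr>carrier := N\<rparr>)" using N'2 by auto
        fix N'' assume *: "(submodule N'' R M \<and> N'' \<subseteq> N) \<and> N' \<subseteq> N''"
        show "N'' = N' \<or> N'' = carrier (M\<lparr>carrier := N\<rparr>)"
        proof (rule ccontr)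
          assume "\<not> ?thesis"
          then have "N' \<subset> N''" "N'' \<subset> N" using * by auto
          then show False using strict[OF N'2(1) _ \<open>N' \<subset> N''\<close>] max[of N''] * by force
        qed
      qed
      have sf: "simple_module R (quotient_module (M\<lparr>carrier := N\<rparr>) N')"
        using lmod.simple_quotient_iff[OF lmod_restrict[OF less.prems]] m N'
          submodule_restrict_iff[OF less.prems] by blast
      have "chain N (Ns @ [N])"
        unfolding chain_def
      proof (intro conjI allI impI)
        fix i assume i: "Suc i < length (Ns @ [N])"
        show "(Ns @ [N]) ! i \<subseteq> (Ns @ [N]) ! Suc i"
          and "simple_module R (series_factor M (Ns @ [N]) i)"
        proof (atomize (full), cases "Suc i < length Ns")
          case True
          then have "Ns ! i \<subseteq> Ns ! Suc i \<and> simple_module R (series_factor M Ns i)"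
            using Ns unfolding chain_def by blast
          then show "(Ns @ [N]) ! i \<subseteq> (Ns @ [N]) ! Suc i \<and> simple_module R (series_factor M (Ns @ [N]) i)"
            using True unfolding series_factor_def by (simp add: nth_append)
        next
          case False
          then have l: "Suc i = length Ns" using i by simp
          then have "Ns ! i = N'" using Ns unfolding chain_def by (metis diff_Suc_1 last_conv_nth)
          then show "(Ns @ [N]) ! i \<subseteq> (Ns @ [N]) ! Suc i \<and> simple_module R (series_factor M (Ns @ [N]) i)"
            using l N' sf unfolding series_factor_def by (auto simp: nth_append)
        qed
      qed (use Ns less.prems in \<open>auto simp: chain_def\<close>)
      then show ?thesis ..
    qed
  qed
  from this[OF submodule_carrier] show ?thesis unfolding chain_def composition_series_def .
qed

lemma first_isomorphism:
  assumes M: "lmod R M" and N: "lmod R N" and f: "f \<in> lmod_hom R M N" and surj: "f ` carrier M = carrier N"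
  defines "K \<equiv> {x \<in> carrier M. f x = \<zero>\<^bsub>N\<^esub>}"
  shows "submodule K R M" "lmod_isomorphic R (quotient_module M K) N"
proof -
  interpret M: lmod R M by fact
  interpret N: lmod R N by fact
  have fc: "f x \<in> carrier N" if "x \<in> carrier M" for x using f that unfolding lmod_hom_def by auto
  have fa: "f (x \<oplus>\<^bsub>M\<^esub> y) = f x \<oplus>\<^bsub>N\<^esub> f y" if "x \<in> carrier M" "y \<in> carrier M" for x y
    using f that unfolding lmod_hom_def by auto
  have fs: "f (a \<odot>\<^bsub>M\<^esub> x) = a \<odot>\<^bsub>N\<^esub> f x" if "x \<in> carrier M" "a \<in> carrier R" for x a
    using f that unfolding lmod_hom_def by auto
  have f0: "f \<zero>\<^bsub>M\<^esub> = \<zero>\<^bsub>N\<^esub>"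
    by (metis M.zero_closed M.r_zero N.add.r_cancel_one' fa fc)
  have fm: "f (\<ominus>\<^bsub>M\<^esub> x) = \<ominus>\<^bsub>N\<^esub> f x" if "x \<in> carrier M" for x
    by (rule sym, rule N.minus_equality) (use that fc f0 fa[of "\<ominus>\<^bsub>M\<^esub> x" x] M.l_neg in auto)
  show K: "submodule K R M"
    unfolding M.submodule_iff K_def
    by (auto simp: fa fs f0 fm N.smult_zero M.smult_closed)
  have eq: "f x = f y \<longleftrightarrow> K +>\<^bsub>M\<^esub> x = K +>\<^bsub>M\<^esub> y" if "x \<in> carrier M" "y \<in> carrier M" for x y
  proof -
    have "f (x \<ominus>\<^bsub>M\<^esub> y) = f x \<ominus>\<^bsub>N\<^esub> f y" using that by (simp add: a_minus_def fa fm)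
    then have "x \<ominus>\<^bsub>M\<^esub> y \<in> K \<longleftrightarrow> f x \<ominus>\<^bsub>N\<^esub> f y = \<zero>\<^bsub>N\<^esub>" using that unfolding K_def by simp
    also have "\<dots> \<longleftrightarrow> f x = f y" using fc[OF that(1)] fc[OF that(2)]
      by (metis a_minus_def N.minus_equality N.minus_minus N.a_inv_closed N.r_neg)
    finally show ?thesis using M.coset_eq_iff[OF K that] by simp
  qed
  \<comment> \<open>\<open>f\<close> is constant on cosets of its kernel, so any representative will
    do.\<close>
  define g where "g U = f (SOME x. x \<in> U)" for U
  have g: "g (K +>\<^bsub>M\<^esub> x) = f x" if x: "x \<in> carrier M" for x
  proof -
    have "(SOME y. y \<in> K +>\<^bsub>M\<^esub> x) \<in> K +>\<^bsub>M\<^esub> x"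
      using M.coset_self[OF K x] by (rule someI)
    from M.mem_cosetD[OF K this x] show ?thesis unfolding g_def using eq x by blast
  qed
  have "g \<in> lmod_hom R (quotient_module M K) N"
    unfolding lmod_hom_def M.quotient_simps[OF K]
    by (auto simp: g fc M.coset_add[OF K] M.quotient_smult[OF K] M.smult_closed fa fs)
  moreover have "bij_betw g (carrier (quotient_module M K)) (carrier N)"
    unfolding M.quotient_simps[OF K] bij_betw_def inj_on_def surj[symmetric] image_image
    by (auto simp: g eq image_iff)
  ultimately show "lmod_isomorphic R (quotient_module M K) N"
    unfolding lmod_isomorphic_def by blast
qed


section \<open>Semilinear isomorphisms\<close>

text \<open>The rings of scalars are only linked by a relation \<open>H\<close> that is total in both directions. This
  covers a change of rings along an isomorphism and along the projection onto a direct factor in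
  a symmetric way.\<close>

locale semi_iso = M: lmod R M + N: lmod S N
  for R :: "('a, 'x) ring_scheme" and S :: "('a1, 'x1) ring_scheme"
    and M :: "('a, 'b, 'y) module_scheme" and N :: "('a1, 'b1, 'y1) module_scheme"
    and H :: "'a \<Rightarrow> 'a1 \<Rightarrow> bool" and \<phi> :: "'b \<Rightarrow> 'b1" +
  assumes left_total: "a \<in> carrier R \<Longrightarrow> \<exists>b\<in>carrier S. H a b"
    and right_total: "b \<in> carrier S \<Longrightarrow> \<exists>a\<in>carrier R. H a b"
    and bij: "bij_betw \<phi> (carrier M) (carrier N)"
    and map_add: "\<lbrakk>x \<in> carrier M; y \<in> carrier M\<rbrakk> \<Longrightarrow> \<phi> (x \<oplus>\<^bsub>M\<^esub> y) = \<phi> x \<oplus>\<^bsub>N\<^esub> \<phi> y"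
    and map_smult: "\<lbrakk>a \<in> carrier R; b \<in> carrier S; H a b; x \<in> carrier M\<rbrakk> \<Longrightarrow> \<phi> (a \<odot>\<^bsub>M\<^esub> x) = b \<odot>\<^bsub>N\<^esub> \<phi> x"
begin

lemma map_closed: "x \<in> carrier M \<Longrightarrow> \<phi> x \<in> carrier N"
  using bij bij_betwE by blast

lemma map_inj: "x \<in> carrier M \<Longrightarrow> y \<in> carrier M \<Longrightarrow> \<phi> x = \<phi> y \<longleftrightarrow> x = y"
  using bij unfolding bij_betw_def inj_on_def by blast

lemma map_zero: "\<phi> \<zero>\<^bsub>M\<^esub> = \<zero>\<^bsub>N\<^esub>"
  by (metis M.zero_closed M.r_zero N.add.r_cancel_one' map_add map_closed)

lemma map_minus: "x \<in> carrier M \<Longrightarrow> \<phi> (\<ominus>\<^bsub>M\<^esub> x) = \<ominus>\<^bsub>N\<^esub> \<phi> x"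
  by (rule sym, rule N.minus_equality)
    (use map_closed map_zero map_add[of "\<ominus>\<^bsub>M\<^esub> x" x] M.l_neg in auto)

lemma image_eq_iff: "U \<subseteq> carrier M \<Longrightarrow> Y \<subseteq> carrier M \<Longrightarrow> \<phi> ` U = \<phi> ` Y \<longleftrightarrow> U = Y"
  using bij inj_on_image_eq_iff unfolding bij_betw_def by blast

lemma image_subset_iff: "U \<subseteq> carrier M \<Longrightarrow> Y \<subseteq> carrier M \<Longrightarrow> \<phi> ` U \<subseteq> \<phi> ` Y \<longleftrightarrow> U \<subseteq> Y"
  using bij unfolding bij_betw_def inj_on_def by blast

lemma image_zero: "\<phi> ` {\<zero>\<^bsub>M\<^esub>} = {\<zero>\<^bsub>N\<^esub>}"
  by (simp add: map_zero)

lemma image_carrier: "\<phi> ` carrier M = carrier N"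
  using bij unfolding bij_betw_def by blast

text \<open>The conditions are symmetric in the two sides. Later equivalences can therefore be
  reduced to one implication.\<close>

lemma sym: "semi_iso S R N M (\<lambda>b a. H a b) (inv_into (carrier M) \<phi>)"
proof -
  let ?\<psi> = "inv_into (carrier M) \<phi>"
  have b: "bij_betw ?\<psi> (carrier N) (carrier M)" using bij by (rule bij_betw_inv_into)
  have l: "?\<psi> (\<phi> x) = x" if "x \<in> carrier M" for x using bij that by (simp add: bij_betw_inv_into_left)
  have ex: "\<exists>x\<in>carrier M. y = \<phi> x" if "y \<in> carrier N" for y
    using bij that unfolding bij_betw_def by blast
  show ?thesis
  proof
    fix x y assume "x \<in> carrier N" "y \<in> carrier N"
    then show "?\<psi> (x \<oplus>\<^bsub>N\<^esub> y) = ?\<psi> x \<oplus>\<^bsub>M\<^esub> ?\<psi> y"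
      using ex by (metis M.add.m_closed l map_add)
  next
    fix b a x assume *: "b \<in> carrier S" "a \<in> carrier R" "H a b" "x \<in> carrier N"
    obtain y where "y \<in> carrier M" "x = \<phi> y" using ex *(4) by blast
    then show "?\<psi> (b \<odot>\<^bsub>N\<^esub> x) = a \<odot>\<^bsub>M\<^esub> ?\<psi> x"
      using map_smult[OF *(2,1,3), of y] * l M.smult_closed by metis
  qed (use left_total right_total b in auto)
qed

lemma submodule_image_iff:
  assumes U: "U \<subseteq> carrier M"
  shows "submodule (\<phi> ` U) S N \<longleftrightarrow> submodule U R M"
proof -
  have mem: "\<phi> x \<in> \<phi> ` U \<longleftrightarrow> x \<in> U" if "x \<in> carrier M" for x
    using that U map_inj by blast
  have xM: "x \<in> carrier M" if "x \<in> U" for x using U that by blast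
  have 1: "(\<forall>x\<in>\<phi>`U. \<forall>y\<in>\<phi>`U. x \<oplus>\<^bsub>N\<^esub> y \<in> \<phi>`U) \<longleftrightarrow> (\<forall>x\<in>U. \<forall>y\<in>U. x \<oplus>\<^bsub>M\<^esub> y \<in> U)"
    using mem xM by (simp add: map_add[symmetric])
  have 2: "(\<forall>x\<in>\<phi>`U. \<ominus>\<^bsub>N\<^esub> x \<in> \<phi>`U) \<longleftrightarrow> (\<forall>x\<in>U. \<ominus>\<^bsub>M\<^esub> x \<in> U)"
    using mem xM by (simp add: map_minus[symmetric])
  have sm: "b \<odot>\<^bsub>N\<^esub> \<phi> x \<in> \<phi>`U \<longleftrightarrow> a \<odot>\<^bsub>M\<^esub> x \<in> U"
    if "a \<in> carrier R" "b \<in> carrier S" "H a b" "x \<in> U" for a b x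
    using map_smult[OF that(1,2,3)] xM[OF that(4)] mem M.smult_closed[OF that(1)] by metis
  have 3: "(\<forall>a\<in>carrier S. \<forall>x\<in>\<phi>`U. a \<odot>\<^bsub>N\<^esub> x \<in> \<phi>`U) \<longleftrightarrow> (\<forall>a\<in>carrier R. \<forall>x\<in>U. a \<odot>\<^bsub>M\<^esub> x \<in> U)"
  proof (intro iffI ballI)
    fix a x assume l: "\<forall>a\<in>carrier S. \<forall>x\<in>\<phi>`U. a \<odot>\<^bsub>N\<^esub> x \<in> \<phi>`U" and ax: "a \<in> carrier R" "x \<in> U"
    obtain b where "b \<in> carrier S" "H a b" using left_total ax(1) by blast
    then show "a \<odot>\<^bsub>M\<^esub> x \<in> U" using sm[OF ax(1) _ _ ax(2)] l ax(2) by blast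
  next
    fix b y assume r: "\<forall>a\<in>carrier R. \<forall>x\<in>U. a \<odot>\<^bsub>M\<^esub> x \<in> U" and b: "b \<in> carrier S" "y \<in> \<phi>`U"
    obtain a where a: "a \<in> carrier R" "H a b" using right_total b(1) by blast
    obtain x where x: "x \<in> U" "y = \<phi> x" using b(2) by blast
    show "b \<odot>\<^bsub>N\<^esub> y \<in> \<phi>`U" using sm[OF a(1) b(1) a(2) x(1)] r a(1) x by blast
  qed
  have 4: "\<zero>\<^bsub>N\<^esub> \<in> \<phi> ` U \<longleftrightarrow> \<zero>\<^bsub>M\<^esub> \<in> U" using mem[of "\<zero>\<^bsub>M\<^esub>"] by (simp add: map_zero)
  show ?thesis
    unfolding M.submodule_iff N.submodule_iff 1 2 3 4 using U map_closed by auto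
qed

lemma submodule_as_image:
  assumes "submodule Y S N"
  obtains U where "submodule U R M" "Y = \<phi> ` U"
proof -
  have "Y \<subseteq> \<phi> ` carrier M" using N.submoduleD(1)[OF assms] image_carrier by simp
  then obtain U where U: "U \<subseteq> carrier M" "Y = \<phi> ` U" by (auto simp: subset_image_iff)
  then have "submodule U R M" using assms submodule_image_iff by simp
  then show thesis using U that by blast
qed

lemma semi_iso_restrict:
  assumes "submodule U R M"
  shows "semi_iso R S (M\<lparr>carrier := U\<rparr>) (N\<lparr>carrier := \<phi> ` U\<rparr>) H \<phi>"
proof -
  have U: "U \<subseteq> carrier M" by (rule M.submoduleD(1)[OF assms])
  interpret M': lmod R "M\<lparr>carrier := U\<rparr>" using M.lmod_restrict[OF assms] .
  interpret N': lmod S "N\<lparr>carrier := \<phi> ` U\<rparr>"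
    using N.lmod_restrict submodule_image_iff[OF U] assms by blast
  show ?thesis
  proof
    show "bij_betw \<phi> (carrier (M\<lparr>carrier := U\<rparr>)) (carrier (N\<lparr>carrier := \<phi> ` U\<rparr>))"
      using bij U by (auto simp: bij_betw_def inj_on_subset)
  qed (use left_total right_total U map_add map_smult in \<open>auto simp: subset_iff\<close>)
qed

lemma image_coset:
  assumes "U \<subseteq> carrier M" "x \<in> carrier M"
  shows "\<phi> ` (U +>\<^bsub>M\<^esub> x) = \<phi> ` U +>\<^bsub>N\<^esub> \<phi> x"
  using assms map_add unfolding a_r_coset_def' by (auto simp: subset_iff image_iff) 

lemma semi_iso_quotient:
  assumes sX: "submodule U R M"
  shows "semi_iso R S (quotient_module M U) (quotient_module N (\<phi> ` U)) H (image \<phi>)"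
proof -
  have U: "U \<subseteq> carrier M" by (rule M.submoduleD(1)[OF assms])
  have sY: "submodule (\<phi> ` U) S N" using submodule_image_iff U assms by blast
  interpret M': lmod R "quotient_module M U" using M.lmod_quotient[OF assms] .
  interpret N': lmod S "quotient_module N (\<phi> ` U)" using N.lmod_quotient[OF sY] .
  have sub: "U +>\<^bsub>M\<^esub> x \<subseteq> carrier M" if "x \<in> carrier M" for x
    using M.mem_cosetD(1)[OF sX _ that] by blast
  note qM = M.quotient_simps[OF sX] and qN = N.quotient_simps[OF sY]
  show ?thesis
  proof
    have "inj_on ((`) \<phi>) ((+>\<^bsub>M\<^esub>) U ` carrier M)"
    proof (rule inj_onI)
      fix A B assume *: "A \<in> (+>\<^bsub>M\<^esub>) U ` carrier M" "B \<in> (+>\<^bsub>M\<^esub>) U ` carrier M" "\<phi> ` A = \<phi> ` B"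
      then have "A \<subseteq> carrier M" "B \<subseteq> carrier M" using sub by auto
      then show "A = B" using image_eq_iff *(3) by simp
    qed
    moreover have "(`) \<phi> ` (+>\<^bsub>M\<^esub>) U ` carrier M = (+>\<^bsub>N\<^esub>) (\<phi> ` U) ` \<phi> ` carrier M"
      unfolding image_image by (intro image_cong refl) (rule image_coset[OF U])
    ultimately show "bij_betw ((`) \<phi>) (carrier (quotient_module M U)) (carrier (quotient_module N (\<phi> ` U)))"
      unfolding qM qN bij_betw_def by (simp add: image_carrier)
  next
    fix A B assume "A \<in> carrier (quotient_module M U)" "B \<in> carrier (quotient_module M U)"
    then obtain x y where *: "x \<in> carrier M" "y \<in> carrier M" "A = U +>\<^bsub>M\<^esub> x" "B = U +>\<^bsub>M\<^esub> y"
      unfolding qM by blast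
    have "\<phi> ` (U +>\<^bsub>M\<^esub> (x \<oplus>\<^bsub>M\<^esub> y)) = (\<phi> ` U +>\<^bsub>N\<^esub> \<phi> x) <+>\<^bsub>N\<^esub> (\<phi> ` U +>\<^bsub>N\<^esub> \<phi> y)"
      using * by (simp add: image_coset[OF U] map_add N.coset_add[OF sY] map_closed)
    then show "\<phi> ` (A \<oplus>\<^bsub>quotient_module M U\<^esub> B) =
        \<phi> ` A \<oplus>\<^bsub>quotient_module N (\<phi> ` U)\<^esub> \<phi> ` B"
      using * by (simp only: qM qN M.coset_add[OF sX] image_coset[OF U])
  next
    fix a b A assume ab: "a \<in> carrier R" "b \<in> carrier S" "H a b" and "A \<in> carrier (quotient_module M U)"
    then obtain x where *: "x \<in> carrier M" "A = U +>\<^bsub>M\<^esub> x"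
      unfolding qM by blast
    have "\<phi> ` (U +>\<^bsub>M\<^esub> (a \<odot>\<^bsub>M\<^esub> x)) = \<phi> ` U +>\<^bsub>N\<^esub> (b \<odot>\<^bsub>N\<^esub> \<phi> x)"
      using * ab by (simp add: image_coset[OF U] M.smult_closed map_smult)
    then show "\<phi> ` (a \<odot>\<^bsub>quotient_module M U\<^esub> A) = b \<odot>\<^bsub>quotient_module N (\<phi> ` U)\<^esub> \<phi> ` A"
      using * ab by (simp only: M.quotient_smult[OF sX] image_coset[OF U] N.quotient_smult[OF sY] map_closed)
  qed (use left_total right_total in auto)
qed

lemma maximal_image_iff:
  assumes U: "U \<subseteq> carrier M"
  shows "maximal_submodule (\<phi> ` U) S N \<longleftrightarrow> maximal_submodule U R M"
proof -
  have "(\<forall>N'. submodule N' S N \<and> \<phi> ` U \<subseteq> N' \<longrightarrow> N' = \<phi> ` U \<or> N' = carrier N) \<longleftrightarrow>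
    (\<forall>N'. submodule N' R M \<and> U \<subseteq> N' \<longrightarrow> N' = U \<or> N' = carrier M)" (is "?l \<longleftrightarrow> ?r")
  proof
    assume l: ?l
    show ?r
    proof (intro allI impI)
      fix N' assume *: "submodule N' R M \<and> U \<subseteq> N'"
      note N' = M.submoduleD(1)[OF conjunct1[OF *]]
      have "\<phi> ` N' = \<phi> ` U \<or> \<phi> ` N' = \<phi> ` carrier M"
        using l * submodule_image_iff[OF N'] image_carrier by (metis image_mono)
      then show "N' = U \<or> N' = carrier M" using image_eq_iff N' U by blast
    qed
  next
    assume r: ?r
    show ?l
    proof (intro allI impI)
      fix N' assume *: "submodule N' S N \<and> \<phi> ` U \<subseteq> N'"
      then obtain Y where Y: "submodule Y R M" "N' = \<phi> ` Y" using submodule_as_image by blast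
      then have "U \<subseteq> Y" using image_subset_iff[OF U] M.submoduleD(1) * by blast
      then have "Y = U \<or> Y = carrier M" using r Y by blast
      then show "N' = \<phi> ` U \<or> N' = carrier N" using Y image_carrier by blast
    qed
  qed
  moreover have "\<phi> ` U \<noteq> carrier N \<longleftrightarrow> U \<noteq> carrier M"
    using image_eq_iff[OF U, of "carrier M"] image_carrier by auto
  ultimately show ?thesis
    unfolding maximal_submodule_def submodule_image_iff[OF U] by blast
qed

lemma simple_iff: "simple_module S N \<longleftrightarrow> simple_module R M"
proof -
  have "carrier N = {\<zero>\<^bsub>N\<^esub>} \<longleftrightarrow> carrier M = {\<zero>\<^bsub>M\<^esub>}"
    using image_eq_iff[of "carrier M" "{\<zero>\<^bsub>M\<^esub>}"] image_carrier image_zero by auto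
  moreover have "(\<forall>U. submodule U S N \<longrightarrow> U = {\<zero>\<^bsub>N\<^esub>} \<or> U = carrier N) \<longleftrightarrow>
     (\<forall>U. submodule U R M \<longrightarrow> U = {\<zero>\<^bsub>M\<^esub>} \<or> U = carrier M)" (is "?l \<longleftrightarrow> ?r")
  proof
    assume l: ?l
    show ?r
    proof (intro allI impI)
      fix U assume *: "submodule U R M"
      note U = M.submoduleD(1)[OF *]
      have "\<phi> ` U = \<phi> ` {\<zero>\<^bsub>M\<^esub>} \<or> \<phi> ` U = \<phi> ` carrier M"
        using l * submodule_image_iff[OF U] image_carrier image_zero by metis
      then show "U = {\<zero>\<^bsub>M\<^esub>} \<or> U = carrier M"
        using image_eq_iff[OF U, of "carrier M"] image_eq_iff[OF U, of "{\<zero>\<^bsub>M\<^esub>}"] by auto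
    qed
  qed (metis submodule_as_image image_carrier image_zero)
  ultimately show ?thesis unfolding simple_module_def by blast
qed

lemma image_set_add:
  assumes "U \<subseteq> carrier M" "Y \<subseteq> carrier M"
  shows "\<phi> ` (U <+>\<^bsub>M\<^esub> Y) = \<phi> ` U <+>\<^bsub>N\<^esub> \<phi> ` Y"
proof -
  have "\<phi> (x \<oplus>\<^bsub>M\<^esub> y) = \<phi> x \<oplus>\<^bsub>N\<^esub> \<phi> y" if "x \<in> U" "y \<in> Y" for x y
    using that assms by (intro map_add) auto
  then show ?thesis unfolding set_add_def' by (auto simp: image_iff) (metis)+
qed

lemma image_Int: "U \<subseteq> carrier M \<Longrightarrow> Y \<subseteq> carrier M \<Longrightarrow> \<phi> ` (U \<inter> Y) = \<phi> ` U \<inter> \<phi> ` Y"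
  using bij unfolding bij_betw_def by (meson inj_on_image_Int)

lemma indecomposable_image:
  assumes "indecomposable_module S N"
  shows "indecomposable_module R M"
  unfolding indecomposable_module_def
proof (intro conjI notI)
  assume "carrier M = {\<zero>\<^bsub>M\<^esub>}"
  then show False using assms image_zero image_carrier unfolding indecomposable_module_def by metis
next
  assume "\<exists>U U'. submodule U R M \<and> submodule U' R M \<and> U \<noteq> {\<zero>\<^bsub>M\<^esub>} \<and> U' \<noteq> {\<zero>\<^bsub>M\<^esub>} \<and>
         U \<inter> U' = {\<zero>\<^bsub>M\<^esub>} \<and> U <+>\<^bsub>M\<^esub> U' = carrier M"
  then obtain U U' where *: "submodule U R M" "submodule U' R M" "U \<noteq> {\<zero>\<^bsub>M\<^esub>}" "U' \<noteq> {\<zero>\<^bsub>M\<^esub>}"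
    "U \<inter> U' = {\<zero>\<^bsub>M\<^esub>}" "U <+>\<^bsub>M\<^esub> U' = carrier M" by blast
  note U = M.submoduleD(1)[OF *(1)] and U' = M.submoduleD(1)[OF *(2)]
  have z: "{\<zero>\<^bsub>M\<^esub>} \<subseteq> carrier M" by simp
  have "submodule (\<phi> ` U) S N" "submodule (\<phi> ` U') S N" using * U U' submodule_image_iff by blast+
  moreover have "\<phi> ` U \<noteq> {\<zero>\<^bsub>N\<^esub>}" "\<phi> ` U' \<noteq> {\<zero>\<^bsub>N\<^esub>}"
    using image_eq_iff[OF U z] image_eq_iff[OF U' z] image_zero * by auto
  moreover have "\<phi> ` U \<inter> \<phi> ` U' = {\<zero>\<^bsub>N\<^esub>}" using image_Int[OF U U'] * image_zero by simp
  moreover have "\<phi> ` U <+>\<^bsub>N\<^esub> \<phi> ` U' = carrier N" using image_set_add[OF U U'] * image_carrier by simp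
  ultimately show False using assms unfolding indecomposable_module_def by blast
qed

lemma indecomposable_iff: "indecomposable_module S N \<longleftrightarrow> indecomposable_module R M"
  using indecomposable_image semi_iso.indecomposable_image[OF sym] by blast

lemma radical_image: "module_radical S N = \<phi> ` module_radical R M"
proof -
  have ms: "U \<subseteq> carrier M" if "maximal_submodule U R M" for U
    using that M.submoduleD(1) unfolding maximal_submodule_def by blast
  have ms': "\<exists>U. Y = \<phi> ` U \<and> maximal_submodule U R M" if m: "maximal_submodule Y S N" for Y
  proof -
    from m have "submodule Y S N" unfolding maximal_submodule_def by blast
    then obtain U where "submodule U R M" "Y = \<phi> ` U" by (rule submodule_as_image)
    then show ?thesis using maximal_image_iff M.submoduleD(1) m by blast
  qed
  have "\<phi> x \<in> module_radical S N \<longleftrightarrow> x \<in> module_radical R M" if x: "x \<in> carrier M" for x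
  proof -
    have "\<phi> x \<in> \<phi> ` U \<longleftrightarrow> x \<in> U" if "U \<subseteq> carrier M" for U using that x map_inj by blast
    then have "(\<forall>Y. maximal_submodule Y S N \<longrightarrow> \<phi> x \<in> Y) \<longleftrightarrow> (\<forall>U. maximal_submodule U R M \<longrightarrow> x \<in> U)"
      using ms ms' maximal_image_iff by metis
    then show ?thesis using x map_closed unfolding module_radical_def by auto
  qed
  moreover have "module_radical S N \<subseteq> \<phi> ` carrier M" "module_radical R M \<subseteq> carrier M"
    unfolding module_radical_def image_carrier by auto
  ultimately show ?thesis by blast
qed

lemma series_factor_semi_iso:
  assumes "submodule (Ns ! i) R M" "submodule (Ns ! Suc i) R M" "Ns ! i \<subseteq> Ns ! Suc i" "Suc i < length Ns"
  shows "semi_iso R S (series_factor M Ns i) (series_factor N (map (image \<phi>) Ns) i) H (image \<phi>)"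
proof -
  interpret r: semi_iso R S "M\<lparr>carrier := Ns ! Suc i\<rparr>" "N\<lparr>carrier := \<phi> ` (Ns ! Suc i)\<rparr>" H \<phi>
    by (rule semi_iso_restrict) fact
  have "submodule (Ns ! i) R (M\<lparr>carrier := Ns ! Suc i\<rparr>)"
    using assms M.submodule_restrict_iff by blast
  from r.semi_iso_quotient[OF this] show ?thesis
    using assms(4) unfolding series_factor_def by simp
qed

lemma composition_series_image:
  assumes "composition_series R M Ns"
  shows "composition_series S N (map (image \<phi>) Ns)"
proof -
  note c = assms[unfolded composition_series_def]
  have sub: "submodule (Ns ! i) R M" if "i < length Ns" for i using c that by auto
  show ?thesis
    unfolding composition_series_def
  proof (intro conjI ballI allI impI)
    show "map ((`) \<phi>) Ns \<noteq> []" using c by simp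
    show "hd (map ((`) \<phi>) Ns) = {\<zero>\<^bsub>N\<^esub>}" using c image_zero by (simp add: hd_map)
    show "last (map ((`) \<phi>) Ns) = carrier N" using c image_carrier by (simp add: last_map)
  next
    fix U assume "U \<in> set (map ((`) \<phi>) Ns)"
    then show "submodule U S N" using c submodule_image_iff M.submoduleD(1) by auto
  next
    fix i assume i: "Suc i < length (map ((`) \<phi>) Ns)"
    then have "Ns ! i \<subseteq> Ns ! Suc i" using c by simp
    then show "map ((`) \<phi>) Ns ! i \<subseteq> map ((`) \<phi>) Ns ! Suc i" using i by (auto simp: image_mono)
    interpret f: semi_iso R S "series_factor M Ns i" "series_factor N (map (image \<phi>) Ns) i" H "image \<phi>"
      by (rule series_factor_semi_iso) (use i c sub in auto)
    show "simple_module S (series_factor N (map ((`) \<phi>) Ns) i)"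
      unfolding f.simple_iff using i c by auto
  qed
qed

end

text \<open>Conjugating an isomorphism by \<open>\<phi>\<close> and \<open>\<psi>\<close> preserves
  linearity because both maps are semilinear for the same relation \<open>H\<close>.\<close>

lemma semi_iso_lmod_isomorphic:
  assumes "semi_iso R S M M' H \<phi>" "semi_iso R S N N' H \<psi>" "lmod_isomorphic R M N"
  shows "lmod_isomorphic S M' N'"
proof -
  interpret a: semi_iso R S M M' H \<phi> by fact
  interpret b: semi_iso R S N N' H \<psi> by fact
  interpret a': semi_iso S R M' M "\<lambda>b a. H a b" "inv_into (carrier M) \<phi>" by (rule a.sym)
  obtain f where f: "f \<in> lmod_hom R M N" "bij_betw f (carrier M) (carrier N)"
    using assms(3) unfolding lmod_isomorphic_def by blast
  let ?g = "\<psi> \<circ> (f \<circ> inv_into (carrier M) \<phi>)"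
  have "bij_betw ?g (carrier M') (carrier N')"
    by (rule bij_betw_trans[OF bij_betw_trans[OF a'.bij f(2)] b.bij])
  moreover have "?g \<in> lmod_hom S M' N'"
    unfolding lmod_hom_def
  proof (intro CollectI conjI ballI)
    show "?g \<in> carrier M' \<rightarrow> carrier N'" using calculation bij_betwE by blast
    have fc: "f x \<in> carrier N" if "x \<in> carrier M" for x using f that bij_betwE by blast
    fix x assume x: "x \<in> carrier M'"
    then have x': "inv_into (carrier M) \<phi> x \<in> carrier M" by (rule a'.map_closed)
    { fix y assume y: "y \<in> carrier M'"
      then have y': "inv_into (carrier M) \<phi> y \<in> carrier M" by (rule a'.map_closed)
      show "?g (x \<oplus>\<^bsub>M'\<^esub> y) = ?g x \<oplus>\<^bsub>N'\<^esub> ?g y"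
        using f(1) x' y' fc x y unfolding lmod_hom_def by (simp add: a'.map_add b.map_add) }
    fix s assume s: "s \<in> carrier S"
    then obtain r where r: "r \<in> carrier R" "H r s" using a.right_total by blast
    show "?g (s \<odot>\<^bsub>M'\<^esub> x) = s \<odot>\<^bsub>N'\<^esub> ?g x"
      using f(1) x' fc x r s unfolding lmod_hom_def
      by (simp add: a'.map_smult[OF s r(1) r(2)] b.map_smult[OF r(1) s r(2)])
  qed
  ultimately show ?thesis unfolding lmod_isomorphic_def by blast
qed

lemma semi_iso_lmod_isomorphic_iff:
  assumes "semi_iso R S M M' H \<phi>" "semi_iso R S N N' H \<psi>"
  shows "lmod_isomorphic R M N \<longleftrightarrow> lmod_isomorphic S M' N'"
  using semi_iso_lmod_isomorphic[OF assms]
    semi_iso_lmod_isomorphic[OF semi_iso.sym[OF assms(1)] semi_iso.sym[OF assms(2)]] by blast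

lemma semi_iso_of_isomorphic:
  assumes "lmod R M" "lmod R N" "f \<in> lmod_hom R M N" "bij_betw f (carrier M) (carrier N)"
  shows "semi_iso R R M N (=) f"
proof -
  interpret lmod R M by fact
  interpret N: lmod R N by fact
  show ?thesis by standard (use assms in \<open>auto simp: lmod_hom_def\<close>)
qed

lemma lmod_isomorphic_of_semi_iso: "semi_iso R R M N (=) f \<Longrightarrow> lmod_isomorphic R M N"
  unfolding lmod_isomorphic_def lmod_hom_def
  by (intro bexI[of _ f]) (auto simp: semi_iso_def semi_iso_axioms_def bij_betw_def)

lemma lmod_isomorphic_sym:
  assumes "lmod R M" "lmod R N" "lmod_isomorphic R M N"
  shows "lmod_isomorphic R N M"
proof -
  obtain f where "f \<in> lmod_hom R M N" "bij_betw f (carrier M) (carrier N)"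
    using assms(3) unfolding lmod_isomorphic_def by blast
  from semi_iso.sym[OF semi_iso_of_isomorphic[OF assms(1,2) this]]
  have "semi_iso R R N M (=) (inv_into (carrier M) f)" by (simp add: eq_commute)
  then show ?thesis by (rule lmod_isomorphic_of_semi_iso)
qed

lemma lmod_isomorphic_trans:
  assumes "lmod_isomorphic R M N" "lmod_isomorphic R N L"
  shows "lmod_isomorphic R M L"
proof -
  obtain f g where *: "f \<in> lmod_hom R M N" "bij_betw f (carrier M) (carrier N)"
    "g \<in> lmod_hom R N L" "bij_betw g (carrier N) (carrier L)"
    using assms unfolding lmod_isomorphic_def by blast
  have "g \<circ> f \<in> lmod_hom R M L" using *(1,3) unfolding lmod_hom_def by (auto simp: Pi_iff)
  then show ?thesis unfolding lmod_isomorphic_def using bij_betw_trans[OF *(2,4)] by blast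
qed

lemma semi_iso_composition_count:
  assumes M: "semi_iso R S M N H \<phi>" and D: "semi_iso R S D D' H \<psi>"
    and "\<exists>Ns. composition_series R M Ns \<and> c = card {i. Suc i < length Ns \<and> lmod_isomorphic R (series_factor M Ns i) D}"
  shows "\<exists>Ns. composition_series S N Ns \<and> c = card {i. Suc i < length Ns \<and> lmod_isomorphic S (series_factor N Ns i) D'}"
proof -
  interpret semi_iso R S M N H \<phi> by fact
  obtain Ns where c: "composition_series R M Ns"
    "c = card {i. Suc i < length Ns \<and> lmod_isomorphic R (series_factor M Ns i) D}" using assms(3) by blast
  have "lmod_isomorphic R (series_factor M Ns i) D \<longleftrightarrow>
      lmod_isomorphic S (series_factor N (map (image \<phi>) Ns) i) D'" if i: "Suc i < length Ns" for i
    by (rule semi_iso_lmod_isomorphic_iff[OF series_factor_semi_iso D])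
      (use i c in \<open>auto simp: composition_series_def\<close>)
  then have "{i. Suc i < length Ns \<and> lmod_isomorphic R (series_factor M Ns i) D} =
    {i. Suc i < length (map (image \<phi>) Ns) \<and> lmod_isomorphic S (series_factor N (map (image \<phi>) Ns) i) D'}"
    by auto
  then show ?thesis using composition_series_image[OF c(1)] c(2) by auto
qed

text \<open>Series and the isomorphism types of their factors are carried across in both directions,
  so the two definite descriptions are over the same predicate in \<open>c\<close>.\<close>

lemma semi_iso_composition_multiplicity:
  assumes M: "semi_iso R S M N H \<phi>" and D: "semi_iso R S D D' H \<psi>"
  shows "composition_multiplicity R M D = composition_multiplicity S N D'"
proof -
  have "(\<exists>Ns. composition_series R M Ns \<and> c = card {i. Suc i < length Ns \<and> lmod_isomorphic R (series_factor M Ns i) D}) \<longleftrightarrow>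
    (\<exists>Ns. composition_series S N Ns \<and> c = card {i. Suc i < length Ns \<and> lmod_isomorphic S (series_factor N Ns i) D'})" for c
    using semi_iso_composition_count[OF M D, of c]
      semi_iso_composition_count[OF semi_iso.sym[OF M] semi_iso.sym[OF D], of c] by (rule iffI)
  then show ?thesis unfolding composition_multiplicity_def by simp
qed

lemma semi_iso_pim_head:
  assumes "semi_iso R S (left_ideal_module R P) (left_ideal_module S P') H \<phi>"
  shows "semi_iso R S (pim_head R P) (pim_head S P') H (image \<phi>)"
proof -
  interpret semi_iso R S "left_ideal_module R P" "left_ideal_module S P'" H \<phi> by fact
  show ?thesis
    unfolding pim_head_def radical_image by (rule semi_iso_quotient[OF M.submodule_radical])
qed

section \<open>Direct products of rings\<close>

lemma ring_lmod_regular: "ring R \<Longrightarrow> lmod R (regular_module R)"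
proof -
  assume "ring R"
  then interpret ring R .
  have "abelian_group (regular_module R)"
    by (rule abelian_groupI) (auto simp: regular_module_def a_ac intro: l_neg)
  then show ?thesis
    by (auto simp: lmod_def lmod_axioms_def regular_module_def r_distr)
qed

lemma regular_module_simps [simp]:
  "carrier (regular_module R) = carrier R" "add (regular_module R) = add R"
  "zero (regular_module R) = zero R" "smult (regular_module R) = mult R"
  by (simp_all add: regular_module_def)

lemma left_ideal_module_simps [simp]:
  "carrier (left_ideal_module R P) = P" "add (left_ideal_module R P) = add R"
  "zero (left_ideal_module R P) = zero R" "smult (left_ideal_module R P) = mult R"
  by (simp_all add: left_ideal_module_def)

lemma a_inv_regular [simp]: "a_inv (regular_module R) x = a_inv R x"
  by (simp add: a_inv_def m_inv_def)

lemma set_add_regular [simp]: "set_add (regular_module R) = set_add R"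
  by (intro ext) (simp add: set_add_def')

lemma lmod_left_ideal: "ring R \<Longrightarrow> submodule P R (regular_module R) \<Longrightarrow> lmod R (left_ideal_module R P)"
  unfolding left_ideal_module_def by (rule lmod.lmod_restrict[OF ring_lmod_regular])

lemmas left_ideal_iff = lmod.submodule_iff[OF ring_lmod_regular, simplified]

lemma ideal_iff:
  assumes "ring R"
  shows "ideal I R \<longleftrightarrow> submodule I R (regular_module R) \<and> (\<forall>x\<in>I. \<forall>r\<in>carrier R. x \<otimes>\<^bsub>R\<^esub> r \<in> I)"
proof -
  have "subgroup I (add_monoid (regular_module R)) \<longleftrightarrow> subgroup I (add_monoid R)"
    unfolding subgroup_def m_inv_def by simp
  then show ?thesis
    using assms unfolding ideal_def ideal_axioms_def submodule_def submodule_axioms_def additive_subgroup_def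
    by auto
qed

lemma is_block_indecomposable:
  assumes "is_block R B" "ideal I R" "ideal J R" "I \<inter> J = {\<zero>\<^bsub>R\<^esub>}" "I <+>\<^bsub>R\<^esub> J = B"
  shows "I = {\<zero>\<^bsub>R\<^esub>} \<or> J = {\<zero>\<^bsub>R\<^esub>}"
proof (rule ccontr)
  assume *: "\<not> ?thesis"
  from assms(1)[unfolded is_block_def] have
    "\<not> (\<exists>I J. ideal I R \<and> ideal J R \<and> I \<noteq> {\<zero>\<^bsub>R\<^esub>} \<and> J \<noteq> {\<zero>\<^bsub>R\<^esub>} \<and>
         I \<inter> J = {\<zero>\<^bsub>R\<^esub>} \<and> I <+>\<^bsub>R\<^esub> J = B)" by (elim conjE)
  then show False by (rule notE) (intro exI[of _ I] exI[of _ J], use * assms in simp)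
qed

lemma is_block_complement:
  assumes "is_block R B"
  obtains B' where "ideal B' R" "B \<inter> B' = {\<zero>\<^bsub>R\<^esub>}" "B <+>\<^bsub>R\<^esub> B' = carrier R" "ideal B R" "B \<noteq> {\<zero>\<^bsub>R\<^esub>}"
  using assms[unfolded is_block_def] that by (elim conjE exE)

lemma set_add_mem: "x \<in> A <+>\<^bsub>R\<^esub> B \<longleftrightarrow> (\<exists>a\<in>A. \<exists>b\<in>B. x = a \<oplus>\<^bsub>R\<^esub> b)"
  unfolding set_add_def' by blast

text \<open>Jointly injective projections, with maps \<open>\<iota> k\<close> that hit one factor
  only, exhibit \<open>R\<close> as the product of the \<open>S k\<close> without forming a product
  ring. The case \<open>m = 1\<close> is a ring isomorphism.\<close>

locale ring_family =
  fixes R :: "('a, 'x) ring_scheme" and m :: nat and S :: "nat \<Rightarrow> ('b, 'y) ring_scheme"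
    and \<pi> :: "nat \<Rightarrow> 'a \<Rightarrow> 'b" and \<iota> :: "nat \<Rightarrow> 'b \<Rightarrow> 'a"
  assumes R: "ring R" and S: "k < m \<Longrightarrow> ring (S k)"
    and proj_hom: "k < m \<Longrightarrow> \<pi> k \<in> ring_hom R (S k)"
    and proj_joint_inj: "\<lbrakk>x \<in> carrier R; y \<in> carrier R; \<And>k. k < m \<Longrightarrow> \<pi> k x = \<pi> k y\<rbrakk> \<Longrightarrow> x = y"
    and incl_closed: "k < m \<Longrightarrow> b \<in> carrier (S k) \<Longrightarrow> \<iota> k b \<in> carrier R"
    and proj_incl: "\<lbrakk>k < m; j < m; b \<in> carrier (S k)\<rbrakk> \<Longrightarrow>
      \<pi> j (\<iota> k b) = (if j = k then b else \<zero>\<^bsub>S j\<^esub>)"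
begin

interpretation R: ring R by (rule R)

lemma proj_closed: "k < m \<Longrightarrow> x \<in> carrier R \<Longrightarrow> \<pi> k x \<in> carrier (S k)"
  using proj_hom ring_hom_closed by metis

lemma proj_add: "k < m \<Longrightarrow> x \<in> carrier R \<Longrightarrow> y \<in> carrier R \<Longrightarrow> \<pi> k (x \<oplus>\<^bsub>R\<^esub> y) = \<pi> k x \<oplus>\<^bsub>S k\<^esub> \<pi> k y"
  using proj_hom ring_hom_add by metis

lemma proj_mult: "k < m \<Longrightarrow> x \<in> carrier R \<Longrightarrow> y \<in> carrier R \<Longrightarrow> \<pi> k (x \<otimes>\<^bsub>R\<^esub> y) = \<pi> k x \<otimes>\<^bsub>S k\<^esub> \<pi> k y"
  using proj_hom ring_hom_mult by metis

lemma proj_zero: "k < m \<Longrightarrow> \<pi> k \<zero>\<^bsub>R\<^esub> = \<zero>\<^bsub>S k\<^esub>"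
  using ring_hom_zero[OF proj_hom R S] by simp

lemma proj_minus: "k < m \<Longrightarrow> x \<in> carrier R \<Longrightarrow> \<pi> k (\<ominus>\<^bsub>R\<^esub> x) = \<ominus>\<^bsub>S k\<^esub> \<pi> k x"
proof -
  assume *: "k < m" "x \<in> carrier R"
  interpret S: ring "S k" using S[OF *(1)] .
  show ?thesis
    using * proj_add[OF *(1), of "\<ominus>\<^bsub>R\<^esub> x" x] proj_zero[OF *(1)]
    by (metis R.l_neg R.a_inv_closed S.minus_equality proj_closed)
qed

lemma incl_eqI:
  assumes "k < m" "b \<in> carrier (S k)" "x \<in> carrier R"
    "\<And>j. j < m \<Longrightarrow> \<pi> j x = (if j = k then b else \<zero>\<^bsub>S j\<^esub>)"
  shows "\<iota> k b = x"
  by (rule proj_joint_inj) (use assms incl_closed proj_incl in auto)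

lemma incl_inj: "k < m \<Longrightarrow> b \<in> carrier (S k) \<Longrightarrow> c \<in> carrier (S k) \<Longrightarrow> \<iota> k b = \<iota> k c \<longleftrightarrow> b = c"
  using proj_incl[of k k] by metis

lemma incl_zero: "k < m \<Longrightarrow> \<iota> k \<zero>\<^bsub>S k\<^esub> = \<zero>\<^bsub>R\<^esub>"
proof -
  assume k: "k < m"
  interpret S: ring "S k" by (rule S[OF k])
  show ?thesis by (rule incl_eqI[OF k]) (auto simp: proj_zero)
qed

lemma incl_add:
  assumes "k < m" "b \<in> carrier (S k)" "c \<in> carrier (S k)"
  shows "\<iota> k (b \<oplus>\<^bsub>S k\<^esub> c) = \<iota> k b \<oplus>\<^bsub>R\<^esub> \<iota> k c"
proof -
  interpret S: ring "S k" by (rule S[OF assms(1)])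
  have "\<zero>\<^bsub>S j\<^esub> \<oplus>\<^bsub>S j\<^esub> \<zero>\<^bsub>S j\<^esub> = \<zero>\<^bsub>S j\<^esub>" if "j < m" for j
  proof -
    interpret S': ring "S j" by (rule S[OF that])
    show ?thesis by simp
  qed
  then show ?thesis
    by (intro incl_eqI[OF assms(1)]) (use assms in \<open>auto simp: incl_closed proj_add proj_incl\<close>)
qed

lemma incl_mult_left:
  assumes "k < m" "b \<in> carrier (S k)" "x \<in> carrier R"
  shows "\<iota> k (\<pi> k x \<otimes>\<^bsub>S k\<^esub> b) = x \<otimes>\<^bsub>R\<^esub> \<iota> k b"
proof -
  interpret S: ring "S k" by (rule S[OF assms(1)])
  have "\<pi> j x \<otimes>\<^bsub>S j\<^esub> \<zero>\<^bsub>S j\<^esub> = \<zero>\<^bsub>S j\<^esub>" if "j < m" for j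
  proof -
    interpret S': ring "S j" by (rule S[OF that])
    show ?thesis using proj_closed[OF that assms(3)] by simp
  qed
  then show ?thesis
    by (intro incl_eqI[OF assms(1)]) (use assms in \<open>auto simp: proj_closed incl_closed proj_mult proj_incl\<close>)
qed

lemma incl_mult_right:
  assumes "k < m" "b \<in> carrier (S k)" "x \<in> carrier R"
  shows "\<iota> k (b \<otimes>\<^bsub>S k\<^esub> \<pi> k x) = \<iota> k b \<otimes>\<^bsub>R\<^esub> x"
proof -
  interpret S: ring "S k" by (rule S[OF assms(1)])
  have "\<zero>\<^bsub>S j\<^esub> \<otimes>\<^bsub>S j\<^esub> \<pi> j x = \<zero>\<^bsub>S j\<^esub>" if "j < m" for j
  proof -
    interpret S': ring "S j" by (rule S[OF that])
    show ?thesis using proj_closed[OF that assms(3)] by simp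
  qed
  then show ?thesis
    by (intro incl_eqI[OF assms(1)]) (use assms in \<open>auto simp: proj_closed incl_closed proj_mult proj_incl\<close>)
qed

lemma incl_minus: "k < m \<Longrightarrow> b \<in> carrier (S k) \<Longrightarrow> \<iota> k (\<ominus>\<^bsub>S k\<^esub> b) = \<ominus>\<^bsub>R\<^esub> \<iota> k b"
proof -
  assume *: "k < m" "b \<in> carrier (S k)"
  interpret S: ring "S k" using S[OF *(1)] .
  show ?thesis
    using * incl_add[OF *(1), of "\<ominus>\<^bsub>S k\<^esub> b" b] incl_zero[OF *(1)]
    by (metis S.l_neg S.a_inv_closed R.minus_equality incl_closed)
qed

lemma incl_image_left_ideal:
  assumes k: "k < m" and P: "submodule P (S k) (regular_module (S k))"
  shows "submodule (\<iota> k ` P) R (regular_module R)"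
proof -
  interpret S: ring "S k" by (rule S[OF k])
  note d = P[unfolded left_ideal_iff[OF S[OF k]]]
  have Pc: "b \<in> carrier (S k)" if "b \<in> P" for b using d that by blast
  show ?thesis
    unfolding left_ideal_iff[OF R]
  proof (intro conjI ballI)
    show "\<iota> k ` P \<subseteq> carrier R" using Pc incl_closed[OF k] by blast
    show "\<zero>\<^bsub>R\<^esub> \<in> \<iota> k ` P" using d incl_zero[OF k] by (metis imageI)
  next
    fix x y assume "x \<in> \<iota> k ` P" "y \<in> \<iota> k ` P"
    then show "x \<oplus>\<^bsub>R\<^esub> y \<in> \<iota> k ` P" using d Pc by (auto simp: incl_add[OF k, symmetric])
  next
    fix x assume "x \<in> \<iota> k ` P"
    then show "\<ominus>\<^bsub>R\<^esub> x \<in> \<iota> k ` P" using d Pc by (auto simp: incl_minus[OF k, symmetric])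
  next
    fix a x assume "a \<in> carrier R" "x \<in> \<iota> k ` P"
    then show "a \<otimes>\<^bsub>R\<^esub> x \<in> \<iota> k ` P"
      using d Pc proj_closed[OF k] by (auto simp: incl_mult_left[OF k, symmetric])
  qed
qed

text \<open>All \<open>r\<close> with the same component \<open>\<pi> k r\<close> act alike on the
  image of \<open>\<iota> k\<close>. Pairing \<open>r\<close> with that component thus makes the two
  module structures correspond, although the rings of scalars differ.\<close>

lemma semi_iso_incl:
  assumes k: "k < m" and P: "submodule P (S k) (regular_module (S k))"
  shows "semi_iso (S k) R (left_ideal_module (S k) P) (left_ideal_module R (\<iota> k ` P)) (\<lambda>b r. \<pi> k r = b) (\<iota> k)"
proof -
  interpret A: lmod "S k" "left_ideal_module (S k) P" by (rule lmod_left_ideal[OF S[OF k] P])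
  interpret B: lmod R "left_ideal_module R (\<iota> k ` P)"
    by (rule lmod_left_ideal[OF R incl_image_left_ideal[OF k P]])
  have Pc: "b \<in> carrier (S k)" if "b \<in> P" for b using P[unfolded left_ideal_iff[OF S[OF k]]] that by blast
  show ?thesis
  proof
    show "bij_betw (\<iota> k) (carrier (left_ideal_module (S k) P)) (carrier (left_ideal_module R (\<iota> k ` P)))"
      unfolding bij_betw_def inj_on_def using Pc incl_inj[OF k] by auto
  next
    fix a assume "a \<in> carrier (S k)"
    then show "\<exists>b\<in>carrier R. \<pi> k b = a" using proj_incl[OF k k] incl_closed[OF k] by (metis (full_types))
  qed (auto simp: proj_closed[OF k] incl_add[OF k] Pc incl_mult_left[OF k])
qed

lemma preimage_left_ideal:
  assumes k: "k < m" and Q: "submodule Q (S k) (regular_module (S k))"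
  shows "submodule {x \<in> carrier R. \<pi> k x \<in> Q} R (regular_module R)"
  using Q unfolding left_ideal_iff[OF R] left_ideal_iff[OF S[OF k]]
  by (auto simp: proj_zero[OF k] proj_add[OF k] proj_minus[OF k] proj_mult[OF k] proj_closed[OF k])

lemma image_left_ideal:
  assumes k: "k < m" and P: "submodule P R (regular_module R)"
  shows "submodule (\<pi> k ` P) (S k) (regular_module (S k))"
proof -
  interpret S: ring "S k" by (rule S[OF k])
  note d = P[unfolded left_ideal_iff[OF R]]
  have Pc: "b \<in> carrier R" if "b \<in> P" for b using d that by blast
  show ?thesis
    unfolding left_ideal_iff[OF S[OF k]]
  proof (intro conjI ballI)
    show "\<pi> k ` P \<subseteq> carrier (S k)" using Pc proj_closed[OF k] by blast
    show "\<zero>\<^bsub>S k\<^esub> \<in> \<pi> k ` P" using d proj_zero[OF k] by (metis imageI)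
  next
    fix x y assume "x \<in> \<pi> k ` P" "y \<in> \<pi> k ` P"
    then show "x \<oplus>\<^bsub>S k\<^esub> y \<in> \<pi> k ` P" using d Pc by (auto simp: proj_add[OF k, symmetric])
  next
    fix x assume "x \<in> \<pi> k ` P"
    then show "\<ominus>\<^bsub>S k\<^esub> x \<in> \<pi> k ` P" using d Pc by (auto simp: proj_minus[OF k, symmetric])
  next
    fix a x assume a: "a \<in> carrier (S k)" and "x \<in> \<pi> k ` P"
    then obtain y where y: "y \<in> P" "x = \<pi> k y" by blast
    have "\<pi> k (\<iota> k a \<otimes>\<^bsub>R\<^esub> y) = a \<otimes>\<^bsub>S k\<^esub> x"
      using y Pc a by (simp add: proj_mult[OF k] incl_closed[OF k] proj_incl[OF k k])
    then show "a \<otimes>\<^bsub>S k\<^esub> x \<in> \<pi> k ` P"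
      using d y a incl_closed[OF k a] by (metis imageI)
  qed
qed

text \<open>Here \<open>N = e\<^sub>k P\<close> and \<open>N' = (1 - e\<^sub>k) P\<close> for the central idempotent \<open>e\<^sub>k = \<iota> k 1\<close>.\<close>

lemma component_split:
  assumes k: "k < m" and P: "submodule P R (regular_module R)"
  defines "N \<equiv> {x \<in> P. \<forall>j<m. j \<noteq> k \<longrightarrow> \<pi> j x = \<zero>\<^bsub>S j\<^esub>}" and "N' \<equiv> {x \<in> P. \<pi> k x = \<zero>\<^bsub>S k\<^esub>}"
  shows "submodule N R (regular_module R)" "submodule N' R (regular_module R)"
    "N \<inter> N' = {\<zero>\<^bsub>R\<^esub>}" "N <+>\<^bsub>R\<^esub> N' = P" "N = \<iota> k ` \<pi> k ` P"
proof -
  note d = P[unfolded left_ideal_iff[OF R]]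
  have Pc: "b \<in> carrier R" if "b \<in> P" for b using d that by blast
  have z: "\<zero>\<^bsub>S j\<^esub> \<oplus>\<^bsub>S j\<^esub> \<zero>\<^bsub>S j\<^esub> = \<zero>\<^bsub>S j\<^esub>" "\<ominus>\<^bsub>S j\<^esub> \<zero>\<^bsub>S j\<^esub> = \<zero>\<^bsub>S j\<^esub>" 
    "x \<in> carrier (S j) \<Longrightarrow> x \<otimes>\<^bsub>S j\<^esub> \<zero>\<^bsub>S j\<^esub> = \<zero>\<^bsub>S j\<^esub>" if "j < m" for j x
  proof -
    interpret S': ring "S j" by (rule S[OF that])
    show "\<zero>\<^bsub>S j\<^esub> \<oplus>\<^bsub>S j\<^esub> \<zero>\<^bsub>S j\<^esub> = \<zero>\<^bsub>S j\<^esub>" "\<ominus>\<^bsub>S j\<^esub> \<zero>\<^bsub>S j\<^esub> = \<zero>\<^bsub>S j\<^esub>"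
      "x \<in> carrier (S j) \<Longrightarrow> x \<otimes>\<^bsub>S j\<^esub> \<zero>\<^bsub>S j\<^esub> = \<zero>\<^bsub>S j\<^esub>" by simp_all
  qed
  show "submodule N R (regular_module R)" "submodule N' R (regular_module R)"
    unfolding left_ideal_iff[OF R] N_def N'_def
    using d k by (auto simp: proj_zero proj_add proj_minus proj_mult proj_closed Pc z)
  have ek: "\<iota> k \<one>\<^bsub>S k\<^esub> \<in> carrier R"
    using incl_closed[OF k] ring.ring_simprules(6)[OF S[OF k]] by blast
  have e: "\<iota> k (\<pi> k x) = \<iota> k \<one>\<^bsub>S k\<^esub> \<otimes>\<^bsub>R\<^esub> x" if "x \<in> carrier R" for x
    using incl_mult_right[OF k _ that, of "\<one>\<^bsub>S k\<^esub>"] ring.ring_simprules(6,12)[OF S[OF k]] proj_closed[OF k that]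
    by simp
  then have eP: "\<iota> k (\<pi> k x) \<in> P" if "x \<in> P" for x using that Pc ek d by simp
  have inN: "\<iota> k (\<pi> k x) \<in> N" if "x \<in> P" for x
    unfolding N_def using eP[OF that] proj_incl[OF k _ proj_closed[OF k Pc[OF that]]] by simp
  show "N \<inter> N' = {\<zero>\<^bsub>R\<^esub>}"
  proof
    show "N \<inter> N' \<subseteq> {\<zero>\<^bsub>R\<^esub>}"
    proof
      fix x assume "x \<in> N \<inter> N'"
      then have "x \<in> carrier R" "\<And>j. j < m \<Longrightarrow> \<pi> j x = \<pi> j \<zero>\<^bsub>R\<^esub>"
        unfolding N_def N'_def using Pc proj_zero by auto
      then show "x \<in> {\<zero>\<^bsub>R\<^esub>}" using proj_joint_inj by blast
    qed
    show "{\<zero>\<^bsub>R\<^esub>} \<subseteq> N \<inter> N'" unfolding N_def N'_def using d k proj_zero by auto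
  qed
  show "N = \<iota> k ` \<pi> k ` P"
  proof
    show "\<iota> k ` \<pi> k ` P \<subseteq> N" using inN by blast
    show "N \<subseteq> \<iota> k ` \<pi> k ` P"
    proof
      fix x assume x: "x \<in> N"
      then have xP: "x \<in> P" unfolding N_def by blast
      have "\<iota> k (\<pi> k x) = x"
        by (rule incl_eqI[OF k]) (use x xP Pc proj_closed[OF k] in \<open>auto simp: N_def\<close>)
      then show "x \<in> \<iota> k ` \<pi> k ` P" using xP by (metis imageI)
    qed
  qed
  show "N <+>\<^bsub>R\<^esub> N' = P"
  proof
    show "N <+>\<^bsub>R\<^esub> N' \<subseteq> P" unfolding set_add_mem subset_iff N_def N'_def using d by auto
    show "P \<subseteq> N <+>\<^bsub>R\<^esub> N'"
    proof
      fix x assume x: "x \<in> P"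
      let ?y = "x \<oplus>\<^bsub>R\<^esub> (\<ominus>\<^bsub>R\<^esub> \<iota> k (\<pi> k x))"
      have c: "\<iota> k (\<pi> k x) \<in> carrier R" using eP[OF x] Pc by blast
      have "\<pi> k ?y = \<zero>\<^bsub>S k\<^esub>"
        using x Pc c by (simp add: proj_add[OF k] proj_minus[OF k] proj_incl[OF k k] proj_closed[OF k] abelian_group.r_neg[OF ring.is_abelian_group[OF S[OF k]]])
      then have "?y \<in> N'" unfolding N'_def using d x eP[OF x] by blast
      moreover have "x = \<iota> k (\<pi> k x) \<oplus>\<^bsub>R\<^esub> ?y"
        using c Pc[OF x] by (metis R.a_inv_closed R.a_lcomm R.r_neg R.r_zero)
      ultimately show "x \<in> N <+>\<^bsub>R\<^esub> N'" unfolding set_add_mem using inN[OF x] by blast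
    qed
  qed
qed

lemma image_eq_zero_iff:
  assumes k: "k < m" and P: "P \<subseteq> carrier (S k)"
  shows "\<iota> k ` P = {\<zero>\<^bsub>R\<^esub>} \<longleftrightarrow> P = {\<zero>\<^bsub>S k\<^esub>}"
proof -
  interpret S: ring "S k" by (rule S[OF k])
  have "\<iota> k ` P = \<iota> k ` {\<zero>\<^bsub>S k\<^esub>} \<longleftrightarrow> P = {\<zero>\<^bsub>S k\<^esub>}"
    by (rule inj_on_image_eq_iff[where C = "carrier (S k)"]) (use P incl_inj[OF k] in \<open>auto simp: inj_on_def\<close>)
  then show ?thesis using incl_zero[OF k] by simp
qed

text \<open>A complement in \<open>R\<close> is the full preimage of a complement in
  \<open>S k\<close>; it contains all the other factors.\<close>

lemma principal_indecomposable_incl: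
  assumes k: "k < m" and P: "principal_indecomposable (S k) P"
  shows "principal_indecomposable R (\<iota> k ` P)"
proof -
  interpret S: ring "S k" by (rule S[OF k])
  obtain Q where sP: "submodule P (S k) (regular_module (S k))" and sQ: "submodule Q (S k) (regular_module (S k))"
    and PQ: "P \<inter> Q = {\<zero>\<^bsub>S k\<^esub>}" "P <+>\<^bsub>S k\<^esub> Q = carrier (S k)"
    and ind: "indecomposable_module (S k) (left_ideal_module (S k) P)"
    using P unfolding principal_indecomposable_def by blast
  note dP = sP[unfolded left_ideal_iff[OF S[OF k]]] and dQ = sQ[unfolded left_ideal_iff[OF S[OF k]]]
  let ?Q = "{x \<in> carrier R. \<pi> k x \<in> Q}"
  show ?thesis
    unfolding principal_indecomposable_def
  proof (intro conjI exI[of _ ?Q])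
    show "submodule (\<iota> k ` P) R (regular_module R)" by (rule incl_image_left_ideal[OF k sP])
    show "submodule ?Q R (regular_module R)" by (rule preimage_left_ideal[OF k sQ])
    show "\<iota> k ` P \<inter> ?Q = {\<zero>\<^bsub>R\<^esub>}"
    proof
      show "\<iota> k ` P \<inter> ?Q \<subseteq> {\<zero>\<^bsub>R\<^esub>}"
      proof
        fix x assume "x \<in> \<iota> k ` P \<inter> ?Q"
        then obtain b where b: "b \<in> P" "x = \<iota> k b" "\<pi> k x \<in> Q" by blast
        then have "b \<in> Q" using dP proj_incl[OF k k, of b] by auto
        then have "b = \<zero>\<^bsub>S k\<^esub>" using b(1) PQ(1) by blast
        then show "x \<in> {\<zero>\<^bsub>R\<^esub>}" using b(2) incl_zero[OF k] by simp
      qed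
      show "{\<zero>\<^bsub>R\<^esub>} \<subseteq> \<iota> k ` P \<inter> ?Q"
      proof -
        have "\<zero>\<^bsub>R\<^esub> \<in> \<iota> k ` P" using dP incl_zero[OF k] by (intro image_eqI[of _ _ "\<zero>\<^bsub>S k\<^esub>"]) auto
        then show ?thesis using dQ proj_zero[OF k] by simp
      qed
    qed
    show "\<iota> k ` P <+>\<^bsub>R\<^esub> ?Q = carrier R"
    proof
      show "\<iota> k ` P <+>\<^bsub>R\<^esub> ?Q \<subseteq> carrier R"
        unfolding subset_iff set_add_mem using dP incl_closed[OF k] by auto
      show "carrier R \<subseteq> \<iota> k ` P <+>\<^bsub>R\<^esub> ?Q"
      proof
        fix x assume x: "x \<in> carrier R"
        then have "\<pi> k x \<in> P <+>\<^bsub>S k\<^esub> Q" using PQ(2) proj_closed[OF k x] by simp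
        then obtain a b where ab: "a \<in> P" "b \<in> Q" "\<pi> k x = a \<oplus>\<^bsub>S k\<^esub> b"
          unfolding set_add_mem by blast
        have abc: "a \<in> carrier (S k)" "b \<in> carrier (S k)" using ab dP dQ by blast+
        let ?y = "x \<oplus>\<^bsub>R\<^esub> (\<ominus>\<^bsub>R\<^esub> \<iota> k a)"
        note c = incl_closed[OF k abc(1)]
        have "\<pi> k ?y = a \<oplus>\<^bsub>S k\<^esub> b \<oplus>\<^bsub>S k\<^esub> (\<ominus>\<^bsub>S k\<^esub> a)"
          using x c abc ab by (simp add: proj_add[OF k] proj_minus[OF k] proj_incl[OF k k])
        also have "\<dots> = b \<oplus>\<^bsub>S k\<^esub> (a \<oplus>\<^bsub>S k\<^esub> (\<ominus>\<^bsub>S k\<^esub> a))" using abc by (simp add: S.a_ac)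
        also have "\<dots> = b" using abc by (simp add: S.r_neg)
        finally have "?y \<in> ?Q" using ab x c by simp
        moreover have "x = \<iota> k a \<oplus>\<^bsub>R\<^esub> ?y" using c x by (metis R.a_inv_closed R.a_lcomm R.r_neg R.r_zero)
        ultimately show "x \<in> \<iota> k ` P <+>\<^bsub>R\<^esub> ?Q" unfolding set_add_mem using ab(1) by blast
      qed
    qed
    show "indecomposable_module R (left_ideal_module R (\<iota> k ` P))"
      using semi_iso.indecomposable_iff[OF semi_iso_incl[OF k sP]] ind by blast
  qed
qed

text \<open>Left ideals are stable under the idempotent \<open>\<iota> k \<one>\<close>. Hence
  \<open>\<iota> k\<close> lifts a common element of the two projections into both \<open>P\<close>
  and \<open>Q\<close>.\<close>

lemma proj_direct_sum:
  assumes k: "k < m" and sP: "submodule P R (regular_module R)" and sQ: "submodule Q R (regular_module R)"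
    and PQ: "P \<inter> Q = {\<zero>\<^bsub>R\<^esub>}" "P <+>\<^bsub>R\<^esub> Q = carrier R"
  shows "\<pi> k ` P \<inter> \<pi> k ` Q = {\<zero>\<^bsub>S k\<^esub>}" "\<pi> k ` P <+>\<^bsub>S k\<^esub> \<pi> k ` Q = carrier (S k)"
proof -
  interpret S: ring "S k" by (rule S[OF k])
  note dP = sP[unfolded left_ideal_iff[OF R]] and dQ = sQ[unfolded left_ideal_iff[OF R]]
  have Pc: "x \<in> carrier R" if "x \<in> P" for x using dP that by blast
  have Qc: "x \<in> carrier R" if "x \<in> Q" for x using dQ that by blast
  have ek: "\<iota> k \<one>\<^bsub>S k\<^esub> \<in> carrier R" by (rule incl_closed[OF k]) simp
  have e: "\<iota> k (\<pi> k z) = \<iota> k \<one>\<^bsub>S k\<^esub> \<otimes>\<^bsub>R\<^esub> z" if "z \<in> carrier R" for z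
    using incl_mult_right[OF k _ that, of "\<one>\<^bsub>S k\<^esub>"] proj_closed[OF k that] by simp
  have eP: "\<iota> k (\<pi> k z) \<in> P" if "z \<in> P" for z unfolding e[OF Pc[OF that]] using dP ek that by blast
  have eQ: "\<iota> k (\<pi> k z) \<in> Q" if "z \<in> Q" for z unfolding e[OF Qc[OF that]] using dQ ek that by blast
  show "\<pi> k ` P \<inter> \<pi> k ` Q = {\<zero>\<^bsub>S k\<^esub>}"
  proof
    show "\<pi> k ` P \<inter> \<pi> k ` Q \<subseteq> {\<zero>\<^bsub>S k\<^esub>}"
    proof
      fix y assume "y \<in> \<pi> k ` P \<inter> \<pi> k ` Q"
      then obtain a b where ab: "a \<in> P" "b \<in> Q" "y = \<pi> k a" "y = \<pi> k b" by blast
      have "\<iota> k y \<in> P \<inter> Q" using eP[OF ab(1)] eQ[OF ab(2)] ab(3,4) by simp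
      then have "\<iota> k y = \<iota> k \<zero>\<^bsub>S k\<^esub>" unfolding PQ incl_zero[OF k] by simp
      then show "y \<in> {\<zero>\<^bsub>S k\<^esub>}"
        using incl_inj[OF k, of y "\<zero>\<^bsub>S k\<^esub>"] ab(3) proj_closed[OF k Pc[OF ab(1)]] by simp
    qed
    have "\<zero>\<^bsub>R\<^esub> \<in> P" "\<zero>\<^bsub>R\<^esub> \<in> Q" using dP dQ by blast+
    then show "{\<zero>\<^bsub>S k\<^esub>} \<subseteq> \<pi> k ` P \<inter> \<pi> k ` Q" using proj_zero[OF k] by (metis IntI empty_subsetI imageI insert_subset)
  qed
  show "\<pi> k ` P <+>\<^bsub>S k\<^esub> \<pi> k ` Q = carrier (S k)"
  proof
    show "\<pi> k ` P <+>\<^bsub>S k\<^esub> \<pi> k ` Q \<subseteq> carrier (S k)"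
    proof
      fix y assume "y \<in> \<pi> k ` P <+>\<^bsub>S k\<^esub> \<pi> k ` Q"
      then obtain a b where "a \<in> P" "b \<in> Q" "y = \<pi> k a \<oplus>\<^bsub>S k\<^esub> \<pi> k b" unfolding set_add_mem by blast
      then show "y \<in> carrier (S k)" using Pc Qc proj_closed[OF k] by simp
    qed
    show "carrier (S k) \<subseteq> \<pi> k ` P <+>\<^bsub>S k\<^esub> \<pi> k ` Q"
    proof
      fix y assume y: "y \<in> carrier (S k)"
      then have "\<iota> k y \<in> P <+>\<^bsub>R\<^esub> Q" using PQ incl_closed[OF k] by blast
      then obtain a b where ab: "a \<in> P" "b \<in> Q" "\<iota> k y = a \<oplus>\<^bsub>R\<^esub> b" unfolding set_add_mem by blast
      have "y = \<pi> k (\<iota> k y)" using proj_incl[OF k k y] by simp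
      also have "\<dots> = \<pi> k a \<oplus>\<^bsub>S k\<^esub> \<pi> k b"
        unfolding ab(3) by (rule proj_add[OF k Pc[OF ab(1)] Qc[OF ab(2)]])
      finally show "y \<in> \<pi> k ` P <+>\<^bsub>S k\<^esub> \<pi> k ` Q" unfolding set_add_mem using ab by blast
    qed
  qed
qed

text \<open>A nonzero element of \<open>P\<close> has a nonzero component at some \<open>k\<close>,
  so the part of \<open>P\<close> in factor \<open>k\<close> is nonzero. Indecomposability then
  kills the complementary part, and \<open>P\<close> lies in that factor.\<close>

lemma principal_indecomposable_cases:
  assumes P: "principal_indecomposable R P"
  obtains k P' where "k < m" "principal_indecomposable (S k) P'" "P = \<iota> k ` P'"
proof -
  obtain Q where sP: "submodule P R (regular_module R)" and sQ: "submodule Q R (regular_module R)"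
    and PQ: "P \<inter> Q = {\<zero>\<^bsub>R\<^esub>}" "P <+>\<^bsub>R\<^esub> Q = carrier R"
    and ind: "indecomposable_module R (left_ideal_module R P)"
    using P unfolding principal_indecomposable_def by blast
  note dP = sP[unfolded left_ideal_iff[OF R]] and dQ = sQ[unfolded left_ideal_iff[OF R]]
  have "P \<noteq> {\<zero>\<^bsub>R\<^esub>}" using ind unfolding indecomposable_module_def by simp
  then obtain x where x: "x \<in> P" "x \<noteq> \<zero>\<^bsub>R\<^esub>" using dP by blast
  then have xc: "x \<in> carrier R" using dP by blast
  obtain k where k: "k < m" and kx: "\<pi> k x \<noteq> \<zero>\<^bsub>S k\<^esub>"
    using proj_joint_inj[OF xc R.zero_closed] x(2) proj_zero by metis
  let ?N = "{x \<in> P. \<forall>j<m. j \<noteq> k \<longrightarrow> \<pi> j x = \<zero>\<^bsub>S j\<^esub>}" and ?N' = "{x \<in> P. \<pi> k x = \<zero>\<^bsub>S k\<^esub>}"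
  note cs = component_split[OF k sP]
  have "?N \<noteq> {\<zero>\<^bsub>R\<^esub>}"
  proof
    assume "?N = {\<zero>\<^bsub>R\<^esub>}"
    moreover have "\<iota> k (\<pi> k x) \<in> \<iota> k ` \<pi> k ` P" using x(1) by blast
    ultimately have "\<iota> k (\<pi> k x) = \<iota> k \<zero>\<^bsub>S k\<^esub>" using cs(5) incl_zero[OF k] by simp
    then show False
      using kx incl_inj[OF k proj_closed[OF k xc]] ring.ring_simprules(2)[OF S[OF k]] by blast
  qed
  have sub: "submodule A R (left_ideal_module R P)" if "submodule A R (regular_module R)" "A \<subseteq> P" for A
    unfolding left_ideal_module_def
    using lmod.submodule_restrict_iff[OF ring_lmod_regular[OF R] sP] that by blast
  have s1: "submodule ?N R (left_ideal_module R P)" by (rule sub[OF cs(1)]) blast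
  have s2: "submodule ?N' R (left_ideal_module R P)" by (rule sub[OF cs(2)]) blast
  have sa: "set_add (left_ideal_module R P) = set_add R" by (intro ext) (simp add: set_add_def')
  have "?N' = {\<zero>\<^bsub>R\<^esub>}"
    using ind s1 s2 \<open>?N \<noteq> {\<zero>\<^bsub>R\<^esub>}\<close> cs(3,4) unfolding indecomposable_module_def sa left_ideal_module_simps by blast
  then have PN: "P = ?N"
  proof -
    have "x \<in> ?N" if x: "x \<in> P" for x
    proof -
      obtain a b where "a \<in> ?N" "b \<in> ?N'" "x = a \<oplus>\<^bsub>R\<^esub> b"
        using x cs(4) set_add_mem by (metis (no_types, lifting))
      moreover have "a \<in> carrier R" using \<open>a \<in> ?N\<close> dP by blast
      ultimately show ?thesis using \<open>?N' = {\<zero>\<^bsub>R\<^esub>}\<close> by (metis (no_types, lifting) R.r_zero singletonD)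
    qed
    then show ?thesis by blast
  qed
  let ?P = "\<pi> k ` P"
  interpret S: ring "S k" by (rule S[OF k])
  have Peq: "P = \<iota> k ` ?P" using PN cs(5) by simp
  note sP' = image_left_ideal[OF k sP] and sQ' = image_left_ideal[OF k sQ]
  have "principal_indecomposable (S k) ?P"
    unfolding principal_indecomposable_def
  proof (intro conjI exI[of _ "\<pi> k ` Q"] sP' sQ')
    show "?P \<inter> \<pi> k ` Q = {\<zero>\<^bsub>S k\<^esub>}" "?P <+>\<^bsub>S k\<^esub> \<pi> k ` Q = carrier (S k)"
      by (rule proj_direct_sum[OF k sP sQ PQ])+
    show "indecomposable_module (S k) (left_ideal_module (S k) ?P)"
      using semi_iso.indecomposable_iff[OF semi_iso_incl[OF k sP']] ind Peq by simp
  qed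
  then show thesis using that[OF k _ Peq] by blast
qed

lemma composition_series_incl:
  assumes "k < m" "submodule P (S k) (regular_module (S k))"
    "composition_series (S k) (left_ideal_module (S k) P) Ns"
  shows "composition_series R (left_ideal_module R (\<iota> k ` P)) (map (image (\<iota> k)) Ns)"
  by (rule semi_iso.composition_series_image[OF semi_iso_incl[OF assms(1,2)] assms(3)])

lemma isomorphic_incl_iff:
  assumes "k < m" "submodule P (S k) (regular_module (S k))" "submodule P' (S k) (regular_module (S k))"
  shows "lmod_isomorphic R (left_ideal_module R (\<iota> k ` P)) (left_ideal_module R (\<iota> k ` P')) \<longleftrightarrow>
    lmod_isomorphic (S k) (left_ideal_module (S k) P) (left_ideal_module (S k) P')"
  by (rule semi_iso_lmod_isomorphic_iff[symmetric, OF semi_iso_incl semi_iso_incl]) (use assms in auto)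

lemma multiplicity_incl:
  assumes "k < m" "submodule P (S k) (regular_module (S k))" "submodule P' (S k) (regular_module (S k))"
  shows "composition_multiplicity R (left_ideal_module R (\<iota> k ` P)) (pim_head R (\<iota> k ` P')) =
    composition_multiplicity (S k) (left_ideal_module (S k) P) (pim_head (S k) P')"
  by (rule semi_iso_composition_multiplicity[symmetric, OF semi_iso_incl semi_iso_pim_head[OF semi_iso_incl]])
    (use assms in auto)

lemma unit_acts_incl:
  assumes "k < m" "j < m" "b \<in> carrier (S j)"
  shows "\<iota> k \<one>\<^bsub>S k\<^esub> \<otimes>\<^bsub>R\<^esub> \<iota> j b = (if j = k then \<iota> j b else \<zero>\<^bsub>R\<^esub>)"
proof -
  interpret S: ring "S k" by (rule S[OF assms(1)])
  have e: "\<iota> k \<one>\<^bsub>S k\<^esub> \<otimes>\<^bsub>R\<^esub> x = \<iota> k (\<pi> k x)" if "x \<in> carrier R" for x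
    using incl_mult_right[OF assms(1) _ that, of "\<one>\<^bsub>S k\<^esub>"] proj_closed[OF assms(1) that] by simp
  show ?thesis
    using e[OF incl_closed[OF assms(2,3)]] proj_incl[OF assms(2,1,3)] incl_zero[OF assms(1)] by simp
qed

text \<open>An isomorphism commutes with \<open>e\<close>, which acts as the identity on one side
  and as zero on the other.\<close>

lemma no_hom_across:
  assumes e: "e \<in> carrier R" and M: "lmod R M" and N: "lmod R N" and f: "lmod_isomorphic R M N"
    and eM: "\<And>x. x \<in> carrier M \<Longrightarrow> e \<odot>\<^bsub>M\<^esub> x = x" and eN: "\<And>x. x \<in> carrier N \<Longrightarrow> e \<odot>\<^bsub>N\<^esub> x = \<zero>\<^bsub>N\<^esub>"
  shows "carrier M = {\<zero>\<^bsub>M\<^esub>}"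
proof -
  interpret M: lmod R M by fact
  interpret N: lmod R N by fact
  obtain f where f: "f \<in> lmod_hom R M N" "bij_betw f (carrier M) (carrier N)"
    using f unfolding lmod_isomorphic_def by blast
  have "f x = \<zero>\<^bsub>N\<^esub>" if "x \<in> carrier M" for x
  proof -
    have "f x \<in> carrier N" using f(1) that unfolding lmod_hom_def by auto
    moreover have "f (e \<odot>\<^bsub>M\<^esub> x) = e \<odot>\<^bsub>N\<^esub> f x" using f(1) e that unfolding lmod_hom_def by auto
    ultimately show ?thesis using eM[OF that] eN by simp
  qed
  then have "x = \<zero>\<^bsub>M\<^esub>" if "x \<in> carrier M" for x
    using f(2) that M.zero_closed unfolding bij_betw_def inj_on_def by metis
  then show ?thesis by auto
qed

lemma not_isomorphic_across:
  assumes "k < m" "j < m" "k \<noteq> j" "submodule P (S k) (regular_module (S k))"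
    "submodule P' (S j) (regular_module (S j))" "P \<noteq> {\<zero>\<^bsub>S k\<^esub>}"
  shows "\<not> lmod_isomorphic R (left_ideal_module R (\<iota> k ` P)) (left_ideal_module R (\<iota> j ` P'))"
proof
  assume f: "lmod_isomorphic R (left_ideal_module R (\<iota> k ` P)) (left_ideal_module R (\<iota> j ` P'))"
  have c: "P \<subseteq> carrier (S k)" "P' \<subseteq> carrier (S j)"
    using assms(4,5) left_ideal_iff S assms(1,2) by metis+
  have "carrier (left_ideal_module R (\<iota> k ` P)) = {\<zero>\<^bsub>left_ideal_module R (\<iota> k ` P)\<^esub>}"
  proof (rule no_hom_across[OF _ _ _ f])
    show "\<iota> k \<one>\<^bsub>S k\<^esub> \<in> carrier R" using incl_closed assms(1) ring.ring_simprules(6)[OF S] by blast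
  qed (use c assms unit_acts_incl[OF assms(1)] incl_image_left_ideal in \<open>auto intro!: lmod_left_ideal R\<close>)
  then show False using image_eq_zero_iff[OF assms(1) c(1)] assms(6) by simp
qed

text \<open>The idempotent of factor \<open>k\<close> acts as the identity on every factor of a
  series of the first module and as zero on the head, so no factor is isomorphic to that head. The
  given series is the witness that 0 is attained in the definite description.\<close>

lemma multiplicity_across:
  assumes "k < m" "j < m" "k \<noteq> j" "submodule P (S k) (regular_module (S k))"
    "submodule P' (S j) (regular_module (S j))" "composition_series (S k) (left_ideal_module (S k) P) Ns"
  shows "composition_multiplicity R (left_ideal_module R (\<iota> k ` P)) (pim_head R (\<iota> j ` P')) = 0"
proof -
  let ?M = "left_ideal_module R (\<iota> k ` P)" and ?L = "left_ideal_module R (\<iota> j ` P')"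
  interpret M: lmod R ?M using incl_image_left_ideal assms by (intro lmod_left_ideal R) auto
  interpret L: lmod R ?L using incl_image_left_ideal assms by (intro lmod_left_ideal R) auto
  let ?rad = "module_radical R ?L"
  have rad: "submodule ?rad R ?L" by (rule L.submodule_radical)
  have c: "P \<subseteq> carrier (S k)" "P' \<subseteq> carrier (S j)"
    using assms(4,5) left_ideal_iff S assms(1,2) by metis+
  have e: "\<iota> k \<one>\<^bsub>S k\<^esub> \<in> carrier R" using incl_closed assms(1) ring.ring_simprules(6)[OF S] by blast
  have none: "\<not> lmod_isomorphic R (series_factor ?M Ns i) (pim_head R (\<iota> j ` P'))"
    if Ns: "composition_series R ?M Ns" and i: "Suc i < length Ns" for Ns i
  proof
    assume f: "lmod_isomorphic R (series_factor ?M Ns i) (pim_head R (\<iota> j ` P'))"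
    have sub: "submodule (Ns ! i) R ?M" "submodule (Ns ! Suc i) R ?M" "Ns ! i \<subseteq> Ns ! Suc i"
      and simp: "simple_module R (series_factor ?M Ns i)"
      using Ns i unfolding composition_series_def by auto
    let ?N = "?M\<lparr>carrier := Ns ! Suc i\<rparr>"
    interpret N: lmod R ?N by (rule M.lmod_restrict[OF sub(2)])
    have sN: "submodule (Ns ! i) R ?N" using M.submodule_restrict_iff[OF sub(2)] sub by blast
    have "carrier (series_factor ?M Ns i) = {\<zero>\<^bsub>series_factor ?M Ns i\<^esub>}"
    proof (rule no_hom_across[OF e _ _ f])
      show "lmod R (series_factor ?M Ns i)" by (rule lmod_series_factor[OF M.lmod_axioms sub])
      show "lmod R (pim_head R (\<iota> j ` P'))" unfolding pim_head_def by (rule L.lmod_quotient[OF rad])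
    next
      fix x assume "x \<in> carrier (series_factor ?M Ns i)"
      then obtain y where y: "y \<in> Ns ! Suc i" "x = Ns ! i +>\<^bsub>?N\<^esub> y"
        unfolding series_factor_def N.quotient_simps[OF sN] by auto
      then obtain b where "b \<in> P" "y = \<iota> k b" using M.submoduleD(1)[OF sub(2)] by auto
      then have "\<iota> k \<one>\<^bsub>S k\<^esub> \<otimes>\<^bsub>R\<^esub> y = y" using unit_acts_incl[OF assms(1,1)] c(1) by auto
      then show "\<iota> k \<one>\<^bsub>S k\<^esub> \<odot>\<^bsub>series_factor ?M Ns i\<^esub> x = x"
        using N.quotient_smult[OF sN e, of y] y unfolding series_factor_def by simp
    next
      fix x assume "x \<in> carrier (pim_head R (\<iota> j ` P'))"
      then obtain b where b: "b \<in> P'" "x = ?rad +>\<^bsub>?L\<^esub> \<iota> j b"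
        unfolding pim_head_def L.quotient_simps[OF rad] by auto
      have "\<iota> k \<one>\<^bsub>S k\<^esub> \<otimes>\<^bsub>R\<^esub> \<iota> j b = \<zero>\<^bsub>R\<^esub>" using unit_acts_incl[OF assms(1,2)] c(2) b assms(3) by auto
      then show "\<iota> k \<one>\<^bsub>S k\<^esub> \<odot>\<^bsub>pim_head R (\<iota> j ` P')\<^esub> x = \<zero>\<^bsub>pim_head R (\<iota> j ` P')\<^esub>"
        using L.quotient_smult[OF rad e, of "\<iota> j b"] b L.coset_zero_iff[OF rad L.zero_closed] L.submoduleD(2)[OF rad]
        unfolding pim_head_def L.quotient_simps[OF rad] by simp
    qed
    then show False using simp unfolding simple_module_def by blast
  qed
  have ex: "composition_series R ?M (map (image (\<iota> k)) Ns)"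
    by (rule composition_series_incl) (use assms in auto)
  show ?thesis
    unfolding composition_multiplicity_def
  proof (rule the_equality)
    have z: "{i. Suc i < length Ns \<and> lmod_isomorphic R (series_factor ?M Ns i) (pim_head R (\<iota> j ` P'))} = {}"
      if "composition_series R ?M Ns" for Ns using none[OF that] by blast
    show "\<exists>Ns. composition_series R ?M Ns \<and>
      0 = card {i. Suc i < length Ns \<and> lmod_isomorphic R (series_factor ?M Ns i) (pim_head R (\<iota> j ` P'))}"
      by (intro exI conjI, rule ex, unfold z[OF ex], simp)
    show "c = 0" if "\<exists>Ns. composition_series R ?M Ns \<and>
      c = card {i. Suc i < length Ns \<and> lmod_isomorphic R (series_factor ?M Ns i) (pim_head R (\<iota> j ` P'))}" for c
      using that
    proof (elim exE conjE)
      fix Ns assume Ns: "composition_series R ?M Ns"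
        "c = card {i. Suc i < length Ns \<and> lmod_isomorphic R (series_factor ?M Ns i) (pim_head R (\<iota> j ` P'))}"
      show "c = 0" unfolding Ns(2) z[OF Ns(1)] by simp
    qed
  qed
qed

end

section \<open>Concatenated lists of representatives and block diagonal Cartan matrices\<close>

lemma square_mat_append:
  assumes "\<And>x y. x \<in> set xs \<Longrightarrow> y \<in> set ys \<Longrightarrow> f x y = (0::nat) \<and> f y x = 0"
  shows "mat (length (xs @ ys)) (length (xs @ ys)) (\<lambda>(i, j). f ((xs @ ys) ! i) ((xs @ ys) ! j)) =
    four_block_mat (mat (length xs) (length xs) (\<lambda>(i, j). f (xs ! i) (xs ! j))) (0\<^sub>m (length xs) (length ys))
      (0\<^sub>m (length ys) (length xs)) (mat (length ys) (length ys) (\<lambda>(i, j). f (ys ! i) (ys ! j)))"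
  by (rule eq_matI) (auto simp: nth_append assms)

lemma diag_block_mat_concat:
  assumes "\<And>k j x y. k < m \<Longrightarrow> j < m \<Longrightarrow> k \<noteq> j \<Longrightarrow> x \<in> set (g k) \<Longrightarrow> y \<in> set (g j) \<Longrightarrow> f x y = (0::nat)"
  shows "diag_block_mat (map (\<lambda>k. mat (length (g k)) (length (g k)) (\<lambda>(i, j). f (g k ! i) (g k ! j))) [0..<m]) =
    (let xs = concat (map g [0..<m]) in mat (length xs) (length xs) (\<lambda>(i, j). f (xs ! i) (xs ! j)))"
  using assms
proof (induction m)
  case (Suc m)
  let ?xs = "concat (map g [0..<m])"
  have IH: "diag_block_mat (map (\<lambda>k. mat (length (g k)) (length (g k)) (\<lambda>(i, j). f (g k ! i) (g k ! j))) [0..<m]) =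
    mat (length ?xs) (length ?xs) (\<lambda>(i, j). f (?xs ! i) (?xs ! j))"
    by (rule Suc.IH[unfolded Let_def]) (use Suc.prems less_SucI in blast)
  have c: "concat (map g [0..<Suc m]) = ?xs @ g m" by simp
  have cross: "f x y = 0 \<and> f y x = 0" if x: "x \<in> set ?xs" and y: "y \<in> set (g m)" for x y
  proof -
    obtain k where "k < m" "x \<in> set (g k)" using x by auto
    then show ?thesis using Suc.prems[of k m x y] Suc.prems[of m k y x] y by auto
  qed
  then show ?case
    unfolding c Let_def by (subst square_mat_append[OF cross]) (simp_all add: diag_block_mat_last IH Let_def)
qed auto

lemma pairwise_concat:
  assumes "\<And>k. k < m \<Longrightarrow> \<forall>i<length (g k). \<forall>j<length (g k). i \<noteq> j \<longrightarrow> \<not> r (g k ! i) (g k ! j)"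
    and "\<And>k j x y. k < m \<Longrightarrow> j < m \<Longrightarrow> k \<noteq> j \<Longrightarrow> x \<in> set (g k) \<Longrightarrow> y \<in> set (g j) \<Longrightarrow> \<not> r x y"
  shows "\<forall>i<length (concat (map g [0..<m])). \<forall>j<length (concat (map g [0..<m])). i \<noteq> j \<longrightarrow>
     \<not> r (concat (map g [0..<m]) ! i) (concat (map g [0..<m]) ! j)"
  using assms
proof (induction m)
  case (Suc m)
  let ?xs = "concat (map g [0..<m])"
  have c: "concat (map g [0..<Suc m]) = ?xs @ g m" by simp
  have IH: "\<forall>i<length ?xs. \<forall>j<length ?xs. i \<noteq> j \<longrightarrow> \<not> r (?xs ! i) (?xs ! j)"
    by (rule Suc.IH) (use Suc.prems less_SucI in blast)+
  have cross: "\<not> r x y \<and> \<not> r y x" if x: "x \<in> set ?xs" and y: "y \<in> set (g m)" for x y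
  proof -
    obtain k where "k < m" "x \<in> set (g k)" using x by auto
    then show ?thesis using Suc.prems(2)[of k m x y] Suc.prems(2)[of m k y x] y by auto
  qed
  show ?case
    unfolding c
  proof (intro allI impI)
    fix i j assume *: "i < length (?xs @ g m)" "j < length (?xs @ g m)" "i \<noteq> j"
    consider "i < length ?xs" "j < length ?xs" | "i < length ?xs" "j \<ge> length ?xs"
      | "i \<ge> length ?xs" "j < length ?xs" | "i \<ge> length ?xs" "j \<ge> length ?xs" by linarith
    then show "\<not> r ((?xs @ g m) ! i) ((?xs @ g m) ! j)"
    proof cases
      case 4
      then have "i - length ?xs \<noteq> j - length ?xs" "i - length ?xs < length (g m)" "j - length ?xs < length (g m)"
        using * by auto
      then show ?thesis using 4 Suc.prems(1)[of m] by (simp add: nth_append)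
    next
      case 1
      then show ?thesis using IH * by (simp add: nth_append)
    next
      case 2
      then have "?xs ! i \<in> set ?xs" "g m ! (j - length ?xs) \<in> set (g m)"
        using * by (auto intro!: nth_mem simp del: set_concat)
      then show ?thesis using cross 2 by (simp add: nth_append del: set_concat)
    next
      case 3
      then have "?xs ! j \<in> set ?xs" "g m ! (i - length ?xs) \<in> set (g m)"
        using * by (auto intro!: nth_mem simp del: set_concat)
      then show ?thesis using cross 3 by (simp add: nth_append del: set_concat)
    qed
  qed
qed simp

context ring_family
begin

interpretation R: ring R by (rule R)

lemma pim_representatives_concat:
  assumes "\<And>k. k < m \<Longrightarrow> pim_representatives (S k) (Pss k)"
  shows "pim_representatives R (concat (map (\<lambda>k. map (image (\<iota> k)) (Pss k)) [0..<m]))"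
proof -
  let ?g = "\<lambda>k. map (image (\<iota> k)) (Pss k)"
  have pim: "principal_indecomposable (S k) P" if "k < m" "P \<in> set (Pss k)" for k P
    using assms that unfolding pim_representatives_def by blast
  have sub: "submodule P (S k) (regular_module (S k))" if "principal_indecomposable (S k) P" for k P
    using that unfolding principal_indecomposable_def by blast
  have nz: "P \<noteq> {\<zero>\<^bsub>S k\<^esub>}" if "principal_indecomposable (S k) P" for k P
    using that unfolding principal_indecomposable_def indecomposable_module_def by simp
  show ?thesis
    unfolding pim_representatives_def
  proof (intro conjI)
    show "\<forall>P\<in>set (concat (map ?g [0..<m])). principal_indecomposable R P"
      using pim principal_indecomposable_incl by auto
    show "\<forall>i<length (concat (map ?g [0..<m])). \<forall>j<length (concat (map ?g [0..<m])). i \<noteq> j \<longrightarrow>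
       \<not> lmod_isomorphic R (left_ideal_module R (concat (map ?g [0..<m]) ! i))
          (left_ideal_module R (concat (map ?g [0..<m]) ! j))"
    proof (rule pairwise_concat)
      fix k assume k: "k < m"
      show "\<forall>i<length (?g k). \<forall>j<length (?g k). i \<noteq> j \<longrightarrow>
          \<not> lmod_isomorphic R (left_ideal_module R (?g k ! i)) (left_ideal_module R (?g k ! j))"
        using assms[OF k] pim[OF k] isomorphic_incl_iff[OF k sub sub] unfolding pim_representatives_def by auto
    next
      fix k j A B assume *: "k < m" "j < m" "k \<noteq> j" "A \<in> set (?g k)" "B \<in> set (?g j)"
      then obtain P P' where "P \<in> set (Pss k)" "A = \<iota> k ` P" "P' \<in> set (Pss j)" "B = \<iota> j ` P'" by auto
      then show "\<not> lmod_isomorphic R (left_ideal_module R A) (left_ideal_module R B)"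
        using not_isomorphic_across[OF *(1,2,3)] sub nz pim * by metis
    qed
    show "\<forall>P. principal_indecomposable R P \<longrightarrow>
       (\<exists>P'\<in>set (concat (map ?g [0..<m])). lmod_isomorphic R (left_ideal_module R P) (left_ideal_module R P'))"
    proof (intro allI impI)
      fix P assume "principal_indecomposable R P"
      then obtain k P' where k: "k < m" "principal_indecomposable (S k) P'" "P = \<iota> k ` P'"
        by (rule principal_indecomposable_cases)
      then obtain Q where Q: "Q \<in> set (Pss k)" "lmod_isomorphic (S k) (left_ideal_module (S k) P') (left_ideal_module (S k) Q)"
        using assms[OF k(1)] unfolding pim_representatives_def by blast
      then have "lmod_isomorphic R (left_ideal_module R P) (left_ideal_module R (\<iota> k ` Q))"
        using isomorphic_incl_iff[OF k(1) sub[OF k(2)] sub[OF pim[OF k(1) Q(1)]]] k(3) by simp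
      then show "\<exists>P'\<in>set (concat (map ?g [0..<m])). lmod_isomorphic R (left_ideal_module R P) (left_ideal_module R P')"
        using Q(1) k(1) by auto
    qed
  qed
qed

text \<open>Composition series serve to evaluate multiplicities between different factors, hence the
  guard \<open>m > 1\<close>. With \<open>m = 1\<close> the lemma transports Cartan matrices along
  an arbitrary ring isomorphism.\<close>

lemma cartan_matrix_concat:
  assumes "\<And>k P. k < m \<Longrightarrow> P \<in> set (Pss k) \<Longrightarrow> submodule P (S k) (regular_module (S k))"
    and "\<And>k P. k < m \<Longrightarrow> P \<in> set (Pss k) \<Longrightarrow> m > 1 \<Longrightarrow> \<exists>Ns. composition_series (S k) (left_ideal_module (S k) P) Ns"
  shows "cartan_matrix R (concat (map (\<lambda>k. map (image (\<iota> k)) (Pss k)) [0..<m])) =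
    diag_block_mat (map (\<lambda>k. cartan_matrix (S k) (Pss k)) [0..<m])"
proof -
  let ?g = "\<lambda>k. map (image (\<iota> k)) (Pss k)"
  let ?f = "\<lambda>A B. composition_multiplicity R (left_ideal_module R A) (pim_head R B)"
  have "cartan_matrix (S k) (Pss k) = mat (length (?g k)) (length (?g k)) (\<lambda>(i, j). ?f (?g k ! i) (?g k ! j))"
    if k: "k < m" for k
    unfolding cartan_matrix_def
    by (rule eq_matI) (use multiplicity_incl[OF k] assms(1)[OF k] in auto)
  then have "diag_block_mat (map (\<lambda>k. cartan_matrix (S k) (Pss k)) [0..<m]) =
    diag_block_mat (map (\<lambda>k. mat (length (?g k)) (length (?g k)) (\<lambda>(i, j). ?f (?g k ! i) (?g k ! j))) [0..<m])"
    by (intro arg_cong[of _ _ diag_block_mat] map_cong) auto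
  also have "\<dots> = cartan_matrix R (concat (map ?g [0..<m]))"
    unfolding cartan_matrix_def
  proof (subst diag_block_mat_concat)
    fix k j A B assume *: "k < m" "j < m" "k \<noteq> j" "A \<in> set (?g k)" "B \<in> set (?g j)"
    then obtain P P' where P: "P \<in> set (Pss k)" "A = \<iota> k ` P" "P' \<in> set (Pss j)" "B = \<iota> j ` P'" by auto
    have "m > 1" using * by linarith
    then obtain Ns where "composition_series (S k) (left_ideal_module (S k) P) Ns"
      using assms(2)[OF *(1) P(1)] by blast
    then show "?f A B = 0" using multiplicity_across[OF *(1,2,3)] assms(1) P * by metis
  qed (simp add: Let_def)
  finally show ?thesis by simp
qed

lemma composition_series_exists:
  assumes "\<And>k P. k < m \<Longrightarrow> principal_indecomposable (S k) P \<Longrightarrow> \<exists>Ns. composition_series (S k) (left_ideal_module (S k) P) Ns"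
    and "principal_indecomposable R P"
  shows "\<exists>Ns. composition_series R (left_ideal_module R P) Ns"
proof -
  from assms(2) obtain k P' where k: "k < m" "principal_indecomposable (S k) P'" "P = \<iota> k ` P'"
    by (rule principal_indecomposable_cases)
  then show ?thesis
    using assms(1) composition_series_incl unfolding principal_indecomposable_def by metis
qed

section \<open>Two-sided ideals and blocks of a product\<close>

lemma image_ideal:
  assumes k: "k < m" and that: "ideal I R"
  shows "ideal (\<pi> k ` I) (S k)"
  unfolding ideal_iff[OF S[OF k]]
proof (intro conjI ballI)
    show "submodule (\<pi> k ` I) (S k) (regular_module (S k))"
      using image_left_ideal[OF k] that ideal_iff[OF R] by blast
    fix x r assume "x \<in> \<pi> k ` I" and r: "r \<in> carrier (S k)"
    then obtain y where y: "y \<in> I" "x = \<pi> k y" by blast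
    have yc: "y \<in> carrier R" using that y ideal.Icarr by metis
    have "x \<otimes>\<^bsub>S k\<^esub> r = \<pi> k (y \<otimes>\<^bsub>R\<^esub> \<iota> k r)"
      using y yc r by (simp add: proj_mult[OF k] incl_closed[OF k] proj_incl[OF k k])
    then show "x \<otimes>\<^bsub>S k\<^esub> r \<in> \<pi> k ` I" using ideal.I_r_closed[OF that y(1)] incl_closed[OF k r] by blast
qed

text \<open>A decomposition of the image of \<open>\<iota> k\<close> into ideals of \<open>R\<close>
  projects to a decomposition of \<open>S k\<close>, and \<open>\<iota> k\<close> after
  \<open>\<pi> k\<close> recovers each summand.\<close>

lemma is_block_incl:
  assumes k: "k < m" and b: "is_block (S k) (carrier (S k))"
  shows "is_block R (\<iota> k ` carrier (S k))"
proof -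
  interpret S: ring "S k" by (rule S[OF k])
  let ?B = "\<iota> k ` carrier (S k)" and ?B' = "{x \<in> carrier R. \<pi> k x = \<zero>\<^bsub>S k\<^esub>}"
  have sc: "submodule (carrier R) R (regular_module R)"
    using lmod.submodule_carrier[OF ring_lmod_regular[OF R]] by simp
  have img: "\<pi> k ` carrier R = carrier (S k)"
    using proj_closed[OF k] proj_incl[OF k k] incl_closed[OF k] by (auto simp: image_iff) metis
  note cs = component_split[OF k sc, unfolded img]
  have B: "ideal ?B R"
    unfolding ideal_iff[OF R] using cs(1,5) proj_closed[OF k]
    by (auto simp: incl_mult_right[OF k, symmetric])
  have B': "ideal ?B' R"
    unfolding ideal_iff[OF R] using cs(2) by (auto simp: proj_mult[OF k] proj_closed[OF k])
  note b' = b[unfolded is_block_def]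
  have nz: "?B \<noteq> {\<zero>\<^bsub>R\<^esub>}" using image_eq_zero_iff[OF k] b' by blast
  have nd: "I = {\<zero>\<^bsub>R\<^esub>} \<or> J = {\<zero>\<^bsub>R\<^esub>}"
    if I: "ideal I R" and J: "ideal J R" and IJ: "I \<inter> J = {\<zero>\<^bsub>R\<^esub>}" "I <+>\<^bsub>R\<^esub> J = ?B" for I J
  proof -
    have Ic: "I \<subseteq> carrier R" "J \<subseteq> carrier R" "\<zero>\<^bsub>R\<^esub> \<in> I" "\<zero>\<^bsub>R\<^esub> \<in> J"
      using I J unfolding ideal_iff[OF R] left_ideal_iff[OF R] by blast+
    have IB: "I \<subseteq> ?B"
    proof
      fix x assume "x \<in> I"
      then have "x \<oplus>\<^bsub>R\<^esub> \<zero>\<^bsub>R\<^esub> \<in> I <+>\<^bsub>R\<^esub> J" using Ic unfolding set_add_mem by blast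
      then show "x \<in> ?B" using IJ \<open>x \<in> I\<close> Ic by auto
    qed
    have JB: "J \<subseteq> ?B"
    proof
      fix x assume "x \<in> J"
      then have "\<zero>\<^bsub>R\<^esub> \<oplus>\<^bsub>R\<^esub> x \<in> I <+>\<^bsub>R\<^esub> J" using Ic unfolding set_add_mem by blast
      then show "x \<in> ?B" using IJ \<open>x \<in> J\<close> Ic by auto
    qed
    have ip: "\<iota> k ` \<pi> k ` A = A" if "A \<subseteq> ?B" for A
    proof -
      have "\<iota> k (\<pi> k x) = x" if "x \<in> ?B" for x using that proj_incl[OF k k] by auto
      then show ?thesis using that by (auto simp: image_image subset_iff)
    qed
    have inter: "\<pi> k ` I \<inter> \<pi> k ` J = {\<zero>\<^bsub>S k\<^esub>}"
    proof
      show "\<pi> k ` I \<inter> \<pi> k ` J \<subseteq> {\<zero>\<^bsub>S k\<^esub>}"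
      proof
        fix y assume y: "y \<in> \<pi> k ` I \<inter> \<pi> k ` J"
        then have "\<iota> k y \<in> I \<inter> J" using ip[OF IB] ip[OF JB] by blast
        then have "\<iota> k y = \<iota> k \<zero>\<^bsub>S k\<^esub>" using IJ incl_zero[OF k] by auto
        moreover have "y \<in> carrier (S k)" using y Ic proj_closed[OF k] by blast
        ultimately show "y \<in> {\<zero>\<^bsub>S k\<^esub>}" using incl_inj[OF k] by blast
      qed
      show "{\<zero>\<^bsub>S k\<^esub>} \<subseteq> \<pi> k ` I \<inter> \<pi> k ` J" using Ic proj_zero[OF k] by (auto simp: image_iff) metis+
    qed
    have "\<pi> k ` I <+>\<^bsub>S k\<^esub> \<pi> k ` J = carrier (S k)"
    proof
      show "\<pi> k ` I <+>\<^bsub>S k\<^esub> \<pi> k ` J \<subseteq> carrier (S k)"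
        unfolding subset_iff set_add_mem using Ic proj_closed[OF k] by blast
      show "carrier (S k) \<subseteq> \<pi> k ` I <+>\<^bsub>S k\<^esub> \<pi> k ` J"
      proof
        fix y assume y: "y \<in> carrier (S k)"
        then have "\<iota> k y \<in> I <+>\<^bsub>R\<^esub> J" using IJ by blast
        then obtain a b where ab: "a \<in> I" "b \<in> J" "\<iota> k y = a \<oplus>\<^bsub>R\<^esub> b" unfolding set_add_mem by blast
        have "y = \<pi> k (\<iota> k y)" using proj_incl[OF k k y] by simp
        also have "\<dots> = \<pi> k a \<oplus>\<^bsub>S k\<^esub> \<pi> k b" using ab Ic proj_add[OF k, of a b] by auto
        finally show "y \<in> \<pi> k ` I <+>\<^bsub>S k\<^esub> \<pi> k ` J" unfolding set_add_mem using ab by blast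
      qed
    qed
    then have "\<pi> k ` I = {\<zero>\<^bsub>S k\<^esub>} \<or> \<pi> k ` J = {\<zero>\<^bsub>S k\<^esub>}"
      by (rule is_block_indecomposable[OF b image_ideal[OF k I] image_ideal[OF k J] inter])
    then show ?thesis using ip[OF IB] ip[OF JB] incl_zero[OF k] by auto
  qed
  have 4: "?B \<inter> ?B' = {\<zero>\<^bsub>R\<^esub>}" "?B <+>\<^bsub>R\<^esub> ?B' = carrier R"
    using cs(3,4,5) by simp_all
  show ?thesis
    unfolding is_block_def using B B' nz nd 4 by blast
qed

text \<open>Some element of \<open>B\<close> has a nonzero component at \<open>k\<close>. Splitting
  \<open>B\<close> by the idempotent of that factor leaves one part only, so \<open>B\<close> sits
  inside factor \<open>k\<close>. The decomposition of \<open>R\<close> by \<open>B\<close> and its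
  complement then projects to one of the indecomposable ring \<open>S k\<close>, so \<open>B\<close>
  fills the factor.\<close>

lemma block_cases:
  assumes b: "is_block R B" and bk: "\<And>k. k < m \<Longrightarrow> is_block (S k) (carrier (S k))"
  obtains k where "k < m" "B = \<iota> k ` carrier (S k)"
proof -
  obtain B' where B: "ideal B R" "B \<noteq> {\<zero>\<^bsub>R\<^esub>}" and B': "ideal B' R" "B \<inter> B' = {\<zero>\<^bsub>R\<^esub>}" "B <+>\<^bsub>R\<^esub> B' = carrier R"
    using is_block_complement[OF b] .
  have sB: "submodule B R (regular_module R)" and sB': "submodule B' R (regular_module R)"
    using B B' ideal_iff[OF R] by blast+
  note d = sB[unfolded left_ideal_iff[OF R]] and d' = sB'[unfolded left_ideal_iff[OF R]]
  obtain x where x: "x \<in> B" "x \<noteq> \<zero>\<^bsub>R\<^esub>" using B d by blast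
  then have xc: "x \<in> carrier R" using d by blast
  obtain k where k: "k < m" and kx: "\<pi> k x \<noteq> \<zero>\<^bsub>S k\<^esub>"
    using proj_joint_inj[OF xc R.zero_closed] x(2) proj_zero by metis
  interpret S: ring "S k" by (rule S[OF k])
  let ?N = "{x \<in> B. \<forall>j<m. j \<noteq> k \<longrightarrow> \<pi> j x = \<zero>\<^bsub>S j\<^esub>}" and ?N' = "{x \<in> B. \<pi> k x = \<zero>\<^bsub>S k\<^esub>}"
  note cs = component_split[OF k sB]
  have zm: "\<zero>\<^bsub>S j\<^esub> \<otimes>\<^bsub>S j\<^esub> y = \<zero>\<^bsub>S j\<^esub>" if "j < m" "y \<in> carrier (S j)" for j y
    using ring.ring_simprules(24)[OF S[OF that(1)] that(2)] .
  have rB: "y \<otimes>\<^bsub>R\<^esub> r \<in> B" if "y \<in> B" "r \<in> carrier R" for y r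
    using ideal.I_r_closed[OF B(1)] that by blast
  have idN: "ideal ?N R" "ideal ?N' R"
    unfolding ideal_iff[OF R] using cs(1,2) d k rB
    by (auto simp: proj_mult zm proj_closed subset_iff)
  moreover have "?N \<noteq> {\<zero>\<^bsub>R\<^esub>}"
  proof
    assume "?N = {\<zero>\<^bsub>R\<^esub>}"
    moreover have "\<iota> k (\<pi> k x) \<in> \<iota> k ` \<pi> k ` B" using x(1) by blast
    ultimately have "\<iota> k (\<pi> k x) = \<iota> k \<zero>\<^bsub>S k\<^esub>" using cs(5) incl_zero[OF k] by simp
    then show False
      using kx incl_inj[OF k proj_closed[OF k xc]] by blast
  qed
  ultimately have N': "?N' = {\<zero>\<^bsub>R\<^esub>}" using is_block_indecomposable[OF b idN cs(3,4)] by simp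
  have BN: "B = \<iota> k ` \<pi> k ` B"
  proof -
    have "y \<in> ?N" if y: "y \<in> B" for y
    proof -
      obtain a b where "a \<in> ?N" "b \<in> ?N'" "y = a \<oplus>\<^bsub>R\<^esub> b"
        using y cs(4) set_add_mem by (metis (no_types, lifting))
      moreover have "a \<in> carrier R" using \<open>a \<in> ?N\<close> d by blast
      ultimately show ?thesis using N' by (metis (no_types, lifting) R.r_zero singletonD)
    qed
    then have "B = ?N" by blast
    then show ?thesis using cs(5) by simp
  qed
  let ?I = "\<pi> k ` B" and ?J = "\<pi> k ` B'"
  have inter: "?I \<inter> ?J = {\<zero>\<^bsub>S k\<^esub>}" and sum: "?I <+>\<^bsub>S k\<^esub> ?J = carrier (S k)"
    by (rule proj_direct_sum[OF k sB sB' B'(2,3)])+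
  have "?I = {\<zero>\<^bsub>S k\<^esub>} \<or> ?J = {\<zero>\<^bsub>S k\<^esub>}"
    by (rule is_block_indecomposable[OF bk[OF k] image_ideal[OF k B(1)] image_ideal[OF k B'(1)] inter sum])
  moreover have "?I \<noteq> {\<zero>\<^bsub>S k\<^esub>}" using x kx by blast
  ultimately have J: "?J = {\<zero>\<^bsub>S k\<^esub>}" by blast
  have "?I = carrier (S k)"
  proof
    show "?I \<subseteq> carrier (S k)" using d proj_closed[OF k] by blast
    show "carrier (S k) \<subseteq> ?I"
    proof
      fix y assume "y \<in> carrier (S k)"
      then obtain a b where "a \<in> ?I" "b \<in> ?J" "y = a \<oplus>\<^bsub>S k\<^esub> b"
        using sum by (metis set_add_mem)
      moreover have "a \<in> carrier (S k)" using \<open>a \<in> ?I\<close> d proj_closed[OF k] by blast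
      ultimately show "y \<in> ?I" using J by (metis S.r_zero singletonD)
    qed
  qed
  then show thesis using that[OF k] BN by simp
qed

lemma blocks_bij_betw:
  assumes bk: "\<And>k. k < m \<Longrightarrow> is_block (S k) (carrier (S k))"
  shows "bij_betw (\<lambda>k. \<iota> k ` carrier (S k)) {..<m} {B. is_block R B}"
  unfolding bij_betw_def
proof
  show "inj_on (\<lambda>k. \<iota> k ` carrier (S k)) {..<m}"
  proof (rule inj_onI, rule ccontr)
    fix k j assume *: "k \<in> {..<m}" "j \<in> {..<m}" "\<iota> k ` carrier (S k) = \<iota> j ` carrier (S j)" "k \<noteq> j"
    have k: "k < m" and j: "j < m" using * by auto
    have "x = \<zero>\<^bsub>S k\<^esub>" if x: "x \<in> carrier (S k)" for x
    proof -
      obtain y where "y \<in> carrier (S j)" "\<iota> k x = \<iota> j y" using * x by blast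
      then show ?thesis using proj_incl[OF k k x] proj_incl[OF j k, of y] *(4) by simp
    qed
    then have "carrier (S k) = {\<zero>\<^bsub>S k\<^esub>}" using ring.ring_simprules(2)[OF S[OF k]] by blast
    then show False using bk[OF k] unfolding is_block_def by blast
  qed
  show "(\<lambda>k. \<iota> k ` carrier (S k)) ` {..<m} = {B. is_block R B}"
  proof (intro equalityI subsetI)
    fix B assume "B \<in> {B. is_block R B}"
    then obtain k where "k < m" "B = \<iota> k ` carrier (S k)" using block_cases[OF _ bk] by blast
    then show "B \<in> (\<lambda>k. \<iota> k ` carrier (S k)) ` {..<m}" by blast
  qed (use is_block_incl bk in blast)
qed

end

section \<open>Transport along a ring isomorphism\<close>

lemma ring_family_iso:
  assumes "ring R" "ring S" "h \<in> ring_iso R S"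
  shows "ring_family R 1 (\<lambda>_. S) (\<lambda>_. h) (\<lambda>_. inv_into (carrier R) h)"
proof -
  have b: "bij_betw h (carrier R) (carrier S)" and hom: "h \<in> ring_hom R S"
    using assms(3) unfolding ring_iso_def by auto
  show ?thesis
  proof (rule ring_family.intro)
    fix k :: nat and c assume "c \<in> carrier S"
    then show "inv_into (carrier R) h c \<in> carrier R" using b by (metis bij_betw_def inv_into_into)
  next
    fix k j :: nat and c assume "k < 1" "j < 1" "c \<in> carrier S"
    then show "h (inv_into (carrier R) h c) = (if j = k then c else \<zero>\<^bsub>S\<^esub>)"
      using b by (auto simp: bij_betw_inv_into_right)
  qed (use assms hom b in \<open>auto simp: bij_betw_def inj_on_def\<close>)
qed

lemma iso_pim_representatives:
  assumes "ring R" "ring S" "h \<in> ring_iso R S" "pim_representatives S Ps"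
  shows "pim_representatives R (map (image (inv_into (carrier R) h)) Ps)"
    "cartan_matrix R (map (image (inv_into (carrier R) h)) Ps) = cartan_matrix S Ps"
proof -
  interpret ring_family R 1 "\<lambda>_. S" "\<lambda>_. h" "\<lambda>_. inv_into (carrier R) h"
    by (rule ring_family_iso) fact+
  show "pim_representatives R (map (image (inv_into (carrier R) h)) Ps)"
    using pim_representatives_concat[of "\<lambda>_. Ps"] assms(4) by simp
  show "cartan_matrix R (map (image (inv_into (carrier R) h)) Ps) = cartan_matrix S Ps"
  proof (rule trans)
    show "cartan_matrix R (map (image (inv_into (carrier R) h)) Ps) = diag_block_mat [cartan_matrix S Ps]"
      using cartan_matrix_concat[of "\<lambda>_. Ps"] assms(4)
      unfolding pim_representatives_def principal_indecomposable_def by simp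
  qed (rule diag_block_mat_singleton)
qed

lemma iso_is_block_carrier:
  assumes "ring R" "ring S" "h \<in> ring_iso R S" "is_block S (carrier S)"
  shows "is_block R (carrier R)"
proof -
  interpret ring_family R 1 "\<lambda>_. S" "\<lambda>_. h" "\<lambda>_. inv_into (carrier R) h"
    by (rule ring_family_iso) fact+
  have "bij_betw h (carrier R) (carrier S)" using assms(3) unfolding ring_iso_def by auto
  then have "inv_into (carrier R) h ` carrier S = carrier R"
    using bij_betw_inv_into bij_betw_imp_surj_on by blast
  then show ?thesis using is_block_incl[of 0] assms(4) by simp
qed

lemma iso_composition_series_exists:
  assumes "ring R" "ring S" "h \<in> ring_iso R S"
    "\<And>P. principal_indecomposable S P \<Longrightarrow> \<exists>Ns. composition_series S (left_ideal_module S P) Ns"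
    "principal_indecomposable R P"
  shows "\<exists>Ns. composition_series R (left_ideal_module R P) Ns"
proof -
  interpret ring_family R 1 "\<lambda>_. S" "\<lambda>_. h" "\<lambda>_. inv_into (carrier R) h"
    by (rule ring_family_iso) fact+
  show ?thesis using composition_series_exists assms(4,5) by blast
qed

text \<open>The complement of any block \<open>B\<close> would decompose \<open>R\<close>, so it
  vanishes because \<open>B\<close> does not.\<close>

lemma unique_block:
  assumes "ring R" "is_block R (carrier R)"
  shows "\<exists>!B. is_block R B"
proof (rule ex1I)
  show "is_block R (carrier R)" by fact
  fix B assume B: "is_block R B"
  interpret ring R by fact
  obtain B' where B': "ideal B' R" "B \<inter> B' = {\<zero>\<^bsub>R\<^esub>}" "B <+>\<^bsub>R\<^esub> B' = carrier R" "ideal B R" "B \<noteq> {\<zero>\<^bsub>R\<^esub>}"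
    using is_block_complement[OF B] .
  then have "B' = {\<zero>\<^bsub>R\<^esub>}"
    using is_block_indecomposable[OF assms(2) B'(4,1,2,3)] by simp
  moreover have "b \<oplus>\<^bsub>R\<^esub> \<zero>\<^bsub>R\<^esub> = b" if "b \<in> B" for b using ideal.Icarr[OF B'(4) that] by simp
  ultimately show "B = carrier R" using B'(3) unfolding set_add_def' by simp
qed

section \<open>Endomorphisms of a primary module over a polynomial ring\<close>

text \<open>A nonzero combination of least degree divides every combination, since the remainder of
  the division is again a combination.\<close>

lemma poly_bezout:
  fixes f g :: "'k::field poly"
  obtains a b d where "d = a * f + b * g" "d dvd f" "d dvd g"
proof (cases "f = 0 \<and> g = 0")
  case True
  then show thesis using that[of 0 0 0] by simp
next
  case False
  define P where "P d \<longleftrightarrow> d \<noteq> 0 \<and> (\<exists>a b. d = a * f + b * g)" for d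
  have "P f \<or> P g" unfolding P_def using False by (metis add.right_neutral add_0 mult_1 mult_zero_left)
  then obtain d0 where "P d0" by blast
  then obtain d where d: "P d" and min: "\<And>e. P e \<Longrightarrow> Polynomial.degree d \<le> Polynomial.degree e"
    using ex_has_least_nat[of P d0 Polynomial.degree] by blast
  obtain a b where ab: "d = a * f + b * g" "d \<noteq> 0" using d unfolding P_def by blast
  have "d dvd u * f + v * g" for u v
  proof (rule ccontr)
    let ?h = "u * f + v * g"
    assume "\<not> d dvd ?h"
    then have r: "?h mod d \<noteq> 0" by (simp add: mod_eq_0_iff_dvd)
    have "?h mod d = (u - ?h div d * a) * f + (v - ?h div d * b) * g"
      unfolding minus_div_mult_eq_mod[symmetric] ab(1) by (simp add: algebra_simps)
    then have "P (?h mod d)" unfolding P_def using r by blast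
    then have "Polynomial.degree d \<le> Polynomial.degree (?h mod d)" by (rule min)
    moreover have "Polynomial.degree (?h mod d) < Polynomial.degree d"
      using degree_mod_less'[OF ab(2) r] .
    ultimately show False by simp
  qed
  from this[of 1 0] this[of 0 1] show thesis using that[OF ab(1)] by simp
qed

lemma coprime_bezout:
  fixes f g :: "'k::field poly"
  assumes "coprime f g"
  obtains a b where "a * f + b * g = 1"
proof -
  obtain a b d where d: "d = a * f + b * g" "d dvd f" "d dvd g" by (rule poly_bezout)
  then have "is_unit d" using assms by (simp add: coprime_def)
  then obtain e where "d * e = 1" by (metis dvdE)
  then have "(e * a) * f + (e * b) * g = 1" unfolding d(1) by (simp add: algebra_simps)
  then show thesis by (rule that)
qed

locale irreducible_poly =
  fixes p :: "'k::field poly"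
  assumes irr: "Factorial_Ring.irreducible p"
begin

lemma p_nz: "p \<noteq> 0" and p_nunit: "\<not> is_unit p"
  using irr unfolding Factorial_Ring.irreducible_def by auto

lemma pow_nz: "p ^ n \<noteq> 0"
  using p_nz by simp

lemma p_prime: "p dvd f * g \<longleftrightarrow> p dvd f \<or> p dvd g"
  using field_poly_irreducible_imp_prime[OF irr] by (simp add: prime_elem_dvd_mult_iff)

lemma unit_mod:
  assumes "\<not> p dvd f"
  obtains s where "p ^ n dvd s * f - 1"
proof -
  obtain a b d where d: "d = a * f + b * p" "d dvd f" "d dvd p" by (rule poly_bezout)
  obtain c where c: "p = d * c" using d(3) unfolding dvd_def by blast
  have "\<not> is_unit c"
  proof
    assume "is_unit c"
    then obtain e where "c * e = 1" unfolding dvd_def by metis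
    then have "d = p * e" using c by (simp add: mult.assoc)
    then have "p dvd f" using d(2) by (metis dvd_triv_left dvd_trans)
    then show False using assms by blast
  qed
  then have "is_unit d" using irr c by (auto dest: Factorial_Ring.irreducibleD)
  then obtain e where e: "d * e = 1" unfolding dvd_def by metis
  \<comment> \<open>\<open>r\<close> is the defect of \<open>e * a\<close> as an inverse of
    \<open>f\<close> modulo \<open>p\<close>, hence a multiple of \<open>p\<close>. As
    \<open>1 - r\<close> is a multiple of \<open>f\<close>, the geometric sum for
    \<open>1 - r ^ n\<close> lifts the inverse to one modulo \<open>p ^ n\<close>.\<close>
  define r where "r = 1 - e * a * f"
  have "r = p * (e * b)" unfolding r_def e[symmetric] d(1) by (simp add: algebra_simps)
  then have "p ^ n dvd r ^ n" by (simp add: power_mult_distrib)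
  moreover have "1 - r ^ n = (\<Sum>i<n. r ^ i) * (e * a) * f"
    unfolding one_diff_power_eq r_def by (simp add: algebra_simps)
  then have "(\<Sum>i<n. r ^ i) * (e * a) * f - 1 = - (r ^ n)" by (simp add: algebra_simps)
  ultimately show thesis using that by (metis dvd_minus_iff)
qed

lemma dvd_cancel_unit:
  assumes "\<not> p dvd s" "p ^ n dvd s * f"
  shows "p ^ n dvd f"
proof -
  obtain t where t: "p ^ n dvd t * s - 1" using unit_mod[OF assms(1)] .
  have "f = t * (s * f) - (t * s - 1) * f" by (simp add: algebra_simps)
  moreover have "p ^ n dvd t * (s * f) - (t * s - 1) * f"
    by (rule dvd_diff[OF dvd_mult[OF assms(2)] dvd_mult2[OF t]])
  ultimately show ?thesis by simp
qed

lemma factor_out_ex: "f \<noteq> 0 \<Longrightarrow> \<exists>a s. f = p ^ a * s \<and> \<not> p dvd s"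
proof (induction "Polynomial.degree f" arbitrary: f rule: less_induct)
  case less
  show ?case
  proof (cases "p dvd f")
    case False
    then show ?thesis by (intro exI[of _ 0] exI[of _ f]) simp
  next
    case True
    then obtain g where g: "f = p * g" unfolding dvd_def by blast
    have "Polynomial.degree p \<noteq> 0" using p_nunit p_nz by (metis is_unit_iff_degree)
    then have "Polynomial.degree g < Polynomial.degree f" "g \<noteq> 0"
      using g less.prems by (auto simp: degree_mult_eq)
    then obtain a s where "g = p ^ a * s" "\<not> p dvd s" using less.hyps[of g] by blast
    then show ?thesis using g by (intro exI[of _ "Suc a"] exI[of _ s]) simp
  qed
qed

lemma pow_dvd_pow_mult:
  assumes "\<not> p dvd s"
  shows "p ^ n dvd p ^ a * s \<longleftrightarrow> n \<le> a"
proof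
  assume d: "p ^ n dvd p ^ a * s"
  show "n \<le> a"
  proof (rule ccontr)
    assume "\<not> n \<le> a"
    then have "p ^ n = p ^ a * p ^ (n - a)" by (simp add: power_add[symmetric])
    then have "p ^ (n - a) dvd s" using d pow_nz by (metis dvd_mult_cancel_left)
    moreover have "p dvd p ^ (n - a)" using \<open>\<not> n \<le> a\<close> by (simp add: dvd_power)
    ultimately show False using assms dvd_trans by blast
  qed
qed (simp add: le_imp_power_dvd)

end

section \<open>The module V, its endomorphism ring and the left ideals End(V) e_x\<close>

locale primary_module = irreducible_poly p for p :: "'k::field poly" +
  fixes I :: "'i set" and L :: "'i \<Rightarrow> nat"
  assumes fin: "finite I" and L_pos: "x \<in> I \<Longrightarrow> 0 < L x"
begin

definition red :: "('i \<Rightarrow> 'k poly) \<Rightarrow> 'i \<Rightarrow> 'k poly" where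
  "red g = (\<lambda>x. if x \<in> I then g x mod p ^ L x else 0)"

text \<open>Elements of the direct sum are stored as their canonical remainders, extended by 0
  outside \<open>I\<close>. Sums of remainders are again reduced, so pointwise addition and equality
  of functions are those of the module.\<close>

definition V :: "('i \<Rightarrow> 'k poly) set" where
  "V = {g. red g = g}"

definition act :: "'k poly \<Rightarrow> ('i \<Rightarrow> 'k poly) \<Rightarrow> 'i \<Rightarrow> 'k poly" where
  "act f g = red (\<lambda>x. f * g x)"

definition gen :: "'i \<Rightarrow> 'i \<Rightarrow> 'k poly" where
  "gen x = (\<lambda>y. if y = x then 1 else 0)"

text \<open>The kernel of multiplication by \<open>p ^ n\<close> on \<open>V\<close>, expressed in
  coordinates.\<close>

definition Vt :: "nat \<Rightarrow> ('i \<Rightarrow> 'k poly) set" where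
  "Vt n = {g \<in> V. \<forall>x\<in>I. p ^ L x dvd p ^ n * g x}"

definition EV :: "(('i \<Rightarrow> 'k poly) \<Rightarrow> ('i \<Rightarrow> 'k poly)) ring" where
  "EV = \<lparr>carrier = {F \<in> extensional V. (\<forall>g\<in>V. F g \<in> V) \<and> (\<forall>g\<in>V. \<forall>h\<in>V. F (g + h) = F g + F h) \<and>
      (\<forall>f. \<forall>g\<in>V. F (act f g) = act f (F g))},
    mult = compose V, one = (\<lambda>v\<in>V. v), zero = (\<lambda>v\<in>V. 0), add = (\<lambda>F G. \<lambda>v\<in>V. F v + G v)\<rparr>"

text \<open>For \<open>w\<close> in \<open>Vt (L x)\<close>, this is the endomorphism that sends the
  generator of summand \<open>x\<close> to \<open>w\<close> and the other generators to
  zero.\<close>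

definition cycl :: "'i \<Rightarrow> ('i \<Rightarrow> 'k poly) \<Rightarrow> ('i \<Rightarrow> 'k poly) \<Rightarrow> ('i \<Rightarrow> 'k poly)" where
  "cycl x w = (\<lambda>g\<in>V. red (\<lambda>y. g x * w y))"

abbreviation idem :: "'i \<Rightarrow> ('i \<Rightarrow> 'k poly) \<Rightarrow> ('i \<Rightarrow> 'k poly)" where
  "idem x \<equiv> cycl x (gen x)"

lemma red_apply: "red g x = (if x \<in> I then g x mod p ^ L x else 0)"
  by (simp add: red_def)

lemma V_iff: "g \<in> V \<longleftrightarrow> (\<forall>x\<in>I. g x mod p ^ L x = g x) \<and> (\<forall>x. x \<notin> I \<longrightarrow> g x = 0)"
  unfolding V_def red_def fun_eq_iff by (auto split: if_splits)

lemma red_V [simp]: "red g \<in> V"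
  unfolding V_iff red_def by simp

lemma red_id: "g \<in> V \<Longrightarrow> red g = g"
  unfolding V_def by simp

lemma red_eq_iff: "red g = red h \<longleftrightarrow> (\<forall>x\<in>I. p ^ L x dvd g x - h x)"
  unfolding red_def fun_eq_iff by (auto simp: mod_eq_dvd_iff)

lemma V_eqI:
  assumes "g \<in> V" "h \<in> V" "\<And>x. x \<in> I \<Longrightarrow> p ^ L x dvd g x - h x"
  shows "g = h"
  using red_eq_iff[of g h] assms red_id by auto

lemma red_dvd: "x \<in> I \<Longrightarrow> p ^ L x dvd red g x - g x" "x \<in> I \<Longrightarrow> p ^ L x dvd g x - red g x"
  by (auto simp: red_apply mod_eq_dvd_iff[symmetric])

lemma red_dvd_iff: "x \<in> I \<Longrightarrow> p ^ L x dvd f * red g x \<longleftrightarrow> p ^ L x dvd f * g x"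
  by (simp add: red_apply dvd_eq_mod_eq_0 mod_mult_right_eq)

lemma p_dvd_red: "x \<in> I \<Longrightarrow> p dvd red g x \<longleftrightarrow> p dvd g x"
proof -
  assume x: "x \<in> I"
  then have "p dvd p ^ L x" using L_pos by (simp add: dvd_power)
  then show ?thesis by (simp add: red_apply x dvd_mod_iff)
qed

lemma red_add: "red (g + h) = red g + red h"
  unfolding red_def by (auto simp: poly_mod_add_left)

lemma red_zero [simp]: "red 0 = 0"
  unfolding red_def by auto

lemma red_uminus: "red (- g) = - red g"
proof -
  have "red (- g) + red g = 0" unfolding red_add[symmetric] by simp
  then show ?thesis by (simp add: eq_neg_iff_add_eq_0)
qed

lemma V_add: "g \<in> V \<Longrightarrow> h \<in> V \<Longrightarrow> g + h \<in> V"
  unfolding V_def by (simp add: red_add)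

lemma V_zero [simp]: "0 \<in> V"
  unfolding V_def by simp

lemma V_uminus: "g \<in> V \<Longrightarrow> - g \<in> V"
  unfolding V_def by (simp add: red_uminus)

lemma act_V [simp]: "act f g \<in> V"
  by (simp add: act_def)

lemma act_add: "act f (g + h) = act f g + act f h"
  unfolding act_def red_add[symmetric] by (rule arg_cong[of _ _ red]) (auto simp: algebra_simps)

lemma act_act: "act f (act g h) = act (f * g) h"
proof -
  have "p ^ L x dvd f * red (\<lambda>x. g * h x) x - f * g * h x" if "x \<in> I" for x
  proof -
    have "f * red (\<lambda>x. g * h x) x - f * g * h x = f * (red (\<lambda>x. g * h x) x - g * h x)" by (simp add: algebra_simps)
    then show ?thesis using red_dvd(1)[OF that, of "\<lambda>x. g * h x"] by simp
  qed
  then show ?thesis unfolding act_def red_eq_iff by blast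
qed

lemma act_one: "g \<in> V \<Longrightarrow> act 1 g = g"
  unfolding act_def by (simp add: red_id)

lemma act_p_dvd: "x \<in> I \<Longrightarrow> p dvd act p g x"
  unfolding act_def by (simp add: p_dvd_red)

lemma act_zero [simp]: "act f 0 = 0"
  by (simp add: act_def red_def fun_eq_iff)

lemma act_uminus: "act f (- g) = - act f g"
proof -
  have "act f (- g) + act f g = act f (- g + g)" by (rule act_add[symmetric])
  also have "\<dots> = 0" unfolding left_minus by (rule act_zero)
  finally show ?thesis by (rule eq_neg_iff_add_eq_0[THEN iffD2])
qed

lemma pow_L_not_dvd_1: "x \<in> I \<Longrightarrow> \<not> p ^ L x dvd 1"
  using p_nunit L_pos[of x] by (metis dvd_trans dvd_power)

lemma gen_V: "x \<in> I \<Longrightarrow> gen x \<in> V"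
  unfolding V_iff gen_def
proof (intro conjI ballI allI impI)
  fix y assume x: "x \<in> I" and y: "y \<in> I"
  have "Polynomial.degree (p ^ L x) > 0"
    using pow_L_not_dvd_1[OF x] pow_nz by (metis gr0I is_unit_iff_degree)
  then have "1 mod p ^ L x = 1" by (simp add: mod_poly_less)
  then show "(if y = x then 1 else 0) mod p ^ L y = (if y = x then 1 else (0::'k poly))" by simp
qed auto

lemma gen_not_dvd: "\<not> p dvd gen x x"
  using p_nunit by (simp add: gen_def)

lemma Vt_V: "g \<in> Vt n \<Longrightarrow> g \<in> V"
  by (simp add: Vt_def)

lemma gen_Vt: "x \<in> I \<Longrightarrow> gen x \<in> Vt (L x)"
  unfolding Vt_def using gen_V by (auto simp: gen_def)

lemma Vt_add: "g \<in> Vt n \<Longrightarrow> h \<in> Vt n \<Longrightarrow> g + h \<in> Vt n"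
  unfolding Vt_def by (auto simp: V_add distrib_left)

lemma Vt_zero [simp]: "0 \<in> Vt n"
  unfolding Vt_def by auto

lemma Vt_uminus: "g \<in> Vt n \<Longrightarrow> - g \<in> Vt n"
  unfolding Vt_def by (auto simp: V_uminus)

lemma Vt_iff_act: "g \<in> V \<Longrightarrow> g \<in> Vt n \<longleftrightarrow> act (p ^ n) g = 0"
proof -
  assume g: "g \<in> V"
  have "act (p ^ n) g = 0 \<longleftrightarrow> (\<forall>x\<in>I. p ^ L x dvd p ^ n * g x)"
    unfolding act_def using red_eq_iff[of "\<lambda>x. p ^ n * g x" 0] by simp
  then show ?thesis using g unfolding Vt_def by blast
qed

lemma EV_simps [simp]:
  "mult EV = compose V" "one EV = (\<lambda>v\<in>V. v)" "zero EV = (\<lambda>v\<in>V. 0)" "add EV = (\<lambda>F G. \<lambda>v\<in>V. F v + G v)"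
  by (simp_all add: EV_def)

lemma EV_carrier: "F \<in> carrier EV \<longleftrightarrow> F \<in> extensional V \<and> (\<forall>g\<in>V. F g \<in> V) \<and>
    (\<forall>g\<in>V. \<forall>h\<in>V. F (g + h) = F g + F h) \<and> (\<forall>f. \<forall>g\<in>V. F (act f g) = act f (F g))"
  by (simp add: EV_def)

lemma EV_D:
  assumes "F \<in> carrier EV"
  shows "F \<in> extensional V" "\<And>g. g \<in> V \<Longrightarrow> F g \<in> V" "\<And>g h. g \<in> V \<Longrightarrow> h \<in> V \<Longrightarrow> F (g + h) = F g + F h"
    "\<And>f g. g \<in> V \<Longrightarrow> F (act f g) = act f (F g)"
  using assms unfolding EV_carrier by blast+

lemma EV_eqI: "F \<in> carrier EV \<Longrightarrow> G \<in> carrier EV \<Longrightarrow> (\<And>g. g \<in> V \<Longrightarrow> F g = G g) \<Longrightarrow> F = G"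
  using EV_D(1) extensionalityI by metis

lemma EV_map_zero: "F \<in> carrier EV \<Longrightarrow> F 0 = 0"
  using EV_D(3)[of F 0 0] by simp

lemma EV_Vt: "F \<in> carrier EV \<Longrightarrow> g \<in> Vt n \<Longrightarrow> F g \<in> Vt n"
  using EV_D(2,4) EV_map_zero Vt_iff_act Vt_V by metis

lemma ring_EV: "ring EV"
proof (rule ringI)
  show "abelian_group EV"
  proof (rule abelian_groupI)
    fix F assume F: "F \<in> carrier EV"
    note d = EV_D[OF F]
    show "\<zero>\<^bsub>EV\<^esub> \<oplus>\<^bsub>EV\<^esub> F = F"
      using d(1,2) by (auto simp: fun_eq_iff extensional_def restrict_def)
    show "\<exists>G\<in>carrier EV. G \<oplus>\<^bsub>EV\<^esub> F = \<zero>\<^bsub>EV\<^esub>"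
    proof (rule bexI[of _ "\<lambda>v\<in>V. - F v"])
      show "(\<lambda>v\<in>V. - F v) \<in> carrier EV"
        unfolding EV_carrier using d by (auto simp: V_uminus V_add act_uminus)
    qed (auto simp: fun_eq_iff)
    fix G assume G: "G \<in> carrier EV"
    note d' = EV_D[OF G]
    show "F \<oplus>\<^bsub>EV\<^esub> G \<in> carrier EV"
      unfolding EV_carrier using d d' by (auto simp: V_add act_add)
    show "F \<oplus>\<^bsub>EV\<^esub> G = G \<oplus>\<^bsub>EV\<^esub> F" by (simp add: add.commute)
    fix H assume "H \<in> carrier EV"
    show "F \<oplus>\<^bsub>EV\<^esub> G \<oplus>\<^bsub>EV\<^esub> H = F \<oplus>\<^bsub>EV\<^esub> (G \<oplus>\<^bsub>EV\<^esub> H)" by (auto simp: fun_eq_iff add.assoc)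
  next
    show "\<zero>\<^bsub>EV\<^esub> \<in> carrier EV" unfolding EV_carrier by (auto simp: V_add)
  qed
  show "Group.monoid EV"
  proof (rule monoidI)
    fix F G assume "F \<in> carrier EV" "G \<in> carrier EV"
    note d = EV_D[OF this(1)] EV_D[OF this(2)]
    show "F \<otimes>\<^bsub>EV\<^esub> G \<in> carrier EV"
      unfolding EV_carrier using d by (auto simp: compose_def V_add)
    fix H assume "H \<in> carrier EV"
    note d = d EV_D[OF this]
    show "F \<otimes>\<^bsub>EV\<^esub> G \<otimes>\<^bsub>EV\<^esub> H = F \<otimes>\<^bsub>EV\<^esub> (G \<otimes>\<^bsub>EV\<^esub> H)"
      using d by (auto simp: compose_def fun_eq_iff restrict_def)
  next
    show "\<one>\<^bsub>EV\<^esub> \<in> carrier EV" unfolding EV_carrier by (auto simp: V_add)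
  next
    fix F assume "F \<in> carrier EV"
    note d = EV_D[OF this]
    show "\<one>\<^bsub>EV\<^esub> \<otimes>\<^bsub>EV\<^esub> F = F" "F \<otimes>\<^bsub>EV\<^esub> \<one>\<^bsub>EV\<^esub> = F"
      using d(1,2) by (auto simp: compose_def fun_eq_iff restrict_def extensional_def)
  qed
  fix F G H assume "F \<in> carrier EV" "G \<in> carrier EV" "H \<in> carrier EV"
  note d = EV_D[OF this(1)] EV_D[OF this(2)] EV_D[OF this(3)]
  show "(F \<oplus>\<^bsub>EV\<^esub> G) \<otimes>\<^bsub>EV\<^esub> H = F \<otimes>\<^bsub>EV\<^esub> H \<oplus>\<^bsub>EV\<^esub> G \<otimes>\<^bsub>EV\<^esub> H"
    by (rule ext) (simp add: compose_def restrict_def d)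
  show "H \<otimes>\<^bsub>EV\<^esub> (F \<oplus>\<^bsub>EV\<^esub> G) = H \<otimes>\<^bsub>EV\<^esub> F \<oplus>\<^bsub>EV\<^esub> H \<otimes>\<^bsub>EV\<^esub> G"
    by (rule ext) (simp add: compose_def restrict_def d)
qed

interpretation EV: ring EV by (rule ring_EV)

lemma EV_minus_apply: "F \<in> carrier EV \<Longrightarrow> G \<in> carrier EV \<Longrightarrow> g \<in> V \<Longrightarrow> (F \<ominus>\<^bsub>EV\<^esub> G) g = F g - G g"
proof -
  assume F: "F \<in> carrier EV" and G: "G \<in> carrier EV" and g: "g \<in> V"
  have "(\<ominus>\<^bsub>EV\<^esub> G) \<oplus>\<^bsub>EV\<^esub> G = \<zero>\<^bsub>EV\<^esub>" using G by (rule EV.l_neg)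
  then have "((\<ominus>\<^bsub>EV\<^esub> G) \<oplus>\<^bsub>EV\<^esub> G) g = \<zero>\<^bsub>EV\<^esub> g" by (rule fun_cong)
  then have "(\<ominus>\<^bsub>EV\<^esub> G) g + G g = 0" using g by simp
  then have "(\<ominus>\<^bsub>EV\<^esub> G) g = - G g" by (rule eq_neg_iff_add_eq_0[THEN iffD2])
  then show ?thesis using g unfolding a_minus_def by simp
qed

lemma scalar_EV: "(\<lambda>v\<in>V. act f v) \<in> carrier EV"
  unfolding EV_carrier by (auto simp: V_add act_add act_act mult.commute)

lemma cycl_apply: "g \<in> V \<Longrightarrow> cycl x w g = red (\<lambda>y. g x * w y)"
  by (simp add: cycl_def)

text \<open>Reducing the coordinate \<open>g x\<close> changes it by a multiple of
  \<open>p ^ L x\<close>, which annihilates \<open>w\<close>; hence the map commutes with the action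
  of polynomials.\<close>

lemma cycl_EV:
  assumes x: "x \<in> I" and w: "w \<in> Vt (L x)"
  shows "cycl x w \<in> carrier EV"
  unfolding EV_carrier
proof (intro conjI ballI allI)
  show "cycl x w \<in> extensional V" by (simp add: cycl_def)
next
  fix g assume g: "g \<in> V"
  then show "cycl x w g \<in> V" by (simp add: cycl_apply)
  fix h assume h: "h \<in> V"
  show "cycl x w (g + h) = cycl x w g + cycl x w h"
    unfolding cycl_apply[OF g] cycl_apply[OF h] cycl_apply[OF V_add[OF g h]] red_add[symmetric]
    by (rule arg_cong[of _ _ red]) (auto simp: algebra_simps)
next
  fix f g assume g: "g \<in> V"
  have "p ^ L y dvd act f g x * w y - f * (g x * w y)" if y: "y \<in> I" for y
  proof -
    have "p ^ L x dvd act f g x - f * g x" unfolding act_def by (rule red_dvd(1)[OF x])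
    then have "p ^ L x * w y dvd (act f g x - f * g x) * w y" by (rule mult_dvd_mono) simp
    moreover have "p ^ L y dvd p ^ L x * w y" using w y unfolding Vt_def by blast
    ultimately have "p ^ L y dvd (act f g x - f * g x) * w y" using dvd_trans by blast
    then show ?thesis by (simp add: left_diff_distrib mult.assoc)
  qed
  then have "red (\<lambda>y. act f g x * w y) = red (\<lambda>y. f * (g x * w y))" unfolding red_eq_iff by blast
  also have "\<dots> = act f (red (\<lambda>y. g x * w y))"
    using red_dvd_iff[of _ f] unfolding act_def red_eq_iff
    by (auto simp: right_diff_distrib[symmetric] intro!: dvd_mult red_dvd)
  finally show "cycl x w (act f g) = act f (cycl x w g)" using g by (simp add: cycl_apply)
qed

lemma cycl_gen: "x \<in> I \<Longrightarrow> w \<in> V \<Longrightarrow> cycl x w (gen x) = w"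
  unfolding cycl_apply[OF gen_V] by (simp add: gen_def red_id)

lemma idem_EV: "x \<in> I \<Longrightarrow> idem x \<in> carrier EV"
  by (rule cycl_EV[OF _ gen_Vt])

lemma idem_apply:
  assumes "x \<in> I" "g \<in> V"
  shows "idem x g = (\<lambda>y. if y = x then g x else 0)"
  using assms unfolding cycl_apply[OF assms(2)] V_iff by (auto simp: red_def gen_def)

lemma idem_act_gen: "x \<in> I \<Longrightarrow> g \<in> V \<Longrightarrow> idem x g = act (g x) (gen x)"
  by (simp add: cycl_apply act_def)

lemma EV_cycl:
  assumes F: "F \<in> carrier EV" and x: "x \<in> I" and w: "w \<in> Vt (L x)"
  shows "F \<otimes>\<^bsub>EV\<^esub> cycl x w = cycl x (F w)"
proof (rule EV_eqI)
  show "F \<otimes>\<^bsub>EV\<^esub> cycl x w \<in> carrier EV" using F cycl_EV[OF x w] by (rule EV.m_closed)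
  show "cycl x (F w) \<in> carrier EV" by (rule cycl_EV[OF x EV_Vt[OF F w]])
  fix g assume g: "g \<in> V"
  have "cycl x w g = act (g x) w" "cycl x (F w) g = act (g x) (F w)"
    using g by (simp_all add: cycl_apply act_def)
  then show "(F \<otimes>\<^bsub>EV\<^esub> cycl x w) g = cycl x (F w) g"
    using EV_D(4)[OF F Vt_V[OF w]] g by (simp add: compose_eq)
qed

lemma cycl_idem: "x \<in> I \<Longrightarrow> w \<in> Vt (L x) \<Longrightarrow> cycl x w \<otimes>\<^bsub>EV\<^esub> idem x = cycl x w"
  by (subst EV_cycl[OF cycl_EV]) (simp_all add: gen_Vt cycl_gen Vt_V)

definition pim :: "'i \<Rightarrow> (('i \<Rightarrow> 'k poly) \<Rightarrow> ('i \<Rightarrow> 'k poly)) set" where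
  "pim x = {F \<otimes>\<^bsub>EV\<^esub> idem x | F. F \<in> carrier EV}"

lemma pim_eq: "x \<in> I \<Longrightarrow> pim x = cycl x ` Vt (L x)"
  unfolding pim_def
  using EV_cycl[OF _ _ gen_Vt] cycl_idem cycl_EV EV_Vt[OF _ gen_Vt] by (auto simp: image_iff) metis+

definition Vmod :: "nat \<Rightarrow> (('i \<Rightarrow> 'k poly) \<Rightarrow> ('i \<Rightarrow> 'k poly), 'i \<Rightarrow> 'k poly) module" where
  "Vmod n = \<lparr>carrier = Vt n, mult = undefined, one = undefined, zero = 0, add = (+), smult = (\<lambda>F v. F v)\<rparr>"

lemma Vmod_simps [simp]:
  "carrier (Vmod n) = Vt n" "zero (Vmod n) = 0" "add (Vmod n) = (+)" "smult (Vmod n) = (\<lambda>F v. F v)"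
  by (simp_all add: Vmod_def)

lemma lmod_Vmod: "lmod EV (Vmod n)"
proof -
  have "abelian_group (Vmod n)"
    by (rule abelian_groupI) (auto simp: Vt_add add.assoc add.commute intro: bexI[of _ "- x" for x] Vt_uminus)
  then show ?thesis by (auto simp: lmod_def lmod_axioms_def EV_Vt EV_D(3) Vt_V)
qed

lemma Vmod_minus: "g \<in> Vt n \<Longrightarrow> \<ominus>\<^bsub>Vmod n\<^esub> g = - g"
proof -
  interpret lmod EV "Vmod n" by (rule lmod_Vmod)
  show "g \<in> Vt n \<Longrightarrow> \<ominus>\<^bsub>Vmod n\<^esub> g = - g"
    by (rule minus_equality) (auto simp: Vt_uminus)
qed

text \<open>Closure under negation is absorbed by closure under \<open>EV\<close>, because
  \<open>- 1\<close> acts through a scalar endomorphism.\<close>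

lemma submodule_Vmod_iff:
  "submodule N EV (Vmod n) \<longleftrightarrow> N \<subseteq> Vt n \<and> 0 \<in> N \<and> (\<forall>g\<in>N. \<forall>h\<in>N. g + h \<in> N) \<and> (\<forall>F\<in>carrier EV. \<forall>g\<in>N. F g \<in> N)"
proof -
  have um: "- g \<in> N" if "N \<subseteq> Vt n" "\<forall>F\<in>carrier EV. \<forall>g\<in>N. F g \<in> N" "g \<in> N" for g
  proof -
    have gV: "g \<in> V" using that Vt_V by blast
    have "- g = act (- 1) g" unfolding act_def
      using red_uminus[of g] red_id[OF gV] by (simp add: fun_Compl_def)
    then show ?thesis using that scalar_EV[of "- 1"] gV by force
  qed
  show ?thesis
    unfolding lmod.submodule_iff[OF lmod_Vmod] Vmod_simps
    using um Vmod_minus by (auto simp: subset_iff)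
qed

end

lemma lmod_hom_image:
  assumes M: "lmod R M" and N: "lmod R N" and f: "f \<in> lmod_hom R M N"
  shows "submodule (f ` carrier M) R N"
proof -
  interpret M: lmod R M by fact
  interpret N: lmod R N by fact
  have fc: "f x \<in> carrier N" if "x \<in> carrier M" for x using f that unfolding lmod_hom_def by auto
  have fa: "f (x \<oplus>\<^bsub>M\<^esub> y) = f x \<oplus>\<^bsub>N\<^esub> f y" if "x \<in> carrier M" "y \<in> carrier M" for x y
    using f that unfolding lmod_hom_def by auto
  have fs: "f (a \<odot>\<^bsub>M\<^esub> x) = a \<odot>\<^bsub>N\<^esub> f x" if "a \<in> carrier R" "x \<in> carrier M" for x a
    using f that unfolding lmod_hom_def by auto
  have f0: "f \<zero>\<^bsub>M\<^esub> = \<zero>\<^bsub>N\<^esub>"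
    by (metis M.zero_closed M.r_zero N.add.r_cancel_one' fa fc)
  have fm: "f (\<ominus>\<^bsub>M\<^esub> x) = \<ominus>\<^bsub>N\<^esub> f x" if "x \<in> carrier M" for x
    by (rule sym, rule N.minus_equality) (use that fc f0 fa[of "\<ominus>\<^bsub>M\<^esub> x" x] M.l_neg in auto)
  show ?thesis
    unfolding N.submodule_iff
  proof (intro conjI ballI)
    show "f ` carrier M \<subseteq> carrier N" using fc by blast
    show "\<zero>\<^bsub>N\<^esub> \<in> f ` carrier M" unfolding f0[symmetric] by (rule imageI) simp
  qed (auto simp: fa[symmetric] fs[symmetric] fm[symmetric] M.smult_closed)
qed

context primary_module
begin

interpretation EV: ring EV by (rule ring_EV)

lemma pim_left_ideal: "x \<in> I \<Longrightarrow> submodule (pim x) EV (regular_module EV)"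
proof -
  assume x: "x \<in> I"
  note e = idem_EV[OF x]
  show ?thesis
    unfolding left_ideal_iff[OF ring_EV]
  proof (intro conjI ballI)
    show "pim x \<subseteq> carrier EV" unfolding pim_def using e EV.m_closed by blast
    show "\<zero>\<^bsub>EV\<^esub> \<in> pim x" unfolding pim_def using EV.l_null[OF e] EV.zero_closed by (metis (mono_tags, lifting) mem_Collect_eq)
  next
    fix F G assume "F \<in> pim x" "G \<in> pim x"
    then obtain A B where "A \<in> carrier EV" "B \<in> carrier EV" "F = A \<otimes>\<^bsub>EV\<^esub> idem x" "G = B \<otimes>\<^bsub>EV\<^esub> idem x"
      unfolding pim_def by blast
    then have "A \<oplus>\<^bsub>EV\<^esub> B \<in> carrier EV" "F \<oplus>\<^bsub>EV\<^esub> G = (A \<oplus>\<^bsub>EV\<^esub> B) \<otimes>\<^bsub>EV\<^esub> idem x"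
      using e EV.l_distr EV.add.m_closed by metis+
    then show "F \<oplus>\<^bsub>EV\<^esub> G \<in> pim x" unfolding pim_def by blast
  next
    fix F assume "F \<in> pim x"
    then obtain A where A: "A \<in> carrier EV" "F = A \<otimes>\<^bsub>EV\<^esub> idem x" unfolding pim_def by blast
    then have "\<ominus>\<^bsub>EV\<^esub> F = (\<ominus>\<^bsub>EV\<^esub> A) \<otimes>\<^bsub>EV\<^esub> idem x" using e EV.l_minus by metis
    then show "\<ominus>\<^bsub>EV\<^esub> F \<in> pim x" unfolding pim_def using A EV.a_inv_closed by blast
    fix G assume G: "G \<in> carrier EV"
    then have "G \<otimes>\<^bsub>EV\<^esub> F = (G \<otimes>\<^bsub>EV\<^esub> A) \<otimes>\<^bsub>EV\<^esub> idem x" using e EV.m_assoc A by metis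
    then show "G \<otimes>\<^bsub>EV\<^esub> F \<in> pim x" unfolding pim_def using A G EV.m_closed by blast
  qed
qed

lemma pim_semi_iso:
  assumes x: "x \<in> I"
  shows "semi_iso EV EV (left_ideal_module EV (pim x)) (Vmod (L x)) (=) (\<lambda>F. F (gen x))"
proof (rule semi_iso_of_isomorphic)
  show "lmod EV (left_ideal_module EV (pim x))" by (rule lmod_left_ideal[OF ring_EV pim_left_ideal[OF x]])
  show "lmod EV (Vmod (L x))" by (rule lmod_Vmod)
  have "\<exists>w\<in>Vt (L x). F = cycl x w \<and> F (gen x) = w" if "F \<in> pim x" for F
    using that cycl_gen[OF x] Vt_V unfolding pim_eq[OF x] by blast
  then show "bij_betw (\<lambda>F. F (gen x)) (carrier (left_ideal_module EV (pim x))) (carrier (Vmod (L x)))"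
    unfolding bij_betw_def inj_on_def left_ideal_module_simps Vmod_simps
    using cycl_gen[OF x Vt_V] pim_eq[OF x] by (auto simp: image_iff)
  then show "(\<lambda>F. F (gen x)) \<in> lmod_hom EV (left_ideal_module EV (pim x)) (Vmod (L x))"
    unfolding lmod_hom_def using gen_V[OF x] by (auto simp: bij_betw_def compose_eq)
qed

section \<open>Moving elements by endomorphisms, and the radical\<close>

text \<open>Ideals of K[t]/(p^l) form a chain: if every power of \<open>p\<close> that kills
  \<open>w x\<close> also kills \<open>g x\<close>, then \<open>g x\<close> is a multiple of
  \<open>w x\<close>. That multiplication, after the projection to summand \<open>x\<close>, is the
  required endomorphism.\<close>

lemma transport:
  assumes x: "x \<in> I" and w: "w \<in> V" and g: "g \<in> V"
    and le: "\<And>h. p ^ L x dvd p ^ h * w x \<Longrightarrow> p ^ L x dvd p ^ h * g x"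
  shows "\<exists>F\<in>carrier EV. F w = idem x g"
proof (cases "w x = 0")
  case True
  then have "p ^ L x dvd g x" using le[of 0] by simp
  moreover have "g x mod p ^ L x = g x" using g x V_iff by blast
  ultimately have "g x = 0" by simp
  then have "idem x g = act 0 w" unfolding idem_apply[OF x g] by (auto simp: act_def red_def)
  then show ?thesis using scalar_EV[of 0] w by (intro bexI[of _ "\<lambda>v\<in>V. act 0 v"]) auto
next
  case False
  then obtain a s where s: "w x = p ^ a * s" "\<not> p dvd s" using factor_out_ex by blast
  have "w x mod p ^ L x = w x" using w x V_iff by blast
  then have "\<not> p ^ L x dvd p ^ a * s" using False s by (metis dvd_imp_mod_0)
  then have a: "a < L x" using pow_dvd_pow_mult[OF s(2)] by simp
  then have eq: "p ^ L x = p ^ (L x - a) * p ^ a" by (simp add: power_add[symmetric])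
  \<comment> \<open>The order of \<open>w x\<close> is exactly \<open>p ^ (L x - a)\<close>, so the
    hypothesis at this exponent makes \<open>g x\<close> divisible by \<open>p ^ a\<close>.\<close>
  have "p ^ L x dvd p ^ (L x - a) * g x" by (rule le) (simp add: s eq)
  then have "p ^ a dvd g x" unfolding eq using p_nz by simp
  then obtain s' where s': "g x = p ^ a * s'" unfolding dvd_def by blast
  obtain t where t: "p ^ L x dvd t * s - 1" using unit_mod[OF s(2)] .
  \<comment> \<open>\<open>t\<close> inverts the part \<open>s\<close> of \<open>w x\<close> prime
    to \<open>p\<close>, and \<open>s'\<close> is the cofactor of \<open>g x\<close>; so
    \<open>s' * t\<close> takes \<open>w x\<close> to \<open>g x\<close>.\<close>
  let ?F = "(\<lambda>v\<in>V. act (s' * t) v) \<otimes>\<^bsub>EV\<^esub> idem x"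
  have "?F w = act (s' * t) (idem x w)" using w EV_D(2)[OF idem_EV[OF x] w] by (simp add: compose_eq)
  also have "\<dots> = idem x g"
  proof (rule V_eqI)
    show "idem x g \<in> V" by (rule EV_D(2)[OF idem_EV[OF x] g])
    fix y assume y: "y \<in> I"
    show "p ^ L y dvd act (s' * t) (idem x w) y - idem x g y"
    proof (cases "y = x")
      case True
      have "p ^ L x dvd act (s' * t) (idem x w) x - s' * t * w x"
        unfolding act_def idem_apply[OF x w] using red_dvd(1)[OF x, of "\<lambda>y. s' * t * (if y = x then w x else 0)"] by simp
      moreover have "s' * t * w x - g x = (t * s - 1) * (p ^ a * s')" unfolding s s' by (simp add: algebra_simps)
      then have "p ^ L x dvd s' * t * w x - g x" using t by simp
      ultimately have "p ^ L x dvd (act (s' * t) (idem x w) x - s' * t * w x) + (s' * t * w x - g x)" by (rule dvd_add)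
      then show ?thesis using True idem_apply[OF x g] by simp
    qed (simp add: act_def idem_apply[OF x w] idem_apply[OF x g] red_def)
  qed simp
  finally show ?thesis using EV.m_closed[OF scalar_EV idem_EV[OF x]] by blast
qed

lemma idem_gen: "x \<in> I \<Longrightarrow> idem x (gen x) = gen x"
  by (simp add: cycl_gen gen_V)

text \<open>A coordinate prime to \<open>p\<close> has full order, so \<open>transport\<close>
  reaches \<open>gen y\<close> from \<open>w\<close>. Since \<open>L y = L x\<close>, the maps
  \<open>cycl y v\<close> then send \<open>gen y\<close> to every \<open>v\<close> in
  \<open>Vt (L x)\<close>.\<close>

lemma generates:
  assumes N: "submodule N EV (Vmod (L x))" and w: "w \<in> N" and y: "y \<in> I" "L y = L x" "\<not> p dvd w y"
  shows "N = Vt (L x)"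
proof
  note d = N[unfolded submodule_Vmod_iff]
  show "N \<subseteq> Vt (L x)" using d by blast
  have wV: "w \<in> V" using d w Vt_V by blast
  have "\<exists>F\<in>carrier EV. F w = idem y (gen y)"
  proof (rule transport[OF y(1) wV gen_V[OF y(1)]])
    fix h assume "p ^ L y dvd p ^ h * w y"
    then show "p ^ L y dvd p ^ h * gen y y"
      using dvd_cancel_unit[OF y(3), of "L y" "p ^ h"] by (simp add: gen_def mult.commute)
  qed
  then have "gen y \<in> N" using d w idem_gen[OF y(1)] by force
  then show "Vt (L x) \<subseteq> N"
    using d cycl_gen[OF y(1) Vt_V] cycl_EV[OF y(1)] y(2) by (metis subsetI)
qed

text \<open>Coordinates in summands of exponent at least \<open>k\<close> are divisible by
  \<open>p\<close> and go into \<open>p V\<close>; the remaining ones live in summands of exponent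
  at most \<open>k - 1\<close>.\<close>

lemma low_decomposition:
  assumes g: "g \<in> V" and low: "\<And>z. z \<in> I \<Longrightarrow> k \<le> L z \<Longrightarrow> p dvd g z"
  obtains v w where "v \<in> V" "w \<in> Vt (k - 1)" "g = act p v + w"
proof -
  let ?v = "red (\<lambda>z. if k \<le> L z then g z div p else 0)" and ?w = "\<lambda>z. if k \<le> L z then 0 else g z"
  have wV: "?w \<in> V" using g unfolding V_iff by auto
  then have w: "?w \<in> Vt (k - 1)" unfolding Vt_def by (auto simp: le_imp_power_dvd)
  have "g = act p ?v + ?w"
  proof (rule V_eqI[OF g V_add[OF act_V wV]])
    fix z assume z: "z \<in> I"
    have "p ^ L z dvd p * (if k \<le> L z then g z div p else 0) - p * ?v z"
      unfolding right_diff_distrib[symmetric] by (rule dvd_mult, rule red_dvd(2)[OF z])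
    moreover have "p ^ L z dvd p * ?v z - act p ?v z"
      unfolding act_def by (rule red_dvd(2)[OF z])
    ultimately have "p ^ L z dvd (p * (if k \<le> L z then g z div p else 0) - p * ?v z) + (p * ?v z - act p ?v z)"
      by (rule dvd_add)
    then show "p ^ L z dvd g z - (act p ?v + ?w) z"
      using low[OF z] by (auto simp: dvd_mult_div_cancel)
  qed
  then show thesis using that w red_V by blast
qed

text \<open>The summand in \<open>p V\<close> stays there. The other summand is killed by
  \<open>p ^ (k - 1)\<close>, and so is its image, which therefore has no coordinate prime to
  \<open>p\<close> in a summand of exponent \<open>k\<close> or more.\<close>

lemma low_image:
  assumes F: "F \<in> carrier EV" and g: "g \<in> V" and low: "\<And>z. z \<in> I \<Longrightarrow> k \<le> L z \<Longrightarrow> p dvd g z"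
    and k: "0 < k" and y: "y \<in> I" "k \<le> L y"
  shows "p dvd F g y"
proof -
  obtain v w where vw: "v \<in> V" "w \<in> Vt (k - 1)" "g = act p v + w" using low_decomposition[OF g low] .
  have "F g = act p (F v) + F w" unfolding vw(3) using EV_D[OF F] vw Vt_V by simp
  moreover have "p dvd F w y"
  proof (rule ccontr)
    assume n: "\<not> p dvd F w y"
    have "p ^ L y dvd p ^ (k - 1) * F w y" using EV_Vt[OF F vw(2)] y unfolding Vt_def by blast
    then have "L y \<le> k - 1" using pow_dvd_pow_mult[OF n] by blast
    then show False using k y by simp
  qed
  ultimately show ?thesis using act_p_dvd[OF y(1)] by simp
qed

text \<open>This turns out to be the unique maximal submodule of \<open>Vmod (L x)\<close>, hence
  its radical.\<close>

definition rad :: "'i \<Rightarrow> ('i \<Rightarrow> 'k poly) set" where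
  "rad x = {w \<in> Vt (L x). \<forall>y\<in>I. L y = L x \<longrightarrow> p dvd w y}"

lemma rad_low:
  assumes x: "x \<in> I" and w: "w \<in> rad x" and z: "z \<in> I" "L x \<le> L z"
  shows "p dvd w z"
proof (cases "L z = L x")
  case False
  show ?thesis
  proof (rule ccontr)
    assume n: "\<not> p dvd w z"
    have "p ^ L z dvd p ^ L x * w z" using w z unfolding rad_def Vt_def by blast
    then have "L z \<le> L x" using pow_dvd_pow_mult[OF n] by blast
    then show False using False z by simp
  qed
qed (use w z in \<open>auto simp: rad_def\<close>)

lemma rad_submodule: "x \<in> I \<Longrightarrow> submodule (rad x) EV (Vmod (L x))"
proof -
  assume x: "x \<in> I"
  show ?thesis
    unfolding submodule_Vmod_iff
  proof (intro conjI ballI)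
    show "rad x \<subseteq> Vt (L x)" "0 \<in> rad x" unfolding rad_def by auto
  next
    fix g h assume "g \<in> rad x" "h \<in> rad x"
    then show "g + h \<in> rad x" unfolding rad_def by (auto simp: Vt_add)
  next
    fix F g assume F: "F \<in> carrier EV" and g: "g \<in> rad x"
    have gV: "g \<in> V" using g Vt_V unfolding rad_def by blast
    have "p dvd F g y" if "y \<in> I" "L y = L x" for y
      by (rule low_image[OF F gV rad_low[OF x g], of "L x"]) (use that L_pos x in auto)
    then show "F g \<in> rad x" using EV_Vt[OF F] g unfolding rad_def by blast
  qed
qed

lemma gen_notin_rad: "x \<in> I \<Longrightarrow> gen x \<notin> rad x"
  unfolding rad_def using gen_not_dvd by blast

text \<open>By \<open>generates\<close>, an element outside \<open>rad x\<close> lies in no proper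
  submodule, so \<open>rad x\<close> contains every proper submodule.\<close>

lemma maximal_iff_rad: "x \<in> I \<Longrightarrow> maximal_submodule N EV (Vmod (L x)) \<longleftrightarrow> N = rad x"
proof -
  assume x: "x \<in> I"
  have proper: "N \<subseteq> rad x" if "submodule N EV (Vmod (L x))" "N \<noteq> Vt (L x)" for N
  proof
    fix w assume w: "w \<in> N"
    then have "w \<in> Vt (L x)" using that(1) unfolding submodule_Vmod_iff by blast
    then show "w \<in> rad x" using generates[OF that(1) w] that(2) unfolding rad_def by blast
  qed
  have "rad x \<noteq> Vt (L x)" using gen_notin_rad[OF x] gen_Vt[OF x] by blast
  then show ?thesis
    unfolding maximal_submodule_def Vmod_simps using proper rad_submodule[OF x] by blast
qed

lemma module_radical_Vmod: "x \<in> I \<Longrightarrow> module_radical EV (Vmod (L x)) = rad x"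
  unfolding module_radical_def by (auto simp: maximal_iff_rad rad_def)

definition D :: "'i \<Rightarrow> (('i \<Rightarrow> 'k poly) \<Rightarrow> ('i \<Rightarrow> 'k poly), ('i \<Rightarrow> 'k poly) set) module" where
  "D x = quotient_module (Vmod (L x)) (rad x)"

lemma pim_head_semi_iso:
  assumes x: "x \<in> I"
  shows "semi_iso EV EV (pim_head EV (pim x)) (D x) (=) (image (\<lambda>F. F (gen x)))"
proof -
  interpret semi_iso EV EV "left_ideal_module EV (pim x)" "Vmod (L x)" "(=)" "\<lambda>F. F (gen x)"
    by (rule pim_semi_iso[OF x])
  show ?thesis
    using semi_iso_quotient[OF M.submodule_radical]
    unfolding radical_image[symmetric] module_radical_Vmod[OF x] D_def pim_head_def .
qed

section \<open>Heights of submodules and composition multiplicities\<close>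

definition hh :: "'i \<Rightarrow> ('i \<Rightarrow> 'k poly) set \<Rightarrow> nat" where
  "hh x N = (LEAST h. \<forall>g\<in>N. p ^ L x dvd p ^ h * g x)"

lemma hh_dvd: "g \<in> N \<Longrightarrow> p ^ L x dvd p ^ hh x N * g x"
proof -
  have "\<forall>g\<in>N. p ^ L x dvd p ^ hh x N * g x"
    unfolding hh_def by (rule LeastI[of _ "L x"]) simp
  then show "g \<in> N \<Longrightarrow> p ^ L x dvd p ^ hh x N * g x" by blast
qed

lemma hh_le: "(\<And>g. g \<in> N \<Longrightarrow> p ^ L x dvd p ^ h * g x) \<Longrightarrow> hh x N \<le> h"
  unfolding hh_def by (rule Least_le) blast

lemma hh_mono: "N \<subseteq> N' \<Longrightarrow> hh x N \<le> hh x N'"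
  by (rule hh_le) (use hh_dvd in blast)

text \<open>Minimality of \<open>hh x N\<close> yields an element of \<open>N\<close> whose
  coordinate \<open>x\<close> has the largest order that occurs in \<open>N\<close>;
  \<open>transport\<close> carries it to \<open>idem x g\<close>.\<close>

lemma idem_mem_iff_hh:
  assumes N: "submodule N EV (Vmod n)" and x: "x \<in> I" and g: "g \<in> V" and d: "p ^ L x dvd p ^ hh x N * g x"
  shows "idem x g \<in> N"
proof -
  note dN = N[unfolded submodule_Vmod_iff]
  have NV: "w \<in> V" if "w \<in> N" for w using dN that Vt_V by blast
  \<comment> \<open>\<open>w\<close> witnesses that the exponent \<open>hh x N - 1\<close> is too
    small. If \<open>hh x N = 0\<close> there is nothing to witness, and 0 is taken.\<close>
  obtain w where w: "w \<in> N" "hh x N = 0 \<or> \<not> p ^ L x dvd p ^ (hh x N - 1) * w x"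
  proof (cases "hh x N = 0")
    case True
    then show thesis using that[of 0] dN by blast
  next
    case False
    then have "\<not> (\<forall>w\<in>N. p ^ L x dvd p ^ (hh x N - 1) * w x)"
      using hh_le[of N x "hh x N - 1"] by force
    then show thesis using that by blast
  qed
  have "\<exists>F\<in>carrier EV. F w = idem x g"
  proof (rule transport[OF x NV[OF w(1)] g])
    fix h assume h: "p ^ L x dvd p ^ h * w x"
    have "hh x N \<le> h"
    proof (rule ccontr)
      assume "\<not> hh x N \<le> h"
      then have "p ^ h dvd p ^ (hh x N - 1)" "hh x N \<noteq> 0" by (auto intro: le_imp_power_dvd)
      then have "p ^ L x dvd p ^ (hh x N - 1) * w x" using h by (meson dvd_trans dvd_refl mult_dvd_mono)
      then show False using w(2) \<open>hh x N \<noteq> 0\<close> by blast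
    qed
    then have "p ^ hh x N * g x dvd p ^ h * g x" by (intro mult_dvd_mono le_imp_power_dvd) auto
    then show "p ^ L x dvd p ^ h * g x" using d dvd_trans by blast
  qed
  then show ?thesis using dN w(1) by force
qed

lemma mem_if_idem_mem:
  assumes N: "submodule N EV (Vmod n)" and g: "g \<in> V" and e: "\<And>x. x \<in> I \<Longrightarrow> idem x g \<in> N"
  shows "g \<in> N"
proof -
  note dN = N[unfolded submodule_Vmod_iff]
  have "(\<lambda>y. if y \<in> J then g y else 0) \<in> N" if "J \<subseteq> I" for J
    using finite_subset[OF that fin] that
  proof (induction J rule: finite_induct)
    case empty
    then show ?case using dN by (simp add: zero_fun_def)
  next
    case (insert x J)
    have "(\<lambda>y. if y \<in> insert x J then g y else 0) = (\<lambda>y. if y \<in> J then g y else 0) + idem x g"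
      using insert g by (auto simp: fun_eq_iff idem_apply)
    then show ?case using insert dN e by simp
  qed
  moreover have "(\<lambda>y. if y \<in> I then g y else 0) = g" using g unfolding V_iff by auto
  ultimately show ?thesis by (metis order_refl)
qed

text \<open>The numbers \<open>hh x N\<close> determine \<open>N\<close>: they determine which
  \<open>idem x g\<close> lie in \<open>N\<close>, and an element is the sum of its components.
  Their sum is the strictly monotone function behind the existence of composition series.\<close>

lemma hh_strict:
  assumes N: "submodule N EV (Vmod n)" and N': "submodule N' EV (Vmod n)" and lt: "N \<subset> N'"
  shows "(\<Sum>x\<in>I. hh x N) < (\<Sum>x\<in>I. hh x N')"
proof (rule ccontr)
  assume "\<not> ?thesis"
  then have eq: "hh x N = hh x N'" if "x \<in> I" for x
    using that hh_mono[OF psubset_imp_subset[OF lt]] sum_strict_mono_ex1[OF fin, of "\<lambda>x. hh x N" "\<lambda>x. hh x N'"]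
    by (metis le_neq_implies_less)
  have "g \<in> N" if "g \<in> N'" for g
  proof (rule mem_if_idem_mem[OF N])
    show gV: "g \<in> V" using that N' Vt_V unfolding submodule_Vmod_iff by blast
    fix x assume x: "x \<in> I"
    show "idem x g \<in> N"
      by (rule idem_mem_iff_hh[OF N x gV]) (use hh_dvd[OF that, of x] eq[OF x] in simp)
  qed
  then show False using lt by blast
qed

lemma composition_series_Vmod: "\<exists>Ns. composition_series EV (Vmod n) Ns"
  by (rule lmod.composition_series_exists[OF lmod_Vmod]) (rule hh_strict)

lemma hh_zero: "hh x {0} = 0"
  using hh_le[of "{0}" x 0] by simp

lemma hh_Vt: "x \<in> I \<Longrightarrow> hh x (Vt n) = min n (L x)"
proof -
  assume x: "x \<in> I"
  \<comment> \<open>\<open>?b\<close> is a multiple of the generator whose order is exactly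
    \<open>p ^ ?m\<close>, so it attains the bound.\<close>
  let ?m = "min n (L x)" and ?b = "act (p ^ (L x - min n (L x))) (gen x)"
  show ?thesis
  proof (rule antisym)
    show "hh x (Vt n) \<le> ?m"
    proof (rule hh_le)
      fix g assume "g \<in> Vt n"
      then show "p ^ L x dvd p ^ ?m * g x" using x unfolding Vt_def min_def by auto
    qed
    have c: "p ^ L y dvd p ^ h * ?b y \<longleftrightarrow> y \<noteq> x \<or> ?m \<le> h" if y: "y \<in> I" for h y
    proof -
      have "p ^ L y dvd p ^ h * ?b y \<longleftrightarrow> p ^ L y dvd p ^ h * (p ^ (L x - ?m) * gen x y)"
        unfolding act_def by (rule red_dvd_iff[OF y])
      also have "\<dots> \<longleftrightarrow> y \<noteq> x \<or> L x \<le> h + (L x - ?m)"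
      proof (cases "y = x")
        case True
        then show ?thesis
          using pow_dvd_pow_mult[OF gen_not_dvd, of "L x" "h + (L x - ?m)" x]
          by (simp only: power_add mult.assoc simp_thms)
      qed (simp add: gen_def)
      also have "\<dots> \<longleftrightarrow> y \<noteq> x \<or> ?m \<le> h" by auto
      finally show ?thesis .
    qed
    have "?b \<in> Vt n" unfolding Vt_def using c by auto
    from hh_dvd[OF this, of x] show "?m \<le> hh x (Vt n)" using c[OF x] by blast
  qed
qed


context
  fixes n N N'
  assumes N: "submodule N EV (Vmod n)" and N': "submodule N' EV (Vmod n)" and sub: "N \<subseteq> N'"
    and max: "maximal_submodule N EV (Vmod n\<lparr>carrier := N'\<rparr>)"
begin

text \<open>By maximality \<open>N + p N'\<close> is \<open>N\<close> or \<open>N'\<close>. In the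
  second case iteration gives \<open>N' = N + p^k N'\<close> for all \<open>k\<close>, and
  nilpotency of \<open>p\<close> puts \<open>N'\<close> inside \<open>N\<close>.\<close>

lemma factor_killed_by_p:
  assumes g: "g \<in> N'"
  shows "act p g \<in> N"
proof -
  note dN = N[unfolded submodule_Vmod_iff] and dN' = N'[unfolded submodule_Vmod_iff]
  have NV: "w \<in> V" if "w \<in> N'" for w using dN' that Vt_V by blast
  have aN': "act f h \<in> N'" if "h \<in> N'" for f h
    using dN' scalar_EV[of f] that NV[OF that] by (metis restrict_apply')
  let ?U = "{a + act p h | a h. a \<in> N \<and> h \<in> N'}"
  have U: "submodule ?U EV (Vmod n)"
    unfolding submodule_Vmod_iff
  proof (intro conjI ballI)
    show "?U \<subseteq> Vt n" using dN dN' aN' by (auto intro!: Vt_add)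
    have "0 = 0 + act p 0" by simp
    then show "0 \<in> ?U" using dN dN' by blast
  next
    fix u v assume "u \<in> ?U" "v \<in> ?U"
    then obtain a h b k where *: "u = a + act p h" "v = b + act p k" "a \<in> N" "h \<in> N'" "b \<in> N" "k \<in> N'" by blast
    then have "u + v = (a + b) + act p (h + k)" by (simp add: act_add algebra_simps)
    moreover have "a + b \<in> N" "h + k \<in> N'" using * dN dN' by auto
    ultimately show "u + v \<in> ?U" by blast
  next
    fix F u assume F: "F \<in> carrier EV" and "u \<in> ?U"
    then obtain a h where *: "u = a + act p h" "a \<in> N" "h \<in> N'" by blast
    then have "F u = F a + act p (F h)" using EV_D[OF F] NV sub by auto
    moreover have "F a \<in> N" "F h \<in> N'" using * dN dN' F by auto
    ultimately show "F u \<in> ?U" by blast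
  qed
  have NU: "N \<subseteq> ?U"
  proof
    fix a assume "a \<in> N"
    moreover have "a = a + act p 0" by simp
    ultimately show "a \<in> ?U" using dN' by blast
  qed
  have UN': "?U \<subseteq> N'" using dN' aN' sub by auto
  have "submodule ?U EV (Vmod n\<lparr>carrier := N'\<rparr>)"
    using lmod.submodule_restrict_iff[OF lmod_Vmod N'] U UN' by simp
  with max NU have "?U = N \<or> ?U = N'" unfolding maximal_submodule_def by simp
  then consider "?U = N" | "?U = N'" by (rule disjE)
  then show ?thesis
  proof cases
    case 1
    have "act p g = 0 + act p g" by simp
    then have "act p g \<in> ?U" using g dN by blast
    then show ?thesis using 1 by simp
  next
    case 2
    \<comment> \<open>The decomposition \<open>N' = N + p N'\<close> is iterated until
      \<open>k = n\<close>, where \<open>p ^ n\<close> annihilates \<open>N'\<close> because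
      \<open>N'\<close> lies in \<open>Vt n\<close>.\<close>
    have "\<exists>a\<in>N. \<exists>h\<in>N'. u = a + act (p ^ k) h" if "u \<in> N'" for u k
    proof (induction k)
      case 0
      have "u = 0 + act (p ^ 0) u" using act_one[OF NV[OF that]] by simp
      then show ?case using that dN by blast
    next
      case (Suc k)
      then obtain a h where 1: "a \<in> N" "h \<in> N'" "u = a + act (p ^ k) h" by blast
      then obtain b h' where 3: "b \<in> N" "h' \<in> N'" "h = b + act p h'" using 2 by blast
      have "act (p ^ k) b \<in> N" using dN scalar_EV[of "p ^ k"] 3(1) NV sub by (metis restrict_apply' subsetD)
      moreover have "u = (a + act (p ^ k) b) + act (p ^ Suc k) h'"
        unfolding 1(3) 3(3) by (simp add: act_add act_act mult.commute add.assoc)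
      ultimately show ?case using 1(1) 3(2) dN by blast
    qed
    then have "u \<in> N" if "u \<in> N'" for u
      using that dN' Vt_iff_act[of _ n] NV by (metis add.right_neutral subsetD)
    then show ?thesis using aN'[OF g] by blast
  qed
qed

lemma hh_step: "x \<in> I \<Longrightarrow> hh x N' \<le> Suc (hh x N)"
proof (rule hh_le)
  fix g assume x: "x \<in> I" and g: "g \<in> N'"
  from hh_dvd[OF factor_killed_by_p[OF g], of x]
  show "p ^ L x dvd p ^ Suc (hh x N) * g x"
    unfolding act_def red_dvd_iff[OF x] by (simp add: algebra_simps)
qed

text \<open>A simple factor \<open>N' / N\<close> is a quotient of \<open>End(V) e\<^sub>x\<close> as soon as \<open>e\<^sub>x\<close> acts nontrivially on it.\<close>

lemma factor_isomorphic_iff: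
  assumes x: "x \<in> I"
  shows "lmod_isomorphic EV (quotient_module (Vmod n\<lparr>carrier := N'\<rparr>) N) (D x) \<longleftrightarrow> hh x N' \<noteq> hh x N"
proof -
  note dN = N[unfolded submodule_Vmod_iff] and dN' = N'[unfolded submodule_Vmod_iff]
  have NV: "w \<in> V" if "w \<in> N'" for w using dN' that Vt_V by blast
  let ?M = "Vmod n\<lparr>carrier := N'\<rparr>"
  let ?Q = "quotient_module ?M N"
  interpret A: lmod EV "Vmod n" by (rule lmod_Vmod)
  interpret M: lmod EV ?M by (rule A.lmod_restrict[OF N'])
  have NM: "submodule N EV ?M" using A.submodule_restrict_iff[OF N'] N sub by blast
  interpret Q: lmod EV ?Q by (rule M.lmod_quotient[OF NM])
  interpret X: lmod EV "Vmod (L x)" by (rule lmod_Vmod)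
  have rs: "submodule (rad x) EV (Vmod (L x))" by (rule rad_submodule[OF x])
  interpret D: lmod EV "D x" unfolding D_def by (rule X.lmod_quotient[OF rs])
  have Mz: "g \<in> N' \<Longrightarrow> N +>\<^bsub>?M\<^esub> g = N \<longleftrightarrow> g \<in> N" for g using M.coset_zero_iff[OF NM, of g] by simp
  have simple: "simple_module EV ?Q" using M.simple_quotient_iff[OF NM] max by blast
  have e: "idem x \<in> carrier EV" by (rule idem_EV[OF x])
  show ?thesis
  proof
    assume iso: "lmod_isomorphic EV ?Q (D x)"
    show "hh x N' \<noteq> hh x N"
    proof
      assume eq: "hh x N' = hh x N"
      \<comment> \<open>With \<open>hh\<close> unchanged, \<open>e_x\<close> maps \<open>N'\<close>
        into \<open>N\<close> and acts as zero on the factor. On \<open>D x\<close>, however, it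
        fixes the class of \<open>gen x\<close>, which is nonzero.\<close>
      have eN: "idem x g \<in> N" if "g \<in> N'" for g
        by (rule idem_mem_iff_hh[OF N x NV[OF that]]) (use hh_dvd[OF that, of x] eq in simp)
      obtain f where f: "f \<in> lmod_hom EV ?Q (D x)" "bij_betw f (carrier ?Q) (carrier (D x))"
        using iso unfolding lmod_isomorphic_def by blast
      have "rad x +>\<^bsub>Vmod (L x)\<^esub> gen x \<in> carrier (D x)"
        unfolding D_def X.quotient_simps[OF rs] using gen_Vt[OF x] by auto
      then have "rad x +>\<^bsub>Vmod (L x)\<^esub> gen x \<in> f ` carrier ?Q"
        unfolding bij_betw_imp_surj_on[OF f(2)] .
      then obtain U where U: "f U = rad x +>\<^bsub>Vmod (L x)\<^esub> gen x" "U \<in> carrier ?Q"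
        by (rule imageE) (rule that, rule sym)
      obtain g where g: "g \<in> N'" "U = N +>\<^bsub>?M\<^esub> g" using U(2) unfolding M.quotient_simps[OF NM] by auto
      have "idem x \<odot>\<^bsub>?Q\<^esub> U = N +>\<^bsub>?M\<^esub> idem x g"
        using M.quotient_smult[OF NM e, of g] g by simp
      also have "\<dots> = N" using Mz eN[OF g(1)] sub by blast
      finally have U0: "idem x \<odot>\<^bsub>?Q\<^esub> U = \<zero>\<^bsub>?Q\<^esub>" unfolding M.quotient_simps[OF NM] .
      have fz: "f \<zero>\<^bsub>?Q\<^esub> = \<zero>\<^bsub>D x\<^esub>"
        using semi_iso.map_zero[OF semi_iso_of_isomorphic[OF Q.lmod_axioms D.lmod_axioms f]] .
      have "f (idem x \<odot>\<^bsub>?Q\<^esub> U) = idem x \<odot>\<^bsub>D x\<^esub> f U" using f(1) e U(2) unfolding lmod_hom_def by blast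
      also have "\<dots> = rad x +>\<^bsub>Vmod (L x)\<^esub> gen x"
        unfolding U(1) D_def using X.quotient_smult[OF rs e, of "gen x"] gen_Vt[OF x] idem_gen[OF x] by simp
      finally have "rad x = rad x +>\<^bsub>Vmod (L x)\<^esub> gen x" unfolding U0 fz D_def X.quotient_simps[OF rs] .
      then show False using X.coset_zero_iff[OF rs, of "gen x"] gen_Vt[OF x] gen_notin_rad[OF x] by auto
    qed
  next
    assume ne: "hh x N' \<noteq> hh x N"
    have "\<exists>v\<in>N'. idem x v \<notin> N"
    proof (rule ccontr)
      assume "\<not> ?thesis"
      then have all: "idem x v \<in> N" if "v \<in> N'" for v using that by blast
      have "hh x N' \<le> hh x N"
      proof (rule hh_le)
        fix g assume g: "g \<in> N'"
        from hh_dvd[OF all[OF g], of x] show "p ^ L x dvd p ^ hh x N * g x"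
          unfolding idem_apply[OF x NV[OF g]] by simp
      qed
      then show False using ne hh_mono[OF sub, of x] by simp
    qed
    then obtain v where v: "v \<in> N'" "idem x v \<notin> N" by blast
    have vV: "v \<in> V" by (rule NV[OF v(1)])
    \<comment> \<open>This map sends the generator to the class of \<open>idem x v\<close>, which is
      nonzero, so it is onto the simple factor. Its kernel is then maximal and must be
      \<open>rad x\<close>.\<close>
    let ?f = "\<lambda>w. N +>\<^bsub>?M\<^esub> cycl x w v"
    have c: "cycl x w v \<in> N'" if "w \<in> Vt (L x)" for w
      using dN' v(1) cycl_EV[OF x that] by blast
    have f: "?f \<in> lmod_hom EV (Vmod (L x)) ?Q"
      unfolding lmod_hom_def
    proof (intro CollectI conjI ballI funcsetI)
      fix w assume w: "w \<in> carrier (Vmod (L x))"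
      then show "?f w \<in> carrier ?Q" unfolding M.quotient_simps[OF NM] using c by auto
      { fix u assume u: "u \<in> carrier (Vmod (L x))"
        have "cycl x (w + u) v = cycl x w v + cycl x u v"
          unfolding cycl_apply[OF vV] red_add[symmetric]
          by (rule arg_cong[of _ _ red]) (auto simp: algebra_simps)
        then show "?f (w \<oplus>\<^bsub>Vmod (L x)\<^esub> u) = ?f w \<oplus>\<^bsub>?Q\<^esub> ?f u"
          unfolding M.quotient_simps[OF NM] using M.coset_add[OF NM, of "cycl x w v" "cycl x u v"] c w u by simp }
      fix F assume F: "F \<in> carrier EV"
      have wt: "w \<in> Vt (L x)" using w by simp
      have "cycl x (F w) v = F (cycl x w v)"
        unfolding EV_cycl[OF F x wt, symmetric] using vV by (simp add: compose_eq)
      then show "?f (F \<odot>\<^bsub>Vmod (L x)\<^esub> w) = F \<odot>\<^bsub>?Q\<^esub> ?f w"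
        using M.quotient_smult[OF NM F, of "cycl x w v"] c[OF wt] by simp
    qed
    have surj: "?f ` carrier (Vmod (L x)) = carrier ?Q"
    proof -
      have "submodule (?f ` carrier (Vmod (L x))) EV ?Q"
        by (rule lmod_hom_image[OF lmod_Vmod Q.lmod_axioms f])
      moreover have "?f ` carrier (Vmod (L x)) \<noteq> {\<zero>\<^bsub>?Q\<^esub>}"
      proof
        assume "?f ` carrier (Vmod (L x)) = {\<zero>\<^bsub>?Q\<^esub>}"
        moreover have "?f (gen x) \<in> ?f ` carrier (Vmod (L x))" using gen_Vt[OF x] by simp
        ultimately have "?f (gen x) = N" unfolding M.quotient_simps[OF NM] by blast
        then show False using Mz[OF c[OF gen_Vt[OF x]]] v(2) by blast
      qed
      ultimately show ?thesis using simple unfolding simple_module_def by blast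
    qed
    let ?K = "{w \<in> carrier (Vmod (L x)). ?f w = \<zero>\<^bsub>?Q\<^esub>}"
    note fi = first_isomorphism[OF lmod_Vmod Q.lmod_axioms f surj]
    interpret K: lmod EV "quotient_module (Vmod (L x)) ?K" by (rule X.lmod_quotient[OF fi(1)])
    obtain h where h: "h \<in> lmod_hom EV (quotient_module (Vmod (L x)) ?K) ?Q"
        "bij_betw h (carrier (quotient_module (Vmod (L x)) ?K)) (carrier ?Q)"
      using fi(2) unfolding lmod_isomorphic_def by blast
    have "simple_module EV (quotient_module (Vmod (L x)) ?K)"
      using semi_iso.simple_iff[OF semi_iso_of_isomorphic[OF K.lmod_axioms Q.lmod_axioms h]] simple by blast
    then have "maximal_submodule ?K EV (Vmod (L x))" by (rule iffD1[OF X.simple_quotient_iff[OF fi(1)]])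
    then have "?K = rad x" by (rule iffD1[OF maximal_iff_rad[OF x]])
    then have "lmod_isomorphic EV (D x) ?Q" using fi(2) unfolding D_def by simp
    then show "lmod_isomorphic EV ?Q (D x)" by (rule lmod_isomorphic_sym[OF D.lmod_axioms Q.lmod_axioms])
  qed
qed

end

text \<open>\<open>hh x\<close> climbs from 0 to its value on \<open>Vt n\<close> in steps of 0 or
  1. The series is arbitrary, which supplies the uniqueness behind the definite description in
  \<open>composition_multiplicity\<close>.\<close>

lemma composition_count:
  assumes x: "x \<in> I" and Ns: "composition_series EV (Vmod n) Ns"
  shows "card {i. Suc i < length Ns \<and> lmod_isomorphic EV (series_factor (Vmod n) Ns i) (D x)} = min n (L x)"
proof -
  let ?S = "\<lambda>k. {i. Suc i \<le> k \<and> lmod_isomorphic EV (series_factor (Vmod n) Ns i) (D x)}"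
  note c = Ns[unfolded composition_series_def]
  have "card (?S k) = hh x (Ns ! k)" if "k < length Ns" for k
    using that
  proof (induction k)
    case 0
    then show ?case using c hh_zero hd_conv_nth[of Ns] by simp
  next
    case (Suc k)
    have s: "submodule (Ns ! k) EV (Vmod n)" "submodule (Ns ! Suc k) EV (Vmod n)" "Ns ! k \<subseteq> Ns ! Suc k"
      and simple: "simple_module EV (series_factor (Vmod n) Ns k)"
      using c Suc.prems by auto
    then have m: "maximal_submodule (Ns ! k) EV (Vmod n\<lparr>carrier := Ns ! Suc k\<rparr>)"
      using simple_series_factor_iff[OF lmod_Vmod] by blast
    have i: "lmod_isomorphic EV (series_factor (Vmod n) Ns k) (D x) \<longleftrightarrow> hh x (Ns ! Suc k) \<noteq> hh x (Ns ! k)"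
      unfolding series_factor_def by (rule factor_isomorphic_iff[OF s m x])
    have le: "hh x (Ns ! k) \<le> hh x (Ns ! Suc k)" "hh x (Ns ! Suc k) \<le> Suc (hh x (Ns ! k))"
      using hh_mono[OF s(3)] hh_step[OF s m x] by auto
    have fin: "finite (?S k)" by (rule finite_subset[of _ "{..<k}"]) auto
    show ?case
    proof (cases "hh x (Ns ! Suc k) = hh x (Ns ! k)")
      case True
      then have "?S (Suc k) = ?S k" using i by (auto simp: le_Suc_eq)
      then show ?thesis using Suc True by simp
    next
      case False
      then have "?S (Suc k) = insert k (?S k)" using i by (auto simp: le_Suc_eq)
      then show ?thesis using Suc False le fin by simp
    qed
  qed
  from this[of "length Ns - 1"] have "card (?S (length Ns - 1)) = hh x (Vt n)"
    using c last_conv_nth[of Ns] by simp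
  moreover have "?S (length Ns - 1) = {i. Suc i < length Ns \<and> lmod_isomorphic EV (series_factor (Vmod n) Ns i) (D x)}"
    by auto
  ultimately show ?thesis using hh_Vt[OF x] by simp
qed

lemma multiplicity_Vmod: "x \<in> I \<Longrightarrow> composition_multiplicity EV (Vmod n) (D x) = min n (L x)"
  unfolding composition_multiplicity_def
  using composition_series_Vmod[of n] composition_count by (intro the_equality) auto

lemma multiplicity_pim:
  assumes "x \<in> I" "y \<in> I"
  shows "composition_multiplicity EV (left_ideal_module EV (pim x)) (pim_head EV (pim y)) = min (L x) (L y)"
  using semi_iso_composition_multiplicity[OF pim_semi_iso pim_head_semi_iso, OF assms] multiplicity_Vmod[OF assms(2)]
  by simp

end

section \<open>Classification of the principal indecomposable modules\<close>

context primary_module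
begin

interpretation EV: ring EV by (rule ring_EV)

text \<open>Write \<open>gen x\<close> as a sum along a decomposition: one of the two terms has its
  coordinate \<open>x\<close> prime to \<open>p\<close>, and so generates the whole module.\<close>

lemma Vmod_indecomposable: "x \<in> I \<Longrightarrow> indecomposable_module EV (Vmod (L x))"
  unfolding indecomposable_module_def Vmod_simps
proof (intro conjI notI)
  assume x: "x \<in> I"
  have g0: "gen x \<noteq> 0" using gen_not_dvd[of x] by (metis dvd_0_right zero_fun_apply)
  then show "Vt (L x) = {0} \<Longrightarrow> False" using gen_Vt[OF x] by blast
  assume "\<exists>N N'. submodule N EV (Vmod (L x)) \<and> submodule N' EV (Vmod (L x)) \<and> N \<noteq> {0} \<and> N' \<noteq> {0} \<and>
    N \<inter> N' = {0} \<and> N <+>\<^bsub>Vmod (L x)\<^esub> N' = Vt (L x)"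
  then obtain N N' where N: "submodule N EV (Vmod (L x))" "submodule N' EV (Vmod (L x))" "N \<noteq> {0}" "N' \<noteq> {0}"
    "N \<inter> N' = {0}" "N <+>\<^bsub>Vmod (L x)\<^esub> N' = Vt (L x)" by blast
  have "gen x \<in> N <+>\<^bsub>Vmod (L x)\<^esub> N'" using N(6) gen_Vt[OF x] by simp
  then obtain a b where ab: "a \<in> N" "b \<in> N'" "gen x = a + b"
    unfolding set_add_mem by auto
  have "\<not> p dvd a x \<or> \<not> p dvd b x"
    using gen_not_dvd[of x] unfolding ab(3) by (auto intro: dvd_add)
  then have "N = Vt (L x) \<or> N' = Vt (L x)"
    using generates[OF N(1) ab(1) x refl] generates[OF N(2) ab(2) x refl] by blast
  then show False using N(1-5) unfolding submodule_Vmod_iff by blast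
qed

lemma pim_principal_indecomposable:
  assumes x: "x \<in> I"
  shows "principal_indecomposable EV (pim x)"
proof -
  \<comment> \<open>This is the left ideal \<open>EV (1 - e_x)\<close>, described by its action on
    the generator.\<close>
  let ?Q = "{F \<in> carrier EV. F (gen x) = 0}"
  have gV: "gen x \<in> V" by (rule gen_V[OF x])
  note e = idem_EV[OF x]
  have pc: "\<exists>w\<in>Vt (L x). F = cycl x w \<and> F (gen x) = w" if "F \<in> pim x" for F
    using that cycl_gen[OF x] Vt_V unfolding pim_eq[OF x] by blast
  have ev: "(F \<otimes>\<^bsub>EV\<^esub> idem x) (gen x) = F (gen x)" for F
    using gV idem_gen[OF x] by (simp add: compose_eq)
  have um: "(\<ominus>\<^bsub>EV\<^esub> F) (gen x) = - F (gen x)" if "F \<in> carrier EV" for F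
  proof -
    have "(\<zero>\<^bsub>EV\<^esub> \<ominus>\<^bsub>EV\<^esub> F) (gen x) = \<zero>\<^bsub>EV\<^esub> (gen x) - F (gen x)"
      by (rule EV_minus_apply[OF EV.zero_closed that gV])
    moreover have "\<zero>\<^bsub>EV\<^esub> \<ominus>\<^bsub>EV\<^esub> F = \<ominus>\<^bsub>EV\<^esub> F" unfolding a_minus_def by (rule EV.l_zero) (simp add: that)
    ultimately show ?thesis using gV by simp
  qed
  show ?thesis
    unfolding principal_indecomposable_def
  proof (intro conjI exI[of _ ?Q])
    show "submodule (pim x) EV (regular_module EV)" by (rule pim_left_ideal[OF x])
    show "submodule ?Q EV (regular_module EV)"
      unfolding left_ideal_iff[OF ring_EV]
    proof (intro conjI ballI)
      show "\<zero>\<^bsub>EV\<^esub> \<in> ?Q" using EV.zero_closed gV by simp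
    next
      fix F G assume "F \<in> ?Q" "G \<in> ?Q"
      then show "F \<oplus>\<^bsub>EV\<^esub> G \<in> ?Q" using EV.a_closed[of F G] gV by simp
    next
      fix F assume F: "F \<in> ?Q"
      then show "\<ominus>\<^bsub>EV\<^esub> F \<in> ?Q" using um EV.a_inv_closed[of F] by simp
      fix G assume G: "G \<in> carrier EV"
      then show "G \<otimes>\<^bsub>EV\<^esub> F \<in> ?Q" using F EV.m_closed[of G F] gV EV_map_zero[OF G] by (simp add: compose_eq)
    qed auto
    show "pim x \<inter> ?Q = {\<zero>\<^bsub>EV\<^esub>}"
    proof
      show "{\<zero>\<^bsub>EV\<^esub>} \<subseteq> pim x \<inter> ?Q"
        using pim_left_ideal[OF x] gV EV.zero_closed unfolding left_ideal_iff[OF ring_EV] by simp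
      show "pim x \<inter> ?Q \<subseteq> {\<zero>\<^bsub>EV\<^esub>}"
      proof
        fix F assume "F \<in> pim x \<inter> ?Q"
        then have "F = cycl x 0" using pc by fastforce
        also have "\<dots> = \<zero>\<^bsub>EV\<^esub>" by (auto simp: cycl_def red_def fun_eq_iff restrict_def)
        finally show "F \<in> {\<zero>\<^bsub>EV\<^esub>}" by blast
      qed
    qed
    show "pim x <+>\<^bsub>EV\<^esub> ?Q = carrier EV"
    proof
      have "pim x \<subseteq> carrier EV" using pim_left_ideal[OF x] unfolding left_ideal_iff[OF ring_EV] by blast
      then show "pim x <+>\<^bsub>EV\<^esub> ?Q \<subseteq> carrier EV" unfolding set_add_def' by (auto intro!: EV.a_closed simp del: EV_simps)
      show "carrier EV \<subseteq> pim x <+>\<^bsub>EV\<^esub> ?Q"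
      proof
        fix F assume F: "F \<in> carrier EV"
        let ?a = "F \<otimes>\<^bsub>EV\<^esub> idem x"
        have a: "?a \<in> carrier EV" using F e by (rule EV.m_closed)
        have "(F \<ominus>\<^bsub>EV\<^esub> ?a) (gen x) = 0" using EV_minus_apply[OF F a gV] unfolding ev by simp
        then have "F \<ominus>\<^bsub>EV\<^esub> ?a \<in> ?Q" using EV.minus_closed[OF F a] by blast
        moreover have "?a \<in> pim x" unfolding pim_def using F by blast
        moreover have "F = ?a \<oplus>\<^bsub>EV\<^esub> (F \<ominus>\<^bsub>EV\<^esub> ?a)"
          unfolding a_minus_def using EV.a_lcomm[OF a F EV.a_inv_closed[OF a]] EV.r_neg[OF a] EV.r_zero[OF F] by (simp del: EV_simps)
        ultimately show "F \<in> pim x <+>\<^bsub>EV\<^esub> ?Q" unfolding set_add_mem by blast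
      qed
    qed
    show "indecomposable_module EV (left_ideal_module EV (pim x))"
      using semi_iso.indecomposable_iff[OF pim_semi_iso[OF x]] Vmod_indecomposable[OF x] by blast
  qed
qed

lemma pim_isomorphic_Vmod: "x \<in> I \<Longrightarrow> lmod_isomorphic EV (left_ideal_module EV (pim x)) (Vmod (L x))"
  by (rule lmod_isomorphic_of_semi_iso[OF pim_semi_iso])

lemma Vmod_isomorphic_pim: "x \<in> I \<Longrightarrow> lmod_isomorphic EV (Vmod (L x)) (left_ideal_module EV (pim x))"
  by (rule lmod_isomorphic_sym[OF lmod_left_ideal[OF ring_EV pim_left_ideal] lmod_Vmod pim_isomorphic_Vmod])

text \<open>\<open>p ^ n\<close> annihilates \<open>Vmod n\<close>, hence also the generator of an
  isomorphic module, and that generator has order \<open>p ^ L x\<close>.\<close>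

lemma Vmod_isomorphic_le:
  assumes x: "x \<in> I" and iso: "lmod_isomorphic EV (Vmod n) (Vmod (L x))"
  shows "L x \<le> n"
proof -
  obtain f where f: "f \<in> lmod_hom EV (Vmod n) (Vmod (L x))" "bij_betw f (Vt n) (Vt (L x))"
    using iso unfolding lmod_isomorphic_def by auto
  interpret s: semi_iso EV EV "Vmod n" "Vmod (L x)" "(=)" f
    by (rule semi_iso_of_isomorphic) (use f lmod_Vmod in auto)
  obtain v where v: "v \<in> Vt n" "f v = gen x"
    using f(2) gen_Vt[OF x] unfolding bij_betw_def by (metis imageE)
  let ?F = "\<lambda>u\<in>V. act (p ^ n) u"
  have vV: "v \<in> V" by (rule Vt_V[OF v(1)])
  have "f (?F v) = ?F (f v)" using f(1) scalar_EV v(1) unfolding lmod_hom_def Vmod_simps by blast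
  moreover have "?F v = 0" using v(1) vV Vt_iff_act[OF vV, of n] by simp
  moreover have "f 0 = 0" using s.map_zero by simp
  ultimately have "act (p ^ n) (gen x) = 0" using v gen_V[OF x] by simp
  then have "p ^ L x dvd p ^ n * gen x x" using Vt_iff_act[OF gen_V[OF x]] x unfolding Vt_def by blast
  then show ?thesis using pow_dvd_pow_mult[OF gen_not_dvd] by blast
qed

lemma pim_isomorphic_iff:
  assumes x: "x \<in> I" and y: "y \<in> I"
  shows "lmod_isomorphic EV (left_ideal_module EV (pim x)) (left_ideal_module EV (pim y)) \<longleftrightarrow> L x = L y"
proof
  assume "L x = L y"
  then show "lmod_isomorphic EV (left_ideal_module EV (pim x)) (left_ideal_module EV (pim y))"
    using lmod_isomorphic_trans[OF pim_isomorphic_Vmod[OF x]] Vmod_isomorphic_pim[OF y] by simp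
next
  assume i: "lmod_isomorphic EV (left_ideal_module EV (pim x)) (left_ideal_module EV (pim y))"
  have xy: "lmod_isomorphic EV (Vmod (L x)) (Vmod (L y))"
    by (rule lmod_isomorphic_trans[OF Vmod_isomorphic_pim[OF x] lmod_isomorphic_trans[OF i pim_isomorphic_Vmod[OF y]]])
  then show "L x = L y"
    using Vmod_isomorphic_le[OF y xy] Vmod_isomorphic_le[OF x lmod_isomorphic_sym[OF lmod_Vmod lmod_Vmod xy]] by simp
qed

lemma Vt_zero_eq: "Vt 0 = {0}"
proof -
  have "g = 0" if "g \<in> Vt 0" for g
    by (rule V_eqI) (use that in \<open>auto simp: Vt_def\<close>)
  then show ?thesis by auto
qed

lemma Vt_top: "V = Vt (\<Sum>x\<in>I. L x)"
proof -
  have "L x \<le> (\<Sum>x\<in>I. L x)" if "x \<in> I" for x using member_le_sum[OF that _ fin, of L] by simp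
  then show ?thesis unfolding Vt_def by (auto intro!: dvd_mult2 le_imp_power_dvd)
qed

text \<open>The smallest \<open>k\<close> for which \<open>e\<close> maps an element of order \<open>p^k\<close> outside of \<open>p V\<close> is the
  exponent of a summand that occurs in \<open>e V\<close>.\<close>

lemma idempotent_unit_coordinate:
  assumes e: "e \<in> carrier EV" "e \<otimes>\<^bsub>EV\<^esub> e = e" "e \<noteq> \<zero>\<^bsub>EV\<^esub>"
  obtains x y where "x \<in> I" "y \<in> Vt (L x)" "e y = y" "\<not> p dvd y x"
proof -
  have ee: "e (e g) = e g" if "g \<in> V" for g
    using e(2) that by (simp add: fun_eq_iff compose_def restrict_def) (metis)
  have ex: "\<exists>y\<in>V. \<exists>z\<in>I. \<not> p dvd e y z"
  proof (rule ccontr)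
    assume "\<not> ?thesis"
    then have all: "p dvd e y z" if "y \<in> V" "z \<in> I" for y z using that by blast
    \<comment> \<open>If \<open>e V\<close> were inside \<open>p V\<close>, then by idempotence it
      would equal \<open>p^k e V\<close> for every \<open>k\<close>, and \<open>e\<close> would
      vanish.\<close>
    have "\<exists>v\<in>V. e y = act (p ^ k) (e v)" if y: "y \<in> V" for y k
    proof (induction k)
      case 0
      then show ?case using y act_one EV_D(2)[OF e(1)] by auto
    next
      case (Suc k)
      then obtain v where v: "v \<in> V" "e y = act (p ^ k) (e v)" by blast
      \<comment> \<open>The parameter 0 makes the condition cover all coordinates, and the remainder
        lies in \<open>Vt (0 - 1) = Vt 0\<close>, which is zero.\<close>
      obtain v' w where vw: "v' \<in> V" "w \<in> Vt (0 - 1)" "e v = act p v' + w"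
        using low_decomposition[OF EV_D(2)[OF e(1) v(1)] all[OF v(1)], of 0] .
      then have "e v = act p v'" using Vt_zero_eq by simp
      then have "e v = act p (e v')" using ee[OF v(1)] EV_D(4)[OF e(1) vw(1)] by simp
      then have "e y = act (p ^ Suc k) (e v')" unfolding v(2) by (simp add: act_act mult.commute)
      then show ?case using vw(1) by blast
    qed
    then have "e y = 0" if "y \<in> V" for y
      using that Vt_iff_act[OF EV_D(2)[OF e(1)]] EV_D(2)[OF e(1)] Vt_top by metis
    then have "e = \<zero>\<^bsub>EV\<^esub>" by (intro EV_eqI[OF e(1) EV.zero_closed]) simp
    then show False using e(3) by blast
  qed
  define P where "P k \<longleftrightarrow> (\<exists>y\<in>Vt k. \<exists>z\<in>I. \<not> p dvd e y z)" for k
  have "P (\<Sum>x\<in>I. L x)" unfolding P_def Vt_top[symmetric] by (rule ex)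
  define k where "k = (LEAST k. P k)"
  have Pk: "P k" unfolding k_def by (rule LeastI) fact
  have k0: "k \<noteq> 0"
  proof
    assume "k = 0"
    then have "P 0" using Pk by simp
    then show False using EV_map_zero[OF e(1)] unfolding P_def Vt_zero_eq by simp
  qed
  then have nPk: "\<not> P (k - 1)" using not_less_Least[of "k - 1" P] unfolding k_def by simp
  obtain y0 z where y0: "y0 \<in> Vt k" "z \<in> I" "\<not> p dvd e y0 z" using Pk unfolding P_def by blast
  let ?y = "e y0"
  have y: "?y \<in> Vt k" "e ?y = ?y" using EV_Vt[OF e(1) y0(1)] ee[OF Vt_V[OF y0(1)]] by auto
  \<comment> \<open>Otherwise \<open>?y\<close> lies in \<open>p V + Vt (k - 1)\<close>. Minimality
    of \<open>k\<close> then makes \<open>e ?y = ?y\<close> divisible by \<open>p\<close> at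
    \<open>z\<close>, a contradiction.\<close>
  have "\<exists>x\<in>I. L x = k \<and> \<not> p dvd ?y x"
  proof (rule ccontr)
    assume n: "\<not> ?thesis"
    have low: "p dvd ?y x" if x: "x \<in> I" "k \<le> L x" for x
    proof (cases "L x = k")
      case False
      show ?thesis
      proof (rule ccontr)
        assume "\<not> p dvd ?y x"
        moreover have "p ^ L x dvd p ^ k * ?y x" using y(1) x unfolding Vt_def by blast
        ultimately show False using pow_dvd_pow_mult[of "?y x" "L x" k] x(2) False by simp
      qed
    qed (use n x in blast)
    obtain v w where vw: "v \<in> V" "w \<in> Vt (k - 1)" "?y = act p v + w"
      using low_decomposition[OF Vt_V[OF y(1)] low] .
    have "e ?y = act p (e v) + e w" unfolding vw(3) using EV_D[OF e(1)] vw Vt_V by simp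
    moreover have "p dvd e w z" using nPk vw(2) y0(2) unfolding P_def by blast
    ultimately have "p dvd e ?y z" using act_p_dvd[OF y0(2)] by simp
    then show False using y0(3) y(2) by simp
  qed
  then show thesis using that y by blast
qed

text \<open>\<open>P\<close> is generated by an idempotent \<open>e\<close>. Evaluation at the
  element \<open>y\<close> supplied by \<open>idempotent_unit_coordinate\<close> maps
  \<open>P\<close> onto \<open>Vmod (L x)\<close> because \<open>y\<close> generates. An element
  \<open>q\<close> of \<open>P\<close> with \<open>q y = gen x\<close> provides a section, so the
  kernel is a direct summand, and indecomposability of \<open>P\<close> makes it zero.\<close>

lemma pim_exhaust:
  assumes P: "principal_indecomposable EV P"
  obtains x where "x \<in> I" "lmod_isomorphic EV (left_ideal_module EV P) (Vmod (L x))"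
proof -
  obtain Q where sP: "submodule P EV (regular_module EV)" and sQ: "submodule Q EV (regular_module EV)"
    and PQ: "P \<inter> Q = {\<zero>\<^bsub>EV\<^esub>}" "P <+>\<^bsub>EV\<^esub> Q = carrier EV"
    and ind: "indecomposable_module EV (left_ideal_module EV P)"
    using P unfolding principal_indecomposable_def by blast
  note dP = sP[unfolded left_ideal_iff[OF ring_EV]] and dQ = sQ[unfolded left_ideal_iff[OF ring_EV]]
  have Pc: "F \<in> carrier EV" if "F \<in> P" for F using dP that by blast
  have "\<one>\<^bsub>EV\<^esub> \<in> P <+>\<^bsub>EV\<^esub> Q" unfolding PQ by (rule EV.one_closed)
  then obtain e f where ef: "e \<in> P" "f \<in> Q" "\<one>\<^bsub>EV\<^esub> = e \<oplus>\<^bsub>EV\<^esub> f" unfolding set_add_mem by blast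
  have ec: "e \<in> carrier EV" and fc: "f \<in> carrier EV" using ef dP dQ by blast+
  \<comment> \<open>As \<open>e\<close> is the component of 1 in \<open>P\<close>, it is a right
    unit on \<open>P\<close>; in particular it is idempotent.\<close>
  have Pe: "F \<otimes>\<^bsub>EV\<^esub> e = F" if F: "F \<in> P" for F
  proof -
    have Fc: "F \<in> carrier EV" by (rule Pc[OF F])
    have "F = F \<otimes>\<^bsub>EV\<^esub> e \<oplus>\<^bsub>EV\<^esub> F \<otimes>\<^bsub>EV\<^esub> f"
      using EV.r_one[OF Fc] EV.r_distr[OF ec fc Fc] unfolding ef(3) by (rule trans[OF sym])
    moreover have Fe: "F \<otimes>\<^bsub>EV\<^esub> e \<in> P" "F \<otimes>\<^bsub>EV\<^esub> f \<in> Q" using dP dQ ef Fc by blast+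
    moreover have "F \<otimes>\<^bsub>EV\<^esub> f = F \<ominus>\<^bsub>EV\<^esub> F \<otimes>\<^bsub>EV\<^esub> e"
    proof -
      have c: "F \<otimes>\<^bsub>EV\<^esub> e \<in> carrier EV" "F \<otimes>\<^bsub>EV\<^esub> f \<in> carrier EV" using Fc ec fc EV.m_closed by blast+
      have "F \<ominus>\<^bsub>EV\<^esub> F \<otimes>\<^bsub>EV\<^esub> e = (F \<otimes>\<^bsub>EV\<^esub> e \<oplus>\<^bsub>EV\<^esub> F \<otimes>\<^bsub>EV\<^esub> f) \<ominus>\<^bsub>EV\<^esub> F \<otimes>\<^bsub>EV\<^esub> e"
        by (rule arg_cong[of _ _ "\<lambda>t. t \<ominus>\<^bsub>EV\<^esub> F \<otimes>\<^bsub>EV\<^esub> e"]) fact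
      also have "\<dots> = F \<otimes>\<^bsub>EV\<^esub> f"
        unfolding a_minus_def using c EV.a_comm[OF c] EV.a_assoc[OF c(2,1) EV.a_inv_closed[OF c(1)]] EV.r_neg[OF c(1)] EV.r_zero[OF c(2)]
        by (simp del: EV_simps)
      finally show ?thesis by (rule sym)
    qed
    then have "F \<otimes>\<^bsub>EV\<^esub> f \<in> P" unfolding a_minus_def using dP F Fe(1) by (simp del: EV_simps)
    ultimately have "F \<otimes>\<^bsub>EV\<^esub> f = \<zero>\<^bsub>EV\<^esub>" using PQ by blast
    then show ?thesis using \<open>F = F \<otimes>\<^bsub>EV\<^esub> e \<oplus>\<^bsub>EV\<^esub> F \<otimes>\<^bsub>EV\<^esub> f\<close> EV.r_zero[OF EV.m_closed[OF Fc ec]] by metis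
  qed
  have e0: "e \<noteq> \<zero>\<^bsub>EV\<^esub>"
  proof
    assume "e = \<zero>\<^bsub>EV\<^esub>"
    then have "F = \<zero>\<^bsub>EV\<^esub>" if "F \<in> P" for F using Pe[OF that] EV.r_null[OF Pc[OF that]] by metis
    then have "P = {\<zero>\<^bsub>EV\<^esub>}" using dP by blast
    then show False using ind unfolding indecomposable_module_def by simp
  qed
  obtain x y where x: "x \<in> I" and y: "y \<in> Vt (L x)" "e y = y" "\<not> p dvd y x"
    using idempotent_unit_coordinate[OF ec Pe[OF ef(1)] e0] .
  have yV: "y \<in> V" by (rule Vt_V[OF y(1)])
  interpret A: lmod EV "left_ideal_module EV P" by (rule lmod_left_ideal[OF ring_EV sP])
  interpret X: lmod EV "Vmod (L x)" by (rule lmod_Vmod)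
  have th: "(\<lambda>F. F y) \<in> lmod_hom EV (left_ideal_module EV P) (Vmod (L x))"
    unfolding lmod_hom_def using EV_Vt[OF Pc y(1)] yV by (auto simp: compose_eq)
  have im: "(\<lambda>F. F y) ` P = Vt (L x)"
  proof (rule generates[of "(\<lambda>F. F y) ` P" x y x])
    show "x \<in> I" "L x = L x" "\<not> p dvd y x" by (rule x refl y(3))+
    show "submodule ((\<lambda>F. F y) ` P) EV (Vmod (L x))" using lmod_hom_image[OF A.lmod_axioms X.lmod_axioms th] by simp
    show "y \<in> (\<lambda>F. F y) ` P" using ef(1) y(2) by (metis (no_types, lifting) image_eqI)
  qed
  have "gen x \<in> (\<lambda>F. F y) ` P" unfolding im by (rule gen_Vt[OF x])
  then obtain q where q: "q y = gen x" "q \<in> P" by (rule imageE) (rule that, rule sym)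
  note qc = Pc[OF q(2)]
  \<comment> \<open>The section: \<open>q\<close> takes \<open>y\<close> to the generator of summand
    \<open>x\<close>, and \<open>cycl x v\<close> takes that generator to \<open>v\<close>.\<close>
  let ?\<sigma> = "\<lambda>v. cycl x v \<otimes>\<^bsub>EV\<^esub> q"
  have \<sigma>P: "?\<sigma> v \<in> P" if "v \<in> Vt (L x)" for v using dP q(2) cycl_EV[OF x that] by blast
  have \<sigma>y: "?\<sigma> v y = v" if "v \<in> Vt (L x)" for v
    using cycl_gen[OF x Vt_V[OF that]] yV q(1) by (simp add: compose_eq)
  have \<sigma>: "?\<sigma> \<in> lmod_hom EV (Vmod (L x)) (left_ideal_module EV P)"
    unfolding lmod_hom_def
  proof (intro CollectI conjI ballI funcsetI)
    fix v assume v: "v \<in> carrier (Vmod (L x))"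
    then have vt: "v \<in> Vt (L x)" by simp
    show "?\<sigma> v \<in> carrier (left_ideal_module EV P)" using \<sigma>P[OF vt] by simp
    { fix u assume "u \<in> carrier (Vmod (L x))"
      then have ut: "u \<in> Vt (L x)" by simp
      have "cycl x (v + u) = cycl x v \<oplus>\<^bsub>EV\<^esub> cycl x u"
        by (rule EV_eqI[OF cycl_EV[OF x Vt_add[OF vt ut]] EV.a_closed[OF cycl_EV[OF x vt] cycl_EV[OF x ut]]])
          (auto simp: cycl_apply red_add[symmetric] algebra_simps intro!: arg_cong[of _ _ red])
      then have "?\<sigma> (v + u) = ?\<sigma> v \<oplus>\<^bsub>EV\<^esub> ?\<sigma> u"
        using EV.l_distr[OF cycl_EV[OF x vt] cycl_EV[OF x ut] qc] by (simp only:)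
      then show "?\<sigma> (v \<oplus>\<^bsub>Vmod (L x)\<^esub> u) = ?\<sigma> v \<oplus>\<^bsub>left_ideal_module EV P\<^esub> ?\<sigma> u"
        by (simp only: Vmod_simps left_ideal_module_simps) }
    fix F assume F: "F \<in> carrier EV"
    have "?\<sigma> (F v) = F \<otimes>\<^bsub>EV\<^esub> ?\<sigma> v"
      unfolding EV_cycl[OF F x vt, symmetric] by (rule EV.m_assoc[OF F cycl_EV[OF x vt] qc])
    then show "?\<sigma> (F \<odot>\<^bsub>Vmod (L x)\<^esub> v) = F \<odot>\<^bsub>left_ideal_module EV P\<^esub> ?\<sigma> v"
      by (simp only: Vmod_simps left_ideal_module_simps)
  qed
  let ?S = "?\<sigma> ` Vt (L x)" and ?K = "{F \<in> P. F y = 0}"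
  have sS: "submodule ?S EV (left_ideal_module EV P)"
    using lmod_hom_image[OF X.lmod_axioms A.lmod_axioms \<sigma>] by simp
  have sK: "submodule ?K EV (left_ideal_module EV P)"
    using first_isomorphism(1)[OF A.lmod_axioms X.lmod_axioms th] im by simp
  have \<sigma>0: "?\<sigma> 0 = \<zero>\<^bsub>EV\<^esub>"
  proof -
    have "cycl x 0 = \<zero>\<^bsub>EV\<^esub>" by (auto simp: cycl_def red_def fun_eq_iff restrict_def)
    then show ?thesis using EV.l_null[OF qc] by metis
  qed
  have SK: "?S \<inter> ?K = {\<zero>\<^bsub>EV\<^esub>}"
  proof
    show "?S \<inter> ?K \<subseteq> {\<zero>\<^bsub>EV\<^esub>}" using \<sigma>y \<sigma>0 by fastforce
    show "{\<zero>\<^bsub>EV\<^esub>} \<subseteq> ?S \<inter> ?K"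
      using A.submoduleD(2)[OF sS] A.submoduleD(2)[OF sK] by simp
  qed
  have sum: "?S <+>\<^bsub>left_ideal_module EV P\<^esub> ?K = P"
  proof
    have "?S \<subseteq> P" using \<sigma>P by blast
    then show "?S <+>\<^bsub>left_ideal_module EV P\<^esub> ?K \<subseteq> P"
      using dP unfolding set_add_def' left_ideal_module_simps by blast
    show "P \<subseteq> ?S <+>\<^bsub>left_ideal_module EV P\<^esub> ?K"
    proof
      fix F assume F: "F \<in> P"
      let ?G = "?\<sigma> (F y)"
      have Ft: "F y \<in> Vt (L x)" by (rule EV_Vt[OF Pc[OF F] y(1)])
      have G: "?G \<in> P" by (rule \<sigma>P[OF Ft])
      have "(F \<ominus>\<^bsub>EV\<^esub> ?G) y = 0" using EV_minus_apply[OF Pc[OF F] Pc[OF G] yV] \<sigma>y[OF Ft] by simp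
      moreover have "F \<ominus>\<^bsub>EV\<^esub> ?G \<in> P" unfolding a_minus_def using dP F G by blast
      moreover have "F = ?G \<oplus>\<^bsub>EV\<^esub> (F \<ominus>\<^bsub>EV\<^esub> ?G)"
        unfolding a_minus_def
        using EV.a_lcomm[OF Pc[OF G] Pc[OF F] EV.a_inv_closed[OF Pc[OF G]]] EV.r_neg[OF Pc[OF G]] EV.r_zero[OF Pc[OF F]]
        by metis
      ultimately show "F \<in> ?S <+>\<^bsub>left_ideal_module EV P\<^esub> ?K"
        unfolding set_add_mem left_ideal_module_simps using Ft by blast
    qed
  qed
  have S0: "?S \<noteq> {\<zero>\<^bsub>EV\<^esub>}"
  proof
    assume "?S = {\<zero>\<^bsub>EV\<^esub>}"
    then have "?\<sigma> (gen x) = \<zero>\<^bsub>EV\<^esub>" using gen_Vt[OF x] by blast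
    then have "gen x = 0" using \<sigma>y[OF gen_Vt[OF x]] yV by (metis EV_simps(3) restrict_apply')
    then show False using gen_not_dvd[of x] by (metis dvd_0_right zero_fun_apply)
  qed
  have K: "?K = {\<zero>\<^bsub>EV\<^esub>}"
  proof (rule ccontr)
    assume "?K \<noteq> {\<zero>\<^bsub>EV\<^esub>}"
    then have "\<exists>N N'. submodule N EV (left_ideal_module EV P) \<and> submodule N' EV (left_ideal_module EV P) \<and>
        N \<noteq> {\<zero>\<^bsub>EV\<^esub>} \<and> N' \<noteq> {\<zero>\<^bsub>EV\<^esub>} \<and> N \<inter> N' = {\<zero>\<^bsub>EV\<^esub>} \<and> N <+>\<^bsub>left_ideal_module EV P\<^esub> N' = P"
      by (intro exI[of _ ?S] exI[of _ ?K] conjI sS sK S0 SK sum)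
    moreover have "\<not> (\<exists>N N'. submodule N EV (left_ideal_module EV P) \<and> submodule N' EV (left_ideal_module EV P) \<and>
        N \<noteq> {\<zero>\<^bsub>EV\<^esub>} \<and> N' \<noteq> {\<zero>\<^bsub>EV\<^esub>} \<and> N \<inter> N' = {\<zero>\<^bsub>EV\<^esub>} \<and> N <+>\<^bsub>left_ideal_module EV P\<^esub> N' = P)"
      using ind unfolding indecomposable_module_def left_ideal_module_simps by (rule conjunct2)
    ultimately show False by (rule notE[rotated])
  qed
  have "inj_on (\<lambda>F. F y) P"
  proof (rule inj_onI)
    fix F G assume *: "F \<in> P" "G \<in> P" "F y = G y"
    have "(F \<ominus>\<^bsub>EV\<^esub> G) y = 0" using EV_minus_apply[OF Pc[OF *(1)] Pc[OF *(2)] yV] *(3) by simp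
    moreover have "F \<ominus>\<^bsub>EV\<^esub> G \<in> P" unfolding a_minus_def using dP *(1,2) by blast
    ultimately have "F \<ominus>\<^bsub>EV\<^esub> G = \<zero>\<^bsub>EV\<^esub>" using K by blast
    then show "F = G" using Pc[OF *(1)] Pc[OF *(2)]
      by (metis a_minus_def EV.minus_equality EV.minus_minus EV.a_inv_closed)
  qed
  then have "lmod_isomorphic EV (left_ideal_module EV P) (Vmod (L x))"
    unfolding lmod_isomorphic_def bij_betw_def using th im by auto
  then show thesis using that[OF x] by blast
qed

lemma composition_series_pim:
  assumes P: "principal_indecomposable EV P"
  shows "\<exists>Ns. composition_series EV (left_ideal_module EV P) Ns"
proof -
  obtain x where x: "lmod_isomorphic EV (left_ideal_module EV P) (Vmod (L x))" using pim_exhaust[OF P] by blast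
  have l: "lmod EV (left_ideal_module EV P)"
    using lmod_left_ideal[OF ring_EV] P unfolding principal_indecomposable_def by blast
  obtain f where f: "f \<in> lmod_hom EV (Vmod (L x)) (left_ideal_module EV P)"
     "bij_betw f (carrier (Vmod (L x))) (carrier (left_ideal_module EV P))"
    using lmod_isomorphic_sym[OF l lmod_Vmod x] unfolding lmod_isomorphic_def by blast
  show ?thesis
    using composition_series_Vmod semi_iso.composition_series_image[OF semi_iso_of_isomorphic[OF lmod_Vmod l f]] by blast
qed

lemma pim_representatives_EV:
  assumes xs: "set xs \<subseteq> I" "distinct (map L xs)" "\<And>y. y \<in> I \<Longrightarrow> L y \<in> L ` set xs"
  shows "pim_representatives EV (map pim xs)"
    "cartan_matrix EV (map pim xs) = mat (length xs) (length xs) (\<lambda>(i, j). min (L (xs ! i)) (L (xs ! j)))"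
proof -
  have xI: "xs ! i \<in> I" if "i < length xs" for i using xs(1) that nth_mem by blast
  show "pim_representatives EV (map pim xs)"
    unfolding pim_representatives_def
  proof (intro conjI)
    show "\<forall>P\<in>set (map pim xs). principal_indecomposable EV P"
      using xs(1) pim_principal_indecomposable by auto
    show "\<forall>i<length (map pim xs). \<forall>j<length (map pim xs). i \<noteq> j \<longrightarrow>
       \<not> lmod_isomorphic EV (left_ideal_module EV (map pim xs ! i)) (left_ideal_module EV (map pim xs ! j))"
      using pim_isomorphic_iff xI xs(2) by (auto simp: distinct_conv_nth)
    show "\<forall>P. principal_indecomposable EV P \<longrightarrow>
       (\<exists>P'\<in>set (map pim xs). lmod_isomorphic EV (left_ideal_module EV P) (left_ideal_module EV P'))"
    proof (intro allI impI)
      fix P assume "principal_indecomposable EV P"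
      then obtain y where y: "y \<in> I" "lmod_isomorphic EV (left_ideal_module EV P) (Vmod (L y))" by (rule pim_exhaust)
      obtain x where x: "x \<in> set xs" "L x = L y" using xs(3)[OF y(1)] by (metis imageE)
      then have "lmod_isomorphic EV (left_ideal_module EV P) (left_ideal_module EV (pim x))"
        using lmod_isomorphic_trans[OF y(2)] Vmod_isomorphic_pim[of x] xs(1) by auto
      then show "\<exists>P'\<in>set (map pim xs). lmod_isomorphic EV (left_ideal_module EV P) (left_ideal_module EV P')"
        using x(1) by auto
    qed
  qed
  show "cartan_matrix EV (map pim xs) = mat (length xs) (length xs) (\<lambda>(i, j). min (L (xs ! i)) (L (xs ! j)))"
    unfolding cartan_matrix_def by (rule eq_matI) (auto simp: multiplicity_pim xI)
qed

section \<open>Indecomposability of End(V) as a ring\<close>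

text \<open>The component \<open>e\<close> of 1 in an ideal of a decomposition is a central
  idempotent. On the generator of a summand of largest exponent it is a scalar \<open>s\<close> with
  \<open>s (s - 1) = 0\<close>, hence 0 or 1, since K[t]/(p^l) is local. Every element of
  \<open>V\<close> is the image of that generator under some endomorphism, so \<open>e\<close> is 0
  or 1.\<close>

lemma is_block_EV:
  assumes ne: "I \<noteq> {}"
  shows "is_block EV (carrier EV)"
proof -
  obtain x where x: "x \<in> I" "\<And>y. y \<in> I \<Longrightarrow> L y \<le> L x"
  proof -
    have "Max (L ` I) \<in> L ` I" using fin ne by simp
    then obtain x where "x \<in> I" "Max (L ` I) = L x" by blast
    then show thesis using that fin by (metis Max_ge finite_imageI imageI)
  qed
  have VL: "V = Vt (L x)"
    unfolding Vt_def using x(2) by (auto intro!: dvd_mult2 le_imp_power_dvd)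
  have carr: "ideal (carrier EV) EV" by (rule EV.oneideal)
  have "idem x \<noteq> \<zero>\<^bsub>EV\<^esub>"
  proof
    assume "idem x = \<zero>\<^bsub>EV\<^esub>"
    then have "idem x (gen x) = \<zero>\<^bsub>EV\<^esub> (gen x)" by (rule arg_cong)
    then have "gen x = 0" using idem_gen[OF x(1)] gen_V[OF x(1)] by simp
    then show False using gen_not_dvd[of x] by (metis dvd_0_right zero_fun_apply)
  qed
  then have nz: "carrier EV \<noteq> {\<zero>\<^bsub>EV\<^esub>}" using idem_EV[OF x(1)] by blast
  have dec: "A = {\<zero>\<^bsub>EV\<^esub>} \<or> B = {\<zero>\<^bsub>EV\<^esub>}"
    if A: "ideal A EV" and B: "ideal B EV" and AB: "A \<inter> B = {\<zero>\<^bsub>EV\<^esub>}" "A <+>\<^bsub>EV\<^esub> B = carrier EV" for A B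
  proof -
    interpret A: ideal A EV by fact
    interpret B: ideal B EV by fact
    obtain e f where ef: "e \<in> A" "f \<in> B" "\<one>\<^bsub>EV\<^esub> = e \<oplus>\<^bsub>EV\<^esub> f"
      using AB(2) EV.one_closed by (metis set_add_mem)
    have c: "e \<in> carrier EV" "f \<in> carrier EV" using ef A.Icarr B.Icarr by blast+
    note i = idem_EV[OF x(1)] and g = gen_V[OF x(1)]
    have sum1: "e v + f v = v" if "v \<in> V" for v
    proof -
      have "\<one>\<^bsub>EV\<^esub> v = (e \<oplus>\<^bsub>EV\<^esub> f) v" unfolding ef(3) ..
      then show ?thesis using that by simp
    qed
    have prod0: "F \<otimes>\<^bsub>EV\<^esub> G = \<zero>\<^bsub>EV\<^esub>" if "F \<in> A" "G \<in> B" for F G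
      using AB(1) A.I_r_closed[OF that(1) B.Icarr[OF that(2)]] B.I_l_closed[OF that(2) A.Icarr[OF that(1)]] by blast
    have prod0': "G \<otimes>\<^bsub>EV\<^esub> F = \<zero>\<^bsub>EV\<^esub>" if "F \<in> A" "G \<in> B" for F G
      using AB(1) A.I_l_closed[OF that(1) B.Icarr[OF that(2)]] B.I_r_closed[OF that(2) A.Icarr[OF that(1)]] by blast
    have app: "(F \<otimes>\<^bsub>EV\<^esub> G) v = F (G v)" if "v \<in> V" for F G v using that by (simp add: compose_eq)
    \<comment> \<open>The products \<open>f F e\<close> and \<open>e F f\<close> lie in both ideals
      and therefore vanish; with \<open>e + f = 1\<close> this gives centrality.\<close>
    have central: "e (F v) = F (e v)" if F: "F \<in> carrier EV" and v: "v \<in> V" for F v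
    proof -
      have ev: "e v \<in> V" "f v \<in> V" using EV_D(2) c v by blast+
      have Fv: "F (e v) \<in> V" "F (f v) \<in> V" using EV_D(2)[OF F] ev by blast+
      have "F (e v) \<in> V" by fact
      have 1: "f (F (e v)) = 0"
        using prod0'[OF A.I_l_closed[OF ef(1) F] ef(2)] v app[OF v, of F e] app[OF v, of f "F \<otimes>\<^bsub>EV\<^esub> e"]
        by (metis EV_simps(3) restrict_apply')
      have 2: "e (F (f v)) = 0"
        using prod0[OF ef(1) B.I_l_closed[OF ef(2) F]] v app[OF v, of F f] app[OF v, of e "F \<otimes>\<^bsub>EV\<^esub> f"]
        by (metis EV_simps(3) restrict_apply')
      have "F v = F (e v) + F (f v)" using EV_D(3)[OF F ev] sum1[OF v] by simp
      then have "e (F v) = e (F (e v)) + e (F (f v))" using EV_D(3)[OF c(1) Fv] by simp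
      also have "\<dots> = e (F (e v)) + f (F (e v))" unfolding 1 2 ..
      also have "\<dots> = F (e v)" by (rule sum1[OF Fv(1)])
      finally show ?thesis .
    qed
    have ee: "e (e v) = e v" if v: "v \<in> V" for v
    proof -
      have "f (e v) = 0" using prod0'[OF ef(1,2)] app[OF v, of f e] v by (metis EV_simps(3) restrict_apply')
      then show ?thesis using sum1[OF EV_D(2)[OF c(1) v]] by simp
    qed
    \<comment> \<open>Centrality with respect to \<open>idem x\<close> confines
      \<open>e (gen x)\<close> to summand \<open>x\<close>, so it is a scalar multiple of
      \<open>gen x\<close>.\<close>
    define s where "s = e (gen x) x"
    have eg: "e (gen x) = act s (gen x)"
      unfolding s_def using central[OF i g] idem_gen[OF x(1)] idem_act_gen[OF x(1) EV_D(2)[OF c(1) g]] by metis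
    have "act (s * s) (gen x) = act s (gen x)"
      using ee[OF g] EV_D(4)[OF c(1) g] unfolding eg act_act[symmetric] by (simp add: eg)
    then have "p ^ L x dvd s * s * gen x x - s * gen x x" using x(1) unfolding act_def red_eq_iff by blast
    then have d: "p ^ L x dvd s * (s - 1)" by (simp add: gen_def algebra_simps)
    have "e (gen x) = 0 \<or> e (gen x) = gen x"
    proof (cases "p dvd s")
      case True
      have "\<not> p dvd s - 1"
      proof
        assume "p dvd s - 1"
        with True have "p dvd s - (s - 1)" by (rule dvd_diff)
        then show False using p_nunit by simp
      qed
      then have "p ^ L x dvd s" using dvd_cancel_unit[of "s - 1" "L x" s] d by (simp add: mult.commute)
      then have "act s (gen x) = act 0 (gen x)" unfolding act_def red_eq_iff by (auto simp: gen_def)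
      then show ?thesis unfolding eg by (simp add: act_def red_def fun_eq_iff)
    next
      case False
      then have "p ^ L x dvd s - 1" using dvd_cancel_unit d by blast
      then have "act s (gen x) = act 1 (gen x)" unfolding act_def red_eq_iff by (auto simp: gen_def)
      then show ?thesis unfolding eg act_one[OF g] by simp
    qed
    note e_eq = this
    have ev: "e v = cycl x v (e (gen x))" if "v \<in> V" for v
      using central[OF cycl_EV[OF x(1)] g, of v] cycl_gen[OF x(1) that] that VL by simp
    from e_eq have "(\<forall>v\<in>V. e v = 0) \<or> (\<forall>v\<in>V. e v = v)"
    proof
      assume 0: "e (gen x) = 0"
      have "e v = 0" if "v \<in> V" for v
        unfolding ev[OF that] 0 by (rule EV_map_zero[OF cycl_EV]) (use x that VL in auto)
      then show ?thesis by blast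
    next
      assume 1: "e (gen x) = gen x"
      have "e v = v" if "v \<in> V" for v unfolding ev[OF that] 1 by (rule cycl_gen[OF x(1) that])
      then show ?thesis by blast
    qed
    then show ?thesis
    proof
      assume "\<forall>v\<in>V. e v = 0"
      then have "f = \<one>\<^bsub>EV\<^esub>" using sum1 by (intro EV_eqI[OF c(2) EV.one_closed]) (metis EV_simps(2) add_0 restrict_apply')
      then have "B = carrier EV" using ef(2) B.one_imp_carrier by simp
      then show ?thesis using AB(1) A.Icarr by blast
    next
      assume "\<forall>v\<in>V. e v = v"
      then have "e = \<one>\<^bsub>EV\<^esub>" by (intro EV_eqI[OF c(1) EV.one_closed]) simp
      then have "A = carrier EV" using ef(1) A.one_imp_carrier by simp
      then show ?thesis using AB(1) B.Icarr by blast
    qed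
  qed
  have z: "ideal {\<zero>\<^bsub>EV\<^esub>} EV" by (rule EV.zeroideal)
  have "carrier EV \<inter> {\<zero>\<^bsub>EV\<^esub>} = {\<zero>\<^bsub>EV\<^esub>}" using EV.zero_closed by blast
  moreover have "carrier EV <+>\<^bsub>EV\<^esub> {\<zero>\<^bsub>EV\<^esub>} = carrier EV"
  proof -
    have "F \<oplus>\<^bsub>EV\<^esub> \<zero>\<^bsub>EV\<^esub> = F" if "F \<in> carrier EV" for F using EV.r_zero[OF that] .
    then show ?thesis unfolding set_add_def' by auto
  qed
  moreover have "\<not> (\<exists>A B. ideal A EV \<and> ideal B EV \<and> A \<noteq> {\<zero>\<^bsub>EV\<^esub>} \<and> B \<noteq> {\<zero>\<^bsub>EV\<^esub>} \<and>
         A \<inter> B = {\<zero>\<^bsub>EV\<^esub>} \<and> A <+>\<^bsub>EV\<^esub> B = carrier EV)"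
  proof (intro notI, elim exE conjE)
    fix A B assume *: "ideal A EV" "ideal B EV" "A \<noteq> {\<zero>\<^bsub>EV\<^esub>}" "B \<noteq> {\<zero>\<^bsub>EV\<^esub>}"
      "A \<inter> B = {\<zero>\<^bsub>EV\<^esub>}" "A <+>\<^bsub>EV\<^esub> B = carrier EV"
    have "A = {\<zero>\<^bsub>EV\<^esub>} \<or> B = {\<zero>\<^bsub>EV\<^esub>}" by (rule dec[OF *(1,2,5,6)])
    then show False using *(3,4) by simp
  qed
  ultimately show ?thesis
    unfolding is_block_def by (intro conjI carr nz exI[of _ "{\<zero>\<^bsub>EV\<^esub>}"] z)
qed

text \<open>The criterion is phrased for a faithful action \<open>\<alpha>\<close> of
  \<open>R\<close> on a set \<open>Y\<close> so that it serves both maps on \<open>E_lam\<close> and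
  matrices acting on vectors. For \<open>M_lam\<close> the ring laws themselves are later pulled
  back along the resulting map.\<close>

lemma ring_iso_EV:
  assumes bij: "bij_betw \<phi> V Y"
    and phi_add: "\<And>g h. g \<in> V \<Longrightarrow> h \<in> V \<Longrightarrow> \<phi> (g + h) = padd (\<phi> g) (\<phi> h)"
    and phi_act: "\<And>f g. g \<in> V \<Longrightarrow> \<phi> (act f g) = \<beta> f (\<phi> g)"
    and cl: "\<And>r u. r \<in> carrier R \<Longrightarrow> u \<in> Y \<Longrightarrow> \<alpha> r u \<in> Y"
    and add: "\<And>r u v. r \<in> carrier R \<Longrightarrow> u \<in> Y \<Longrightarrow> v \<in> Y \<Longrightarrow> \<alpha> r (padd u v) = padd (\<alpha> r u) (\<alpha> r v)"
    and comm: "\<And>r f u. r \<in> carrier R \<Longrightarrow> u \<in> Y \<Longrightarrow> \<alpha> r (\<beta> f u) = \<beta> f (\<alpha> r u)"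
    and alpha_mult: "\<And>r s u. r \<in> carrier R \<Longrightarrow> s \<in> carrier R \<Longrightarrow> u \<in> Y \<Longrightarrow> \<alpha> (r \<otimes>\<^bsub>R\<^esub> s) u = \<alpha> r (\<alpha> s u)"
    and alpha_add: "\<And>r s u. r \<in> carrier R \<Longrightarrow> s \<in> carrier R \<Longrightarrow> u \<in> Y \<Longrightarrow> \<alpha> (r \<oplus>\<^bsub>R\<^esub> s) u = padd (\<alpha> r u) (\<alpha> s u)"
    and alpha_one: "\<And>u. u \<in> Y \<Longrightarrow> \<alpha> \<one>\<^bsub>R\<^esub> u = u"
    and faithful: "\<And>r s. r \<in> carrier R \<Longrightarrow> s \<in> carrier R \<Longrightarrow> (\<And>u. u \<in> Y \<Longrightarrow> \<alpha> r u = \<alpha> s u) \<Longrightarrow> r = s"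
    and full: "\<And>F. F \<in> carrier EV \<Longrightarrow> \<exists>r\<in>carrier R. \<forall>g\<in>V. \<alpha> r (\<phi> g) = \<phi> (F g)"
  defines "h \<equiv> (\<lambda>r. \<lambda>g\<in>V. inv_into V \<phi> (\<alpha> r (\<phi> g)))"
  shows "h \<in> ring_iso R EV" "\<And>r g. r \<in> carrier R \<Longrightarrow> g \<in> V \<Longrightarrow> \<phi> (h r g) = \<alpha> r (\<phi> g)"
proof -
  have phiY: "\<phi> g \<in> Y" if "g \<in> V" for g using bij that bij_betwE by blast
  have inj: "g = g'" if "g \<in> V" "g' \<in> V" "\<phi> g = \<phi> g'" for g g'
    using bij that unfolding bij_betw_def inj_on_def by blast
  show ph: "\<phi> (h r g) = \<alpha> r (\<phi> g)" if "r \<in> carrier R" "g \<in> V" for r g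
    using bij_betw_inv_into_right[OF bij cl[OF that(1) phiY[OF that(2)]]] that unfolding h_def by simp
  have hV: "h r g \<in> V" if "r \<in> carrier R" "g \<in> V" for r g
    unfolding h_def using bij_betw_inv_into[OF bij] cl[OF that(1) phiY[OF that(2)]] that(2) bij_betwE by fastforce
  have hE: "h r \<in> carrier EV" if r: "r \<in> carrier R" for r
    unfolding EV_carrier
  proof (intro conjI ballI allI)
    show "h r \<in> extensional V" unfolding h_def by simp
    fix g assume g: "g \<in> V"
    show "h r g \<in> V" by (rule hV[OF r g])
    { fix k assume k: "k \<in> V"
      show "h r (g + k) = h r g + h r k"
        by (rule inj) (simp_all add: hV r g k V_add ph phi_add add phiY) }
    fix f show "h r (act f g) = act f (h r g)"
      by (rule inj) (simp_all add: hV r g ph phi_act comm phiY)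
  qed
  show "h \<in> ring_iso R EV"
    unfolding ring_iso_def
  proof (intro CollectI conjI ring_hom_memI)
    fix r s assume r: "r \<in> carrier R"
    then show "h r \<in> carrier EV" by (rule hE)
    assume s: "s \<in> carrier R"
    show "h (r \<otimes>\<^bsub>R\<^esub> s) = h r \<otimes>\<^bsub>EV\<^esub> h s"
    proof
      fix g
      show "h (r \<otimes>\<^bsub>R\<^esub> s) g = (h r \<otimes>\<^bsub>EV\<^esub> h s) g"
      proof (cases "g \<in> V")
        case True
        have "\<phi> (h r (h s g)) = \<alpha> (r \<otimes>\<^bsub>R\<^esub> s) (\<phi> g)"
          by (simp add: ph r hV s True alpha_mult phiY)
        moreover have "h (r \<otimes>\<^bsub>R\<^esub> s) g = inv_into V \<phi> (\<alpha> (r \<otimes>\<^bsub>R\<^esub> s) (\<phi> g))"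
          using True by (simp add: h_def)
        ultimately have "h (r \<otimes>\<^bsub>R\<^esub> s) g = h r (h s g)"
          using bij_betw_inv_into_left[OF bij hV[OF r hV[OF s True]]] by simp
        then show ?thesis using True by (simp add: compose_eq)
      qed (simp add: h_def compose_def)
    qed
    show "h (r \<oplus>\<^bsub>R\<^esub> s) = h r \<oplus>\<^bsub>EV\<^esub> h s"
    proof
      fix g
      show "h (r \<oplus>\<^bsub>R\<^esub> s) g = (h r \<oplus>\<^bsub>EV\<^esub> h s) g"
      proof (cases "g \<in> V")
        case True
        have "\<phi> (h r g + h s g) = \<alpha> (r \<oplus>\<^bsub>R\<^esub> s) (\<phi> g)"
          by (simp add: phi_add ph r hV s True alpha_add phiY)
        moreover have "h (r \<oplus>\<^bsub>R\<^esub> s) g = inv_into V \<phi> (\<alpha> (r \<oplus>\<^bsub>R\<^esub> s) (\<phi> g))"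
          using True by (simp add: h_def)
        ultimately have "h (r \<oplus>\<^bsub>R\<^esub> s) g = h r g + h s g"
          using bij_betw_inv_into_left[OF bij V_add[OF hV[OF r True] hV[OF s True]]] by simp
        then show ?thesis using True by simp
      qed (simp add: h_def)
    qed
  next
    show "h \<one>\<^bsub>R\<^esub> = \<one>\<^bsub>EV\<^esub>"
      unfolding h_def using bij_betw_inv_into_left[OF bij] by (auto simp: fun_eq_iff restrict_def alpha_one phiY)
  next
    show "bij_betw h (carrier R) (carrier EV)"
      unfolding bij_betw_def
    proof
      show "inj_on h (carrier R)"
      proof (rule inj_onI)
        fix r s assume *: "r \<in> carrier R" "s \<in> carrier R" "h r = h s"
        show "r = s"
        proof (rule faithful[OF *(1,2)])
          fix u assume "u \<in> Y"
          then obtain g where "g \<in> V" "u = \<phi> g" using bij unfolding bij_betw_def by blast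
          then show "\<alpha> r u = \<alpha> s u" using ph[OF *(1)] ph[OF *(2)] *(3) by metis
        qed
      qed
      show "h ` carrier R = carrier EV"
      proof
        show "h ` carrier R \<subseteq> carrier EV" using hE by blast
        show "carrier EV \<subseteq> h ` carrier R"
        proof
          fix F assume F: "F \<in> carrier EV"
          then obtain r where r: "r \<in> carrier R" "\<And>g. g \<in> V \<Longrightarrow> \<alpha> r (\<phi> g) = \<phi> (F g)" using full by blast
          have "F = h r"
            by (rule EV_eqI[OF F hE[OF r(1)]]) (rule inj, auto simp: ph r EV_D(2)[OF F] hV)
          then show "F \<in> h ` carrier R" using r(1) by blast
        qed
      qed
    qed
  qed
qed

end

section \<open>The algebras \<open>M\<^sub>\<lambda>(E)\<close> as endomorphism rings of primary modules\<close>

text \<open>If the derivative vanishes, only exponents divisible by the characteristic occur. Taking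
  roots of the coefficients, the additivity of Frobenius writes \<open>p\<close> as a power with
  exponent \<open>CHAR('k)\<close>, against irreducibility.\<close>

lemma perfect_pderiv_nonzero:
  fixes p :: "'k::field poly"
  assumes perf: "perfect_field TYPE('k)" and irr: "Factorial_Ring.irreducible p"
  shows "pderiv p \<noteq> 0"
proof
  assume d: "pderiv p = 0"
  have p0: "p \<noteq> 0" and pu: "\<not> is_unit p" using irr unfolding Factorial_Ring.irreducible_def by auto
  have deg: "Polynomial.degree p \<noteq> 0" using p0 pu by (metis is_unit_iff_degree)
  have c: "of_nat n * Polynomial.coeff p n = 0" for n
    using arg_cong[OF d, of "\<lambda>f. Polynomial.coeff f (n - 1)"] by (cases n) (simp_all add: coeff_pderiv)
  let ?q = "CHAR('k)"
  have q: "?q dvd n" if "Polynomial.coeff p n \<noteq> 0" for n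
    using c[of n] that by (simp add: of_nat_eq_0_iff_char_dvd)
  show False
  proof (cases "?q = 0")
    \<comment> \<open>In characteristic 0 the divisibility \<open>0 dvd n\<close> forces
      \<open>n = 0\<close>, so \<open>p\<close> would be constant.\<close>
    case True
    then show False using q[of "Polynomial.degree p"] p0 deg by simp
  next
    case False
    then have prime: "Factorial_Ring.prime ?q" by (intro prime_CHAR_semidom) simp
    have "\<forall>x::'k. \<exists>y. y ^ ?q = x" using perf False unfolding perfect_field_def by blast
    then obtain r where r: "\<And>x::'k. r x ^ ?q = x" by metis
    \<comment> \<open>The bound \<open>degree p\<close> on the index \<open>i\<close> is generous:
      coefficients of \<open>p\<close> beyond its degree are zero and contribute nothing to the
      power.\<close>
    define b where "b = (\<Sum>i\<le>Polynomial.degree p. Polynomial.monom (r (Polynomial.coeff p (?q * i))) i)"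
    have "b ^ ?q = (\<Sum>i\<le>Polynomial.degree p. Polynomial.monom (r (Polynomial.coeff p (?q * i))) i ^ ?q)"
      unfolding b_def by (rule freshmans_dream_sum) (simp_all add: prime)
    also have "\<dots> = (\<Sum>i\<le>Polynomial.degree p. Polynomial.monom (Polynomial.coeff p (?q * i)) (?q * i))"
      by (simp add: monom_power r mult.commute)
    also have "\<dots> = p"
    proof (rule poly_eqI)
      fix n
      have "Polynomial.coeff (\<Sum>i\<le>Polynomial.degree p. Polynomial.monom (Polynomial.coeff p (?q * i)) (?q * i)) n
          = (\<Sum>i\<le>Polynomial.degree p. if ?q * i = n then Polynomial.coeff p n else 0)"
        by (simp add: coeff_sum) (intro sum.cong, auto)
      also have "\<dots> = Polynomial.coeff p n"
      proof (cases "Polynomial.coeff p n = 0")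
        case False
        then obtain i where i: "n = ?q * i" using q by (metis dvdE)
        have "n \<le> Polynomial.degree p" using False by (rule le_degree)
        then have "i \<le> Polynomial.degree p" using i \<open>?q \<noteq> 0\<close> by (metis dual_order.trans le_add1 mult_eq_if)
        moreover have "?q * j = n \<longleftrightarrow> j = i" for j using i \<open>?q \<noteq> 0\<close> by simp
        ultimately show ?thesis by simp
      next
        case True
        then show ?thesis by (auto intro!: sum.neutral)
      qed
      finally show "Polynomial.coeff (\<Sum>i\<le>Polynomial.degree p. Polynomial.monom (Polynomial.coeff p (?q * i)) (?q * i)) n
        = Polynomial.coeff p n" .
    qed
    finally have pb: "p = b ^ ?q" by (rule sym)
    have "?q = Suc (Suc (?q - 2))" using prime_ge_2_nat[OF prime] by simp
    then have "p = b * (b * b ^ (?q - 2))" using pb by (metis power_Suc)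
    then have "is_unit b \<or> is_unit (b * b ^ (?q - 2))" using irr by (auto dest: Factorial_Ring.irreducibleD)
    then have "is_unit b" by (metis dvd_mult_left)
    then have "b ^ ?q dvd 1 ^ ?q" by (rule dvd_power_same)
    then show False using pb pu by (metis power_one)
  qed
qed

lemma perfect_not_dvd_pderiv:
  fixes p :: "'k::field poly"
  assumes "perfect_field TYPE('k)" "Factorial_Ring.irreducible p"
  shows "\<not> p dvd pderiv p"
proof
  assume "p dvd pderiv p"
  then have "Polynomial.degree p \<le> Polynomial.degree (pderiv p)"
    using perfect_pderiv_nonzero[OF assms] by (rule dvd_imp_degree_le)
  moreover have "Polynomial.degree p \<noteq> 0" 
  proof
    assume "Polynomial.degree p = 0"
    then obtain a where "p = [:a:]" by (rule degree_eq_zeroE)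
    then show False using perfect_pderiv_nonzero[OF assms] by (simp add: pderiv_pCons)
  qed
  moreover have "Polynomial.degree (pderiv p) \<le> Polynomial.degree p - 1" by (rule degree_pderiv_le)
  ultimately show False by simp
qed

section \<open>Evaluation of polynomials in a ring\<close>

text \<open>The target may be noncommutative, but \<open>\<tau>\<close> has to commute with the
  scalars. The instances are \<open>E[u]\<close> with \<open>\<tau> = \<theta> + u\<close> and rings
  of square matrices.\<close>

locale poly_eval = ring B for B :: "('b, 'y) ring_scheme" (structure) +
  fixes c :: "'k::field \<Rightarrow> 'b" and \<tau> :: 'b
  assumes c_closed [simp]: "c a \<in> carrier B" and c_add: "c (a + b) = c a \<oplus> c b"
    and c_mult: "c (a * b) = c a \<otimes> c b" and c_one: "c 1 = \<one>"
    and tau_closed [simp]: "\<tau> \<in> carrier B" and tau_comm: "\<tau> \<otimes> c a = c a \<otimes> \<tau>"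
begin

lemma c_zero: "c 0 = \<zero>"
  using c_add[of 0 0] by (metis add.r_cancel_one' add_0 c_closed)

definition ev :: "'k poly \<Rightarrow> 'b" where
  "ev f = fold_coeffs (\<lambda>a y. c a \<oplus> \<tau> \<otimes> y) f \<zero>"

lemma ev_0: "ev 0 = \<zero>"
  by (simp add: ev_def)

lemma ev_pCons: "ev (pCons a f) = c a \<oplus> \<tau> \<otimes> ev f"
  by (cases "a = 0 \<and> f = 0") (auto simp: ev_def c_zero fold_coeffs_pCons_eq)

lemma ev_closed [simp]: "ev f \<in> carrier B"
  by (induction f) (auto simp: ev_0 ev_pCons)

lemma ev_const: "ev [:a:] = c a"
  by (simp add: ev_pCons ev_0)

lemma ev_one: "ev 1 = \<one>"
  unfolding one_pCons ev_const c_one ..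

lemma ev_X: "ev [:0, 1:] = \<tau>"
  by (simp add: ev_pCons ev_0 c_zero c_one)

lemma ev_add: "ev (f + g) = ev f \<oplus> ev g"
proof (induction f g rule: poly_induct2)
  case (pCons a f b g)
  then show ?case by (simp add: ev_pCons c_add r_distr a_ac)
qed (simp add: ev_0)

lemma ev_smult: "ev (Polynomial.smult a f) = c a \<otimes> ev f"
proof (induction f)
  case (pCons b f)
  have "c a \<otimes> (\<tau> \<otimes> ev f) = \<tau> \<otimes> (c a \<otimes> ev f)"
    by (metis c_closed ev_closed m_assoc tau_closed tau_comm)
  then show ?case using pCons by (simp add: ev_pCons c_mult r_distr)
qed (simp add: ev_0)

lemma ev_mult: "ev (f * g) = ev f \<otimes> ev g"
proof (induction f)
  case (pCons a f)
  then show ?case by (simp add: ev_add ev_smult ev_pCons c_zero l_distr m_assoc)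
qed (simp add: ev_0)

lemma ev_uminus: "ev (- f) = \<ominus> ev f"
  using ev_add[of "- f" f] by (metis ev_0 ev_closed left_minus minus_equality)

lemma ev_diff: "ev (f - g) = ev f \<ominus> ev g"
  unfolding diff_conv_add_uminus ev_add ev_uminus a_minus_def ..

lemma ev_power: "ev (f ^ n) = ev f [^] n"
  by (induction n) (simp_all add: ev_one ev_mult power_Suc2 del: power_Suc)

end

lemma ring_of_type_algebra_simps:
  "carrier ring_of_type_algebra = UNIV" "mult ring_of_type_algebra = (*)" "one ring_of_type_algebra = 1"
  "zero ring_of_type_algebra = 0" "add ring_of_type_algebra = (+)"
  by (simp_all add: ring_of_type_algebra_def)

section \<open>The residue field E and the map from K[t] to E[u]\<close>

locale separable_irreducible = irreducible_poly p for p :: "'k::field poly" +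
  assumes separable: "\<not> p dvd pderiv p"
begin

abbreviation "A \<equiv> ring_of_type_algebra :: 'k poly ring"
abbreviation "J \<equiv> PIdl\<^bsub>A\<^esub> p"
abbreviation "E \<equiv> residue_field p"
abbreviation "cls f \<equiv> J +>\<^bsub>A\<^esub> f"

sublocale A: cring A
  by (rule cring_from_type_algebra)

lemma J_ideal: "ideal J A"
  by (rule A.cgenideal_ideal) (simp add: ring_of_type_algebra_simps)

lemma J_iff: "f \<in> J \<longleftrightarrow> p dvd f"
  unfolding cgenideal_def ring_of_type_algebra_simps dvd_def by (auto simp: mult.commute)

lemma E_eq: "E = A Quot J"
  unfolding residue_field_def ..

lemma cls_hom: "cls \<in> ring_hom A E"
  unfolding E_eq by (rule ideal.rcos_ring_hom[OF J_ideal])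

lemma E_cring: "cring E"
  unfolding E_eq by (rule ideal.quotient_is_cring[OF J_ideal A.cring_axioms])

lemma cls_closed [simp]: "cls f \<in> carrier E"
  using ring_hom_closed[OF cls_hom] by (simp add: ring_of_type_algebra_simps)

lemma cls_add: "cls (f + g) = cls f \<oplus>\<^bsub>E\<^esub> cls g"
  using ring_hom_add[OF cls_hom, of f g] by (simp add: ring_of_type_algebra_simps)

lemma cls_mult: "cls (f * g) = cls f \<otimes>\<^bsub>E\<^esub> cls g"
  using ring_hom_mult[OF cls_hom, of f g] by (simp add: ring_of_type_algebra_simps)

lemma cls_one: "cls 1 = \<one>\<^bsub>E\<^esub>"
  using ring_hom_one[OF cls_hom] by (simp add: ring_of_type_algebra_simps)

lemma cls_zero_iff: "cls f = \<zero>\<^bsub>E\<^esub> \<longleftrightarrow> p dvd f"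
proof -
  interpret ideal J A by (rule J_ideal)
  have z: "\<zero>\<^bsub>E\<^esub> = J" unfolding E_eq FactRing_def by simp
  have "cls f = J \<longleftrightarrow> f \<in> J"
    using a_rcos_self[of f] a_rcos_const[of f] by (auto simp: ring_of_type_algebra_simps)
  then show ?thesis unfolding z J_iff .
qed

lemma cls_surj: "e \<in> carrier E \<Longrightarrow> \<exists>f. e = cls f"
  unfolding E_eq FactRing_def A_RCOSETS_def' by auto

lemma E_field: "field E"
proof -
  interpret E: cring E by (rule E_cring)
  show ?thesis
  proof (rule E.cring_fieldI2)
    have "cls 1 \<noteq> \<zero>\<^bsub>E\<^esub>" unfolding cls_zero_iff using p_nunit .
    then show "\<zero>\<^bsub>E\<^esub> \<noteq> \<one>\<^bsub>E\<^esub>" unfolding cls_one by simp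
    fix e assume "e \<in> carrier E" "e \<noteq> \<zero>\<^bsub>E\<^esub>"
    then obtain f where f: "e = cls f" "\<not> p dvd f" using cls_surj cls_zero_iff by metis
    obtain s where s: "p ^ 1 dvd s * f - 1" using unit_mod[OF f(2)] .
    have "cls (s * f) = cls (s * f - 1) \<oplus>\<^bsub>E\<^esub> cls 1" unfolding cls_add[symmetric] by simp
    also have "\<dots> = \<one>\<^bsub>E\<^esub>" using s cls_zero_iff[of "s * f - 1"] by (simp add: cls_one)
    finally show "\<exists>b\<in>carrier E. e \<otimes>\<^bsub>E\<^esub> b = \<one>\<^bsub>E\<^esub>"
      unfolding f(1) cls_mult using E.m_comm[of "cls f" "cls s"] by (intro bexI[of _ "cls s"]) simp_all
  qed
qed

sublocale E: field E
  by (rule E_field)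

abbreviation "Ou \<equiv> Poly_Ring E"

sublocale Ou: domain Ou
  by (rule E.univ_poly_is_domain[OF E.carrier_is_subring])

abbreviation "const \<equiv> E.poly_of_const"
abbreviation "u \<equiv> X\<^bsub>E\<^esub>"
abbreviation "c0 \<equiv> E.const_term"

lemma u_closed [simp]: "u \<in> carrier Ou"
  by (rule E.var_closed(1)[OF E.carrier_is_subring])

lemma const_hom: "const \<in> ring_hom E Ou"
  using E.canonical_embedding_is_hom[OF E.carrier_is_subring] by simp

lemma const_closed [simp]: "e \<in> carrier E \<Longrightarrow> const e \<in> carrier Ou"
  by (rule ring_hom_closed[OF const_hom])

lemma c0_hom: "c0 \<in> ring_hom Ou E"
  unfolding E.const_term_def using E.eval_is_hom[OF E.carrier_is_subring E.zero_closed] .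

lemma c0_closed [simp]: "q \<in> carrier Ou \<Longrightarrow> c0 q \<in> carrier E"
  by (rule ring_hom_closed[OF c0_hom])

lemma c0_const [simp]: "e \<in> carrier E \<Longrightarrow> c0 (const e) = e"
  unfolding E.poly_of_const_def E.const_term_def by auto

lemma c0_u [simp]: "c0 u = \<zero>\<^bsub>E\<^esub>"
  unfolding E.const_term_def by (rule E.eval_var) simp

lemma c0_add: "q \<in> carrier Ou \<Longrightarrow> r \<in> carrier Ou \<Longrightarrow> c0 (q \<oplus>\<^bsub>Ou\<^esub> r) = c0 q \<oplus>\<^bsub>E\<^esub> c0 r"
  by (rule ring_hom_add[OF c0_hom])

lemma c0_mult: "q \<in> carrier Ou \<Longrightarrow> r \<in> carrier Ou \<Longrightarrow> c0 (q \<otimes>\<^bsub>Ou\<^esub> r) = c0 q \<otimes>\<^bsub>E\<^esub> c0 r"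
  by (rule ring_hom_mult[OF c0_hom])

lemma c0_pow: "q \<in> carrier Ou \<Longrightarrow> c0 (q [^]\<^bsub>Ou\<^esub> (n::nat)) = c0 q [^]\<^bsub>E\<^esub> n"
  by (induction n) (simp_all add: ring_hom_one[OF c0_hom] c0_mult)

lemma c0_minus: "q \<in> carrier Ou \<Longrightarrow> c0 (\<ominus>\<^bsub>Ou\<^esub> q) = \<ominus>\<^bsub>E\<^esub> c0 q"
  by (rule E.const_term_simprules_shell(4)[OF E.carrier_is_subring])

lemma c0_zero_factor:
  assumes q: "q \<in> carrier Ou" and z: "c0 q = \<zero>\<^bsub>E\<^esub>"
  shows "\<exists>r\<in>carrier Ou. q = u \<otimes>\<^bsub>Ou\<^esub> r"
proof (cases "q = []")
  case True
  then have "q = u \<otimes>\<^bsub>Ou\<^esub> \<zero>\<^bsub>Ou\<^esub>" using u_closed by (simp add: univ_poly_zero[symmetric, of E "carrier E"])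
  then show ?thesis using Ou.zero_closed by blast
next
  case False
  have "polynomial\<^bsub>E\<^esub> (carrier E) q" using q by (simp add: univ_poly_carrier)
  then obtain q' where q': "polynomial\<^bsub>E\<^esub> (carrier E) q'" "q' \<noteq> []" "q = q' @ [\<zero>\<^bsub>E\<^esub>]"
    using E.const_term_zero[OF E.carrier_is_subring _ False z] by blast
  have c: "q' \<in> carrier Ou" using q'(1) by (simp add: univ_poly_carrier)
  have "q = q' \<otimes>\<^bsub>Ou\<^esub> u" using E.poly_mult_var[OF E.carrier_is_subring c] q' by simp
  then show ?thesis using c Ou.m_comm[OF c u_closed] by auto
qed

text \<open>The embedding of \<open>K[t]\<close> into \<open>E[u]\<close> with \<open>t \<mapsto> \<theta> + u\<close>, where \<open>\<theta>\<close> is the class of \<open>t\<close>. By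
  separability \<open>p\<close> is mapped to a uniformizer at \<open>u = 0\<close>.\<close>

abbreviation "\<theta> \<equiv> cls [:0, 1:]"

sublocale rho: poly_eval Ou "\<lambda>a::'k. const (cls [:a:])" "const \<theta> \<oplus>\<^bsub>Ou\<^esub> u"
proof (rule poly_eval.intro[OF Ou.ring_axioms], rule poly_eval_axioms.intro)
  fix a b :: 'k
  show "const (cls [:a:]) \<in> carrier Ou" "const \<theta> \<oplus>\<^bsub>Ou\<^esub> u \<in> carrier Ou"
    by (simp_all only: const_closed cls_closed u_closed Ou.a_closed)
  show "(const \<theta> \<oplus>\<^bsub>Ou\<^esub> u) \<otimes>\<^bsub>Ou\<^esub> const (cls [:a:]) = const (cls [:a:]) \<otimes>\<^bsub>Ou\<^esub> (const \<theta> \<oplus>\<^bsub>Ou\<^esub> u)"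
    by (rule Ou.m_comm) (simp_all only: const_closed cls_closed u_closed Ou.a_closed)
  show "const (cls [:a + b:]) = const (cls [:a:]) \<oplus>\<^bsub>Ou\<^esub> const (cls [:b:])"
    using cls_add[of "[:a:]" "[:b:]"] ring_hom_add[OF const_hom] by simp
  show "const (cls [:a * b:]) = const (cls [:a:]) \<otimes>\<^bsub>Ou\<^esub> const (cls [:b:])"
    using cls_mult[of "[:a:]" "[:b:]"] ring_hom_mult[OF const_hom] by (simp add: mult.commute[of a b])
  show "const (cls [:1:]) = \<one>\<^bsub>Ou\<^esub>"
    using cls_one ring_hom_one[OF const_hom] by (simp add: one_pCons)
qed

abbreviation "\<rho> \<equiv> rho.ev"

lemma cls_pCons: "cls (pCons a f) = cls [:a:] \<oplus>\<^bsub>E\<^esub> \<theta> \<otimes>\<^bsub>E\<^esub> cls f"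
proof -
  have "pCons a f = [:a:] + [:0, 1:] * f" by simp
  then show ?thesis using cls_add[of "[:a:]" "[:0,1:] * f"] cls_mult[of "[:0,1:]" f] by simp
qed

lemma c0_rho: "c0 (\<rho> f) = cls f"
proof (induction f)
  case 0
  have "cls 0 = \<zero>\<^bsub>E\<^esub>" unfolding cls_zero_iff by simp
  then show ?case unfolding rho.ev_0 univ_poly_zero E.const_term_def by simp
next
  case (pCons a f)
  then show ?case unfolding rho.ev_pCons cls_pCons[of a f] by (simp add: c0_add c0_mult)
qed

text \<open>Taylor expansion of \<open>f\<close> at \<open>\<theta>\<close> up to first order in
  \<open>u\<close>; all higher terms are collected in \<open>w\<close>.\<close>

lemma rho_taylor:
  "\<exists>w\<in>carrier Ou. \<rho> f = const (cls f) \<oplus>\<^bsub>Ou\<^esub> u \<otimes>\<^bsub>Ou\<^esub> (const (cls (pderiv f)) \<oplus>\<^bsub>Ou\<^esub> u \<otimes>\<^bsub>Ou\<^esub> w)"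
proof (induction f)
  case 0
  have "cls 0 = \<zero>\<^bsub>E\<^esub>" unfolding cls_zero_iff by simp
  then have "const (cls 0) = \<zero>\<^bsub>Ou\<^esub>" using ring_hom_zero[OF const_hom E.ring_axioms Ou.ring_axioms] by simp
  then show ?case unfolding rho.ev_0 by (intro bexI[of _ "\<zero>\<^bsub>Ou\<^esub>"]) simp_all
next
  case (pCons a f)
  then obtain w where w: "w \<in> carrier Ou"
    "\<rho> f = const (cls f) \<oplus>\<^bsub>Ou\<^esub> u \<otimes>\<^bsub>Ou\<^esub> (const (cls (pderiv f)) \<oplus>\<^bsub>Ou\<^esub> u \<otimes>\<^bsub>Ou\<^esub> w)" by blast
  let ?a = "const (cls [:a:])" and ?t = "const \<theta>" and ?f = "const (cls f)" and ?d = "const (cls (pderiv f))"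
  have 1: "const (cls (pCons a f)) = ?a \<oplus>\<^bsub>Ou\<^esub> ?t \<otimes>\<^bsub>Ou\<^esub> ?f"
    unfolding cls_pCons[of a f] using ring_hom_add[OF const_hom] ring_hom_mult[OF const_hom] by simp
  have z: "cls [:0:] = \<zero>\<^bsub>E\<^esub>" unfolding cls_zero_iff by simp
  have "cls (pderiv (pCons a f)) = cls f \<oplus>\<^bsub>E\<^esub> \<theta> \<otimes>\<^bsub>E\<^esub> cls (pderiv f)"
    unfolding pderiv_pCons cls_add cls_pCons[of 0 "pderiv f"] z by simp
  then have 2: "const (cls (pderiv (pCons a f))) = ?f \<oplus>\<^bsub>Ou\<^esub> ?t \<otimes>\<^bsub>Ou\<^esub> ?d"
    using ring_hom_add[OF const_hom] ring_hom_mult[OF const_hom] by simp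
  have cl: "?a \<in> carrier Ou" "?t \<in> carrier Ou" "?f \<in> carrier Ou" "?d \<in> carrier Ou" by simp_all
  \<comment> \<open>This is the higher order part of the product of \<open>\<theta> + u\<close> with
    the expansion of \<open>f\<close>.\<close>
  let ?w = "?t \<otimes>\<^bsub>Ou\<^esub> w \<oplus>\<^bsub>Ou\<^esub> ?d \<oplus>\<^bsub>Ou\<^esub> u \<otimes>\<^bsub>Ou\<^esub> w"
  have "\<rho> (pCons a f) = ?a \<oplus>\<^bsub>Ou\<^esub> ?t \<otimes>\<^bsub>Ou\<^esub> ?f \<oplus>\<^bsub>Ou\<^esub> u \<otimes>\<^bsub>Ou\<^esub> (?f \<oplus>\<^bsub>Ou\<^esub> ?t \<otimes>\<^bsub>Ou\<^esub> ?d \<oplus>\<^bsub>Ou\<^esub> u \<otimes>\<^bsub>Ou\<^esub> ?w)"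
    unfolding rho.ev_pCons w(2) using cl w(1) u_closed
    by (simp add: Ou.r_distr Ou.l_distr Ou.m_assoc Ou.a_assoc Ou.m_lcomm[of u ?t] Ou.a_lcomm Ou.a_comm Ou.m_comm Ou.m_lcomm)
  then show ?case unfolding 1 2 using w(1) by (intro bexI[of _ ?w]) simp_all
qed

lemma rho_p: "\<exists>v\<in>carrier Ou. \<rho> p = u \<otimes>\<^bsub>Ou\<^esub> v \<and> c0 v \<noteq> \<zero>\<^bsub>E\<^esub>"
proof -
  obtain w where w: "w \<in> carrier Ou"
    "\<rho> p = const (cls p) \<oplus>\<^bsub>Ou\<^esub> u \<otimes>\<^bsub>Ou\<^esub> (const (cls (pderiv p)) \<oplus>\<^bsub>Ou\<^esub> u \<otimes>\<^bsub>Ou\<^esub> w)"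
    using rho_taylor by blast
  let ?v = "const (cls (pderiv p)) \<oplus>\<^bsub>Ou\<^esub> u \<otimes>\<^bsub>Ou\<^esub> w"
  have "cls p = \<zero>\<^bsub>E\<^esub>" unfolding cls_zero_iff by simp
  then have "const (cls p) = \<zero>\<^bsub>Ou\<^esub>" using ring_hom_zero[OF const_hom E.ring_axioms Ou.ring_axioms] by simp
  then have "\<rho> p = u \<otimes>\<^bsub>Ou\<^esub> ?v" using w by simp
  moreover have "c0 ?v = cls (pderiv p)" using w(1) by (simp add: c0_add c0_mult)
  then have "c0 ?v \<noteq> \<zero>\<^bsub>E\<^esub>" using separable cls_zero_iff by metis
  ultimately show ?thesis using w(1) by (intro bexI[of _ ?v]) simp_all
qed

lemma rho_p_pow:
  obtains v where "v \<in> carrier Ou" "c0 v \<noteq> \<zero>\<^bsub>E\<^esub>" "\<rho> (p ^ n) = u [^]\<^bsub>Ou\<^esub> n \<otimes>\<^bsub>Ou\<^esub> v"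
proof -
  obtain v where v: "v \<in> carrier Ou" "\<rho> p = u \<otimes>\<^bsub>Ou\<^esub> v" "c0 v \<noteq> \<zero>\<^bsub>E\<^esub>" using rho_p by blast
  have "\<rho> (p ^ n) = u [^]\<^bsub>Ou\<^esub> n \<otimes>\<^bsub>Ou\<^esub> v [^]\<^bsub>Ou\<^esub> n"
    unfolding rho.ev_power v(2) using v(1) by (simp add: Ou.nat_pow_distrib)
  moreover have "c0 (v [^]\<^bsub>Ou\<^esub> n) \<noteq> \<zero>\<^bsub>E\<^esub>"
    unfolding c0_pow[OF v(1)] using v by (induction n) (auto simp: E.integral_iff)
  ultimately show thesis using that[of "v [^]\<^bsub>Ou\<^esub> n"] v(1) by simp
qed

text \<open>Successive approximation: \<open>\<rho>\<close> sends \<open>p ^ n\<close> to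
  \<open>u^n\<close> times an element with nonzero constant term, so adding a suitable multiple
  \<open>p ^ n * h\<close> removes the term of order \<open>n\<close> from the remainder.\<close>

lemma rho_surj:
  assumes q: "q \<in> carrier Ou"
  shows "\<exists>g. \<exists>r\<in>carrier Ou. q = \<rho> g \<oplus>\<^bsub>Ou\<^esub> u [^]\<^bsub>Ou\<^esub> (n::nat) \<otimes>\<^bsub>Ou\<^esub> r"
proof (induction n)
  case 0
  then show ?case using q by (intro exI[of _ 0] bexI[of _ q]) (simp_all add: rho.ev_0)
next
  case (Suc n)
  then obtain g r where g: "r \<in> carrier Ou" "q = \<rho> g \<oplus>\<^bsub>Ou\<^esub> u [^]\<^bsub>Ou\<^esub> n \<otimes>\<^bsub>Ou\<^esub> r" by blast
  obtain v where v: "v \<in> carrier Ou" "c0 v \<noteq> \<zero>\<^bsub>E\<^esub>" "\<rho> (p ^ n) = u [^]\<^bsub>Ou\<^esub> n \<otimes>\<^bsub>Ou\<^esub> v"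
    by (rule rho_p_pow)
  have "c0 v \<in> Units E" using v E.field_Units by simp
  then obtain i where i: "i \<in> carrier E" "i \<otimes>\<^bsub>E\<^esub> c0 v = \<one>\<^bsub>E\<^esub>" unfolding Units_def by blast
  \<comment> \<open>\<open>h\<close> is chosen so that \<open>v \<rho>(h)\<close> has the same
    constant term as \<open>r\<close>; the difference \<open>?s\<close> is then divisible by
    \<open>u\<close>.\<close>
  obtain h where h: "i \<otimes>\<^bsub>E\<^esub> c0 r = cls h" using cls_surj[of "i \<otimes>\<^bsub>E\<^esub> c0 r"] i(1) g(1) by auto
  let ?s = "r \<ominus>\<^bsub>Ou\<^esub> v \<otimes>\<^bsub>Ou\<^esub> \<rho> h"
  have "c0 v \<otimes>\<^bsub>E\<^esub> cls h = (i \<otimes>\<^bsub>E\<^esub> c0 v) \<otimes>\<^bsub>E\<^esub> c0 r"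
    unfolding h[symmetric] using i(1) v(1) g(1) by (simp add: E.m_ac)
  then have "c0 v \<otimes>\<^bsub>E\<^esub> cls h = c0 r" using i(2) g(1) by simp
  then have "c0 ?s = \<zero>\<^bsub>E\<^esub>"
    unfolding a_minus_def using g(1) v(1) by (simp add: c0_add c0_mult c0_minus c0_rho E.r_neg)
  then obtain r' where r': "r' \<in> carrier Ou" "?s = u \<otimes>\<^bsub>Ou\<^esub> r'"
    using c0_zero_factor[of ?s] g(1) v(1) by auto
  have up: "u [^]\<^bsub>Ou\<^esub> n \<in> carrier Ou" by simp
  have "r = v \<otimes>\<^bsub>Ou\<^esub> \<rho> h \<oplus>\<^bsub>Ou\<^esub> ?s"
    unfolding a_minus_def using g(1) v(1) by (simp add: Ou.a_lcomm Ou.r_neg)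
  then have "u [^]\<^bsub>Ou\<^esub> n \<otimes>\<^bsub>Ou\<^esub> r = u [^]\<^bsub>Ou\<^esub> n \<otimes>\<^bsub>Ou\<^esub> (v \<otimes>\<^bsub>Ou\<^esub> \<rho> h \<oplus>\<^bsub>Ou\<^esub> u \<otimes>\<^bsub>Ou\<^esub> r')" using r'(2) by simp
  also have "\<dots> = \<rho> (p ^ n * h) \<oplus>\<^bsub>Ou\<^esub> u [^]\<^bsub>Ou\<^esub> Suc n \<otimes>\<^bsub>Ou\<^esub> r'"
    unfolding rho.ev_mult v(3) using v(1) r'(1) up by (simp add: Ou.r_distr Ou.m_assoc)
  finally have "q = \<rho> (g + p ^ n * h) \<oplus>\<^bsub>Ou\<^esub> u [^]\<^bsub>Ou\<^esub> Suc n \<otimes>\<^bsub>Ou\<^esub> r'"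
    unfolding g(2) rho.ev_add using r'(1) by (simp add: Ou.a_assoc)
  then show ?case using r'(1) by blast
qed

text \<open>Divisibility by \<open>p ^ n\<close> corresponds to divisibility by \<open>u^n\<close>,
  so the map induced from K[t]/p^n to E[u]/u^n is injective; \<open>rho_surj\<close> makes it onto.
  In the harder direction the exact power of \<open>u\<close> is cancelled and the constant terms
  are compared in the field \<open>E\<close>.\<close>

lemma rho_dvd_iff: "(\<exists>r\<in>carrier Ou. \<rho> f = r \<otimes>\<^bsub>Ou\<^esub> u [^]\<^bsub>Ou\<^esub> n) \<longleftrightarrow> p ^ n dvd f"
proof
  assume "p ^ n dvd f"
  then obtain g where g: "f = p ^ n * g" unfolding dvd_def by blast
  obtain v where v: "v \<in> carrier Ou" "\<rho> (p ^ n) = u [^]\<^bsub>Ou\<^esub> n \<otimes>\<^bsub>Ou\<^esub> v" using rho_p_pow by metis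
  have "\<rho> f = (v \<otimes>\<^bsub>Ou\<^esub> \<rho> g) \<otimes>\<^bsub>Ou\<^esub> u [^]\<^bsub>Ou\<^esub> n"
    unfolding g rho.ev_mult v(2) using v(1) by (simp add: Ou.m_ac)
  then show "\<exists>r\<in>carrier Ou. \<rho> f = r \<otimes>\<^bsub>Ou\<^esub> u [^]\<^bsub>Ou\<^esub> n" using v(1) by (intro bexI[of _ "v \<otimes>\<^bsub>Ou\<^esub> \<rho> g"]) simp_all
next
  assume "\<exists>r\<in>carrier Ou. \<rho> f = r \<otimes>\<^bsub>Ou\<^esub> u [^]\<^bsub>Ou\<^esub> n"
  then obtain r where r: "r \<in> carrier Ou" "\<rho> f = r \<otimes>\<^bsub>Ou\<^esub> u [^]\<^bsub>Ou\<^esub> n" by blast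
  show "p ^ n dvd f"
  proof (rule ccontr)
    assume nd: "\<not> p ^ n dvd f"
    then have "f \<noteq> 0" by auto
    then obtain a s where s: "f = p ^ a * s" "\<not> p dvd s" using factor_out_ex by blast
    then have a: "a < n" using nd pow_dvd_pow_mult[OF s(2), of n a] by simp
    obtain v where v: "v \<in> carrier Ou" "c0 v \<noteq> \<zero>\<^bsub>E\<^esub>" "\<rho> (p ^ a) = u [^]\<^bsub>Ou\<^esub> a \<otimes>\<^bsub>Ou\<^esub> v" by (rule rho_p_pow)
    define m where "m = n - Suc a"
    have n: "n = a + Suc m" using a unfolding m_def by simp
    have un: "u [^]\<^bsub>Ou\<^esub> n = u [^]\<^bsub>Ou\<^esub> a \<otimes>\<^bsub>Ou\<^esub> (u [^]\<^bsub>Ou\<^esub> m \<otimes>\<^bsub>Ou\<^esub> u)"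
      unfolding n Ou.nat_pow_mult[OF u_closed, symmetric] by simp
    have ua: "u [^]\<^bsub>Ou\<^esub> a \<in> carrier Ou" "u [^]\<^bsub>Ou\<^esub> m \<in> carrier Ou" by simp_all
    have u0: "u \<noteq> \<zero>\<^bsub>Ou\<^esub>" unfolding var_def univ_poly_zero by simp
    have ua0: "u [^]\<^bsub>Ou\<^esub> a \<noteq> \<zero>\<^bsub>Ou\<^esub>"
      using u0 by (induction a) (auto simp: Ou.integral_iff)
    have "u [^]\<^bsub>Ou\<^esub> a \<otimes>\<^bsub>Ou\<^esub> (v \<otimes>\<^bsub>Ou\<^esub> \<rho> s) = \<rho> f"
      unfolding s(1) rho.ev_mult v(3) using v(1) ua by (simp add: Ou.m_assoc)
    also have "\<dots> = u [^]\<^bsub>Ou\<^esub> a \<otimes>\<^bsub>Ou\<^esub> (r \<otimes>\<^bsub>Ou\<^esub> u [^]\<^bsub>Ou\<^esub> m \<otimes>\<^bsub>Ou\<^esub> u)"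
      unfolding r(2) un using r(1) ua by (simp add: Ou.m_ac)
    finally have "v \<otimes>\<^bsub>Ou\<^esub> \<rho> s = r \<otimes>\<^bsub>Ou\<^esub> u [^]\<^bsub>Ou\<^esub> m \<otimes>\<^bsub>Ou\<^esub> u"
      using Ou.m_lcancel[OF ua0 ua(1)] v(1) r(1) by simp
    then have "c0 (v \<otimes>\<^bsub>Ou\<^esub> \<rho> s) = c0 (r \<otimes>\<^bsub>Ou\<^esub> u [^]\<^bsub>Ou\<^esub> m \<otimes>\<^bsub>Ou\<^esub> u)" by simp
    then have "c0 v \<otimes>\<^bsub>E\<^esub> cls s = \<zero>\<^bsub>E\<^esub>" using v(1) r(1) ua by (simp add: c0_mult c0_rho)
    moreover have "cls s \<noteq> \<zero>\<^bsub>E\<^esub>" unfolding cls_zero_iff by (rule s(2))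
    ultimately show False using E.integral[of "c0 v" "cls s"] v by simp
  qed
qed

end

text \<open>The ring laws are transferred to a record for which closure and compatibility of the
  operations with \<open>h\<close> have been checked.\<close>

lemma ring_pullback:
  assumes S: "ring S" and inj: "inj_on h (carrier R)" and onto: "h ` carrier R = carrier S"
    and closed: "\<And>x y. x \<in> carrier R \<Longrightarrow> y \<in> carrier R \<Longrightarrow> x \<oplus>\<^bsub>R\<^esub> y \<in> carrier R"
      "\<And>x y. x \<in> carrier R \<Longrightarrow> y \<in> carrier R \<Longrightarrow> x \<otimes>\<^bsub>R\<^esub> y \<in> carrier R"
      "\<zero>\<^bsub>R\<^esub> \<in> carrier R" "\<one>\<^bsub>R\<^esub> \<in> carrier R"
    and hom: "\<And>x y. x \<in> carrier R \<Longrightarrow> y \<in> carrier R \<Longrightarrow> h (x \<oplus>\<^bsub>R\<^esub> y) = h x \<oplus>\<^bsub>S\<^esub> h y"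
      "\<And>x y. x \<in> carrier R \<Longrightarrow> y \<in> carrier R \<Longrightarrow> h (x \<otimes>\<^bsub>R\<^esub> y) = h x \<otimes>\<^bsub>S\<^esub> h y"
      "h \<zero>\<^bsub>R\<^esub> = \<zero>\<^bsub>S\<^esub>" "h \<one>\<^bsub>R\<^esub> = \<one>\<^bsub>S\<^esub>"
  shows "ring R"
proof -
  interpret S: ring S by fact
  have hc: "h x \<in> carrier S" if "x \<in> carrier R" for x using onto that by blast
  have eq: "x = y" if "x \<in> carrier R" "y \<in> carrier R" "h x = h y" for x y
    using inj that unfolding inj_on_def by blast
  show ?thesis
  proof (rule ringI)
    show "abelian_group R"
    proof (rule abelian_groupI)
      fix x assume x: "x \<in> carrier R"
      have "\<ominus>\<^bsub>S\<^esub> h x \<in> h ` carrier R" unfolding onto using hc[OF x] by simp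
      then obtain y where y: "y \<in> carrier R" "h y = \<ominus>\<^bsub>S\<^esub> h x" by (metis imageE)
      then have "y \<oplus>\<^bsub>R\<^esub> x = \<zero>\<^bsub>R\<^esub>" using x hc by (intro eq) (simp_all add: closed hom S.l_neg)
      then show "\<exists>y\<in>carrier R. y \<oplus>\<^bsub>R\<^esub> x = \<zero>\<^bsub>R\<^esub>" using y(1) by blast
    qed (auto intro!: eq simp: closed hom hc S.a_ac)
    show "Group.monoid R"
      by (rule monoidI) (auto intro!: eq simp: closed hom hc S.m_assoc)
  qed (auto intro!: eq simp: closed hom hc S.l_distr S.r_distr)
qed

section \<open>The isomorphism of M_lambda(E) with End(V)\<close>

locale lam_algebra = separable_irreducible p for p :: "'k::field poly" +
  fixes lam :: "(nat \<times> nat) list"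
  assumes part: "exp_partition lam"
begin

abbreviation "Lm x \<equiv> fst (lam ! fst x)"

lemma lam_pos: "i < length lam \<Longrightarrow> 0 < fst (lam ! i)" "i < length lam \<Longrightarrow> 0 < snd (lam ! i)"
  using part nth_mem[of i lam] unfolding exp_partition_def by fastforce+

lemma finite_summands: "finite (summands lam)"
proof -
  have "summands lam = (SIGMA i:{..<length lam}. {..<snd (lam ! i)})"
    unfolding summands_def by auto
  then show ?thesis by simp
qed

sublocale M: primary_module p "summands lam" "\<lambda>x. fst (lam ! fst x)"
proof (rule primary_module.intro[OF irreducible_poly_axioms], rule primary_module_axioms.intro)
  show "finite (summands lam)" by (rule finite_summands)
  show "0 < Lm x" if "x \<in> summands lam" for x using that lam_pos unfolding summands_def by auto
qed

abbreviation "I \<equiv> summands lam"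
abbreviation "Z l \<equiv> PIdl\<^bsub>Ou\<^esub> (u [^]\<^bsub>Ou\<^esub> (l::nat))"
abbreviation "reg \<equiv> regular_module Ou"
abbreviation "rcl l q \<equiv> Z l +>\<^bsub>reg\<^esub> q"
abbreviation "Tm l \<equiv> truncated_module E l"

lemma lmod_reg: "lmod Ou reg"
  by (rule ring_lmod_regular[OF Ou.ring_axioms])

lemma Z_submodule: "submodule (Z l) Ou reg"
  using Ou.cgenideal_ideal[of "u [^]\<^bsub>Ou\<^esub> l"] ideal_iff[OF Ou.ring_axioms] by simp

lemma Tm_eq: "Tm l = quotient_module reg (Z l)"
  unfolding truncated_module_def ..

lemma Tm_simps:
  "carrier (Tm l) = (\<lambda>q. rcl l q) ` carrier Ou" "zero (Tm l) = Z l"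
  unfolding Tm_eq using lmod.quotient_simps[OF lmod_reg Z_submodule] by simp_all

lemma Tm_add: "q \<in> carrier Ou \<Longrightarrow> r \<in> carrier Ou \<Longrightarrow> rcl l q \<oplus>\<^bsub>Tm l\<^esub> rcl l r = rcl l (q \<oplus>\<^bsub>Ou\<^esub> r)"
  unfolding Tm_eq using lmod.quotient_simps(3)[OF lmod_reg Z_submodule] lmod.coset_add[OF lmod_reg Z_submodule]
  by simp

lemma Tm_smult: "q \<in> carrier Ou \<Longrightarrow> r \<in> carrier Ou \<Longrightarrow> q \<odot>\<^bsub>Tm l\<^esub> rcl l r = rcl l (q \<otimes>\<^bsub>Ou\<^esub> r)"
  unfolding Tm_eq using lmod.quotient_smult[OF lmod_reg Z_submodule] by simp

lemma Z_mem: "q \<in> Z l \<longleftrightarrow> (\<exists>r\<in>carrier Ou. q = r \<otimes>\<^bsub>Ou\<^esub> u [^]\<^bsub>Ou\<^esub> l)"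
  unfolding cgenideal_def by blast

lemma cos_eq_iff: "q \<in> carrier Ou \<Longrightarrow> r \<in> carrier Ou \<Longrightarrow> rcl l q = rcl l r \<longleftrightarrow> q \<ominus>\<^bsub>Ou\<^esub> r \<in> Z l"
  using lmod.coset_eq_iff[OF lmod_reg Z_submodule, of q r l] by (simp add: a_minus_def)

lemma cos_rho_eq_iff: "rcl l (\<rho> f) = rcl l (\<rho> g) \<longleftrightarrow> p ^ l dvd f - g"
  unfolding cos_eq_iff[OF rho.ev_closed rho.ev_closed] rho.ev_diff[symmetric] Z_mem rho_dvd_iff ..

lemma cos_rho_zero: "rcl l (\<rho> 0) = Z l"
  using lmod.coset_zero_iff[OF lmod_reg Z_submodule, of "\<zero>\<^bsub>Ou\<^esub>" l] lmod.submoduleD(2)[OF lmod_reg Z_submodule, of l]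
  by (simp add: rho.ev_0)

lemma cos_rho_approx:
  assumes "r \<in> carrier Ou" "q = \<rho> g \<oplus>\<^bsub>Ou\<^esub> u [^]\<^bsub>Ou\<^esub> n \<otimes>\<^bsub>Ou\<^esub> r" "l \<le> n" "s \<in> carrier Ou"
  shows "rcl l (q \<otimes>\<^bsub>Ou\<^esub> s) = rcl l (\<rho> g \<otimes>\<^bsub>Ou\<^esub> s)"
proof -
  have up: "u [^]\<^bsub>Ou\<^esub> (n - l) \<in> carrier Ou" "u [^]\<^bsub>Ou\<^esub> l \<in> carrier Ou" by simp_all
  have un: "u [^]\<^bsub>Ou\<^esub> n = u [^]\<^bsub>Ou\<^esub> (n - l) \<otimes>\<^bsub>Ou\<^esub> u [^]\<^bsub>Ou\<^esub> l"
    using Ou.nat_pow_mult[OF u_closed, of "n - l" l] assms(3) by simp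
  let ?w = "u [^]\<^bsub>Ou\<^esub> (n - l) \<otimes>\<^bsub>Ou\<^esub> r \<otimes>\<^bsub>Ou\<^esub> s"
  have q: "q \<otimes>\<^bsub>Ou\<^esub> s = \<rho> g \<otimes>\<^bsub>Ou\<^esub> s \<oplus>\<^bsub>Ou\<^esub> ?w \<otimes>\<^bsub>Ou\<^esub> u [^]\<^bsub>Ou\<^esub> l"
    unfolding assms(2) un using assms(1,4) up by (simp add: Ou.l_distr Ou.r_distr Ou.m_ac)
  have cancel: "a \<oplus>\<^bsub>Ou\<^esub> b \<oplus>\<^bsub>Ou\<^esub> (\<ominus>\<^bsub>Ou\<^esub> a) = b" if "a \<in> carrier Ou" "b \<in> carrier Ou" for a b
    using that by (simp add: Ou.a_comm[of a b] Ou.a_assoc Ou.r_neg)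
  have wc: "?w \<otimes>\<^bsub>Ou\<^esub> u [^]\<^bsub>Ou\<^esub> l \<in> carrier Ou" "\<rho> g \<otimes>\<^bsub>Ou\<^esub> s \<in> carrier Ou" "?w \<in> carrier Ou"
    using assms(1,4) up by simp_all
  have "q \<otimes>\<^bsub>Ou\<^esub> s \<ominus>\<^bsub>Ou\<^esub> \<rho> g \<otimes>\<^bsub>Ou\<^esub> s = ?w \<otimes>\<^bsub>Ou\<^esub> u [^]\<^bsub>Ou\<^esub> l"
    unfolding q a_minus_def by (rule cancel[OF wc(2,1)])
  then have "q \<otimes>\<^bsub>Ou\<^esub> s \<ominus>\<^bsub>Ou\<^esub> \<rho> g \<otimes>\<^bsub>Ou\<^esub> s \<in> Z l" unfolding Z_mem using wc(3) by blast
  moreover have "q \<otimes>\<^bsub>Ou\<^esub> s \<in> carrier Ou" unfolding q using wc by simp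
  ultimately show ?thesis using cos_eq_iff wc(2) by blast
qed

lemma cos_surj: "q \<in> carrier Ou \<Longrightarrow> \<exists>g. rcl l q = rcl l (\<rho> g)"
proof -
  assume q: "q \<in> carrier Ou"
  obtain g r where g: "r \<in> carrier Ou" "q = \<rho> g \<oplus>\<^bsub>Ou\<^esub> u [^]\<^bsub>Ou\<^esub> l \<otimes>\<^bsub>Ou\<^esub> r" using rho_surj[OF q] by blast
  have "rcl l (q \<otimes>\<^bsub>Ou\<^esub> \<one>\<^bsub>Ou\<^esub>) = rcl l (\<rho> g \<otimes>\<^bsub>Ou\<^esub> \<one>\<^bsub>Ou\<^esub>)" by (rule cos_rho_approx[OF g order_refl Ou.one_closed])
  then show ?thesis using q by auto
qed

abbreviation "W \<equiv> E_lam E lam"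

text \<open>The direct sum over all summands of the isomorphisms K[t]/p^l to E[u]/u^l induced by
  \<open>\<rho>\<close>.\<close>

definition \<phi> :: "(nat \<times> nat \<Rightarrow> 'k poly) \<Rightarrow> nat \<times> nat \<Rightarrow> 'k poly set list set" where
  "\<phi> g = (\<lambda>x\<in>I. rcl (Lm x) (\<rho> (g x)))"

lemma W_eq: "W = direct_sum_module I (\<lambda>x. Tm (Lm x))"
  unfolding E_lam_def by (rule arg_cong[of _ _ "direct_sum_module I"]) auto

lemma W_simps:
  "carrier W = (\<Pi>\<^sub>E x\<in>I. carrier (Tm (Lm x)))" "zero W = (\<lambda>x\<in>I. Z (Lm x))"
  "add W = (\<lambda>v w. \<lambda>x\<in>I. v x \<oplus>\<^bsub>Tm (Lm x)\<^esub> w x)" "smult W = (\<lambda>q v. \<lambda>x\<in>I. q \<odot>\<^bsub>Tm (Lm x)\<^esub> v x)"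
  unfolding W_eq direct_sum_module_def by (simp_all add: Tm_simps(2))

lemma phi_W: "\<phi> g \<in> carrier W"
  unfolding W_simps Tm_simps \<phi>_def by auto

lemma phi_eq_iff: "\<phi> g = \<phi> h \<longleftrightarrow> (\<forall>x\<in>I. p ^ Lm x dvd g x - h x)"
  unfolding \<phi>_def cos_rho_eq_iff[symmetric] by (auto simp: fun_eq_iff restrict_def)

lemma phi_bij: "bij_betw \<phi> M.V (carrier W)"
  unfolding bij_betw_def
proof
  show "inj_on \<phi> M.V"
    by (rule inj_onI, rule M.V_eqI) (use phi_eq_iff in auto)
  show "\<phi> ` M.V = carrier W"
  proof
    show "\<phi> ` M.V \<subseteq> carrier W" using phi_W by blast
    show "carrier W \<subseteq> \<phi> ` M.V"
    proof
      fix w assume w: "w \<in> carrier W"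
      have "\<exists>g. w x = rcl (Lm x) (\<rho> g)" if "x \<in> I" for x
      proof -
        have "w x \<in> (\<lambda>q. rcl (Lm x) q) ` carrier Ou" using w that unfolding W_simps Tm_simps by blast
        then show ?thesis using cos_surj by auto
      qed
      then obtain g where g: "\<And>x. x \<in> I \<Longrightarrow> w x = rcl (Lm x) (\<rho> (g x))" by metis
      have "\<phi> (M.red g) = \<phi> g" unfolding phi_eq_iff using M.red_dvd(1) by blast
      also have "\<dots> = w"
      proof
        fix x
        show "\<phi> g x = w x"
        proof (cases "x \<in> I")
          case False
          then have "w x = undefined" using w unfolding W_simps by (rule PiE_arb[rotated])
          then show ?thesis using False unfolding \<phi>_def by simp
        qed (simp add: \<phi>_def g)
      qed
      finally show "w \<in> \<phi> ` M.V" using M.red_V by (metis imageI)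
    qed
  qed
qed

lemma phi_add: "\<phi> (g + h) = \<phi> g \<oplus>\<^bsub>W\<^esub> \<phi> h"
  unfolding W_simps \<phi>_def by (auto simp: rho.ev_add Tm_add fun_eq_iff restrict_def)

lemma phi_act: "\<phi> (M.act f g) = \<rho> f \<odot>\<^bsub>W\<^esub> \<phi> g"
proof -
  have "\<phi> (M.act f g) = \<phi> (\<lambda>x. f * g x)"
    unfolding phi_eq_iff M.act_def using M.red_dvd(1)[where g = "\<lambda>x. f * g x"] by blast
  also have "\<dots> = \<rho> f \<odot>\<^bsub>W\<^esub> \<phi> g"
    unfolding W_simps \<phi>_def by (auto simp: rho.ev_mult Tm_smult fun_eq_iff restrict_def)
  finally show ?thesis .
qed

text \<open>A power of \<open>u\<close> annihilates \<open>W\<close>, and modulo that power every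
  element of \<open>E[u]\<close> is in the image of \<open>\<rho>\<close>. Hence maps of
  \<open>W\<close> that are linear over K[t] are linear over \<open>E[u]\<close>.\<close>

lemma Ou_acts_as_rho:
  assumes q: "q \<in> carrier Ou"
  shows "\<exists>f. \<forall>w\<in>carrier W. q \<odot>\<^bsub>W\<^esub> w = \<rho> f \<odot>\<^bsub>W\<^esub> w"
proof -
  let ?n = "\<Sum>x\<in>I. Lm x"
  have le: "Lm x \<le> ?n" if "x \<in> I" for x using member_le_sum[OF that _ finite_summands, of Lm] by simp
  obtain g r where g: "r \<in> carrier Ou" "q = \<rho> g \<oplus>\<^bsub>Ou\<^esub> u [^]\<^bsub>Ou\<^esub> ?n \<otimes>\<^bsub>Ou\<^esub> r" using rho_surj[OF q] by blast
  have "q \<odot>\<^bsub>W\<^esub> w = \<rho> g \<odot>\<^bsub>W\<^esub> w" if w: "w \<in> carrier W" for w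
  proof -
    have "q \<odot>\<^bsub>Tm (Lm x)\<^esub> w x = \<rho> g \<odot>\<^bsub>Tm (Lm x)\<^esub> w x" if x: "x \<in> I" for x
    proof -
      have "w x \<in> (\<lambda>q. rcl (Lm x) q) ` carrier Ou" using w x unfolding W_simps Tm_simps by blast
      then obtain s where s: "s \<in> carrier Ou" "w x = rcl (Lm x) s" by blast
      show ?thesis unfolding s(2) using Tm_smult[OF q s(1)] Tm_smult[OF rho.ev_closed s(1)]
        cos_rho_approx[OF g le[OF x] s(1)] by simp
    qed
    then show ?thesis unfolding W_simps by (intro restrict_ext)
  qed
  then show ?thesis by blast
qed

abbreviation "R \<equiv> M_lam E lam"

lemma R_simps:
  "carrier R = lmod_hom Ou W W \<inter> extensional (carrier W)" "mult R = (\<lambda>f g. compose (carrier W) f g)"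
  "one R = (\<lambda>v\<in>carrier W. v)" "zero R = (\<lambda>v\<in>carrier W. \<zero>\<^bsub>W\<^esub>)"
  "add R = (\<lambda>f g. \<lambda>v\<in>carrier W. f v \<oplus>\<^bsub>W\<^esub> g v)"
  "smult R = (\<lambda>c f. \<lambda>v\<in>carrier W. const c \<odot>\<^bsub>W\<^esub> f v)"
  unfolding M_lam_def Let_def by simp_all

definition H :: "((nat \<times> nat \<Rightarrow> 'k poly set list set) \<Rightarrow> (nat \<times> nat \<Rightarrow> 'k poly set list set)) \<Rightarrow>
    (nat \<times> nat \<Rightarrow> 'k poly) \<Rightarrow> (nat \<times> nat \<Rightarrow> 'k poly)" where
  "H = (\<lambda>r. \<lambda>g\<in>M.V. inv_into M.V \<phi> (r (\<phi> g)))"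

lemma W_image: "w \<in> carrier W \<Longrightarrow> \<exists>g\<in>M.V. w = \<phi> g"
  using phi_bij unfolding bij_betw_def by blast

lemma R_full:
  assumes F: "F \<in> carrier M.EV"
  shows "\<exists>r\<in>carrier R. \<forall>g\<in>M.V. r (\<phi> g) = \<phi> (F g)"
proof -
  note d = M.EV_D[OF F]
  define r where "r = (\<lambda>w\<in>carrier W. \<phi> (F (inv_into M.V \<phi> w)))"
  have r: "r (\<phi> g) = \<phi> (F g)" if "g \<in> M.V" for g
    unfolding r_def using phi_W bij_betw_inv_into_left[OF phi_bij that] by simp
  have "r \<in> carrier R"
    unfolding R_simps lmod_hom_def
  proof (intro IntI CollectI conjI ballI funcsetI)
    show "r \<in> extensional (carrier W)" unfolding r_def by simp
  next
    fix w assume "w \<in> carrier W"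
    then obtain g where g: "g \<in> M.V" "w = \<phi> g" using W_image by blast
    show "r w \<in> carrier W" using g r phi_W by simp
    { fix v assume "v \<in> carrier W"
      then obtain h where h: "h \<in> M.V" "v = \<phi> h" using W_image by blast
      show "r (w \<oplus>\<^bsub>W\<^esub> v) = r w \<oplus>\<^bsub>W\<^esub> r v"
        unfolding g(2) h(2) phi_add[symmetric] r[OF M.V_add[OF g(1) h(1)]] r[OF g(1)] r[OF h(1)] d(3)[OF g(1) h(1)] .. }
    fix q assume q: "q \<in> carrier Ou"
    obtain f where f: "\<And>w. w \<in> carrier W \<Longrightarrow> q \<odot>\<^bsub>W\<^esub> w = \<rho> f \<odot>\<^bsub>W\<^esub> w"
      using Ou_acts_as_rho[OF q] by blast
    show "r (q \<odot>\<^bsub>W\<^esub> w) = q \<odot>\<^bsub>W\<^esub> r w"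
      unfolding g(2) r[OF g(1)] f[OF phi_W] phi_act[symmetric] r[OF M.act_V] d(4)[OF g(1)] ..
  qed
  then show ?thesis using r by blast
qed

lemma R_D:
  assumes "r \<in> carrier R"
  shows "\<And>w. w \<in> carrier W \<Longrightarrow> r w \<in> carrier W"
    "\<And>w v. w \<in> carrier W \<Longrightarrow> v \<in> carrier W \<Longrightarrow> r (w \<oplus>\<^bsub>W\<^esub> v) = r w \<oplus>\<^bsub>W\<^esub> r v"
    "\<And>q w. q \<in> carrier Ou \<Longrightarrow> w \<in> carrier W \<Longrightarrow> r (q \<odot>\<^bsub>W\<^esub> w) = q \<odot>\<^bsub>W\<^esub> r w"
    "r \<in> extensional (carrier W)"
  using assms unfolding R_simps lmod_hom_def by blast+

lemma R_eqI: "r \<in> extensional (carrier W) \<Longrightarrow> s \<in> extensional (carrier W) \<Longrightarrow> (\<And>g. g \<in> M.V \<Longrightarrow> r (\<phi> g) = s (\<phi> g)) \<Longrightarrow> r = s"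
  by (rule extensionalityI[of _ "carrier W"]) (use W_image in auto)

lemma H_iso: "H \<in> ring_iso R M.EV" and phi_H: "r \<in> carrier R \<Longrightarrow> g \<in> M.V \<Longrightarrow> \<phi> (H r g) = r (\<phi> g)"
proof -
  have faithful: "r = s" if "r \<in> carrier R" "s \<in> carrier R" "\<And>w. w \<in> carrier W \<Longrightarrow> r w = s w" for r s
    using that R_D(4) extensionalityI by metis
  note iso = M.ring_iso_EV[where \<phi> = \<phi> and Y = "carrier W" and padd = "add W" and
    \<beta> = "\<lambda>f w. \<rho> f \<odot>\<^bsub>W\<^esub> w" and R = R and \<alpha> = "\<lambda>r w. r w", folded H_def]
  show "H \<in> ring_iso R M.EV"
    by (rule iso(1), rule phi_bij, rule phi_add, rule phi_act, erule R_D(1), assumption, erule R_D(2), assumption,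
      assumption, erule R_D(3), rule rho.ev_closed, assumption)
      (simp_all add: R_simps(2,3,5) compose_eq faithful R_full)
  show "r \<in> carrier R \<Longrightarrow> g \<in> M.V \<Longrightarrow> \<phi> (H r g) = r (\<phi> g)"
    using bij_betw_inv_into_right[OF phi_bij R_D(1)[OF _ phi_W]] unfolding H_def by simp
qed

text \<open>Each result of an operation on \<open>R\<close> is recognized as the map on
  \<open>W\<close> that corresponds to some endomorphism of \<open>V\<close>; this yields closure,
  and the ring laws are pulled back along \<open>H\<close>.\<close>

lemma R_ring: "ring R"
proof -
  interpret EV: ring M.EV by (rule M.ring_EV)
  have hom: "H \<in> ring_hom R M.EV" and b: "bij_betw H (carrier R) (carrier M.EV)"
    using H_iso unfolding ring_iso_def by auto
  have H: "H r \<in> carrier M.EV" if "r \<in> carrier R" for r using ring_hom_closed[OF hom that] .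
  have ex: "r \<in> carrier R" if F: "F \<in> carrier M.EV" and r: "r \<in> extensional (carrier W)"
    and rF: "\<And>g. g \<in> M.V \<Longrightarrow> r (\<phi> g) = \<phi> (F g)" for F r
  proof -
    obtain s where s: "s \<in> carrier R" "\<And>g. g \<in> M.V \<Longrightarrow> s (\<phi> g) = \<phi> (F g)" using R_full[OF F] by blast
    have "r = s" by (rule R_eqI[OF r R_D(4)[OF s(1)]]) (simp add: s rF)
    then show ?thesis using s(1) by simp
  qed
  have phi0: "\<phi> 0 = \<zero>\<^bsub>W\<^esub>" unfolding \<phi>_def W_simps by (auto simp: cos_rho_zero fun_eq_iff restrict_def)
  have z: "\<zero>\<^bsub>R\<^esub> \<in> carrier R"
    by (rule ex[OF EV.zero_closed]) (simp_all add: R_simps(4) phi_W phi0)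
  have z2: "H \<zero>\<^bsub>R\<^esub> = \<zero>\<^bsub>M.EV\<^esub>"
  proof (rule M.EV_eqI[OF H[OF z] EV.zero_closed])
    fix g assume g: "g \<in> M.V"
    have "\<phi> (H \<zero>\<^bsub>R\<^esub> g) = \<phi> 0" using phi_H[OF z g] phi_W phi0 by (simp add: R_simps(4))
    then show "H \<zero>\<^bsub>R\<^esub> g = \<zero>\<^bsub>M.EV\<^esub> g"
      using phi_bij M.EV_D(2)[OF H[OF z] g] M.V_zero g unfolding bij_betw_def inj_on_def by simp
  qed
  show ?thesis
  proof (rule ring_pullback[OF M.ring_EV])
    show "inj_on H (carrier R)" "H ` carrier R = carrier M.EV" using b unfolding bij_betw_def by blast+
    fix r s assume r: "r \<in> carrier R" and s: "s \<in> carrier R"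
    show "r \<oplus>\<^bsub>R\<^esub> s \<in> carrier R"
      by (rule ex[OF EV.a_closed[OF H[OF r] H[OF s]]])
        (simp_all add: R_simps(5) phi_W phi_add phi_H r s)
    show "r \<otimes>\<^bsub>R\<^esub> s \<in> carrier R"
      by (rule ex[OF EV.m_closed[OF H[OF r] H[OF s]]])
        (simp_all add: R_simps(2) phi_W phi_H r s compose_eq compose_def M.EV_D(2)[OF H[OF s]])
    show "H (r \<oplus>\<^bsub>R\<^esub> s) = H r \<oplus>\<^bsub>M.EV\<^esub> H s" "H (r \<otimes>\<^bsub>R\<^esub> s) = H r \<otimes>\<^bsub>M.EV\<^esub> H s"
      using ring_hom_add[OF hom r s] ring_hom_mult[OF hom r s] by blast+
  next
    show "\<one>\<^bsub>R\<^esub> \<in> carrier R" by (rule ex[OF EV.one_closed]) (simp_all add: R_simps(3) phi_W)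
    show "H \<one>\<^bsub>R\<^esub> = \<one>\<^bsub>M.EV\<^esub>" by (rule ring_hom_one[OF hom])
  qed (fact z z2)+
qed

lemma proj_R:
  assumes i: "i < length lam"
  shows "proj_lam E lam i \<in> carrier R" "H (proj_lam E lam i) = M.idem (i, 0)"
proof -
  have x: "(i, 0) \<in> I" using i lam_pos(2) unfolding summands_def by auto
  obtain r where r: "r \<in> carrier R" "\<And>g. g \<in> M.V \<Longrightarrow> r (\<phi> g) = \<phi> (M.idem (i, 0) g)"
    using R_full[OF M.idem_EV[OF x]] by blast
  have "proj_lam E lam i = r"
  proof (rule R_eqI[OF _ R_D(4)[OF r(1)]])
    show "proj_lam E lam i \<in> extensional (carrier W)" unfolding proj_lam_def by simp
    fix g assume g: "g \<in> M.V"
    show "proj_lam E lam i (\<phi> g) = r (\<phi> g)"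
      unfolding r(2)[OF g] M.idem_apply[OF x g] proj_lam_def using phi_W
      by (auto simp: \<phi>_def W_simps(2) fun_eq_iff restrict_def cos_rho_zero)
  qed
  then show P: "proj_lam E lam i \<in> carrier R" using r(1) by simp
  have He: "H (proj_lam E lam i) \<in> carrier M.EV"
    using H_iso P unfolding ring_iso_def by (auto simp: ring_hom_closed)
  show "H (proj_lam E lam i) = M.idem (i, 0)"
  proof (rule M.EV_eqI[OF He M.idem_EV[OF x]])
    fix g assume g: "g \<in> M.V"
    have "\<phi> (H (proj_lam E lam i) g) = \<phi> (M.idem (i, 0) g)"
      using phi_H[OF P g] r(2)[OF g] \<open>proj_lam E lam i = r\<close> by simp
    then show "H (proj_lam E lam i) g = M.idem (i, 0) g"
      using phi_bij M.EV_D(2)[OF He g] M.EV_D(2)[OF M.idem_EV[OF x] g] unfolding bij_betw_def inj_on_def by blast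
  qed
qed

lemma pim_lam_eq:
  assumes i: "i < length lam"
  shows "pim_lam E lam i = inv_into (carrier R) H ` M.pim (i, 0)"
proof -
  interpret R: ring R by (rule R_ring)
  have hom: "H \<in> ring_hom R M.EV" and b: "bij_betw H (carrier R) (carrier M.EV)"
    using H_iso unfolding ring_iso_def by auto
  have "M.pim (i, 0) = H ` pim_lam E lam i"
  proof
    show "M.pim (i, 0) \<subseteq> H ` pim_lam E lam i"
    proof
      fix F assume "F \<in> M.pim (i, 0)"
      then obtain G where G: "G \<in> carrier M.EV" "F = G \<otimes>\<^bsub>M.EV\<^esub> M.idem (i, 0)" unfolding M.pim_def by blast
      then obtain r where r: "r \<in> carrier R" "G = H r" using b unfolding bij_betw_def by blast
      have "F = H (r \<otimes>\<^bsub>R\<^esub> proj_lam E lam i)"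
        unfolding G(2) r(2) proj_R(2)[OF i, symmetric] by (rule ring_hom_mult[OF hom r(1) proj_R(1)[OF i], symmetric])
      then show "F \<in> H ` pim_lam E lam i" unfolding pim_lam_def cgenideal_def using r(1) by blast
    qed
    show "H ` pim_lam E lam i \<subseteq> M.pim (i, 0)"
    proof
      fix F assume "F \<in> H ` pim_lam E lam i"
      then obtain r where r: "r \<in> carrier R" "F = H (r \<otimes>\<^bsub>R\<^esub> proj_lam E lam i)"
        unfolding pim_lam_def cgenideal_def by blast
      then have "F = H r \<otimes>\<^bsub>M.EV\<^esub> M.idem (i, 0)"
        using ring_hom_mult[OF hom r(1) proj_R(1)[OF i]] proj_R(2)[OF i] by simp
      then show "F \<in> M.pim (i, 0)" unfolding M.pim_def using ring_hom_closed[OF hom r(1)] by blast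
    qed
  qed
  moreover have "pim_lam E lam i \<subseteq> carrier R"
    unfolding pim_lam_def cgenideal_def using proj_R(1)[OF i] R.m_closed by blast
  ultimately show ?thesis
    using b by (simp add: bij_betw_def inv_into_image_cancel)
qed

theorem M_lam_cartan:
  "pim_representatives R (map (pim_lam E lam) [0..<length lam])"
  "cartan_matrix R (map (pim_lam E lam) [0..<length lam]) = min_matrix lam"
  "is_block R (carrier R)"
proof -
  \<comment> \<open>The first copy of each part represents all its copies, and different parts have
    different exponents.\<close>
  let ?xs = "map (\<lambda>i. (i, 0::nat)) [0..<length lam]"
  have xs: "set ?xs \<subseteq> I" using lam_pos(2) unfolding summands_def by auto
  have "map Lm ?xs = map fst lam" by (rule nth_equalityI) auto
  then have dist: "distinct (map Lm ?xs)"
    using part strict_sorted_iff unfolding exp_partition_def by metis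
  have cov: "Lm y \<in> Lm ` set ?xs" if "y \<in> I" for y
    using that unfolding summands_def by force
  note rep = M.pim_representatives_EV[OF xs dist cov]
  have eq: "map (image (inv_into (carrier R) H)) (map M.pim ?xs) = map (pim_lam E lam) [0..<length lam]"
    using pim_lam_eq by simp
  note iso = iso_pim_representatives[OF R_ring M.ring_EV H_iso rep(1)]
  show "pim_representatives R (map (pim_lam E lam) [0..<length lam])" using iso(1) unfolding eq .
  show "cartan_matrix R (map (pim_lam E lam) [0..<length lam]) = min_matrix lam"
  proof -
    have "cartan_matrix R (map (pim_lam E lam) [0..<length lam]) = cartan_matrix M.EV (map M.pim ?xs)"
      using iso(2) unfolding eq .
    also have "\<dots> = min_matrix lam"
      by (rule trans[OF rep(2)]) (auto simp: min_matrix_def intro!: eq_matI)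
    finally show ?thesis .
  qed
  have "I \<noteq> {}" using xs part unfolding exp_partition_def by auto
  then show "is_block R (carrier R)" using iso_is_block_carrier[OF R_ring M.ring_EV H_iso] M.is_block_EV by blast
qed

lemma M_lam_composition_series:
  "principal_indecomposable R P \<Longrightarrow> \<exists>Ns. composition_series R (left_ideal_module R P) Ns"
  by (rule iso_composition_series_exists[OF R_ring M.ring_EV H_iso M.composition_series_pim])

end

section \<open>Polynomials in a matrix\<close>

definition pmat :: "'k::field mat \<Rightarrow> 'k poly \<Rightarrow> 'k mat" where
  "pmat A = poly_eval.ev (ring_mat TYPE('k) (dim_row A) ()) (\<lambda>a. a \<cdot>\<^sub>m 1\<^sub>m (dim_row A)) A"

lemma poly_eval_mat:
  assumes A: "(A :: 'k::field mat) \<in> carrier_mat n n"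
  shows "poly_eval (ring_mat TYPE('k) n ()) (\<lambda>a. a \<cdot>\<^sub>m 1\<^sub>m n) A"
proof (rule poly_eval.intro[OF ring_mat], rule poly_eval_axioms.intro, unfold ring_mat_simps)
  fix a b :: 'k
  show "(a + b) \<cdot>\<^sub>m 1\<^sub>m n = a \<cdot>\<^sub>m 1\<^sub>m n + b \<cdot>\<^sub>m 1\<^sub>m n" by (rule eq_matI) auto
  show "(a * b) \<cdot>\<^sub>m 1\<^sub>m n = a \<cdot>\<^sub>m 1\<^sub>m n * (b \<cdot>\<^sub>m 1\<^sub>m n)"
    by (subst mult_smult_assoc_mat[of _ n n _ n]) (auto simp: mult_smult_distrib[of _ n n _ n])
  show "A * (a \<cdot>\<^sub>m 1\<^sub>m n) = a \<cdot>\<^sub>m 1\<^sub>m n * A"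
    using A by (simp add: mult_smult_assoc_mat[of _ n n _ n] mult_smult_distrib[of _ n n _ n])
qed (use A in auto)

context
  fixes A :: "'k::field mat" and n :: nat
  assumes A: "A \<in> carrier_mat n n"
begin

interpretation pe: poly_eval "ring_mat TYPE('k) n ()" "\<lambda>a. a \<cdot>\<^sub>m 1\<^sub>m n" A
  by (rule poly_eval_mat[OF A])

lemma pmat_eq: "pmat A = pe.ev"
  using A unfolding pmat_def by simp

lemma pmat_carrier [simp]: "pmat A f \<in> carrier_mat n n"
  unfolding pmat_eq using pe.ev_closed[of f] unfolding ring_mat_simps .

lemma pmat_0: "pmat A 0 = 0\<^sub>m n n"
  unfolding pmat_eq using pe.ev_0 unfolding ring_mat_simps .

lemma pmat_pCons: "pmat A (pCons a f) = a \<cdot>\<^sub>m 1\<^sub>m n + A * pmat A f"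
  unfolding pmat_eq using pe.ev_pCons unfolding ring_mat_simps .

lemma pmat_add: "pmat A (f + g) = pmat A f + pmat A g"
  unfolding pmat_eq using pe.ev_add unfolding ring_mat_simps .

lemma pmat_mult: "pmat A (f * g) = pmat A f * pmat A g"
  unfolding pmat_eq using pe.ev_mult unfolding ring_mat_simps .

lemma pmat_1: "pmat A 1 = 1\<^sub>m n"
  unfolding pmat_eq using pe.ev_one unfolding ring_mat_simps .

lemma pmat_const: "pmat A [:a:] = a \<cdot>\<^sub>m 1\<^sub>m n"
  unfolding pmat_eq using pe.ev_const unfolding ring_mat_simps .

lemma pmat_X: "pmat A [:0, 1:] = A"
  unfolding pmat_eq using pe.ev_X unfolding ring_mat_simps .

lemma pmat_dvd_zero: "f dvd g \<Longrightarrow> pmat A f = 0\<^sub>m n n \<Longrightarrow> pmat A g = 0\<^sub>m n n"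
  unfolding dvd_def by (auto simp: pmat_mult left_mult_zero_mat[OF pmat_carrier])

end

lemma pmat_intertwine:
  assumes A: "(A :: 'k::field mat) \<in> carrier_mat n n" and C: "C \<in> carrier_mat m m" and B: "B \<in> carrier_mat n m"
    and AB: "A * B = B * C"
  shows "pmat A f * B = B * pmat C f"
proof (induction f)
  case 0
  show ?case using B by (simp add: pmat_0[OF A] pmat_0[OF C])
next
  case (pCons a f)
  have "A * pmat A f * B = B * (C * pmat C f)"
  proof -
    have "A * pmat A f * B = A * (pmat A f * B)" by (rule assoc_mult_mat[OF A pmat_carrier[OF A] B])
    also have "\<dots> = A * (B * pmat C f)" unfolding pCons.IH ..
    also have "\<dots> = (A * B) * pmat C f" by (rule assoc_mult_mat[OF A B pmat_carrier[OF C], symmetric])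
    also have "\<dots> = B * (C * pmat C f)" unfolding AB by (rule assoc_mult_mat[OF B C pmat_carrier[OF C]])
    finally show ?thesis .
  qed
  moreover have "(a \<cdot>\<^sub>m 1\<^sub>m n) * B = B * (a \<cdot>\<^sub>m 1\<^sub>m m)"
    using B by (simp add: mult_smult_assoc_mat[of _ n n _ m] mult_smult_distrib[of _ n m _ m])
  moreover have "(a \<cdot>\<^sub>m 1\<^sub>m n + A * pmat A f) * B = (a \<cdot>\<^sub>m 1\<^sub>m n) * B + A * pmat A f * B"
    by (rule add_mult_distrib_mat[of _ n n _ _ m]) (use A B in \<open>auto intro: mult_carrier_mat[OF A pmat_carrier[OF A]]\<close>)
  moreover have "B * (a \<cdot>\<^sub>m 1\<^sub>m m + C * pmat C f) = B * (a \<cdot>\<^sub>m 1\<^sub>m m) + B * (C * pmat C f)"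
    by (rule mult_add_distrib_mat[of _ n m _ m]) (use C B in \<open>auto intro: mult_carrier_mat[OF C pmat_carrier[OF C]]\<close>)
  ultimately show ?case unfolding pmat_pCons[OF A] pmat_pCons[OF C] by simp
qed

lemma pmat_commute:
  assumes A: "(A :: 'k::field mat) \<in> carrier_mat n n" and B: "B \<in> carrier_mat n n" and AB: "A * B = B * A"
  shows "pmat A f * B = B * pmat A f"
  by (rule pmat_intertwine[OF A A B AB])

abbreviation cmat :: "'k::field mat \<Rightarrow> 'k poly mat" where
  "cmat \<equiv> map_mat (\<lambda>a. [:a:])"

lemma cmat_mult:
  assumes "(A :: 'k::field mat) \<in> carrier_mat n n" "B \<in> carrier_mat n n"
  shows "cmat (A * B) = cmat A * cmat B"
proof -
  have hom: "(\<Sum>i\<in>S. [:f i:]) = [:\<Sum>i\<in>S. f i:]" for S and f :: "nat \<Rightarrow> 'k"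
    by (induction S rule: infinite_finite_induct) auto
  show ?thesis
    by (rule eq_matI) (use assms in \<open>auto simp: scalar_prod_def hom[symmetric] mult.commute\<close>)
qed

text \<open>Division of \<open>f(t) - f(A)\<close> by \<open>t - A\<close>.\<close>

lemma char_poly_matrix_division:
  assumes A: "(A :: 'k::field mat) \<in> carrier_mat n n"
  shows "\<exists>M\<in>carrier_mat n n. cmat (pmat A f) + char_poly_matrix A * M = f \<cdot>\<^sub>m 1\<^sub>m n"
proof -
  let ?R = "ring_mat TYPE('k poly) n ()"
  interpret R: ring ?R by (rule ring_mat)
  let ?C = "char_poly_matrix A" and ?c = "cmat A" and ?T = "[:0, 1:] \<cdot>\<^sub>m 1\<^sub>m n :: 'k poly mat"
  have cl: "?C \<in> carrier ?R" "?c \<in> carrier ?R" "?T \<in> carrier ?R" "\<And>f :: 'k poly. f \<cdot>\<^sub>m 1\<^sub>m n \<in> carrier ?R"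
    using A by (auto simp: ring_mat_simps)
  have CcT: "?C \<oplus>\<^bsub>?R\<^esub> ?c = ?T"
    unfolding ring_mat_simps char_poly_matrix_def by (rule eq_matI) (use A in auto)
  have sc: "f \<cdot>\<^sub>m 1\<^sub>m n \<otimes>\<^bsub>?R\<^esub> B = B \<otimes>\<^bsub>?R\<^esub> (f \<cdot>\<^sub>m 1\<^sub>m n)" if "B \<in> carrier ?R" for f :: "'k poly" and B
    using that unfolding ring_mat_simps
    by (simp add: mult_smult_assoc_mat[of _ n n _ n] mult_smult_distrib[of _ n n _ n])
  \<comment> \<open>The constant matrix \<open>?c\<close> commutes with the scalar matrix
    \<open>?T\<close>, which is the sum of \<open>?C\<close> and \<open>?c\<close>, hence it
    commutes with \<open>?C\<close>.\<close>
  have cC: "?c \<otimes>\<^bsub>?R\<^esub> ?C = ?C \<otimes>\<^bsub>?R\<^esub> ?c"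
  proof -
    have "?c \<otimes>\<^bsub>?R\<^esub> ?C \<oplus>\<^bsub>?R\<^esub> ?c \<otimes>\<^bsub>?R\<^esub> ?c = ?C \<otimes>\<^bsub>?R\<^esub> ?c \<oplus>\<^bsub>?R\<^esub> ?c \<otimes>\<^bsub>?R\<^esub> ?c"
      using cl sc[OF cl(2)] by (simp only: R.r_distr[symmetric] R.l_distr[symmetric] CcT)
    then show ?thesis using cl R.add.r_cancel[of "?c \<otimes>\<^bsub>?R\<^esub> ?c"] by simp
  qed
  have "\<exists>M\<in>carrier ?R. cmat (pmat A f) \<oplus>\<^bsub>?R\<^esub> ?C \<otimes>\<^bsub>?R\<^esub> M = f \<cdot>\<^sub>m 1\<^sub>m n"
  proof (induction f)
    case 0
    have "cmat (pmat A 0) = \<zero>\<^bsub>?R\<^esub>" "(0 :: 'k poly) \<cdot>\<^sub>m 1\<^sub>m n = \<zero>\<^bsub>?R\<^esub>"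
      unfolding pmat_0[OF A] ring_mat_simps by (auto intro!: eq_matI)
    then show ?case using cl(1) by (intro bexI[of _ "\<zero>\<^bsub>?R\<^esub>"]) simp_all
  next
    case (pCons a f)
    then obtain M where M: "M \<in> carrier ?R" "cmat (pmat A f) \<oplus>\<^bsub>?R\<^esub> ?C \<otimes>\<^bsub>?R\<^esub> M = f \<cdot>\<^sub>m 1\<^sub>m n" by blast
    let ?P = "cmat (pmat A f)" and ?a = "[:a:] \<cdot>\<^sub>m 1\<^sub>m n :: 'k poly mat" and ?f = "f \<cdot>\<^sub>m 1\<^sub>m n"
    have P: "?P \<in> carrier ?R" using pmat_carrier[OF A] by (simp add: ring_mat_simps)
    have mcl: "?c \<otimes>\<^bsub>?R\<^esub> M \<in> carrier ?R" "?C \<otimes>\<^bsub>?R\<^esub> ?f \<in> carrier ?R" "?c \<otimes>\<^bsub>?R\<^esub> ?P \<in> carrier ?R"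
      "?C \<otimes>\<^bsub>?R\<^esub> M \<in> carrier ?R" "?c \<otimes>\<^bsub>?R\<^esub> (?C \<otimes>\<^bsub>?R\<^esub> M) \<in> carrier ?R"
      using cl M(1) P by (simp_all del: ring_mat_simps)
    have "cmat (pmat A (pCons a f)) = ?a \<oplus>\<^bsub>?R\<^esub> ?c \<otimes>\<^bsub>?R\<^esub> ?P"
      unfolding ring_mat_simps cmat_mult[OF A pmat_carrier[OF A], symmetric] pmat_pCons[OF A]
      by (rule eq_matI) (use A pmat_carrier[OF A, of f] in \<open>auto simp del: pmat_carrier\<close>)
    \<comment> \<open>From \<open>t f(t) - A f(A) = (t - A) f(t) + A (f(t) - f(A))\<close> the
      quotient for \<open>pCons a f\<close> is \<open>f(t) + A M\<close>.\<close>
    moreover have "?C \<otimes>\<^bsub>?R\<^esub> (?f \<oplus>\<^bsub>?R\<^esub> ?c \<otimes>\<^bsub>?R\<^esub> M) = ?C \<otimes>\<^bsub>?R\<^esub> ?f \<oplus>\<^bsub>?R\<^esub> ?c \<otimes>\<^bsub>?R\<^esub> (?C \<otimes>\<^bsub>?R\<^esub> M)"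
      using R.r_distr[OF cl(4) mcl(1) cl(1)] R.m_assoc[OF cl(1,2) M(1)] R.m_assoc[OF cl(2,1) M(1)] cC by simp
    moreover have "?c \<otimes>\<^bsub>?R\<^esub> ?P \<oplus>\<^bsub>?R\<^esub> ?c \<otimes>\<^bsub>?R\<^esub> (?C \<otimes>\<^bsub>?R\<^esub> M) = ?c \<otimes>\<^bsub>?R\<^esub> ?f"
      using R.r_distr[OF P mcl(4) cl(2)] M(2) by simp
    moreover have "?a \<oplus>\<^bsub>?R\<^esub> ?c \<otimes>\<^bsub>?R\<^esub> ?P \<oplus>\<^bsub>?R\<^esub> (?C \<otimes>\<^bsub>?R\<^esub> ?f \<oplus>\<^bsub>?R\<^esub> ?c \<otimes>\<^bsub>?R\<^esub> (?C \<otimes>\<^bsub>?R\<^esub> M)) =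
        ?a \<oplus>\<^bsub>?R\<^esub> (?C \<otimes>\<^bsub>?R\<^esub> ?f \<oplus>\<^bsub>?R\<^esub> (?c \<otimes>\<^bsub>?R\<^esub> ?P \<oplus>\<^bsub>?R\<^esub> ?c \<otimes>\<^bsub>?R\<^esub> (?C \<otimes>\<^bsub>?R\<^esub> M)))"
      using cl(4) mcl by (simp add: R.a_ac)
    moreover have "?C \<otimes>\<^bsub>?R\<^esub> ?f \<oplus>\<^bsub>?R\<^esub> ?c \<otimes>\<^bsub>?R\<^esub> ?f = ?T \<otimes>\<^bsub>?R\<^esub> ?f"
      using R.l_distr[OF cl(1,2,4)] CcT by simp
    moreover have "?a \<oplus>\<^bsub>?R\<^esub> ?T \<otimes>\<^bsub>?R\<^esub> ?f = pCons a f \<cdot>\<^sub>m 1\<^sub>m n"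
    proof -
      have "?T \<otimes>\<^bsub>?R\<^esub> ?f = ([:0, 1:] * f) \<cdot>\<^sub>m 1\<^sub>m n"
        unfolding ring_mat_simps
        by (subst mult_smult_assoc_mat[of _ n n _ n]) (auto simp: mult_smult_distrib[of _ n n _ n])
      then show ?thesis unfolding ring_mat_simps by (auto intro!: eq_matI)
    qed
    ultimately have "cmat (pmat A (pCons a f)) \<oplus>\<^bsub>?R\<^esub> ?C \<otimes>\<^bsub>?R\<^esub> (?f \<oplus>\<^bsub>?R\<^esub> ?c \<otimes>\<^bsub>?R\<^esub> M) = pCons a f \<cdot>\<^sub>m 1\<^sub>m n"
      by simp
    then show ?case using R.a_closed[OF cl(4) mcl(1)] by blast
  qed
  then show ?thesis unfolding ring_mat_simps .
qed

text \<open>When \<open>f(A) = 0\<close>, the division exhibits the scalar matrix \<open>f\<close>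
  as a multiple of \<open>t - A\<close>; taking determinants gives the claim.\<close>

lemma char_poly_dvd_power:
  assumes A: "(A :: 'k::field mat) \<in> carrier_mat n n" and f: "pmat A f = 0\<^sub>m n n"
  shows "char_poly A dvd f ^ n"
proof -
  obtain M where M: "M \<in> carrier_mat n n" "cmat (pmat A f) + char_poly_matrix A * M = f \<cdot>\<^sub>m 1\<^sub>m n"
    using char_poly_matrix_division[OF A] by blast
  have c: "char_poly_matrix A \<in> carrier_mat n n" using A by simp
  have "cmat (pmat A f) = 0\<^sub>m n n" unfolding f by (rule eq_matI) auto
  then have "char_poly_matrix A * M = f \<cdot>\<^sub>m 1\<^sub>m n" using M mult_carrier_mat[OF c M(1)] by simp
  then have "det (char_poly_matrix A * M) = f ^ n" by simp
  then show ?thesis unfolding det_mult[OF c M(1)] char_poly_def by (metis dvd_triv_left)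
qed

text \<open>By the previous division, \<open>c(A) = (t - A) N\<close> for a polynomial matrix \<open>N\<close>. Comparing the
  coefficients of highest degree gives \<open>N = 0\<close>.\<close>

lemma cayley_hamilton:
  assumes A: "(A :: 'k::field mat) \<in> carrier_mat n n"
  shows "pmat A (char_poly A) = 0\<^sub>m n n"
proof -
  let ?C = "char_poly_matrix A" and ?P = "pmat A (char_poly A)"
  have c: "?C \<in> carrier_mat n n" using A by simp
  have P: "?P \<in> carrier_mat n n" by (rule pmat_carrier[OF A])
  obtain M where M: "M \<in> carrier_mat n n" "cmat ?P + ?C * M = char_poly A \<cdot>\<^sub>m 1\<^sub>m n"
    using char_poly_matrix_division[OF A] by blast
  define N where "N = adj_mat ?C - M"
  have N: "N \<in> carrier_mat n n" unfolding N_def by (rule minus_carrier_mat[OF M(1)])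
  have "?C * N = ?C * adj_mat ?C - ?C * M"
    unfolding N_def by (rule mult_minus_distrib_mat[OF c adj_mat(1)[OF c] M(1)])
  also have "\<dots> = cmat ?P"
    unfolding adj_mat(2)[OF c] char_poly_def[symmetric] M(2)[symmetric]
    by (rule eq_matI) (use P c M(1) in auto)
  finally have CN: "?C * N = cmat ?P" .
  \<comment> \<open>\<open>?C * N\<close> is a constant matrix, so its coefficients of degree
    \<open>Suc d\<close> vanish; this says that the degree \<open>d\<close> part of \<open>N\<close>
    is \<open>A\<close> times its part of degree \<open>Suc d\<close>.\<close>
  have step: "Polynomial.coeff (N $$ (i, j)) d = (\<Sum>k<n. A $$ (i, k) * Polynomial.coeff (N $$ (k, j)) (Suc d))"
    if ij: "i < n" "j < n" for i j d
  proof -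
    have "[:?P $$ (i, j):] = (?C * N) $$ (i, j)" unfolding CN using ij P by simp
    also have "\<dots> = (\<Sum>k<n. ?C $$ (i, k) * N $$ (k, j))"
      using ij c N by (simp add: scalar_prod_def atLeast0LessThan)
    also have "\<dots> = (\<Sum>k<n. (if k = i then [:0, 1:] * N $$ (k, j) else 0) - Polynomial.smult (A $$ (i, k)) (N $$ (k, j)))"
      by (rule sum.cong) (use ij A in \<open>auto simp: char_poly_matrix_def\<close>)
    also have "\<dots> = [:0, 1:] * N $$ (i, j) - (\<Sum>k<n. Polynomial.smult (A $$ (i, k)) (N $$ (k, j)))"
      using ij by (simp add: sum_subtractf)
    finally have "Polynomial.coeff [:?P $$ (i, j):] (Suc d) =
        Polynomial.coeff ([:0, 1:] * N $$ (i, j) - (\<Sum>k<n. Polynomial.smult (A $$ (i, k)) (N $$ (k, j)))) (Suc d)"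
      by (rule arg_cong)
    then show ?thesis by (simp add: coeff_sum)
  qed
  obtain b where b: "\<And>i j d. i < n \<Longrightarrow> j < n \<Longrightarrow> b \<le> d \<Longrightarrow> Polynomial.coeff (N $$ (i, j)) d = 0"
  proof -
    let ?D = "(\<lambda>(i, j). Polynomial.degree (N $$ (i, j))) ` ({..<n} \<times> {..<n})"
    have "Polynomial.degree (N $$ (i, j)) < Suc (Max ?D)" if "i < n" "j < n" for i j
      using that by (intro le_imp_less_Suc Max_ge) auto
    then show thesis using that[of "Suc (Max ?D)"] by (meson coeff_eq_0 less_le_trans)
  qed
  have z: "\<forall>i<n. \<forall>j<n. \<forall>d'\<ge>d. Polynomial.coeff (N $$ (i, j)) d' = 0" if "d \<le> b" for d
    using that
  proof (induction rule: inc_induct)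
    case base
    then show ?case using b by blast
  next
    case (step d)
    show ?case
    proof (intro allI impI)
      fix i j d' assume ij: "i < n" "j < n" and d': "d \<le> d'"
      have "Polynomial.coeff (N $$ (k, j)) (Suc d') = 0" if "k < n" for k using step.IH that ij d' by auto
      then show "Polynomial.coeff (N $$ (i, j)) d' = 0"
        using \<open>\<And>i j d. i < n \<Longrightarrow> j < n \<Longrightarrow> Polynomial.coeff (N $$ (i, j)) d = (\<Sum>k<n. A $$ (i, k) * Polynomial.coeff (N $$ (k, j)) (Suc d))\<close>[OF ij, of d']
        by simp
    qed
  qed
  have "N = 0\<^sub>m n n"
  proof (rule eq_matI)
    fix i j assume "i < dim_row (0\<^sub>m n n :: 'k poly mat)" "j < dim_col (0\<^sub>m n n :: 'k poly mat)"
    then show "N $$ (i, j) = 0\<^sub>m n n $$ (i, j)" using z[of 0] by (auto intro: poly_eqI)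
  qed (use N in auto)
  then have cP: "cmat ?P = 0\<^sub>m n n" using CN c by simp
  show ?thesis
  proof (rule eq_matI)
    fix i j assume ij: "i < dim_row (0\<^sub>m n n :: 'k mat)" "j < dim_col (0\<^sub>m n n :: 'k mat)"
    have "cmat ?P $$ (i, j) = 0" unfolding cP using ij by simp
    then show "?P $$ (i, j) = 0\<^sub>m n n $$ (i, j)" using ij P by simp
  qed (use P in auto)
qed


section \<open>The structure theorem for primary modules\<close>

text \<open>If the generators satisfy a nontrivial relation, then the coefficient with the smallest power
  of \<open>p\<close> allows to replace its generator by one of smaller order.\<close>

lemma (in irreducible_poly) primary_generators:
  fixes scale :: "'k poly \<Rightarrow> 'v::ab_group_add \<Rightarrow> 'v" and v :: "'i \<Rightarrow> 'v" and l :: "'i \<Rightarrow> nat"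
  assumes mod: "Modules.module scale" and fin: "finite S" and v: "\<And>x. x \<in> S \<Longrightarrow> scale (p ^ l x) (v x) = 0"
  shows "\<exists>v' l'. (\<forall>x\<in>S. scale (p ^ l' x) (v' x) = 0) \<and>
    range (\<lambda>f. \<Sum>x\<in>S. scale (f x) (v' x)) = range (\<lambda>f. \<Sum>x\<in>S. scale (f x) (v x)) \<and>
    (\<forall>f. (\<Sum>x\<in>S. scale (f x) (v' x)) = 0 \<longrightarrow> (\<forall>x\<in>S. p ^ l' x dvd f x))"
  using v
proof (induction "\<Sum>x\<in>S. l x" arbitrary: v l rule: less_induct)
  case less
  interpret m: Modules.module scale by (rule mod)
  have sz: "scale g (v x) = 0" if xS: "x \<in> S" and dv: "p ^ l x dvd g" for g x
  proof -
    obtain h where g: "g = p ^ l x * h" using dv unfolding dvd_def by blast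
    have "scale g (v x) = scale h (scale (p ^ l x) (v x))" unfolding g m.scale_scale by (simp only: mult.commute)
    then show ?thesis unfolding less.prems[OF xS] by simp
  qed
  show ?case
  proof (cases "\<forall>f. (\<Sum>x\<in>S. scale (f x) (v x)) = 0 \<longrightarrow> (\<forall>x\<in>S. p ^ l x dvd f x)")
    case True
    then show ?thesis using less.prems by blast
  next
    case False
    then obtain f x1 where f: "(\<Sum>x\<in>S. scale (f x) (v x)) = 0" and x1: "x1 \<in> S" "\<not> p ^ l x1 dvd f x1" by blast
    define B where "B = {x \<in> S. \<not> p ^ l x dvd f x}"
    have "\<exists>a s. f x = p ^ a * s \<and> \<not> p dvd s \<and> a < l x" if x: "x \<in> B" for x
    proof -
      have "f x \<noteq> 0" using x unfolding B_def by auto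
      then obtain a s where s: "f x = p ^ a * s" "\<not> p dvd s" using factor_out_ex by blast
      have "\<not> l x \<le> a" using x s(1) unfolding B_def by (auto dest: le_imp_power_dvd[of "l x" a p])
      then show ?thesis using s by (intro exI[of _ a] exI[of _ s]) simp
    qed
    then obtain a s where as: "\<And>x. x \<in> B \<Longrightarrow> f x = p ^ a x * s x \<and> \<not> p dvd s x \<and> a x < l x" by metis
    obtain y where y: "y \<in> B" and min: "\<And>x. x \<in> B \<Longrightarrow> a y \<le> a x"
      using ex_has_least_nat[of "\<lambda>x. x \<in> B" x1 a] x1 unfolding B_def by auto
    have yS: "y \<in> S" using y unfolding B_def by blast
    \<comment> \<open>This is the relation divided by \<open>p ^ a y\<close>. The coefficients
      outside \<open>B\<close> annihilate their generators and are replaced by 0.\<close>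
    define c where "c x = (if x \<in> B then p ^ (a x - a y) * s x else 0)" for x
    define w where "w = (\<Sum>x\<in>S. scale (c x) (v x))"
    have cy: "c y = s y" unfolding c_def using y by simp
    have "scale (p ^ a y) w = (\<Sum>x\<in>S. scale (p ^ a y * c x) (v x))"
      unfolding w_def m.scale_sum_right by simp
    also have "\<dots> = (\<Sum>x\<in>S. scale (f x) (v x))"
    proof (rule sum.cong[OF refl])
      fix x assume x: "x \<in> S"
      show "scale (p ^ a y * c x) (v x) = scale (f x) (v x)"
      proof (cases "x \<in> B")
        case True
        then have "p ^ a y * c x = f x"
          using as[OF True] min[OF True] unfolding c_def by (simp add: mult.assoc[symmetric] power_add[symmetric])
        then show ?thesis by simp
      next
        case False
        then show ?thesis using sz[OF x] x unfolding c_def B_def by simp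
      qed
    qed
    finally have w0: "scale (p ^ a y) w = 0" using f by simp
    obtain h where h: "p ^ l y dvd h * s y - 1" using unit_mod[of "s y" "l y"] as[OF y] by blast
    have hy: "scale (h * c y) (v y) = v y"
    proof -
      have "scale (h * s y - 1) (v y) = 0" by (rule sz[OF yS h])
      then show ?thesis unfolding cy m.scale_left_diff_distrib by simp
    qed
    \<comment> \<open>\<open>w\<close> is killed by the smaller power \<open>p ^ a y\<close>. It
      spans the same module together with the other generators, since its coefficient
      \<open>c y = s y\<close> at \<open>v y\<close> is invertible modulo
      \<open>p ^ l y\<close>.\<close>
    let ?v = "v(y := w)" and ?l = "l(y := a y)"
    have ay: "a y < l y" using as[OF y] by blast
    have "(\<Sum>x\<in>S. ?l x) < (\<Sum>x\<in>S. l x)"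
      by (rule sum_strict_mono_ex1[OF fin]) (use ay yS in auto)
    moreover have "scale (p ^ ?l x) (?v x) = 0" if "x \<in> S" for x using w0 less.prems that by simp
    ultimately obtain v' l' where v': "\<forall>x\<in>S. scale (p ^ l' x) (v' x) = 0"
      "range (\<lambda>f. \<Sum>x\<in>S. scale (f x) (v' x)) = range (\<lambda>f. \<Sum>x\<in>S. scale (f x) (?v x))"
      "\<forall>f. (\<Sum>x\<in>S. scale (f x) (v' x)) = 0 \<longrightarrow> (\<forall>x\<in>S. p ^ l' x dvd f x)"
      using less.hyps[of ?l ?v] by blast
    have w_split: "w = scale (c y) (v y) + (\<Sum>x\<in>S - {y}. scale (c x) (v x))"
      unfolding w_def by (rule sum.remove[OF fin yS])
    have new: "(\<Sum>x\<in>S. scale (g x) (?v x)) = scale (g y) w + (\<Sum>x\<in>S - {y}. scale (g x) (v x))" for g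
      by (subst sum.remove[OF fin yS]) simp
    have old: "(\<Sum>x\<in>S. scale (g x) (v x)) = scale (g y) (v y) + (\<Sum>x\<in>S - {y}. scale (g x) (v x))" for g
      by (rule sum.remove[OF fin yS])
    have "range (\<lambda>f. \<Sum>x\<in>S. scale (f x) (?v x)) = range (\<lambda>f. \<Sum>x\<in>S. scale (f x) (v x))"
    proof (intro equalityI subsetI)
      fix t assume "t \<in> range (\<lambda>f. \<Sum>x\<in>S. scale (f x) (?v x))"
      then obtain g where "t = (\<Sum>x\<in>S. scale (g x) (?v x))" by blast
      then have "t = scale (g y) w + (\<Sum>x\<in>S - {y}. scale (g x) (v x))" unfolding new .
      also have "\<dots> = scale (g y * c y) (v y) + (\<Sum>x\<in>S - {y}. scale (g y * c x + g x) (v x))"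
        unfolding w_split by (simp add: m.scale_right_distrib m.scale_sum_right m.scale_left_distrib sum.distrib)
      also have "\<dots> = (\<Sum>x\<in>S. scale ((\<lambda>x. if x = y then g y * c y else g y * c x + g x) x) (v x))"
        unfolding old by (intro arg_cong2[of _ _ _ _ "(+)"] sum.cong) auto
      finally show "t \<in> range (\<lambda>f. \<Sum>x\<in>S. scale (f x) (v x))"
        by (rule image_eqI[OF _ UNIV_I, where f = "\<lambda>f. \<Sum>x\<in>S. scale (f x) (v x)"])
    next
      fix t assume "t \<in> range (\<lambda>f. \<Sum>x\<in>S. scale (f x) (v x))"
      then obtain g where "t = (\<Sum>x\<in>S. scale (g x) (v x))" by blast
      then have t: "t = scale (g y) (v y) + (\<Sum>x\<in>S - {y}. scale (g x) (v x))" unfolding old .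
      have "scale h w = v y + (\<Sum>x\<in>S - {y}. scale (h * c x) (v x))"
        unfolding w_split using hy by (simp add: m.scale_right_distrib m.scale_sum_right)
      then have vy: "v y = scale h w - (\<Sum>x\<in>S - {y}. scale (h * c x) (v x))" by simp
      have "t = scale (g y * h) w + (\<Sum>x\<in>S - {y}. scale (g x - g y * (h * c x)) (v x))"
        unfolding t by (subst vy) (simp add: m.scale_right_diff_distrib m.scale_sum_right m.scale_left_diff_distrib sum_subtractf)
      also have "\<dots> = (\<Sum>x\<in>S. scale ((\<lambda>x. if x = y then g y * h else g x - g y * (h * c x)) x) (?v x))"
        unfolding new by (intro arg_cong2[of _ _ _ _ "(+)"] sum.cong) auto
      finally show "t \<in> range (\<lambda>f. \<Sum>x\<in>S. scale (f x) (?v x))"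
        by (rule image_eqI[OF _ UNIV_I, where f = "\<lambda>f. \<Sum>x\<in>S. scale (f x) (?v x)"])
    qed
    then show ?thesis using v' by (intro exI[of _ v'] exI[of _ l']) simp
  qed
qed

text \<open>The parts are the sorted distinct values of \<open>l\<close>, and the copies of a part
  enumerate the fibre of \<open>l\<close> over it.\<close>

lemma exp_partition_of_family:
  fixes S :: "'i set" and l :: "'i \<Rightarrow> nat"
  assumes fin: "finite S" and ne: "S \<noteq> {}" and pos: "\<And>x. x \<in> S \<Longrightarrow> 0 < l x"
  obtains lam \<beta> where "exp_partition lam" "bij_betw \<beta> (summands lam) S"
    "\<And>x. x \<in> summands lam \<Longrightarrow> l (\<beta> x) = fst (lam ! fst x)"
proof -
  define vs where "vs = sorted_list_of_set (l ` S)"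
  define fib where "fib a = {x \<in> S. l x = a}" for a
  define lam where "lam = map (\<lambda>a. (a, card (fib a))) vs"
  have set_vs: "set vs = l ` S" and sorted: "sorted_wrt (<) vs"
    unfolding vs_def using fin by simp_all
  have ffib: "finite (fib a)" for a unfolding fib_def using fin by simp
  have "\<exists>g. bij_betw g {..<card (fib a)} (fib a)" for a
    using ex_bij_betw_nat_finite[OF ffib] by (simp add: atLeast0LessThan)
  then obtain g where g: "\<And>a. bij_betw (g a) {..<card (fib a)} (fib a)" by metis
  have len: "length lam = length vs" unfolding lam_def by simp
  have nth: "lam ! i = (vs ! i, card (fib (vs ! i)))" if "i < length vs" for i using that unfolding lam_def by simp
  have vsS: "vs ! i \<in> l ` S" if "i < length vs" for i using that set_vs nth_mem by blast
  show thesis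
  proof (rule that[of lam "\<lambda>(i, k). g (vs ! i) k"])
    have "map fst lam = vs" unfolding lam_def by (simp add: comp_def)
    moreover have "0 < a \<and> 0 < card (fib a)" if "a \<in> l ` S" for a
      using that pos ffib unfolding fib_def by (auto simp: card_gt_0_iff)
    ultimately show "exp_partition lam"
      unfolding exp_partition_def using sorted set_vs ne unfolding lam_def by auto
    have gi: "g (vs ! i) k \<in> fib (vs ! i)" if "k < card (fib (vs ! i))" for i k
      using g[of "vs ! i"] that unfolding bij_betw_def by blast
    have fib_S: "fib a \<subseteq> S" for a unfolding fib_def by blast
    have sm: "(i, k) \<in> summands lam \<longleftrightarrow> i < length vs \<and> k < card (fib (vs ! i))" for i k
      unfolding summands_def len using nth by auto
    show "l ((\<lambda>(i, k). g (vs ! i) k) x) = fst (lam ! fst x)" if "x \<in> summands lam" for x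
      using that gi nth by (cases x) (auto simp: sm fib_def)
    show "bij_betw (\<lambda>(i, k). g (vs ! i) k) (summands lam) S"
      unfolding bij_betw_def
    proof
      show "inj_on (\<lambda>(i, k). g (vs ! i) k) (summands lam)"
      proof (rule inj_onI, clarify)
        fix i k j m assume *: "(i, k) \<in> summands lam" "(j, m) \<in> summands lam" "g (vs ! i) k = g (vs ! j) m"
        then have "vs ! i = vs ! j" using gi[of k i] gi[of m j] unfolding sm fib_def by auto
        moreover have "distinct vs" unfolding vs_def by simp
        ultimately have "i = j" using * unfolding sm by (simp add: nth_eq_iff_index_eq)
        then show "i = j \<and> k = m" using * g[of "vs ! i"] unfolding sm bij_betw_def inj_on_def by auto
      qed
      show "(\<lambda>(i, k). g (vs ! i) k) ` summands lam = S"
      proof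
        show "(\<lambda>(i, k). g (vs ! i) k) ` summands lam \<subseteq> S" using gi fib_S by (fastforce simp: sm)
        show "S \<subseteq> (\<lambda>(i, k). g (vs ! i) k) ` summands lam"
        proof
          fix x assume x: "x \<in> S"
          then obtain i where i: "i < length vs" "vs ! i = l x" using set_vs by (metis imageI in_set_conv_nth)
          have "x \<in> fib (vs ! i)" unfolding fib_def using x i by simp
          then obtain k where "k < card (fib (vs ! i))" "x = g (vs ! i) k" using g[of "vs ! i"] unfolding bij_betw_def by blast
          then show "x \<in> (\<lambda>(i, k). g (vs ! i) k) ` summands lam" using i(1) sm[of i k] by force
        qed
      qed
    qed
  qed
qed

lemma ring_iso_inv_into:
  assumes R: "ring R" and h: "h \<in> ring_iso R S"
  shows "inv_into (carrier R) h \<in> ring_iso S R"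
proof -
  interpret ring R by (rule R)
  have hom: "h \<in> ring_hom R S" and b: "bij_betw h (carrier R) (carrier S)"
    using h unfolding ring_iso_def by auto
  have ex: "\<exists>r\<in>carrier R. x = h r" if "x \<in> carrier S" for x
    using that b unfolding bij_betw_def by blast
  have i: "inv_into (carrier R) h (h r) = r" if "r \<in> carrier R" for r
    by (rule bij_betw_inv_into_left[OF b that])
  have "inv_into (carrier R) h \<in> ring_hom S R"
  proof (rule ring_hom_memI)
    fix x y assume "x \<in> carrier S" "y \<in> carrier S"
    then obtain r s where r: "r \<in> carrier R" "x = h r" and s: "s \<in> carrier R" "y = h s" using ex by metis
    show "inv_into (carrier R) h (x \<otimes>\<^bsub>S\<^esub> y) = inv_into (carrier R) h x \<otimes>\<^bsub>R\<^esub> inv_into (carrier R) h y"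
      unfolding r(2) s(2) ring_hom_mult[OF hom r(1) s(1), symmetric] i[OF r(1)] i[OF s(1)]
      by (rule i[OF m_closed[OF r(1) s(1)]])
    show "inv_into (carrier R) h (x \<oplus>\<^bsub>S\<^esub> y) = inv_into (carrier R) h x \<oplus>\<^bsub>R\<^esub> inv_into (carrier R) h y"
      unfolding r(2) s(2) ring_hom_add[OF hom r(1) s(1), symmetric] i[OF r(1)] i[OF s(1)]
      by (rule i[OF a_closed[OF r(1) s(1)]])
  next
    fix x assume "x \<in> carrier S"
    then show "inv_into (carrier R) h x \<in> carrier R" using ex i by metis
  next
    show "inv_into (carrier R) h \<one>\<^bsub>S\<^esub> = \<one>\<^bsub>R\<^esub>"
      unfolding ring_hom_one[OF hom, symmetric] by (rule i[OF one_closed])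
  qed
  then show ?thesis unfolding ring_iso_def using bij_betw_inv_into[OF b] by blast
qed

text \<open>\<open>primary_generators\<close> makes the sum of the cyclic submodules direct.
  Generators with exponent 0 are zero and are discarded, because parts must be positive;
  \<open>y0\<close> ensures that some generator remains.\<close>

lemma (in separable_irreducible) module_partition:
  fixes scale :: "'k poly \<Rightarrow> 'v::ab_group_add \<Rightarrow> 'v" and v :: "'i \<Rightarrow> 'v" and l :: "'i \<Rightarrow> nat"
  assumes mod: "Modules.module scale" and fin: "finite S" and v: "\<And>x. x \<in> S \<Longrightarrow> scale (p ^ l x) (v x) = 0"
    and Y: "Y = range (\<lambda>f. \<Sum>x\<in>S. scale (f x) (v x))" and ne: "y0 \<in> Y" "y0 \<noteq> 0"
  obtains lam \<psi> where "exp_partition lam"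
    "bij_betw \<psi> (primary_module.V p (summands lam) (\<lambda>x. fst (lam ! fst x))) Y"
    "\<And>g h. \<psi> (g + h) = \<psi> g + \<psi> h"
    "\<And>f g. \<psi> (primary_module.act p (summands lam) (\<lambda>x. fst (lam ! fst x)) f g) = scale f (\<psi> g)"
proof -
  interpret m: Modules.module scale by (rule mod)
  obtain v' l' where v': "\<And>x. x \<in> S \<Longrightarrow> scale (p ^ l' x) (v' x) = 0"
    and Y': "Y = range (\<lambda>f. \<Sum>x\<in>S. scale (f x) (v' x))"
    and ind: "\<And>f x. (\<Sum>x\<in>S. scale (f x) (v' x)) = 0 \<Longrightarrow> x \<in> S \<Longrightarrow> p ^ l' x dvd f x"
  proof -
    obtain v' l' where *: "\<forall>x\<in>S. scale (p ^ l' x) (v' x) = 0"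
      "range (\<lambda>f. \<Sum>x\<in>S. scale (f x) (v' x)) = range (\<lambda>f. \<Sum>x\<in>S. scale (f x) (v x))"
      "\<forall>f. (\<Sum>x\<in>S. scale (f x) (v' x)) = 0 \<longrightarrow> (\<forall>x\<in>S. p ^ l' x dvd f x)"
      using primary_generators[OF mod fin v, of "\<lambda>x. x"] by blast
    show thesis by (rule that[of l' v']) (simp_all add: * Y)
  qed
  define S' where "S' = {x \<in> S. 0 < l' x}"
  have v'0: "scale f (v' x) = 0" if "x \<in> S - S'" for x f
    using v'[of x] that unfolding S'_def by simp
  have sumS': "(\<Sum>x\<in>S'. scale (f x) (v' x)) = (\<Sum>x\<in>S. scale (f x) (v' x))" for f
    by (rule sum.mono_neutral_left[OF fin]) (use v'0 S'_def in auto)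
  have finS': "finite S'" unfolding S'_def using fin by simp
  have "S' \<noteq> {}"
  proof
    assume "S' = {}"
    then have "y = 0" if "y \<in> Y" for y using that sumS' unfolding Y' by auto
    then show False using ne by blast
  qed
  then obtain lam \<beta> where lam: "exp_partition lam" and \<beta>: "bij_betw \<beta> (summands lam) S'"
    and l\<beta>: "\<And>x. x \<in> summands lam \<Longrightarrow> l' (\<beta> x) = fst (lam ! fst x)"
    using exp_partition_of_family[OF finS', of l'] unfolding S'_def by blast
  interpret L: lam_algebra p lam
    by (rule lam_algebra.intro[OF separable_irreducible_axioms lam_algebra_axioms.intro[OF lam]])
  define \<psi> where "\<psi> g = (\<Sum>x\<in>summands lam. scale (g x) (v' (\<beta> x)))" for g
  have sumI: "\<psi> (\<lambda>x. f (\<beta> x)) = (\<Sum>x\<in>S. scale (f x) (v' x))" for f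
    unfolding \<psi>_def sumS'[symmetric] by (rule sum.reindex_bij_betw[OF \<beta>])
  have kill: "scale f (v' (\<beta> x)) = scale g (v' (\<beta> x))" if x: "x \<in> summands lam" and d: "p ^ fst (lam ! fst x) dvd f - g" for f g x
  proof -
    have "\<beta> x \<in> S" using \<beta> x unfolding bij_betw_def S'_def by blast
    then have z: "scale (p ^ fst (lam ! fst x)) (v' (\<beta> x)) = 0" using v' l\<beta>[OF x] by metis
    obtain h where "f - g = p ^ fst (lam ! fst x) * h" using d unfolding dvd_def by blast
    then have "scale (f - g) (v' (\<beta> x)) = scale h (scale (p ^ fst (lam ! fst x)) (v' (\<beta> x)))"
      unfolding m.scale_scale by (simp only: mult.commute)
    then have "scale (f - g) (v' (\<beta> x)) = 0" unfolding z by simp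
    then show ?thesis unfolding m.scale_left_diff_distrib by simp
  qed
  have red: "\<psi> (L.M.red g) = \<psi> g" for g
    unfolding \<psi>_def by (rule sum.cong[OF refl], rule kill, assumption, rule L.M.red_dvd(1))
  have add: "\<psi> (g + h) = \<psi> g + \<psi> h" for g h
    unfolding \<psi>_def by (simp add: m.scale_left_distrib sum.distrib)
  have act: "\<psi> (L.M.act f g) = scale f (\<psi> g)" for f g
    unfolding L.M.act_def red unfolding \<psi>_def by (simp add: m.scale_sum_right)
  have bij: "bij_betw \<psi> L.M.V Y"
    unfolding bij_betw_def
  proof
    show "inj_on \<psi> L.M.V"
    proof (rule inj_onI)
      fix g h assume g: "g \<in> L.M.V" and h: "h \<in> L.M.V" and eq: "\<psi> g = \<psi> h"
      let ?f = "\<lambda>y. let x = inv_into (summands lam) \<beta> y in g x - h x"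
      have inv: "inv_into (summands lam) \<beta> (\<beta> x) = x" if "x \<in> summands lam" for x
        by (rule bij_betw_inv_into_left[OF \<beta> that])
      have "(\<Sum>x\<in>S. scale (?f x) (v' x)) = \<psi> (\<lambda>x. ?f (\<beta> x))" by (rule sumI[symmetric])
      also have "\<dots> = (\<Sum>x\<in>summands lam. scale (g x) (v' (\<beta> x)) - scale (h x) (v' (\<beta> x)))"
        unfolding \<psi>_def by (rule sum.cong[OF refl]) (simp add: inv m.scale_left_diff_distrib)
      also have "\<dots> = 0" using eq unfolding \<psi>_def sum_subtractf by simp
      finally have d: "p ^ l' y dvd ?f y" if "y \<in> S" for y by (rule ind[OF _ that, of ?f])
      show "g = h"
      proof (rule L.M.V_eqI[OF g h])
        fix x assume x: "x \<in> summands lam"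
        then have "\<beta> x \<in> S" using \<beta> unfolding bij_betw_def S'_def by blast
        then show "p ^ fst (lam ! fst x) dvd g x - h x" using d[of "\<beta> x"] l\<beta>[OF x] inv[OF x] by simp
      qed
    qed
    show "\<psi> ` L.M.V = Y"
    proof
      show "\<psi> ` L.M.V \<subseteq> Y"
      proof
        fix y assume "y \<in> \<psi> ` L.M.V"
        then obtain g where g: "y = \<psi> g" by blast
        have "\<psi> g = \<psi> (\<lambda>x. (\<lambda>y. g (inv_into (summands lam) \<beta> y)) (\<beta> x))"
          unfolding \<psi>_def by (rule sum.cong[OF refl]) (simp add: bij_betw_inv_into_left[OF \<beta>])
        also have "\<dots> \<in> Y"
          unfolding sumI[of "\<lambda>y. g (inv_into (summands lam) \<beta> y)"] Y' by (rule image_eqI[OF refl UNIV_I, where f = "\<lambda>f. \<Sum>x\<in>S. scale (f x) (v' x)"])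
        finally show "y \<in> Y" unfolding g .
      qed
      show "Y \<subseteq> \<psi> ` L.M.V"
      proof
        fix y assume "y \<in> Y"
        then obtain f where "y = (\<Sum>x\<in>S. scale (f x) (v' x))" unfolding Y' by blast
        then have "y = \<psi> (L.M.red (\<lambda>x. f (\<beta> x)))" unfolding red sumI .
        then show "y \<in> \<psi> ` L.M.V" using L.M.red_V by blast
      qed
    qed
  qed
  show thesis by (rule that[OF lam bij add act])
qed

lemma (in separable_irreducible) matrix_partition:
  assumes T: "(T :: 'k mat) \<in> carrier_mat n n" and n: "0 < n" and N: "pmat T (p ^ N) = 0\<^sub>m n n"
  obtains lam \<psi> where "exp_partition lam"
    "bij_betw \<psi> (primary_module.V p (summands lam) (\<lambda>x. fst (lam ! fst x))) (carrier_vec n)"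
    "\<And>g h. \<psi> (g + h) = \<psi> g + \<psi> h"
    "\<And>f g. \<psi> (primary_module.act p (summands lam) (\<lambda>x. fst (lam ! fst x)) f g) = pmat T f *\<^sub>v \<psi> g"
proof -
  \<comment> \<open>The locale of modules needs an action on a whole type; \<open>t\<close> acts as zero beyond the first \<open>n\<close> coordinates.\<close>
  define scale where "scale f v = (\<lambda>i. if i < n then (pmat T f *\<^sub>v vec n v) $ i else Polynomial.coeff f 0 * v i)"
    for f and v :: "nat \<Rightarrow> 'k"
  note P = pmat_carrier[OF T]
  have vec_scale: "vec n (scale f v) = pmat T f *\<^sub>v vec n v" for f v
    by (rule eq_vecI) (use P[of f] in \<open>auto simp: scale_def simp del: index_mult_mat_vec\<close>)
  have vec_add: "vec n (v + w) = vec n v + vec n w" for v w :: "nat \<Rightarrow> 'k" by (rule eq_vecI) auto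
  have mod: "Modules.module scale"
  proof
    fix f g :: "'k poly" and v w :: "nat \<Rightarrow> 'k"
    show "scale f (v + w) = scale f v + scale f w"
      unfolding scale_def vec_add mult_add_distrib_mat_vec[OF P vec_carrier vec_carrier]
      using P[of f] by (auto simp: distrib_left simp del: index_mult_mat_vec)
    show "scale (f + g) v = scale f v + scale g v"
      unfolding scale_def pmat_add[OF T] add_mult_distrib_mat_vec[OF P P vec_carrier]
      using P[of f] P[of g] by (auto simp: distrib_right simp del: index_mult_mat_vec)
    show "scale f (scale g v) = scale (f * g) v"
      unfolding scale_def[of f] vec_scale scale_def[of "f * g"] pmat_mult[OF T] assoc_mult_mat_vec[OF P P vec_carrier]
      by (auto simp: scale_def coeff_mult_0)
    show "scale 1 v = v" unfolding scale_def pmat_1[OF T] by auto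
  qed
  interpret m: Modules.module scale by (rule mod)
  define e where "e x = (\<lambda>i. if i = x then 1 else 0 :: 'k)" for x :: nat
  define Y where "Y = {v :: nat \<Rightarrow> 'k. \<forall>i\<ge>n. v i = 0}"
  have killed: "scale (p ^ N) (e x) = 0" if "x \<in> {..<n}" for x
  proof
    fix i show "scale (p ^ N) (e x) i = 0 i"
      using that unfolding scale_def N e_def by auto
  qed
  have sum_apply: "(\<Sum>x\<in>D. h x) i = (\<Sum>x\<in>D. h x i)" for D and h :: "nat \<Rightarrow> nat \<Rightarrow> 'k" and i
    by (induction D rule: infinite_finite_induct) auto
  have const: "scale [:a:] (e x) = (\<lambda>i. a * e x i)" if "x < n" for a x
  proof
    fix i
    have "(a \<cdot>\<^sub>m 1\<^sub>m n *\<^sub>v vec n (e x)) $ i = a * e x i" if "i < n"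
    proof -
      have "(a \<cdot>\<^sub>m 1\<^sub>m n *\<^sub>v vec n (e x)) $ i = (\<Sum>j<n. if j = i then a * e x j else 0)"
        using that by (auto simp: scalar_prod_def atLeast0LessThan if_distrib[of "\<lambda>z. a * z"] if_distrib[of "\<lambda>z. z * _"] cong: if_cong)
      then show ?thesis using that by simp
    qed
    then show "scale [:a:] (e x) i = a * e x i" unfolding scale_def pmat_const[OF T] by auto
  qed
  have Y: "Y = range (\<lambda>f. \<Sum>x\<in>{..<n}. scale (f x) (e x))"
  proof (intro equalityI subsetI)
    fix v assume v: "v \<in> Y"
    have "v = (\<Sum>x\<in>{..<n}. scale ((\<lambda>x. [:v x:]) x) (e x))"
    proof
      fix i
      have "(\<Sum>x\<in>{..<n}. scale [:v x:] (e x)) i = (\<Sum>x\<in>{..<n}. if x = i then v x else 0)"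
        unfolding sum_apply by (rule sum.cong[OF refl]) (simp add: const, simp add: e_def)
      then show "v i = (\<Sum>x\<in>{..<n}. scale ((\<lambda>x. [:v x:]) x) (e x)) i"
        using v unfolding Y_def by simp
    qed
    then show "v \<in> range (\<lambda>f. \<Sum>x\<in>{..<n}. scale (f x) (e x))"
      by (rule image_eqI[OF _ UNIV_I, where f = "\<lambda>f. \<Sum>x\<in>{..<n}. scale (f x) (e x)"])
  next
    fix v assume "v \<in> range (\<lambda>f. \<Sum>x\<in>{..<n}. scale (f x) (e x))"
    then obtain f where "v = (\<Sum>x\<in>{..<n}. scale (f x) (e x))" by blast
    then show "v \<in> Y" unfolding Y_def by (auto simp: sum_apply scale_def e_def intro!: sum.neutral)
  qed
  have e0: "e 0 \<in> Y" "e 0 \<noteq> 0" using n unfolding Y_def e_def by (auto simp: fun_eq_iff)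
  obtain lam \<psi> where *: "exp_partition lam"
    "bij_betw \<psi> (primary_module.V p (summands lam) (\<lambda>x. fst (lam ! fst x))) Y"
    "\<And>g h. \<psi> (g + h) = \<psi> g + \<psi> h"
    "\<And>f g. \<psi> (primary_module.act p (summands lam) (\<lambda>x. fst (lam ! fst x)) f g) = scale f (\<psi> g)"
    by (rule module_partition[OF mod finite_lessThan killed Y e0]) blast+
  have bv: "bij_betw (vec n) Y (carrier_vec n)"
  proof (rule bij_betw_byWitness[where f' = "\<lambda>u i. if i < n then vec_index u i else 0"])
    show "\<forall>v\<in>Y. (\<lambda>i. if i < n then vec_index (vec n v) i else 0) = v" unfolding Y_def by (auto simp: fun_eq_iff)
  qed (auto simp: Y_def)
  show thesis
  proof (rule that[of lam "vec n \<circ> \<psi>"])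
    show "bij_betw (vec n \<circ> \<psi>) (primary_module.V p (summands lam) (\<lambda>x. fst (lam ! fst x))) (carrier_vec n)"
      by (rule bij_betw_trans[OF *(2) bv])
  qed (simp_all add: * vec_add vec_scale)
qed

section \<open>Centralizer algebras and associated partitions\<close>

lemma centralizer_algebra_simps:
  assumes "A \<in> carrier_mat n n"
  shows "carrier (centralizer_algebra A) = {B \<in> carrier_mat n n. A * B = B * A}"
    "mult (centralizer_algebra A) = (*)" "add (centralizer_algebra A) = (+)"
    "one (centralizer_algebra A) = 1\<^sub>m n" "zero (centralizer_algebra A) = 0\<^sub>m n n"
  using assms unfolding centralizer_algebra_def module_mat_def by auto

lemma ring_centralizer_algebra:
  assumes A: "(A :: 'k::field mat) \<in> carrier_mat n n"
  shows "ring (centralizer_algebra A)"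
proof -
  interpret M: ring "ring_mat TYPE('k) n ()" by (rule ring_mat)
  let ?S = "{B \<in> carrier_mat n n. A * B = B * A}"
  have "subring ?S (ring_mat TYPE('k) n ())"
  proof (rule M.subringI, unfold ring_mat_simps)
    fix B C assume B: "B \<in> ?S" and C: "C \<in> ?S"
    show "B + C \<in> ?S" using A B C by (auto simp: mult_add_distrib_mat[OF A] add_mult_distrib_mat[OF _ _ A])
    have c: "A \<in> carrier_mat n n" "B \<in> carrier_mat n n" "C \<in> carrier_mat n n" "A * B = B * A" "A * C = C * A"
      using A B C by auto
    have "A * (B * C) = A * B * C" by (rule assoc_mult_mat[OF c(1,2,3), symmetric])
    also have "\<dots> = B * (A * C)" unfolding c(4) by (rule assoc_mult_mat[OF c(2,1,3)])
    also have "\<dots> = B * C * A" unfolding c(5) by (rule assoc_mult_mat[OF c(2,3,1), symmetric])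
    finally show "B * C \<in> ?S" using B C by auto
  next
    fix B assume B: "B \<in> ?S"
    have "\<ominus>\<^bsub>ring_mat TYPE('k) n ()\<^esub> B = - B"
      by (rule M.minus_equality) (use B in \<open>auto simp: ring_mat_simps\<close>)
    then show "\<ominus>\<^bsub>ring_mat TYPE('k) n ()\<^esub> B \<in> ?S" using A B by auto
  qed (use A in auto)
  then have "ring ((ring_mat TYPE('k) n ())\<lparr>carrier := ?S\<rparr>)" by (rule M.subring_is_ring)
  then show ?thesis
    by (rule ring_pullback[of _ "\<lambda>x. x"])
      (simp_all add: centralizer_algebra_simps[OF A] ring_mat_simps subringE[OF \<open>subring ?S (ring_mat TYPE('k) n ())\<close>, unfolded ring_mat_simps]
        del: mem_Collect_eq)
qed

lemma matrix_of_linear_map: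
  fixes L :: "'k::field vec \<Rightarrow> 'k vec"
  assumes cl: "\<And>v. v \<in> carrier_vec n \<Longrightarrow> L v \<in> carrier_vec m"
    and add: "\<And>v w. v \<in> carrier_vec n \<Longrightarrow> w \<in> carrier_vec n \<Longrightarrow> L (v + w) = L v + L w"
    and smult: "\<And>a v. v \<in> carrier_vec n \<Longrightarrow> L (a \<cdot>\<^sub>v v) = a \<cdot>\<^sub>v L v"
  shows "\<exists>B\<in>carrier_mat m n. \<forall>v\<in>carrier_vec n. B *\<^sub>v v = L v"
proof -
  define B where "B = mat m n (\<lambda>(i, j). vec_index (L (unit_vec n j)) i)"
  have B: "B \<in> carrier_mat m n" unfolding B_def by simp
  have L0: "L (0\<^sub>v n) = 0\<^sub>v m"
  proof -
    have "L (0\<^sub>v n) = L (0 \<cdot>\<^sub>v 0\<^sub>v n)" by (intro arg_cong[of _ _ L] eq_vecI) auto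
    also have "\<dots> = 0 \<cdot>\<^sub>v L (0\<^sub>v n)" by (rule smult) simp
    also have "\<dots> = 0\<^sub>v m" using cl[of "0\<^sub>v n"] by (intro eq_vecI) auto
    finally show ?thesis .
  qed
  have "B *\<^sub>v v = L v" if v: "v \<in> carrier_vec n" for v
  proof -
    \<comment> \<open>Induction on \<open>k\<close>, the number of leading coordinates of
      \<open>v\<close> that are kept while the others are set to 0.\<close>
    have "L (vec n (\<lambda>i. if i < k then vec_index v i else 0)) =
        vec m (\<lambda>i. \<Sum>j<k. vec_index v j * vec_index (L (unit_vec n j)) i)" if "k \<le> n" for k
      using that
    proof (induction k)
      case 0
      have "vec n (\<lambda>i. if i < 0 then vec_index v i else 0) = 0\<^sub>v n" by (rule eq_vecI) auto
      then show ?case using L0 by (auto intro!: eq_vecI)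
    next
      case (Suc k)
      have "vec n (\<lambda>i. if i < Suc k then vec_index v i else 0) =
          vec n (\<lambda>i. if i < k then vec_index v i else 0) + vec_index v k \<cdot>\<^sub>v unit_vec n k"
        by (rule eq_vecI) (use Suc.prems in \<open>auto simp: unit_vec_def less_Suc_eq\<close>)
      then have "L (vec n (\<lambda>i. if i < Suc k then vec_index v i else 0)) =
          L (vec n (\<lambda>i. if i < k then vec_index v i else 0)) + vec_index v k \<cdot>\<^sub>v L (unit_vec n k)"
        by (simp add: add smult)
      also have "\<dots> = vec m (\<lambda>i. \<Sum>j<Suc k. vec_index v j * vec_index (L (unit_vec n j)) i)"
        by (rule eq_vecI) (use Suc cl[of "unit_vec n k"] in auto)
      finally show ?case .
    qed
    from this[of n] have "L (vec n (\<lambda>i. if i < n then vec_index v i else 0)) =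
        vec m (\<lambda>i. \<Sum>j<n. vec_index v j * vec_index (L (unit_vec n j)) i)" by simp
    moreover have "vec n (\<lambda>i. if i < n then vec_index v i else 0) = v" using v by (auto intro!: eq_vecI)
    moreover have "B *\<^sub>v v = vec m (\<lambda>i. \<Sum>j<n. vec_index v j * vec_index (L (unit_vec n j)) i)"
      by (rule eq_vecI) (use v in \<open>auto simp: B_def scalar_prod_def atLeast0LessThan mult.commute\<close>)
    ultimately show ?thesis by simp
  qed
  then show ?thesis using B by blast
qed

lemma mat_eqI_mult_vec:
  assumes B: "(B :: 'k::field mat) \<in> carrier_mat m n" and C: "C \<in> carrier_mat m n"
    and eq: "\<And>v. v \<in> carrier_vec n \<Longrightarrow> B *\<^sub>v v = C *\<^sub>v v"
  shows "B = C"
proof (rule eq_matI)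
  fix i j assume ij: "i < dim_row C" "j < dim_col C"
  have "B *\<^sub>v unit_vec n j = C *\<^sub>v unit_vec n j" by (rule eq) simp
  then have "vec_index (B *\<^sub>v unit_vec n j) i = vec_index (C *\<^sub>v unit_vec n j) i" by simp
  then show "B $$ (i, j) = C $$ (i, j)" using ij B C by simp
qed (use B C in auto)

context separable_irreducible
begin

text \<open>The centralizer of \<open>T\<close> is the endomorphism ring of the column vectors as a
  K[t]-module. Through \<open>\<psi>\<close> it becomes End(V), and the inverse of
  \<open>L.H\<close> leads on to \<open>M_lam\<close>. The composite respects scalars because these
  act on all the modules involved as constant polynomials.\<close>

lemma associated_partition_exists:
  assumes T: "(T :: 'k mat) \<in> carrier_mat n n" and n: "0 < n" and N: "pmat T (p ^ N) = 0\<^sub>m n n"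
  shows "\<exists>lam. associated_partition p T lam"
proof -
  obtain lam \<psi> where lam: "exp_partition lam"
    and bij: "bij_betw \<psi> (primary_module.V p (summands lam) (\<lambda>x. fst (lam ! fst x))) (carrier_vec n)"
    and add: "\<And>g h. \<psi> (g + h) = \<psi> g + \<psi> h"
    and act: "\<And>f g. \<psi> (primary_module.act p (summands lam) (\<lambda>x. fst (lam ! fst x)) f g) = pmat T f *\<^sub>v \<psi> g"
    using matrix_partition[OF T n N] by blast
  interpret L: lam_algebra p lam
    by (rule lam_algebra.intro[OF separable_irreducible_axioms lam_algebra_axioms.intro[OF lam]])
  let ?C = "centralizer_algebra T"
  note s = centralizer_algebra_simps[OF T]
  note P = pmat_carrier[OF T]
  define h where "h = (\<lambda>r. \<lambda>g\<in>L.M.V. inv_into L.M.V \<psi> (r *\<^sub>v \<psi> g))"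
  have psi: "\<psi> g \<in> carrier_vec n" if "g \<in> L.M.V" for g using bij_betwE[OF bij] that by blast
  have comm: "r *\<^sub>v (pmat T f *\<^sub>v v) = pmat T f *\<^sub>v (r *\<^sub>v v)"
    if r: "r \<in> carrier_mat n n" "T * r = r * T" and v: "v \<in> carrier_vec n" for r f v
    unfolding assoc_mult_mat_vec[OF r(1) P v, symmetric] assoc_mult_mat_vec[OF P r(1) v, symmetric]
      pmat_commute[OF T r] ..
  \<comment> \<open>An endomorphism of \<open>V\<close> becomes a map of vectors that commutes with
    every polynomial in \<open>T\<close>. Constant polynomials make it linear, hence a matrix, and
    the polynomial \<open>t\<close> makes that matrix centralize \<open>T\<close>.\<close>
  have full: "\<exists>r\<in>carrier ?C. \<forall>g\<in>L.M.V. r *\<^sub>v \<psi> g = \<psi> (F g)" if F: "F \<in> carrier L.M.EV" for F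
  proof -
    let ?i = "inv_into L.M.V \<psi>"
    define \<Lambda> where "\<Lambda> v = \<psi> (F (?i v))" for v
    have i: "?i v \<in> L.M.V" "\<psi> (?i v) = v" if "v \<in> carrier_vec n" for v
      using bij_betw_inv_into_right[OF bij that] bij_betwE[OF bij_betw_inv_into[OF bij]] that by auto
    have lam_psi: "\<Lambda> (\<psi> g) = \<psi> (F g)" if "g \<in> L.M.V" for g
      unfolding \<Lambda>_def bij_betw_inv_into_left[OF bij that] ..
    note FD = L.M.EV_D[OF F]
    have cl: "\<Lambda> v \<in> carrier_vec n" if "v \<in> carrier_vec n" for v
      unfolding \<Lambda>_def by (rule psi[OF FD(2)[OF i(1)[OF that]]])
    have Ladd: "\<Lambda> (v + w) = \<Lambda> v + \<Lambda> w" if v: "v \<in> carrier_vec n" and w: "w \<in> carrier_vec n" for v w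
    proof -
      have "\<Lambda> (v + w) = \<Lambda> (\<psi> (?i v + ?i w))" unfolding add i(2)[OF v] i(2)[OF w] ..
      also have "\<dots> = \<Lambda> v + \<Lambda> w"
        unfolding lam_psi[OF L.M.V_add[OF i(1)[OF v] i(1)[OF w]]] FD(3)[OF i(1)[OF v] i(1)[OF w]] unfolding add \<Lambda>_def ..
      finally show ?thesis .
    qed
    have Lact: "\<Lambda> (pmat T f *\<^sub>v v) = pmat T f *\<^sub>v \<Lambda> v" if v: "v \<in> carrier_vec n" for f v
    proof -
      have "\<Lambda> (pmat T f *\<^sub>v v) = \<Lambda> (\<psi> (L.M.act f (?i v)))" unfolding act i(2)[OF v] ..
      also have "\<dots> = pmat T f *\<^sub>v \<Lambda> v"
        unfolding lam_psi[OF L.M.act_V] FD(4)[OF i(1)[OF v]] unfolding act \<Lambda>_def ..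
      finally show ?thesis .
    qed
    have sm: "pmat T [:a:] *\<^sub>v v = a \<cdot>\<^sub>v v" if "v \<in> carrier_vec n" for a v
      unfolding pmat_const[OF T] by (rule eq_vecI) (use that in auto)
    have Lsm: "\<Lambda> (a \<cdot>\<^sub>v v) = a \<cdot>\<^sub>v \<Lambda> v" if "v \<in> carrier_vec n" for a v
      using Lact[OF that, of "[:a:]"] unfolding sm[OF that] sm[OF cl[OF that]] .
    obtain r where r: "r \<in> carrier_mat n n" "\<And>v. v \<in> carrier_vec n \<Longrightarrow> r *\<^sub>v v = \<Lambda> v"
      using matrix_of_linear_map[of n \<Lambda> n, OF cl Ladd Lsm] by blast
    have "T * r = r * T"
    proof (rule mat_eqI_mult_vec)
      fix v :: "'k vec" assume v: "v \<in> carrier_vec n"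
      have Tv: "T *\<^sub>v v \<in> carrier_vec n" using T v by simp
      show "T * r *\<^sub>v v = r * T *\<^sub>v v"
        unfolding assoc_mult_mat_vec[OF T r(1) v] assoc_mult_mat_vec[OF r(1) T v] r(2)[OF v] r(2)[OF Tv]
        using Lact[OF v, of "[:0, 1:]"] unfolding pmat_X[OF T] by simp
    qed (use T r(1) in auto)
    then show ?thesis using r lam_psi psi unfolding s by auto
  qed
  have c: "r \<in> carrier_mat n n" "T * r = r * T" if "r \<in> carrier ?C" for r using that unfolding s by auto
  have clC: "r *\<^sub>v v \<in> carrier_vec n" if "r \<in> carrier ?C" "v \<in> carrier_vec n" for r v
    using c(1)[OF that(1)] that(2) by simp
  have addC: "r *\<^sub>v (v + w) = r *\<^sub>v v + r *\<^sub>v w"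
    if "r \<in> carrier ?C" "v \<in> carrier_vec n" "w \<in> carrier_vec n" for r v w
    by (rule mult_add_distrib_mat_vec[OF c(1)[OF that(1)] that(2,3)])
  have multC: "(r \<otimes>\<^bsub>?C\<^esub> q) *\<^sub>v v = r *\<^sub>v (q *\<^sub>v v)"
    if "r \<in> carrier ?C" "q \<in> carrier ?C" "v \<in> carrier_vec n" for r q v
    unfolding s by (rule assoc_mult_mat_vec[OF c(1)[OF that(1)] c(1)[OF that(2)] that(3)])
  have plusC: "(r \<oplus>\<^bsub>?C\<^esub> q) *\<^sub>v v = r *\<^sub>v v + q *\<^sub>v v"
    if "r \<in> carrier ?C" "q \<in> carrier ?C" "v \<in> carrier_vec n" for r q v
    unfolding s by (rule add_mult_distrib_mat_vec[OF c(1)[OF that(1)] c(1)[OF that(2)] that(3)])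
  have oneC: "\<one>\<^bsub>?C\<^esub> *\<^sub>v v = v" if "v \<in> carrier_vec n" for v using that unfolding s by simp
  have faithC: "r = q" if "r \<in> carrier ?C" "q \<in> carrier ?C" "\<And>v. v \<in> carrier_vec n \<Longrightarrow> r *\<^sub>v v = q *\<^sub>v v" for r q
    by (rule mat_eqI_mult_vec[OF c(1)[OF that(1)] c(1)[OF that(2)] that(3)])
  note iso = L.M.ring_iso_EV[where \<phi> = \<psi> and Y = "carrier_vec n" and padd = "(+)" and
    \<beta> = "\<lambda>f v. pmat T f *\<^sub>v v" and R = ?C and \<alpha> = "\<lambda>r v. r *\<^sub>v v", folded h_def,
    OF bij add act clC addC comm[OF c] multC plusC oneC faithC full]
  have h: "h \<in> ring_iso ?C L.M.EV" by (rule iso(1))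
  have psi_h: "\<psi> (h r g) = r *\<^sub>v \<psi> g" if "r \<in> carrier ?C" "g \<in> L.M.V" for r g
    using bij_betw_inv_into_right[OF bij clC[OF that(1) psi[OF that(2)]]] that(2) unfolding h_def by simp
  let ?H' = "inv_into (carrier L.R) L.H"
  define G where "G = ?H' \<circ> h"
  have G: "G \<in> ring_iso ?C L.R"
    unfolding G_def by (rule ring_iso_set_trans[OF h ring_iso_inv_into[OF L.R_ring L.H_iso]])
  have hEV: "h r \<in> carrier L.M.EV" if "r \<in> carrier ?C" for r
    using h that unfolding ring_iso_def by (auto simp: ring_hom_closed)
  have GR: "G r \<in> carrier L.R" if "r \<in> carrier ?C" for r
    using G that unfolding ring_iso_def by (auto simp: ring_hom_closed)
  have phiG: "G r (L.\<phi> g) = L.\<phi> (h r g)" if r: "r \<in> carrier ?C" and g: "g \<in> L.M.V" for r g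
  proof -
    have "bij_betw L.H (carrier L.R) (carrier L.M.EV)" using L.H_iso unfolding ring_iso_def by blast
    then have "L.H (G r) = h r" unfolding G_def comp_def using hEV[OF r] by (rule bij_betw_inv_into_right)
    then show ?thesis using L.phi_H[OF GR[OF r] g] by simp
  qed
  have "G (a \<cdot>\<^sub>m B) = cls [:a:] \<odot>\<^bsub>L.R\<^esub> G B" if B: "B \<in> carrier ?C" for a B
  proof (rule L.R_eqI)
    have aB: "a \<cdot>\<^sub>m B \<in> carrier ?C" using B T unfolding s
      by (auto simp: mult_smult_assoc_mat[of _ n n _ n] mult_smult_distrib[of _ n n _ n])
    show "G (a \<cdot>\<^sub>m B) \<in> extensional (carrier L.W)" by (rule L.R_D(4)[OF GR[OF aB]])
    show "cls [:a:] \<odot>\<^bsub>L.R\<^esub> G B \<in> extensional (carrier L.W)" unfolding L.R_simps by simp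
    fix g assume g: "g \<in> L.M.V"
    \<comment> \<open>Multiplication by \<open>a\<close> is the action of \<open>[:a:]\<close>,
      which \<open>L.\<phi>\<close> turns into multiplication by \<open>\<rho> [:a:]\<close>, the
      constant given by the class of \<open>a\<close>.\<close>
    have "h (a \<cdot>\<^sub>m B) g = L.M.act [:a:] (h B g)"
    proof (rule inj_onD[OF bij_betw_imp_inj_on[OF bij]])
      have B': "B \<in> carrier_mat n n" using B unfolding s by blast
      have Bg: "B *\<^sub>v \<psi> g \<in> carrier_vec n" using B' psi[OF g] by simp
      have "\<psi> (h (a \<cdot>\<^sub>m B) g) = (a \<cdot>\<^sub>m B) *\<^sub>v \<psi> g" by (rule psi_h[OF aB g])
      also have "\<dots> = (a \<cdot>\<^sub>m 1\<^sub>m n) *\<^sub>v (B *\<^sub>v \<psi> g)"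
        by (rule eq_vecI) (use B' psi[OF g] in auto)
      also have "B *\<^sub>v \<psi> g = \<psi> (h B g)" by (rule psi_h[OF B g, symmetric])
      finally show "\<psi> (h (a \<cdot>\<^sub>m B) g) = \<psi> (L.M.act [:a:] (h B g))" unfolding act pmat_const[OF T] .
    qed (use L.M.EV_D(2)[OF hEV[OF aB] g] in auto)
    then have "G (a \<cdot>\<^sub>m B) (L.\<phi> g) = \<rho> [:a:] \<odot>\<^bsub>L.W\<^esub> G B (L.\<phi> g)"
      unfolding phiG[OF aB g] phiG[OF B g] L.phi_act[symmetric] by simp
    then show "G (a \<cdot>\<^sub>m B) (L.\<phi> g) = (cls [:a:] \<odot>\<^bsub>L.R\<^esub> G B) (L.\<phi> g)"
      unfolding L.R_simps(6) rho.ev_const by (simp add: L.phi_W)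
  qed
  then show ?thesis unfolding associated_partition_def using lam G by blast
qed

lemma centralizer_of_associated_partition:
  assumes T: "(T :: 'k mat) \<in> carrier_mat n n" and ap: "associated_partition p T lam"
  shows "is_cartan_matrix (centralizer_algebra T) (min_matrix lam)"
    "is_block (centralizer_algebra T) (carrier (centralizer_algebra T))"
    "principal_indecomposable (centralizer_algebra T) Q \<Longrightarrow>
      \<exists>Ns. composition_series (centralizer_algebra T) (left_ideal_module (centralizer_algebra T) Q) Ns"
proof -
  obtain h where lam: "exp_partition lam" and h: "h \<in> ring_iso (centralizer_algebra T) (M_lam E lam)"
    using ap unfolding associated_partition_def by blast
  interpret L: lam_algebra p lam
    by (rule lam_algebra.intro[OF separable_irreducible_axioms lam_algebra_axioms.intro[OF lam]])
  note r = ring_centralizer_algebra[OF T]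
  show "is_cartan_matrix (centralizer_algebra T) (min_matrix lam)"
    unfolding is_cartan_matrix_def L.M_lam_cartan(2)[symmetric]
    using iso_pim_representatives[OF r L.R_ring h L.M_lam_cartan(1)] by metis
  show "is_block (centralizer_algebra T) (carrier (centralizer_algebra T))"
    by (rule iso_is_block_carrier[OF r L.R_ring h L.M_lam_cartan(3)])
  show "principal_indecomposable (centralizer_algebra T) Q \<Longrightarrow>
      \<exists>Ns. composition_series (centralizer_algebra T) (left_ideal_module (centralizer_algebra T) Q) Ns"
    by (rule iso_composition_series_exists[OF r L.R_ring h L.M_lam_composition_series])
qed

end

section \<open>Primary decompositions\<close>

text \<open>Suppose \<open>n < m\<close> and pad both matrices with zeros to size \<open>m\<close>.
  The padded \<open>Q\<close> is a left inverse of the padded \<open>P\<close>, hence also a right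
  inverse, but the product in that order has a zero row.\<close>

lemma left_inverse_dim_le:
  assumes P: "(P :: 'k::field mat) \<in> carrier_mat n m" and Q: "Q \<in> carrier_mat m n" and QP: "Q * P = 1\<^sub>m m"
  shows "m \<le> n"
proof (rule ccontr)
  assume "\<not> m \<le> n"
  then have nm: "n < m" by simp
  define P' where "P' = mat m m (\<lambda>(i, j). if i < n then P $$ (i, j) else 0)"
  define Q' where "Q' = mat m m (\<lambda>(i, j). if j < n then Q $$ (i, j) else 0)"
  have c: "P' \<in> carrier_mat m m" "Q' \<in> carrier_mat m m" unfolding P'_def Q'_def by auto
  have "Q' * P' = Q * P"
  proof (rule eq_matI)
    fix i j assume ij: "i < dim_row (Q * P)" "j < dim_col (Q * P)"
    have "(Q' * P') $$ (i, j) = (\<Sum>k<m. if k < n then Q $$ (i, k) * P $$ (k, j) else 0)"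
      using ij P Q by (auto simp: P'_def Q'_def scalar_prod_def atLeast0LessThan intro!: sum.cong)
    also have "\<dots> = (\<Sum>k<n. Q $$ (i, k) * P $$ (k, j))"
      by (rule sum.mono_neutral_cong_right) (use nm in auto)
    also have "\<dots> = (Q * P) $$ (i, j)"
      using ij P Q by (auto simp: scalar_prod_def atLeast0LessThan)
    finally show "(Q' * P') $$ (i, j) = (Q * P) $$ (i, j)" .
  qed (use P Q in \<open>auto simp: P'_def Q'_def\<close>)
  then have "P' * Q' = 1\<^sub>m m" using QP mat_mult_left_right_inverse[OF c(2,1)] by simp
  then have "(P' * Q') $$ (n, n) = 1" using nm by simp
  moreover have "(P' * Q') $$ (n, n) = 0"
    using nm unfolding P'_def Q'_def by (simp add: scalar_prod_def)
  ultimately show False by simp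
qed

text \<open>In a factorization \<open>E = U W\<close> with \<open>E U = U\<close> and minimal \<open>r\<close>, a nonzero column \<open>z\<close> of \<open>1 - W U\<close>
  satisfies \<open>U z = 0\<close> and could be used to eliminate one of the \<open>r\<close> indices.\<close>

lemma idempotent_factorization:
  assumes E: "(E :: 'k::field mat) \<in> carrier_mat n n" and idem: "E * E = E"
  obtains r U W where "U \<in> carrier_mat n r" "W \<in> carrier_mat r n" "E = U * W" "W * U = 1\<^sub>m r"
proof -
  define good where "good r \<longleftrightarrow> (\<exists>U W. U \<in> carrier_mat n r \<and> W \<in> carrier_mat r n \<and> E = U * W)" for r
  have "good n" unfolding good_def using E by (intro exI[of _ E] exI[of _ "1\<^sub>m n"]) simp
  then obtain r where r: "good r" and least: "\<And>s. good s \<Longrightarrow> r \<le> s"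
    using LeastI[of good n] Least_le[of good] by blast
  obtain U0 W where U0: "U0 \<in> carrier_mat n r" and W: "W \<in> carrier_mat r n" and EUW0: "E = U0 * W"
    using r unfolding good_def by blast
  \<comment> \<open>Multiplying by the idempotent keeps the factorization and ensures
    \<open>E * U = U\<close>.\<close>
  define U where "U = E * U0"
  have U: "U \<in> carrier_mat n r" unfolding U_def using E U0 by simp
  have EUW: "E = U * W"
    unfolding U_def assoc_mult_mat[OF E U0 W] EUW0[symmetric] idem ..
  have EU: "E * U = U"
    unfolding U_def assoc_mult_mat[OF E E U0, symmetric] idem ..
  have WU: "W * U \<in> carrier_mat r r" using U W by simp
  have UWU: "U * (W * U) = U"
    unfolding assoc_mult_mat[OF U W U, symmetric] EUW[symmetric] by (rule EU)
  have "W * U = 1\<^sub>m r"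
  proof (rule ccontr)
    assume neq: "W * U \<noteq> 1\<^sub>m r"
    define Z where "Z = 1\<^sub>m r - W * U"
    have Z: "Z \<in> carrier_mat r r" unfolding Z_def using WU by (rule minus_carrier_mat)
    have UZ: "U * Z = 0\<^sub>m n r"
      unfolding Z_def mult_minus_distrib_mat[OF U one_carrier_mat WU] UWU using U by simp
    have "\<exists>i j. i < r \<and> j < r \<and> Z $$ (i, j) \<noteq> 0"
    proof (rule ccontr)
      assume "\<not> ?thesis"
      then have z: "Z $$ (i, j) = 0" if "i < r" "j < r" for i j using that by blast
      have "(W * U) $$ (i, j) = 1\<^sub>m r $$ (i, j)" if "i < r" "j < r" for i j
        using z[OF that] that WU unfolding Z_def by (simp del: index_mult_mat index_one_mat)
      then have "W * U = 1\<^sub>m r" using WU by (intro eq_matI) auto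
      then show False using neq by blast
    qed
    then obtain i j where ij: "i < r" "j < r" "Z $$ (i, j) \<noteq> 0" by blast
    \<comment> \<open>A column of \<open>Z\<close>, scaled to have entry 1 at \<open>i\<close>; it
      lies in the kernel of \<open>U\<close>.\<close>
    define z where "z k = Z $$ (k, j) / Z $$ (i, j)" for k
    have zi: "z i = 1" unfolding z_def using ij by simp
    have Uz: "(\<Sum>k<r. U $$ (a, k) * z k) = 0" if "a < n" for a
    proof -
      have "(\<Sum>k<r. U $$ (a, k) * Z $$ (k, j)) = (U * Z) $$ (a, j)"
        using that ij U Z by (simp add: scalar_prod_def atLeast0LessThan)
      also have "\<dots> = 0" unfolding UZ using that ij by simp
      finally show ?thesis unfolding z_def times_divide_eq_right sum_divide_distrib[symmetric] by simp
    qed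
    obtain s where s: "r = Suc s" using ij by (cases r) auto
    define U' where "U' = mat n s (\<lambda>(a, k). U $$ (a, insert_index i k))"
    define W' where "W' = mat s n (\<lambda>(k, b). W $$ (insert_index i k, b) - z (insert_index i k) * W $$ (i, b))"
    have "E = U' * W'"
    proof (rule eq_matI)
      fix a b assume "a < dim_row (U' * W')" "b < dim_col (U' * W')"
      then have ab: "a < n" "b < n" unfolding U'_def W'_def by auto
      let ?f = "\<lambda>k. U $$ (a, k) * (W $$ (k, b) - z k * W $$ (i, b))"
      have "(U' * W') $$ (a, b) = (\<Sum>k<s. ?f (insert_index i k))"
        using ab unfolding U'_def W'_def by (simp add: scalar_prod_def atLeast0LessThan)
      also have "\<dots> = sum ?f (insert_index i ` {..<s})"
        by (rule sum.reindex[symmetric, unfolded comp_def]) (use insert_index_inj_on in blast)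
      also have "insert_index i ` {..<s} = {..<r} - {i}"
        using insert_index_image[of i s] ij(1) unfolding s by (simp add: atLeast0LessThan)
      also have "sum ?f ({..<r} - {i}) = sum ?f {..<r}"
        by (rule sum.mono_neutral_left) (use zi ij in auto)
      also have "\<dots> = (\<Sum>k<r. U $$ (a, k) * W $$ (k, b)) - (\<Sum>k<r. U $$ (a, k) * z k) * W $$ (i, b)"
        by (simp add: sum_subtractf sum_distrib_right right_diff_distrib mult.assoc)
      also have "\<dots> = (U * W) $$ (a, b)"
        using ab U W by (simp add: Uz scalar_prod_def atLeast0LessThan)
      finally show "E $$ (a, b) = (U' * W') $$ (a, b)" using EUW by simp
    qed (use E in \<open>auto simp: U'_def W'_def\<close>)
    then have "good s" unfolding good_def U'_def W'_def
      by (intro exI conjI) (auto simp: U'_def W'_def)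
    then show False using least[of s] s by simp
  qed
  then show thesis using that U W EUW by blast
qed

section \<open>Splitting a matrix by coprime annihilators\<close>

text \<open>The image of the idempotent \<open>U * W\<close> is invariant under \<open>T\<close>,
  since the two commute. \<open>W * T * U\<close> is the restriction of \<open>T\<close> to this
  image, in the coordinates given by the columns of \<open>U\<close>.\<close>

lemma pmat_compress:
  assumes T: "(T :: 'k::field mat) \<in> carrier_mat n n" and U: "U \<in> carrier_mat n r" and W: "W \<in> carrier_mat r n"
    and WU: "W * U = 1\<^sub>m r" and comm: "T * (U * W) = U * W * T"
  shows "T * U = U * (W * T * U)" "W * T = W * T * U * W" "pmat (W * T * U) f = W * pmat T f * U"
proof -
  have S: "W * T * U \<in> carrier_mat r r" using T U W by simp
  have UW: "U * W \<in> carrier_mat n n" "W * T \<in> carrier_mat r n" "T * U \<in> carrier_mat n r" using U W T by simp_all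
  have "U * (W * T * U) = U * (W * (T * U))" unfolding assoc_mult_mat[OF W T U] ..
  also have "\<dots> = U * W * T * U"
    unfolding assoc_mult_mat[OF U W UW(3), symmetric] assoc_mult_mat[OF UW(1) T U] ..
  also have "\<dots> = T * (U * W * U)" unfolding comm[symmetric] by (rule assoc_mult_mat[OF T UW(1) U])
  also have "U * W * U = U" unfolding assoc_mult_mat[OF U W U] WU using U by simp
  finally show TU: "T * U = U * (W * T * U)" ..
  have "W * T * U * W = W * (T * (U * W))"
    unfolding assoc_mult_mat[OF UW(2) U W] assoc_mult_mat[OF W T UW(1)] ..
  also have "\<dots> = W * (U * W) * T" unfolding comm by (rule assoc_mult_mat[OF W UW(1) T, symmetric])
  also have "W * (U * W) = W" unfolding assoc_mult_mat[OF W U W, symmetric] WU using W by simp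
  finally show "W * T = W * T * U * W" ..
  have "W * pmat T f * U = W * (pmat T f * U)" by (rule assoc_mult_mat[OF W pmat_carrier[OF T] U])
  also have "\<dots> = W * U * pmat (W * T * U) f"
    unfolding pmat_intertwine[OF T S U TU] by (rule assoc_mult_mat[OF W U pmat_carrier[OF S], symmetric])
  finally show "pmat (W * T * U) f = W * pmat T f * U" unfolding WU using left_mult_one_mat[OF pmat_carrier[OF S], of f] by simp
qed

text \<open>From \<open>a * f + b * g = 1\<close> the matrices \<open>(b g)(T)\<close> and
  \<open>(a f)(T)\<close> are complementary idempotents. \<open>f(T)\<close> kills the image of the
  first and \<open>g(T)\<close> that of the second; the two blocks are the compressions of
  \<open>T\<close> to these images.\<close>

lemma coprime_splitting:
  assumes T: "(T :: 'k::field mat) \<in> carrier_mat n n" and cop: "Rings.coprime f g" and fg: "pmat T (f * g) = 0\<^sub>m n n"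
  obtains r s T1 T2 where "T1 \<in> carrier_mat r r" "T2 \<in> carrier_mat s s" "pmat T1 f = 0\<^sub>m r r" "pmat T2 g = 0\<^sub>m s s"
    "similar_mat T (four_block_mat T1 (0\<^sub>m r s) (0\<^sub>m s r) T2)"
proof -
  obtain a b where ab: "a * f + b * g = 1" using coprime_bezout[OF cop] by blast
  note P = pmat_carrier[OF T]
  define E1 where "E1 = pmat T (b * g)"
  define E2 where "E2 = pmat T (a * f)"
  have E: "E1 \<in> carrier_mat n n" "E2 \<in> carrier_mat n n" unfolding E1_def E2_def by (rule P)+
  have sum: "E2 + E1 = 1\<^sub>m n" unfolding E1_def E2_def pmat_add[OF T, symmetric] ab pmat_1[OF T] ..
  have kill: "pmat T h = 0\<^sub>m n n" if "f * g dvd h" for h by (rule pmat_dvd_zero[OF T that fg])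
  have E12: "E1 * E2 = 0\<^sub>m n n" "E2 * E1 = 0\<^sub>m n n" "pmat T f * E1 = 0\<^sub>m n n" "pmat T g * E2 = 0\<^sub>m n n"
    unfolding E1_def E2_def pmat_mult[OF T, symmetric]
    by (rule kill, rule dvdI[of _ _ "a * b"], simp add: ac_simps)
      (rule kill, rule dvdI[of _ _ "a * b"], simp add: ac_simps, rule kill, rule dvdI[of _ _ b], simp add: ac_simps,
        rule kill, rule dvdI[of _ _ a], simp add: ac_simps)
  have idem: "E1 * E1 = E1" "E2 * E2 = E2"
  proof -
    have "E1 = (E2 + E1) * E1" unfolding sum using E by simp
    also have "\<dots> = E1 * E1" unfolding add_mult_distrib_mat[OF E(2,1,1)] E12 using E by simp
    finally show "E1 * E1 = E1" ..
    have "E2 = (E2 + E1) * E2" unfolding sum using E by simp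
    also have "\<dots> = E2 * E2" unfolding add_mult_distrib_mat[OF E(2,1,2)] E12 using E by simp
    finally show "E2 * E2 = E2" ..
  qed
  obtain r U1 W1 where U1: "U1 \<in> carrier_mat n r" "W1 \<in> carrier_mat r n" "E1 = U1 * W1" "W1 * U1 = 1\<^sub>m r"
    using idempotent_factorization[OF E(1) idem(1)] .
  obtain s U2 W2 where U2: "U2 \<in> carrier_mat n s" "W2 \<in> carrier_mat s n" "E2 = U2 * W2" "W2 * U2 = 1\<^sub>m s"
    using idempotent_factorization[OF E(2) idem(2)] .
  have abs: "E1 * U1 = U1" "E2 * U2 = U2" "W1 * E1 = W1" "W2 * E2 = W2"
  proof -
    show "E1 * U1 = U1" unfolding U1(3) assoc_mult_mat[OF U1(1,2,1)] U1(4) using U1 by simp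
    show "E2 * U2 = U2" unfolding U2(3) assoc_mult_mat[OF U2(1,2,1)] U2(4) using U2 by simp
    show "W1 * E1 = W1" unfolding U1(3) assoc_mult_mat[OF U1(2,1,2), symmetric] U1(4) using U1 by simp
    show "W2 * E2 = W2" unfolding U2(3) assoc_mult_mat[OF U2(2,1,2), symmetric] U2(4) using U2 by simp
  qed
  have re: "A * B * C * (D * F) = A * (B * (C * D)) * F"
    if A: "A \<in> carrier_mat a' n" and B: "B \<in> carrier_mat n n" and C: "C \<in> carrier_mat n n"
      and D: "D \<in> carrier_mat n n" and F: "F \<in> carrier_mat n b'" for A B C D F :: "'k mat" and a' b'
  proof -
    have AB: "A * B \<in> carrier_mat a' n" and DF: "D * F \<in> carrier_mat n b'" and CD: "C * D \<in> carrier_mat n n"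
      using that by auto
    have "A * B * C * (D * F) = A * B * (C * D * F)"
      unfolding assoc_mult_mat[OF AB C DF] assoc_mult_mat[OF C D F] ..
    also have "\<dots> = A * B * (C * D) * F" by (rule assoc_mult_mat[OF AB CD F, symmetric])
    finally show ?thesis unfolding assoc_mult_mat[OF A B CD] .
  qed
  have cross: "W1 * Y * U2 = 0\<^sub>m r s" "W2 * Y * U1 = 0\<^sub>m s r" if Y: "Y = pmat T h" for Y h
  proof -
    have Yc: "Y \<in> carrier_mat n n" unfolding Y by (rule P)
    have "E1 * Y * E2 = 0\<^sub>m n n" "E2 * Y * E1 = 0\<^sub>m n n"
      unfolding E1_def E2_def Y pmat_mult[OF T, symmetric] by (rule kill, rule dvdI[of _ _ "a * b * h"], simp add: ac_simps)+
    then have z: "E1 * (Y * E2) = 0\<^sub>m n n" "E2 * (Y * E1) = 0\<^sub>m n n"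
      using assoc_mult_mat[OF E(1) Yc E(2)] assoc_mult_mat[OF E(2) Yc E(1)] by simp_all
    have "W1 * Y * U2 = W1 * E1 * Y * (E2 * U2)" unfolding abs ..
    also have "\<dots> = W1 * (E1 * (Y * E2)) * U2"
      by (rule re[OF U1(2) E(1) Yc E(2) U2(1)])
    also have "\<dots> = 0\<^sub>m r s" unfolding z using U1 U2 by simp
    finally show "W1 * Y * U2 = 0\<^sub>m r s" .
    have "W2 * Y * U1 = W2 * E2 * Y * (E1 * U1)" unfolding abs ..
    also have "\<dots> = W2 * (E2 * (Y * E1)) * U1"
      by (rule re[OF U2(2) E(2) Yc E(1) U1(1)])
    also have "\<dots> = 0\<^sub>m s r" unfolding z using U1 U2 by simp
    finally show "W2 * Y * U1 = 0\<^sub>m s r" .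
  qed
  have commT: "T * pmat T h = pmat T h * T" for h
    using pmat_commute[OF T T refl, of h] by simp
  note c1 = pmat_compress[OF T U1(1,2,4), folded U1(3), OF commT[of "b * g", folded E1_def]]
  note c2 = pmat_compress[OF T U2(1,2,4), folded U2(3), OF commT[of "a * f", folded E2_def]]
  have WXU: "W1 * T * U1 \<in> carrier_mat r r" "W2 * T * U2 \<in> carrier_mat s s" using T U1 U2 by auto
  \<comment> \<open>These are \<open>[U\<^sub>1 U\<^sub>2]\<close> and the transposed arrangement of \<open>W\<^sub>1\<close> and \<open>W\<^sub>2\<close>: the other blocks are empty.\<close>
  let ?P = "four_block_mat U1 U2 (0\<^sub>m 0 r) (0\<^sub>m 0 s)" and ?Q = "four_block_mat W1 (0\<^sub>m r 0) W2 (0\<^sub>m s 0)"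
  have Pc: "?P \<in> carrier_mat n (r + s)" and Qc: "?Q \<in> carrier_mat (r + s) n"
    using four_block_carrier_mat[OF U1(1), of "0\<^sub>m 0 s" 0 s] four_block_carrier_mat[OF U1(2), of "0\<^sub>m s 0" s 0] by simp_all
  have "W1 * pmat T 1 * U2 = 0\<^sub>m r s" "W2 * pmat T 1 * U1 = 0\<^sub>m s r" by (rule cross[OF refl])+
  then have W12: "W1 * U2 = 0\<^sub>m r s" "W2 * U1 = 0\<^sub>m s r" using U1 U2 unfolding pmat_1[OF T] by simp_all
  have QP: "?Q * ?P = 1\<^sub>m (r + s)"
    unfolding mult_four_block_mat[OF U1(2) zero_carrier_mat U2(2) zero_carrier_mat U1(1) U2(1) zero_carrier_mat zero_carrier_mat]
      W12 U1(4) U2(4) by simp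
  have fb0: "four_block_mat (Y :: 'k mat) (0\<^sub>m n 0) (0\<^sub>m 0 n) (0\<^sub>m 0 0) = Y" if "Y \<in> carrier_mat n n" for Y
    by (rule eq_matI) (use that in auto)
  have PQ: "?P * ?Q = 1\<^sub>m n"
  proof -
    have "?P * ?Q = four_block_mat (E1 + E2) (0\<^sub>m n 0) (0\<^sub>m 0 n) (0\<^sub>m 0 0)"
      unfolding mult_four_block_mat[OF U1(1) U2(1) zero_carrier_mat zero_carrier_mat U1(2) zero_carrier_mat U2(2) zero_carrier_mat]
        U1(3)[symmetric] U2(3)[symmetric] using U1 U2 by simp
    also have "\<dots> = 1\<^sub>m n" using fb0[of "E1 + E2"] sum comm_add_mat[OF E] E by simp
    finally show ?thesis .
  qed
  have nrs: "n = r + s"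
    using left_inverse_dim_le[OF Pc Qc QP] left_inverse_dim_le[OF Qc Pc PQ] by simp
  have D: "?Q * T * ?P = four_block_mat (W1 * T * U1) (0\<^sub>m r s) (0\<^sub>m s r) (W2 * T * U2)"
  proof -
    have "T * ?P = four_block_mat T (0\<^sub>m n 0) (0\<^sub>m 0 n) (0\<^sub>m 0 0) * ?P" unfolding fb0[OF T] ..
    also have "\<dots> = four_block_mat (T * U1) (T * U2) (0\<^sub>m 0 r) (0\<^sub>m 0 s)"
      unfolding mult_four_block_mat[OF T zero_carrier_mat zero_carrier_mat zero_carrier_mat U1(1) U2(1) zero_carrier_mat zero_carrier_mat]
      using T U1 U2 by simp
    finally have TP: "T * ?P = four_block_mat (T * U1) (T * U2) (0\<^sub>m 0 r) (0\<^sub>m 0 s)" .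
    have TU: "T * U1 \<in> carrier_mat n r" "T * U2 \<in> carrier_mat n s" using T U1 U2 by auto
    have "W1 * pmat T [:0, 1:] * U2 = 0\<^sub>m r s" "W2 * pmat T [:0, 1:] * U1 = 0\<^sub>m s r" by (rule cross[OF refl])+
    then have WTU: "W1 * (T * U2) = 0\<^sub>m r s" "W2 * (T * U1) = 0\<^sub>m s r"
      unfolding pmat_X[OF T] assoc_mult_mat[OF U1(2) T U2(1)] assoc_mult_mat[OF U2(2) T U1(1)] by simp_all
    show ?thesis
      unfolding assoc_mult_mat[OF Qc T Pc] TP
        mult_four_block_mat[OF U1(2) zero_carrier_mat U2(2) zero_carrier_mat TU zero_carrier_mat zero_carrier_mat]
        WTU assoc_mult_mat[OF U1(2) T U1(1)] assoc_mult_mat[OF U2(2) T U2(1)]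
      using T U1 U2 by simp
  qed
  have "similar_mat T (four_block_mat (W1 * T * U1) (0\<^sub>m r s) (0\<^sub>m s r) (W2 * T * U2))"
    unfolding similar_mat_def D[symmetric]
  proof (intro exI)
    have Pn: "?P \<in> carrier_mat n n" and Qn: "?Q \<in> carrier_mat n n" using Pc Qc nrs by simp_all
    have QTP: "?Q * T * ?P \<in> carrier_mat n n" using Pn Qn T by (meson mult_carrier_mat)
    show "similar_mat_wit T (?Q * T * ?P) ?P ?Q"
    proof (rule similar_mat_witI[OF PQ _ _ T QTP Pn Qn])
      show "?Q * ?P = 1\<^sub>m n" using QP nrs by simp
      have QT: "?Q * T \<in> carrier_mat n n" using Qn T by simp
      have "?P * (?Q * T * ?P) * ?Q = ?P * (?Q * T) * (?P * ?Q)"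
        unfolding assoc_mult_mat[OF Pn QT Pn, symmetric]
        by (rule assoc_mult_mat[OF mult_carrier_mat[OF Pn QT] Pn Qn])
      also have "\<dots> = ?P * ?Q * T * (?P * ?Q)" unfolding assoc_mult_mat[OF Pn Qn T] ..
      finally show "T = ?P * (?Q * T * ?P) * ?Q" unfolding PQ using T by simp
    qed
  qed
  moreover have "pmat (W1 * T * U1) f = 0\<^sub>m r r"
  proof -
    have "W1 * pmat T f * U1 = W1 * (pmat T f * E1) * U1"
      using U1 P[of f] E abs(1) by (simp add: assoc_mult_mat[of _ r n _ n] assoc_mult_mat[of _ n n _ n])
    then show ?thesis unfolding c1(3) E12 using U1 by simp
  qed
  moreover have "pmat (W2 * T * U2) g = 0\<^sub>m s s"
  proof -
    have "W2 * pmat T g * U2 = W2 * (pmat T g * E2) * U2"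
      using U2 P[of g] E abs(2) by (simp add: assoc_mult_mat[of _ s n _ n] assoc_mult_mat[of _ n n _ n])
    then show ?thesis unfolding c2(3) E12 using U2 by simp
  qed
  ultimately show thesis using that WXU by blast
qed

text \<open>Multiplying two Bezout identities gives one for the product.\<close>

lemma coprime_poly_mult_left:
  fixes f g h :: "'k::field poly"
  assumes "Rings.coprime f h" "Rings.coprime g h"
  shows "Rings.coprime (f * g) h"
proof (rule Rings.coprimeI)
  fix d assume d: "d dvd f * g" "d dvd h"
  obtain a b where ab: "a * f + b * h = 1" using coprime_bezout[OF assms(1)] .
  obtain u v where uv: "u * g + v * h = 1" using coprime_bezout[OF assms(2)] .
  have "1 = (a * f + b * h) * (u * g + v * h)" unfolding ab uv by simp
  also have "\<dots> = (a * u) * (f * g) + (a * f * v + b * u * g + b * h * v) * h" by (simp add: algebra_simps)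
  finally have 1: "1 = (a * u) * (f * g) + (a * f * v + b * u * g + b * h * v) * h" .
  show "is_unit d" by (subst 1) (intro dvd_add dvd_mult d)
qed

lemma coprime_poly_prod_left:
  fixes f :: "'i \<Rightarrow> 'k::field poly"
  shows "(\<And>i. i \<in> S \<Longrightarrow> Rings.coprime (f i) h) \<Longrightarrow> Rings.coprime (\<Prod>i\<in>S. f i) h"
  by (induction S rule: infinite_finite_induct) (auto simp: coprime_poly_mult_left)

lemma coprime_poly_power:
  fixes f g :: "'k::field poly"
  assumes "Rings.coprime f g"
  shows "Rings.coprime (f ^ m) (g ^ n)"
proof -
  have *: "Rings.coprime (f ^ m) g" if "Rings.coprime f g" for f g :: "'k poly" and m
    using coprime_poly_prod_left[of "{..<m}" "\<lambda>_. f" g] that by simp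
  have "Rings.coprime g f" by (rule Rings.coprime_commute[THEN iffD1, OF assms])
  then have "Rings.coprime (g ^ n) f" by (rule *)
  then have "Rings.coprime f (g ^ n)" by (rule Rings.coprime_commute[THEN iffD1])
  then show ?thesis by (rule *)
qed

lemma primary_splitting:
  assumes "(T :: 'k::field mat) \<in> carrier_mat n n" "pmat T (\<Prod>k<m. f k) = 0\<^sub>m n n"
    and "\<And>j k. j < m \<Longrightarrow> k < m \<Longrightarrow> j \<noteq> k \<Longrightarrow> Rings.coprime (f j) (f k)"
  shows "\<exists>Ts. length Ts = m \<and> (\<forall>k<m. square_mat (Ts ! k) \<and> pmat (Ts ! k) (f k) = 0\<^sub>m (dim_row (Ts ! k)) (dim_row (Ts ! k))) \<and>
    similar_mat T (diag_block_mat Ts)"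
  using assms
proof (induction m arbitrary: T n)
  case 0
  \<comment> \<open>The empty product is the polynomial 1. That it annihilates \<open>T\<close>
    means that the matrix has size 0.\<close>
  then have "1\<^sub>m n = (0\<^sub>m n n :: 'k mat)" unfolding pmat_1[OF 0(1)] by (simp add: pmat_1[OF 0(1)])
  have "n = 0"
  proof (rule ccontr)
    assume "n \<noteq> 0"
    then have "(1\<^sub>m n :: 'k mat) $$ (0, 0) = 1" by simp
    then show False using \<open>1\<^sub>m n = (0\<^sub>m n n :: 'k mat)\<close> \<open>n \<noteq> 0\<close> by simp
  qed
  then have "T = diag_block_mat []" using 0(1) by (intro eq_matI) auto
  then have "similar_mat T (diag_block_mat [])" using similar_mat_refl[OF 0(1)] by simp
  then show ?case by (intro exI[of _ "[]"]) simp
next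
  case (Suc m)
  have cop: "Rings.coprime (\<Prod>k<m. f k) (f m)" by (rule coprime_poly_prod_left) (use Suc.prems(3) in auto)
  have z: "pmat T ((\<Prod>k<m. f k) * f m) = 0\<^sub>m n n" using Suc.prems(2) by simp
  obtain r s T1 T2 where T12: "T1 \<in> carrier_mat r r" "T2 \<in> carrier_mat s s"
    "pmat T1 (\<Prod>k<m. f k) = 0\<^sub>m r r" "pmat T2 (f m) = 0\<^sub>m s s"
    and sim: "similar_mat T (four_block_mat T1 (0\<^sub>m r s) (0\<^sub>m s r) T2)"
    by (rule coprime_splitting[OF Suc.prems(1) cop z])
  obtain Ts where Ts: "length Ts = m"
    "\<forall>k<m. square_mat (Ts ! k) \<and> pmat (Ts ! k) (f k) = 0\<^sub>m (dim_row (Ts ! k)) (dim_row (Ts ! k))"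
    "similar_mat T1 (diag_block_mat Ts)"
    using Suc.IH[OF T12(1,3)] Suc.prems(3) less_SucI by metis
  have D: "diag_block_mat Ts \<in> carrier_mat r r" using Ts(3) T12(1) unfolding similar_mat_def
    by (meson similar_mat_witD2(5))
  have "similar_mat (four_block_mat T1 (0\<^sub>m r s) (0\<^sub>m s r) T2) (four_block_mat (diag_block_mat Ts) (0\<^sub>m r s) (0\<^sub>m s r) T2)"
    by (rule similar_mat_four_block_0_0[OF Ts(3) similar_mat_refl[OF T12(2)] T12(1,2)])
  also have "four_block_mat (diag_block_mat Ts) (0\<^sub>m r s) (0\<^sub>m s r) T2 = diag_block_mat (Ts @ [T2])"
    unfolding diag_block_mat_last Let_def using D T12(2) by simp
  finally have "similar_mat T (diag_block_mat (Ts @ [T2]))" by (rule similar_mat_trans[OF sim])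
  then show ?case
    using Ts T12(2,4) by (intro exI[of _ "Ts @ [T2]"]) (auto simp: nth_append less_Suc_eq)
qed

section \<open>Factorization into monic irreducible polynomials\<close>

lemma monic_dvd_unit: "f dvd 1 \<Longrightarrow> Polynomial.lead_coeff f = 1 \<Longrightarrow> f = (1 :: 'k::field poly)"
  by (metis degree_eq_zeroE is_unit_iff_degree lead_coeff_pCons(2) not_is_unit_0 one_pCons)

lemma irreducible_monic_dvd_eq:
  fixes f g :: "'k::field poly"
  assumes "Factorial_Ring.irreducible f" "Factorial_Ring.irreducible g" "f dvd g"
    and "Polynomial.lead_coeff f = 1" "Polynomial.lead_coeff g = 1"
  shows "f = g"
proof -
  obtain c where c: "g = f * c" using assms(3) unfolding dvd_def by blast
  have "\<not> is_unit f" using assms(1) unfolding Factorial_Ring.irreducible_def by blast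
  then have "is_unit c" using assms(2) c by (auto dest: Factorial_Ring.irreducibleD)
  moreover have "Polynomial.lead_coeff c = 1" using assms(4,5) unfolding c lead_coeff_mult by simp
  ultimately show ?thesis using c monic_dvd_unit by fastforce
qed

lemma monic_irreducible_coprime:
  fixes f g :: "'k::field poly"
  assumes "Factorial_Ring.irreducible f" "Factorial_Ring.irreducible g" "f \<noteq> g"
    and "Polynomial.lead_coeff f = 1" "Polynomial.lead_coeff g = 1"
  shows "Rings.coprime f g"
proof (rule Rings.coprimeI)
  fix c assume c: "c dvd f" "c dvd g"
  have "\<not> f dvd g" using irreducible_monic_dvd_eq[OF assms(1,2) _ assms(4,5)] assms(3) by blast
  then have "\<not> f dvd c" using c(2) dvd_trans by blast
  then show "is_unit c" using Factorial_Ring.irreducibleD'[OF assms(1) c(1)] by blast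
qed

text \<open>A nonconstant divisor of least degree is irreducible; dividing by its leading
  coefficient makes it monic.\<close>

lemma monic_irreducible_factor_exists:
  fixes f :: "'k::field poly"
  assumes "0 < Polynomial.degree f"
  obtains q where "q \<in> irreducible_factors f"
proof -
  define Q where "Q g \<longleftrightarrow> g dvd f \<and> 0 < Polynomial.degree g" for g
  have "Q f" unfolding Q_def using assms by simp
  then obtain g where g: "Q g" "\<And>h. Q h \<Longrightarrow> Polynomial.degree g \<le> Polynomial.degree h"
    using ex_has_least_nat[of Q f Polynomial.degree] by blast
  have g0: "g \<noteq> 0" "0 < Polynomial.degree g" "g dvd f" using g(1) unfolding Q_def by auto
  have "Factorial_Ring.irreducible g"
  proof (rule Factorial_Ring.irreducibleI[OF g0(1)])
    show "\<not> is_unit g" using g0 is_unit_iff_degree by auto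
    fix a b assume ab: "g = a * b"
    then have nz: "a \<noteq> 0" "b \<noteq> 0" using g0 by auto
    have deg: "Polynomial.degree g = Polynomial.degree a + Polynomial.degree b"
      unfolding ab by (rule degree_mult_eq[OF nz])
    show "is_unit a \<or> is_unit b"
    proof (rule ccontr)
      assume "\<not> ?thesis"
      then have "0 < Polynomial.degree a" "0 < Polynomial.degree b" using nz is_unit_iff_degree by auto
      moreover have "a dvd f" using g0(3) ab by (metis dvd_mult_left)
      ultimately show False using g(2)[of a] deg unfolding Q_def by simp
    qed
  qed
  moreover define c where "c = inverse (Polynomial.lead_coeff g)"
  have c: "c \<noteq> 0" unfolding c_def using g0 by simp
  then have "[:c:] dvd 1" by (simp add: is_unit_poly_iff)
  then have u: "is_unit [:c:]" .
  have sm: "Polynomial.smult c g = g * [:c:]" by simp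
  ultimately have "Factorial_Ring.irreducible (Polynomial.smult c g)"
    unfolding sm using u by (simp only: irreducible_mult_unit_right)
  moreover have "Polynomial.lead_coeff (Polynomial.smult c g) = 1" unfolding c_def using g0 by simp
  moreover have "Polynomial.smult c g dvd f" using g0(3) c by (simp add: smult_dvd_iff)
  ultimately show thesis using that unfolding irreducible_factors_def by blast
qed

lemma monic_factorization:
  fixes f :: "'k::field poly"
  assumes "Polynomial.lead_coeff f = 1"
  shows "finite (irreducible_factors f) \<and> (\<exists>e. f = (\<Prod>q\<in>irreducible_factors f. q ^ e q))"
  using assms
proof (induction "Polynomial.degree f" arbitrary: f rule: less_induct)
  case less
  show ?case
  proof (cases "Polynomial.degree f = 0")
    case True
    then have f: "f = 1" using less.prems by (metis degree_eq_zeroE lead_coeff_pCons(2) one_pCons)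
    have "irreducible_factors f = {}"
      unfolding irreducible_factors_def f Factorial_Ring.irreducible_def by blast
    then show ?thesis using f by simp
  next
    case False
    then obtain q where q: "q \<in> irreducible_factors f" using monic_irreducible_factor_exists by blast
    then have q1: "Factorial_Ring.irreducible q" "Polynomial.lead_coeff q = 1" "q dvd f"
      unfolding irreducible_factors_def by auto
    obtain g where g: "f = q * g" using q1(3) unfolding dvd_def by blast
    interpret q: irreducible_poly q by (rule irreducible_poly.intro[OF q1(1)])
    have lg: "Polynomial.lead_coeff g = 1" using less.prems q1(2) unfolding g lead_coeff_mult by simp
    then have g0: "g \<noteq> 0" by auto
    have "0 < Polynomial.degree q" using q.p_nz q.p_nunit is_unit_iff_degree by auto
    then have "Polynomial.degree g < Polynomial.degree f" unfolding g degree_mult_eq[OF q.p_nz g0] by simp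
    from less.hyps[OF this lg] obtain e where fin: "finite (irreducible_factors g)"
      and e: "g = (\<Prod>q\<in>irreducible_factors g. q ^ e q)" by blast
    have ins: "irreducible_factors f = insert q (irreducible_factors g)"
    proof
      show "insert q (irreducible_factors g) \<subseteq> irreducible_factors f"
        using q unfolding irreducible_factors_def g by auto
      show "irreducible_factors f \<subseteq> insert q (irreducible_factors g)"
      proof
        fix r assume "r \<in> irreducible_factors f"
        then have r: "Factorial_Ring.irreducible r" "Polynomial.lead_coeff r = 1" "r dvd q * g"
          unfolding irreducible_factors_def g by auto
        then have "r dvd q \<or> r dvd g" using irreducible_poly.p_prime[OF irreducible_poly.intro[OF r(1)]] by blast
        then show "r \<in> insert q (irreducible_factors g)"
          using irreducible_monic_dvd_eq[OF r(1) q1(1) _ r(2) q1(2)] r unfolding irreducible_factors_def by blast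
      qed
    qed
    let ?S = "irreducible_factors g"
    \<comment> \<open>The exponent of \<open>q\<close> grows by one. If \<open>q\<close> is no
      factor of \<open>g\<close>, the value \<open>e q\<close> carries no information and the
      exponent is set to 1.\<close>
    let ?e = "\<lambda>r. if r = q then (if q \<in> ?S then Suc (e q) else 1) else e r"
    have "(\<Prod>r\<in>insert q ?S. r ^ ?e r) = q * g"
    proof (cases "q \<in> ?S")
      case True
      have "(\<Prod>r\<in>?S. r ^ ?e r) = q ^ Suc (e q) * (\<Prod>r\<in>?S - {q}. r ^ e r)"
        by (subst prod.remove[OF fin True]) (use True in simp)
      also have "\<dots> = q * (\<Prod>r\<in>?S. r ^ e r)"
        unfolding prod.remove[OF fin True, of "\<lambda>r. r ^ e r"] by (simp add: mult.assoc)
      finally show ?thesis using True e[symmetric] by (simp add: insert_absorb)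
    next
      case False
      then have "(\<Prod>r\<in>?S. r ^ ?e r) = (\<Prod>r\<in>?S. r ^ e r)" by (intro prod.cong) auto
      then show ?thesis using False fin e[symmetric] by simp
    qed
    then show ?thesis unfolding ins using fin g by (intro conjI exI[of _ ?e]) simp_all
  qed
qed

text \<open>Split \<open>f\<close> as \<open>p ^ a * s\<close> with \<open>s\<close> prime to
  \<open>p\<close>. Then \<open>s\<close> divides \<open>p ^ n\<close> and is invertible modulo
  \<open>p ^ n\<close>, so it is a unit; being monic, it is 1.\<close>

lemma (in irreducible_poly) monic_dvd_power_eq:
  assumes p: "Polynomial.lead_coeff p = 1" and f: "Polynomial.lead_coeff f = 1" "f dvd p ^ n"
  shows "\<exists>e. f = p ^ e"
proof -
  have "f \<noteq> 0" using f(1) by auto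
  then obtain a s where s: "f = p ^ a * s" "\<not> p dvd s" using factor_out_ex by blast
  obtain h where h: "p ^ n dvd h * s - 1" using unit_mod[OF s(2)] .
  have "s dvd p ^ n" using f(2) s(1) by (metis dvd_mult_right)
  then have "s dvd h * s - 1" using h by (rule dvd_trans)
  then have "s dvd h * s - (h * s - 1)" by (rule dvd_diff[OF dvd_triv_right])
  moreover have "h * s - (h * s - 1) = 1" by (simp only: diff_diff_eq2 add_diff_cancel_left')
  ultimately have "s dvd 1" by (simp only:)
  moreover have "Polynomial.lead_coeff s = 1"
    using f(1) p unfolding s(1) lead_coeff_mult lead_coeff_power by simp
  ultimately show ?thesis using s(1) monic_dvd_unit by fastforce
qed

lemma lead_coeff_char_poly: "(T :: 'k::field mat) \<in> carrier_mat n n \<Longrightarrow> Polynomial.lead_coeff (char_poly T) = 1"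
  using degree_monic_char_poly[of T n] by simp

text \<open>By Cayley-Hamilton the prime power factors of the characteristic polynomial split
  \<open>T\<close>. A block annihilated by a power of \<open>q\<close> has a characteristic
  polynomial that divides a power of \<open>q\<close> by \<open>char_poly_dvd_power\<close>, hence
  is itself such a power.\<close>

lemma primary_decomposition_exists:
  assumes T: "(T :: 'k::field mat) \<in> carrier_mat n n"
  shows "\<exists>ps Ts P Q. primary_decomposition T ps Ts P Q"
proof -
  let ?c = "char_poly T"
  obtain e where fin: "finite (irreducible_factors ?c)" and e: "?c = (\<Prod>q\<in>irreducible_factors ?c. q ^ e q)"
    using monic_factorization[OF lead_coeff_char_poly[OF T]] by blast
  obtain ps where ps: "set ps = irreducible_factors ?c" "distinct ps" using finite_distinct_list[OF fin] by blast
  let ?f = "\<lambda>k. (ps ! k) ^ e (ps ! k)"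
  have "bij_betw ((!) ps) {..<length ps} (irreducible_factors ?c)" unfolding ps(1)[symmetric] by (rule bij_betw_nth[OF ps(2) refl refl])
  then have "(\<Prod>k<length ps. ?f k) = ?c" by (subst e) (rule prod.reindex_bij_betw)
  then have z: "pmat T (\<Prod>k<length ps. ?f k) = 0\<^sub>m n n" using cayley_hamilton[OF T] by simp
  have psk: "Factorial_Ring.irreducible (ps ! k)" "Polynomial.lead_coeff (ps ! k) = 1" if "k < length ps" for k
    using ps(1) nth_mem[OF that] unfolding irreducible_factors_def by auto
  have cop: "Rings.coprime (?f j) (?f k)" if "j < length ps" "k < length ps" "j \<noteq> k" for j k
  proof -
    have "ps ! j \<noteq> ps ! k" using nth_eq_iff_index_eq[OF ps(2) that(1,2)] that(3) by blast
    then show ?thesis using psk that by (intro coprime_poly_power monic_irreducible_coprime) blast+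
  qed
  obtain Ts where Ts: "length Ts = length ps"
    "\<And>k. k < length ps \<Longrightarrow> square_mat (Ts ! k) \<and> pmat (Ts ! k) (?f k) = 0\<^sub>m (dim_row (Ts ! k)) (dim_row (Ts ! k))"
    "similar_mat T (diag_block_mat Ts)"
    using primary_splitting[OF T z cop] by blast
  obtain P Q where PQ: "similar_mat_wit T (diag_block_mat Ts) P Q" using Ts(3) unfolding similar_mat_def by blast
  have "\<exists>d. char_poly (Ts ! k) = ps ! k ^ d" if k: "k < length ps" for k
  proof -
    interpret irreducible_poly "ps ! k" by (rule irreducible_poly.intro[OF psk(1)[OF k]])
    have c: "Ts ! k \<in> carrier_mat (dim_row (Ts ! k)) (dim_row (Ts ! k))" using Ts(2)[OF k] by auto
    have "char_poly (Ts ! k) dvd ps ! k ^ (e (ps ! k) * dim_row (Ts ! k))"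
      unfolding power_mult by (rule char_poly_dvd_power[OF c]) (use Ts(2)[OF k] in blast)
    then show ?thesis by (rule monic_dvd_power_eq[OF psk(2)[OF k] lead_coeff_char_poly[OF c]])
  qed
  then have "primary_decomposition T ps Ts P Q"
    unfolding primary_decomposition_def using ps Ts(1,2) PQ by simp
  then show ?thesis by blast
qed

section \<open>Block diagonal matrices\<close>

definition block_offset :: "'a mat list \<Rightarrow> nat \<Rightarrow> nat" where
  "block_offset As k = sum_list (map dim_row (take k As))"

lemma block_offset_simps: "block_offset As 0 = 0" "block_offset (A # As) (Suc k) = dim_row A + block_offset As k"
  unfolding block_offset_def by simp_all

lemma block_offset_bound:
  "k < length As \<Longrightarrow> a < dim_row (As ! k) \<Longrightarrow> block_offset As k + a < sum_list (map dim_row As)"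
proof (induction As arbitrary: k)
  case (Cons A As)
  then show ?case by (cases k) (auto simp: block_offset_simps)
qed simp

lemma block_offset_cover:
  "i < sum_list (map dim_row As) \<Longrightarrow> \<exists>k<length As. \<exists>a<dim_row (As ! k). i = block_offset As k + a"
proof (induction As arbitrary: i)
  case (Cons A As)
  show ?case
  proof (cases "i < dim_row A")
    case True
    then show ?thesis by (intro exI[of _ 0]) (simp add: block_offset_simps)
  next
    case False
    then have "i - dim_row A < sum_list (map dim_row As)" using Cons.prems by simp
    then obtain k a where "k < length As" "a < dim_row (As ! k)" "i - dim_row A = block_offset As k + a"
      using Cons.IH by blast
    then show ?thesis using False by (intro exI[of _ "Suc k"]) (auto simp: block_offset_simps)
  qed
qed simp

lemma block_offset_inj:
  "\<lbrakk>j < length As; k < length As; a < dim_row (As ! j); b < dim_row (As ! k);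
    block_offset As j + a = block_offset As k + b\<rbrakk> \<Longrightarrow> j = k \<and> a = b"
proof (induction As arbitrary: j k)
  case (Cons A As)
  then show ?case by (cases j; cases k) (auto simp: block_offset_simps)
qed simp

lemma block_offset_cong: "map dim_row As = map dim_row Bs \<Longrightarrow> block_offset As = block_offset Bs"
  unfolding block_offset_def take_map[symmetric] fun_eq_iff by (simp add: take_map[symmetric])

lemma diag_block_mat_entry:
  "\<lbrakk>\<And>A. A \<in> set As \<Longrightarrow> square_mat A; j < length As; k < length As; a < dim_row (As ! j); b < dim_row (As ! k)\<rbrakk> \<Longrightarrow>
    diag_block_mat As $$ (block_offset As j + a, block_offset As k + b) = (if j = k then As ! k $$ (a, b) else 0)"
proof (induction As arbitrary: j k)
  case (Cons A As)
  have sq: "dim_col A = dim_row A" "dim_col (As ! i) = dim_row (As ! i)" if "i < length As" for i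
    using Cons.prems(1) that by auto
  have sqs: "map dim_col As = map dim_row As" using Cons.prems(1) by auto
  have dims: "dim_row (diag_block_mat As) = sum_list (map dim_row As)" "dim_col (diag_block_mat As) = sum_list (map dim_row As)"
    using dim_diag_block_mat[of As] sqs by simp_all
  have A: "dim_col A = dim_row A" using Cons.prems(1) by auto
  show ?case
    using Cons.prems(2-) block_offset_bound[of _ As] Cons.IH[OF Cons.prems(1)] A dims
    by (cases j; cases k) (auto simp: block_offset_simps Let_def)
qed simp

section \<open>Abstract block coordinates\<close>

text \<open>\<open>R k\<close> reads off the coordinates of block \<open>k\<close> and
  \<open>C k\<close> inserts them. Joint injectivity on both sides expresses that the sum of the
  \<open>C k * R k\<close> is the identity, without sums of matrices.\<close>

locale block_embedding =
  fixes n m :: nat and d :: "nat \<Rightarrow> nat" and R C :: "nat \<Rightarrow> 'k::field mat"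
  assumes R_carrier: "k < m \<Longrightarrow> R k \<in> carrier_mat (d k) n"
    and C_carrier: "k < m \<Longrightarrow> C k \<in> carrier_mat n (d k)"
    and RC: "j < m \<Longrightarrow> k < m \<Longrightarrow> R j * C k = (if j = k then 1\<^sub>m (d k) else 0\<^sub>m (d j) (d k))"
    and row_inj: "\<lbrakk>M \<in> carrier_mat n q; M' \<in> carrier_mat n q; \<And>k. k < m \<Longrightarrow> R k * M = R k * M'\<rbrakk> \<Longrightarrow> M = M'"
    and col_inj: "\<lbrakk>M \<in> carrier_mat q n; M' \<in> carrier_mat q n; \<And>k. k < m \<Longrightarrow> M * C k = M' * C k\<rbrakk> \<Longrightarrow> M = M'"
begin

definition diagonal :: "'k mat \<Rightarrow> (nat \<Rightarrow> 'k mat) \<Rightarrow> bool" where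
  "diagonal M B \<longleftrightarrow> M \<in> carrier_mat n n \<and> (\<forall>k<m. B k \<in> carrier_mat (d k) (d k)) \<and>
    (\<forall>j<m. \<forall>k<m. R j * M * C k = (if j = k then B k else 0\<^sub>m (d j) (d k)))"

lemma diagonalD:
  assumes "diagonal M B"
  shows "M \<in> carrier_mat n n" "\<And>k. k < m \<Longrightarrow> B k \<in> carrier_mat (d k) (d k)"
    "\<And>j k. j < m \<Longrightarrow> k < m \<Longrightarrow> R j * M * C k = (if j = k then B k else 0\<^sub>m (d j) (d k))"
  using assms unfolding diagonal_def by blast+

lemma diagonal_cong: "diagonal M B \<Longrightarrow> (\<And>k. k < m \<Longrightarrow> B k = B' k) \<Longrightarrow> diagonal M B'"
  unfolding diagonal_def by simp

lemma diagonal_C: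
  assumes M: "diagonal M B" and k: "k < m"
  shows "M * C k = C k * B k"
proof (rule row_inj)
  note D = diagonalD[OF M] and c = C_carrier[OF k]
  show "M * C k \<in> carrier_mat n (d k)" "C k * B k \<in> carrier_mat n (d k)" using D(1) D(2)[OF k] c by auto
  fix j assume j: "j < m"
  show "R j * (M * C k) = R j * (C k * B k)"
    unfolding assoc_mult_mat[OF R_carrier[OF j] D(1) c, symmetric] D(3)[OF j k]
      assoc_mult_mat[OF R_carrier[OF j] c D(2)[OF k], symmetric] RC[OF j k]
    using D(2)[OF k] by simp
qed

lemma diagonal_R:
  assumes M: "diagonal M B" and k: "k < m"
  shows "R k * M = B k * R k"
proof (rule col_inj)
  note D = diagonalD[OF M] and c = R_carrier[OF k]
  show "R k * M \<in> carrier_mat (d k) n" "B k * R k \<in> carrier_mat (d k) n" using D(1) D(2)[OF k] c by auto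
  fix j assume j: "j < m"
  show "R k * M * C j = B k * R k * C j"
    unfolding D(3)[OF k j] assoc_mult_mat[OF D(2)[OF k] c C_carrier[OF j]] RC[OF k j]
    by (cases "k = j") (use D(2)[OF k] in auto)
qed

lemma diagonal_mult:
  assumes M: "diagonal M B" and M': "diagonal M' B'"
  shows "diagonal (M * M') (\<lambda>k. B k * B' k)"
  unfolding diagonal_def
proof (intro conjI allI impI)
  note D = diagonalD[OF M] and D' = diagonalD[OF M']
  show "M * M' \<in> carrier_mat n n" using D(1) D'(1) by simp
  show "B k * B' k \<in> carrier_mat (d k) (d k)" if "k < m" for k using D(2)[OF that] D'(2)[OF that] by simp
  fix j k assume j: "j < m" and k: "k < m"
  have RM: "R j * M \<in> carrier_mat (d j) n" using R_carrier[OF j] D(1) by simp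
  have "R j * (M * M') * C k = R j * M * (M' * C k)"
    unfolding assoc_mult_mat[OF R_carrier[OF j] D(1) D'(1), symmetric] by (rule assoc_mult_mat[OF RM D'(1) C_carrier[OF k]])
  also have "\<dots> = R j * M * C k * B' k"
    unfolding diagonal_C[OF M' k] by (rule assoc_mult_mat[OF RM C_carrier[OF k] D'(2)[OF k], symmetric])
  also have "\<dots> = (if j = k then B k * B' k else 0\<^sub>m (d j) (d k))"
    unfolding D(3)[OF j k] using D'(2)[OF k] by simp
  finally show "R j * (M * M') * C k = (if j = k then B k * B' k else 0\<^sub>m (d j) (d k))" .
qed

lemma diagonal_unique:
  assumes M: "diagonal M B" and M': "diagonal M' B'" and eq: "\<And>k. k < m \<Longrightarrow> B k = B' k"
  shows "M = M'"
  by (rule col_inj[OF diagonalD(1)[OF M] diagonalD(1)[OF M']])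
    (simp add: diagonal_C[OF M] diagonal_C[OF M'] eq)

lemma diagonal_one: "diagonal (1\<^sub>m n) (\<lambda>k. 1\<^sub>m (d k))"
  unfolding diagonal_def
proof (intro conjI allI impI)
  fix j k assume j: "j < m" and k: "k < m"
  show "R j * 1\<^sub>m n * C k = (if j = k then 1\<^sub>m (d k) else 0\<^sub>m (d j) (d k))"
    unfolding right_mult_one_mat[OF R_carrier[OF j]] by (rule RC[OF j k])
qed auto

end

locale primary_blocks = block_embedding n m d R C for n m d and R C :: "nat \<Rightarrow> 'k::field mat" +
  fixes T :: "'k mat" and S :: "nat \<Rightarrow> 'k mat" and f :: "nat \<Rightarrow> 'k poly"
  assumes T: "diagonal T S"
    and ann: "k < m \<Longrightarrow> pmat (S k) (f k) = 0\<^sub>m (d k) (d k)"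
    and cop: "j < m \<Longrightarrow> k < m \<Longrightarrow> j \<noteq> k \<Longrightarrow> Rings.coprime (f j) (f k)"
begin

lemmas T_carrier = diagonalD(1)[OF T] and S_carrier = diagonalD(2)[OF T]

lemma centralizer_block_intertwines:
  assumes r: "r \<in> carrier_mat n n" "T * r = r * T" and j: "j < m" and k: "k < m"
  shows "S j * (R j * r * C k) = R j * r * C k * S k"
proof -
  note Rj = R_carrier[OF j] and Ck = C_carrier[OF k] and Sj = S_carrier[OF j] and Sk = S_carrier[OF k]
  have Rr: "R j * r \<in> carrier_mat (d j) n" using Rj r(1) by simp
  have "S j * (R j * r * C k) = S j * R j * r * C k"
    unfolding assoc_mult_mat[OF Sj Rr Ck, symmetric] assoc_mult_mat[OF Sj Rj r(1)] ..
  also have "S j * R j * r = R j * r * T"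
    unfolding diagonal_R[OF T j, symmetric] assoc_mult_mat[OF Rj T_carrier r(1)] r(2)
    by (rule assoc_mult_mat[OF Rj r(1) T_carrier, symmetric])
  also have "R j * r * T * C k = R j * r * C k * S k"
    unfolding assoc_mult_mat[OF Rr T_carrier Ck] diagonal_C[OF T k]
    by (rule assoc_mult_mat[OF Rr Ck Sk, symmetric])
  finally show ?thesis .
qed

text \<open>The off-diagonal blocks intertwine matrices with coprime annihilators, and so vanish.\<close>

lemma centralizer_diagonal:
  assumes r: "r \<in> carrier (centralizer_algebra T)"
  shows "diagonal r (\<lambda>k. R k * r * C k)"
proof -
  have rc: "r \<in> carrier_mat n n" "T * r = r * T" using r unfolding centralizer_algebra_simps[OF T_carrier] by auto
  have "R j * r * C k = 0\<^sub>m (d j) (d k)" if j: "j < m" and k: "k < m" and jk: "j \<noteq> k" for j k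
  proof -
    let ?Y = "R j * r * C k"
    note Sj = S_carrier[OF j] and Sk = S_carrier[OF k]
    have Y: "?Y \<in> carrier_mat (d j) (d k)" using R_carrier[OF j] C_carrier[OF k] rc(1) by simp
    obtain a b where ab: "a * f j + b * f k = 1" using coprime_bezout[OF cop[OF j k jk]] .
    have inter: "pmat (S j) g * ?Y = ?Y * pmat (S k) g" for g
      by (rule pmat_intertwine[OF Sj Sk Y centralizer_block_intertwines[OF rc j k]])
    have z: "pmat (S j) (a * f j) = 0\<^sub>m (d j) (d j)" "pmat (S k) (b * f k) = 0\<^sub>m (d k) (d k)"
      using pmat_dvd_zero[OF Sj dvd_triv_right ann[OF j]] pmat_dvd_zero[OF Sk dvd_triv_right ann[OF k]] by blast+
    have "?Y = pmat (S j) (a * f j + b * f k) * ?Y" unfolding ab pmat_1[OF Sj] left_mult_one_mat[OF Y] ..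
    also have "\<dots> = pmat (S j) (a * f j) * ?Y + pmat (S j) (b * f k) * ?Y"
      unfolding pmat_add[OF Sj] by (rule add_mult_distrib_mat[OF pmat_carrier[OF Sj] pmat_carrier[OF Sj] Y])
    also have "\<dots> = 0\<^sub>m (d j) (d k)" unfolding inter[of "b * f k"] z left_mult_zero_mat[OF Y] right_mult_zero_mat[OF Y] by simp
    finally show ?thesis .
  qed
  then show ?thesis unfolding diagonal_def
    using rc(1) mult_carrier_mat[OF mult_carrier_mat[OF R_carrier rc(1)] C_carrier] by simp
qed

lemma block_in_centralizer:
  assumes r: "r \<in> carrier (centralizer_algebra T)" and k: "k < m"
  shows "R k * r * C k \<in> carrier (centralizer_algebra (S k))"
  using centralizer_block_intertwines[of r k k] r k R_carrier[OF k] C_carrier[OF k]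
  unfolding centralizer_algebra_simps[OF T_carrier] centralizer_algebra_simps[OF S_carrier[OF k]] by auto

lemma diagonal_in_centralizer:
  assumes M: "diagonal M B" and B: "\<And>k. k < m \<Longrightarrow> B k \<in> carrier (centralizer_algebra (S k))"
  shows "M \<in> carrier (centralizer_algebra T)"
proof -
  have "T * M = M * T"
    by (rule diagonal_unique[OF diagonal_mult[OF T M] diagonal_mult[OF M T]])
      (use B in \<open>auto simp: centralizer_algebra_simps[OF S_carrier]\<close>)
  then show ?thesis unfolding centralizer_algebra_simps[OF T_carrier] using diagonalD(1)[OF M] by blast
qed

text \<open>Compression to a block is multiplicative because matrices commuting with
  \<open>T\<close> are block diagonal; for the same reason the compressions to all blocks determine
  such a matrix.\<close>

lemma ring_family_centralizer:
  assumes \<iota>: "\<And>k B. k < m \<Longrightarrow> B \<in> carrier (centralizer_algebra (S k)) \<Longrightarrow>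
    diagonal (\<iota> k B) (\<lambda>j. if j = k then B else 0\<^sub>m (d j) (d j))"
  shows "ring_family (centralizer_algebra T) m (\<lambda>k. centralizer_algebra (S k)) (\<lambda>k r. R k * r * C k) \<iota>"
proof (rule ring_family.intro)
  show "ring (centralizer_algebra T)" by (rule ring_centralizer_algebra[OF T_carrier])
  fix k assume k: "k < m"
  note sT = centralizer_algebra_simps[OF T_carrier] and sS = centralizer_algebra_simps[OF S_carrier[OF k]]
  note Rk = R_carrier[OF k] and Ck = C_carrier[OF k]
  show rS: "ring (centralizer_algebra (S k))" by (rule ring_centralizer_algebra[OF S_carrier[OF k]])
  show "(\<lambda>r. R k * r * C k) \<in> ring_hom (centralizer_algebra T) (centralizer_algebra (S k))"
  proof (rule ring_hom_memI)
    fix r s assume r: "r \<in> carrier (centralizer_algebra T)" and s: "s \<in> carrier (centralizer_algebra T)"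
    have c: "r \<in> carrier_mat n n" "s \<in> carrier_mat n n" using r s unfolding sT by auto
    show "R k * (r \<otimes>\<^bsub>centralizer_algebra T\<^esub> s) * C k =
        (R k * r * C k) \<otimes>\<^bsub>centralizer_algebra (S k)\<^esub> (R k * s * C k)"
      unfolding sT sS
      using diagonalD(3)[OF diagonal_mult[OF centralizer_diagonal[OF r] centralizer_diagonal[OF s]] k k] by simp
    have Rrs: "R k * r \<in> carrier_mat (d k) n" "R k * s \<in> carrier_mat (d k) n" using Rk c by auto
    show "R k * (r \<oplus>\<^bsub>centralizer_algebra T\<^esub> s) * C k =
        (R k * r * C k) \<oplus>\<^bsub>centralizer_algebra (S k)\<^esub> (R k * s * C k)"
      unfolding sT sS mult_add_distrib_mat[OF Rk c] by (rule add_mult_distrib_mat[OF Rrs Ck])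
  next
    show "R k * \<one>\<^bsub>centralizer_algebra T\<^esub> * C k = \<one>\<^bsub>centralizer_algebra (S k)\<^esub>"
      unfolding sT sS using diagonalD(3)[OF diagonal_one k k] by simp
  qed (rule block_in_centralizer[OF _ k])
  fix B assume B: "B \<in> carrier (centralizer_algebra (S k))"
  have z: "0\<^sub>m (d j) (d j) \<in> carrier (centralizer_algebra (S j))" if "j < m" for j
    using S_carrier[OF that] unfolding centralizer_algebra_simps[OF S_carrier[OF that]] by simp
  show "\<iota> k B \<in> carrier (centralizer_algebra T)"
    by (rule diagonal_in_centralizer[OF \<iota>[OF k B]]) (use B z in auto)
  fix j assume j: "j < m"
  show "R j * \<iota> k B * C j = (if j = k then B else \<zero>\<^bsub>centralizer_algebra (S j)\<^esub>)"
    unfolding centralizer_algebra_simps[OF S_carrier[OF j]] using diagonalD(3)[OF \<iota>[OF k B] j j] by simp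
next
  fix r s assume rs: "r \<in> carrier (centralizer_algebra T)" "s \<in> carrier (centralizer_algebra T)"
    "\<And>k. k < m \<Longrightarrow> R k * r * C k = R k * s * C k"
  then show "r = s" using diagonal_unique[OF centralizer_diagonal centralizer_diagonal] by blast
qed

lemma pmat_zero_if_blocks_zero:
  assumes z: "\<And>k. k < m \<Longrightarrow> pmat (S k) g = 0\<^sub>m (d k) (d k)"
  shows "pmat T g = 0\<^sub>m n n"
proof (rule col_inj[OF pmat_carrier[OF T_carrier] zero_carrier_mat])
  fix k assume k: "k < m"
  show "pmat T g * C k = 0\<^sub>m n n * C k"
    unfolding pmat_intertwine[OF T_carrier S_carrier[OF k] C_carrier[OF k] diagonal_C[OF T k]] z[OF k]
    using C_carrier[OF k] by simp
qed

end

lemma block_embedding_conj: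
  assumes "block_embedding n m d R C" and P: "P \<in> carrier_mat n n" and Q: "Q \<in> carrier_mat n n"
    and PQ: "P * Q = 1\<^sub>m n" and QP: "Q * P = 1\<^sub>m n"
  shows "block_embedding n m d (\<lambda>k. R k * Q) (\<lambda>k. P * C k)"
    "k < m \<Longrightarrow> j < m \<Longrightarrow> M \<in> carrier_mat n n \<Longrightarrow> R k * Q * (P * M * Q) * (P * C j) = R k * M * C j"
proof -
  interpret block_embedding n m d R C by fact
  have cancelQ: "R k * Q * (P * M) = R k * M" if k: "k < m" and M: "M \<in> carrier_mat n q" for k M q
  proof -
    have "R k * Q * (P * M) = R k * (Q * P * M)"
      using R_carrier[OF k] P Q M by (simp add: assoc_mult_mat[of _ _ n _ n _ q])
    then show ?thesis unfolding QP using M by simp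
  qed
  have cancelP: "M * Q * (P * C k) = M * C k" if k: "k < m" and M: "M \<in> carrier_mat q n" for k M q
  proof -
    have PC: "P * C k \<in> carrier_mat n (d k)" using P C_carrier[OF k] by simp
    have "M * Q * (P * C k) = M * (Q * P * C k)"
      unfolding assoc_mult_mat[OF M Q PC] assoc_mult_mat[OF Q P C_carrier[OF k]] ..
    then show ?thesis unfolding QP using C_carrier[OF k] by simp
  qed
  show "block_embedding n m d (\<lambda>k. R k * Q) (\<lambda>k. P * C k)"
  proof
    fix k assume k: "k < m"
    show "R k * Q \<in> carrier_mat (d k) n" "P * C k \<in> carrier_mat n (d k)" using P Q R_carrier[OF k] C_carrier[OF k] by auto
    fix j assume "j < m"
    then show "R j * Q * (P * C k) = (if j = k then 1\<^sub>m (d k) else 0\<^sub>m (d j) (d k))"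
      using cancelP[OF k R_carrier] RC[OF _ k] by simp
  next
    fix M M' :: "'a mat" and q assume M: "M \<in> carrier_mat n q" "M' \<in> carrier_mat n q" "\<And>k. k < m \<Longrightarrow> R k * Q * M = R k * Q * M'"
    have "Q * M = Q * M'"
    proof (rule row_inj[of _ q])
      fix k assume k: "k < m"
      show "R k * (Q * M) = R k * (Q * M')"
        unfolding assoc_mult_mat[OF R_carrier[OF k] Q M(1), symmetric] assoc_mult_mat[OF R_carrier[OF k] Q M(2), symmetric]
        by (rule M(3)[OF k])
    qed (use M Q in auto)
    then have "P * (Q * M) = P * (Q * M')" by simp
    then show "M = M'" using M unfolding assoc_mult_mat[OF P Q M(1), symmetric] assoc_mult_mat[OF P Q M(2), symmetric] PQ by simp
  next
    fix M M' :: "'a mat" and q assume M: "M \<in> carrier_mat q n" "M' \<in> carrier_mat q n" "\<And>k. k < m \<Longrightarrow> M * (P * C k) = M' * (P * C k)"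
    have "M * P = M' * P"
    proof (rule col_inj[of _ q])
      fix k assume k: "k < m"
      show "M * P * C k = M' * P * C k"
        unfolding assoc_mult_mat[OF M(1) P C_carrier[OF k]] assoc_mult_mat[OF M(2) P C_carrier[OF k]] by (rule M(3)[OF k])
    qed (use M P in auto)
    then have "M * P * Q = M' * P * Q" by simp
    then show "M = M'" using M unfolding assoc_mult_mat[OF M(1) P Q] assoc_mult_mat[OF M(2) P Q] PQ by simp
  qed
  assume k: "k < m" and j: "j < m" and M: "M \<in> carrier_mat n n"
  have MQ: "M * Q \<in> carrier_mat n n" and RM: "R k * M \<in> carrier_mat (d k) n" using M Q R_carrier[OF k] by auto
  have "R k * Q * (P * M * Q) = R k * M * Q"
    unfolding assoc_mult_mat[OF P M Q] cancelQ[OF k MQ] assoc_mult_mat[OF R_carrier[OF k] M Q] ..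
  then show "R k * Q * (P * M * Q) * (P * C j) = R k * M * C j" using cancelP[OF j RM] by simp
qed

section \<open>Block coordinates of a concrete block diagonal matrix\<close>

text \<open>The rows of the identity matrix that belong to block \<open>k\<close>.\<close>

definition row_block :: "'k::field mat list \<Rightarrow> nat \<Rightarrow> 'k mat" where
  "row_block As k = mat (dim_row (As ! k)) (sum_list (map dim_row As))
    (\<lambda>(a, i). if i = block_offset As k + a then 1 else 0)"

abbreviation col_block :: "'k::field mat list \<Rightarrow> nat \<Rightarrow> 'k mat" where
  "col_block As k \<equiv> transpose_mat (row_block As k)"

lemma row_block_mult:
  assumes "k < length As" "a < dim_row (As ! k)" "M \<in> carrier_mat (sum_list (map dim_row As)) q" "j < q"
  shows "(row_block As k * M) $$ (a, j) = M $$ (block_offset As k + a, j)"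
  using assms block_offset_bound[OF assms(1,2)]
  by (simp add: row_block_def scalar_prod_def if_distrib[of "\<lambda>z. z * _"] cong: if_cong)

lemma col_block_mult:
  assumes "k < length As" "b < dim_row (As ! k)" "M \<in> carrier_mat q (sum_list (map dim_row As))" "i < q"
  shows "(M * col_block As k) $$ (i, b) = M $$ (i, block_offset As k + b)"
  using assms block_offset_bound[OF assms(1,2)]
  by (simp add: row_block_def scalar_prod_def if_distrib[of "\<lambda>z. _ * z"] cong: if_cong)

lemma row_block_carrier: "row_block As k \<in> carrier_mat (dim_row (As ! k)) (sum_list (map dim_row As))"
  unfolding row_block_def by simp

lemma row_col_block_mult:
  assumes jk: "j < length As" "k < length As" "a < dim_row (As ! j)" "b < dim_row (As ! k)"
    and M: "M \<in> carrier_mat (sum_list (map dim_row As)) (sum_list (map dim_row As))"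
  shows "(row_block As j * M * col_block As k) $$ (a, b) = M $$ (block_offset As j + a, block_offset As k + b)"
  using col_block_mult[OF jk(2,4) mult_carrier_mat[OF row_block_carrier M] jk(3)]
    row_block_mult[OF jk(1,3) M block_offset_bound[OF jk(2,4)]] by simp

lemma block_embedding_row_block:
  "block_embedding (sum_list (map dim_row As)) (length As) (\<lambda>k. dim_row (As ! k)) (row_block As) (col_block As :: nat \<Rightarrow> 'k::field mat)"
proof
  let ?N = "sum_list (map dim_row As)"
  show "row_block As k \<in> carrier_mat (dim_row (As ! k)) ?N" "col_block As k \<in> carrier_mat ?N (dim_row (As ! k))" for k
    using row_block_carrier[of As k] by auto
  fix j k assume jk: "j < length As" "k < length As"
  show "row_block As j * col_block As k = (if j = k then 1\<^sub>m (dim_row (As ! k)) else 0\<^sub>m (dim_row (As ! j)) (dim_row (As ! k)))"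
  proof (rule eq_matI)
    fix a b assume "a < dim_row (if j = k then 1\<^sub>m (dim_row (As ! k)) else 0\<^sub>m (dim_row (As ! j)) (dim_row (As ! k)) :: 'k mat)"
      "b < dim_col (if j = k then 1\<^sub>m (dim_row (As ! k)) else 0\<^sub>m (dim_row (As ! j)) (dim_row (As ! k)) :: 'k mat)"
    then have ab: "a < dim_row (As ! j)" "b < dim_row (As ! k)" by (auto split: if_splits)
    have "(row_block As j * col_block As k) $$ (a, b) = row_block As j $$ (a, block_offset As k + b)"
      by (rule col_block_mult[OF jk(2) ab(2) row_block_carrier ab(1)])
    then show "(row_block As j * col_block As k) $$ (a, b) =
        (if j = k then 1\<^sub>m (dim_row (As ! k)) else 0\<^sub>m (dim_row (As ! j)) (dim_row (As ! k))) $$ (a, b)"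
      using ab jk block_offset_bound[OF jk(2) ab(2)] block_offset_inj[OF jk(2,1) ab(2,1)]
      by (auto simp: row_block_def)
  qed (auto simp: row_block_def)
next
  fix M M' :: "'k mat" and q
  assume M: "M \<in> carrier_mat (sum_list (map dim_row As)) q" "M' \<in> carrier_mat (sum_list (map dim_row As)) q"
    "\<And>k. k < length As \<Longrightarrow> row_block As k * M = row_block As k * M'"
  show "M = M'"
  proof (rule eq_matI)
    fix i j assume ij: "i < dim_row M'" "j < dim_col M'"
    then obtain k a where k: "k < length As" "a < dim_row (As ! k)" "i = block_offset As k + a" and j: "j < q"
      using block_offset_cover[of i As] M(2) by auto
    show "M $$ (i, j) = M' $$ (i, j)"
      unfolding k(3) row_block_mult[OF k(1,2) M(1) j, symmetric] row_block_mult[OF k(1,2) M(2) j, symmetric] M(3)[OF k(1)] ..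
  qed (use M in auto)
next
  fix M M' :: "'k mat" and q
  assume M: "M \<in> carrier_mat q (sum_list (map dim_row As))" "M' \<in> carrier_mat q (sum_list (map dim_row As))"
    "\<And>k. k < length As \<Longrightarrow> M * col_block As k = M' * col_block As k"
  show "M = M'"
  proof (rule eq_matI)
    fix i j assume ij: "i < dim_row M'" "j < dim_col M'"
    then obtain k a where k: "k < length As" "a < dim_row (As ! k)" "j = block_offset As k + a" and i: "i < q"
      using block_offset_cover[of j As] M(2) by auto
    show "M $$ (i, j) = M' $$ (i, j)"
      unfolding k(3) col_block_mult[OF k(1,2) M(1) i, symmetric] col_block_mult[OF k(1,2) M(2) i, symmetric] M(3)[OF k(1)] ..
  qed (use M in auto)
qed

lemma diagonal_diag_block_mat:
  assumes sq: "\<And>B. B \<in> set Bs \<Longrightarrow> square_mat B" and dims: "map dim_row Bs = map dim_row As"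
  shows "block_embedding.diagonal (sum_list (map dim_row As)) (length As) (\<lambda>k. dim_row (As ! k)) (row_block As) (col_block As)
    (diag_block_mat Bs) (\<lambda>k. Bs ! k :: 'k::field mat)"
proof -
  interpret block_embedding "sum_list (map dim_row As)" "length As" "\<lambda>k. dim_row (As ! k)" "row_block As" "col_block As :: nat \<Rightarrow> 'k mat"
    by (rule block_embedding_row_block)
  let ?N = "sum_list (map dim_row As)"
  have len: "length Bs = length As" using map_eq_imp_length_eq[OF dims] .
  have dim: "dim_row (Bs ! k) = dim_row (As ! k)" if "k < length As" for k
    using dims len that by (metis nth_map)
  have cB: "Bs ! k \<in> carrier_mat (dim_row (As ! k)) (dim_row (As ! k))" if "k < length As" for k
    using sq[of "Bs ! k"] dim[OF that] len that by auto
  have "map dim_col Bs = map dim_row Bs" using sq by auto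
  then have D: "diag_block_mat Bs \<in> carrier_mat ?N ?N"
    using dim_diag_block_mat[of Bs] unfolding dims by auto
  have off: "block_offset As = block_offset Bs" by (rule block_offset_cong[OF dims[symmetric]])
  have "row_block As j * diag_block_mat Bs * col_block As k = (if j = k then Bs ! k else 0\<^sub>m (dim_row (As ! j)) (dim_row (As ! k)))"
    if jk: "j < length As" "k < length As" for j k
  proof (rule eq_matI)
    let ?M = "if j = k then Bs ! k else 0\<^sub>m (dim_row (As ! j)) (dim_row (As ! k))"
    fix a b assume "a < dim_row ?M" "b < dim_col ?M"
    then have ab: "a < dim_row (As ! j)" "b < dim_row (As ! k)" using cB[OF jk(2)] by (auto split: if_splits)
    show "(row_block As j * diag_block_mat Bs * col_block As k) $$ (a, b) = ?M $$ (a, b)"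
      unfolding row_col_block_mult[OF jk ab D] off
      using diag_block_mat_entry[of Bs j k a b, OF sq] jk ab len dim by simp
  qed (use cB[OF jk(2)] in \<open>auto simp: row_block_def\<close>)
  then show ?thesis unfolding diagonal_def using D cB by blast
qed

section \<open>From primary decompositions to block coordinates\<close>

text \<open>The coordinates of the block diagonal matrix are conjugated by \<open>P\<close> and
  \<open>Q\<close>. Each block is annihilated by its own characteristic polynomial, and these are
  powers of distinct monic irreducibles, hence pairwise coprime.\<close>

lemma primary_decomposition_blocks:
  fixes T :: "'k::field mat"
  assumes T: "T \<in> carrier_mat n n" and dec: "primary_decomposition T ps Ts P Q"
  obtains R C f where
    "primary_blocks n (length ps) (\<lambda>k. dim_row (Ts ! k)) R C T ((!) Ts) f"
    "\<And>k. k < length ps \<Longrightarrow> \<exists>N. f k = (ps ! k) ^ N"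
    "\<And>k B. k < length ps \<Longrightarrow> B \<in> carrier_mat (dim_row (Ts ! k)) (dim_row (Ts ! k)) \<Longrightarrow>
      block_embedding.diagonal n (length ps) (\<lambda>k. dim_row (Ts ! k)) R C
        (P * diag_block_mat (map (\<lambda>j. if j = k then B else 0\<^sub>m (dim_row (Ts ! j)) (dim_row (Ts ! j))) [0..<length Ts]) * Q)
        (\<lambda>j. if j = k then B else 0\<^sub>m (dim_row (Ts ! j)) (dim_row (Ts ! j)))"
proof -
  have dist: "distinct ps" and sps: "set ps = irreducible_factors (char_poly T)" and len: "length Ts = length ps"
    and sq: "\<And>k. k < length ps \<Longrightarrow> square_mat (Ts ! k)" and cp: "\<And>k. k < length ps \<Longrightarrow> \<exists>e. char_poly (Ts ! k) = (ps ! k) ^ e"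
    and sim: "similar_mat_wit T (diag_block_mat Ts) P Q"
    using dec unfolding primary_decomposition_def by blast+
  note w = similar_mat_witD2[OF T sim]
  let ?d = "\<lambda>k. dim_row (Ts ! k)"
  have N: "sum_list (map dim_row Ts) = n" using w(5) dim_diag_block_mat(1)[of Ts] by simp
  let ?R = "\<lambda>k. row_block Ts k * Q" and ?C = "\<lambda>k. P * col_block Ts k"
  have emb0: "block_embedding n (length ps) ?d (row_block Ts) (col_block Ts)"
    using block_embedding_row_block[of Ts] unfolding N len .
  note conj = block_embedding_conj[OF emb0 w(6,7,1,2)]
  interpret e0: block_embedding n "length ps" ?d "row_block Ts" "col_block Ts" by (rule emb0)
  interpret e: block_embedding n "length ps" ?d ?R ?C by (rule conj(1))
  have diag: "e.diagonal (P * diag_block_mat Bs * Q) (\<lambda>k. Bs ! k)"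
    if "\<And>B. B \<in> set Bs \<Longrightarrow> square_mat B" "map dim_row Bs = map dim_row Ts" for Bs
  proof -
    have 0: "e0.diagonal (diag_block_mat Bs) (\<lambda>k. Bs ! k)"
      using diagonal_diag_block_mat[OF that] unfolding N len .
    have "P * diag_block_mat Bs * Q \<in> carrier_mat n n" using w e0.diagonalD(1)[OF 0] by simp
    then show ?thesis
      unfolding e.diagonal_def using e0.diagonalD[OF 0] conj(2) by simp
  qed
  have sqT: "square_mat B" if "B \<in> set Ts" for B using that sq unfolding len[symmetric] in_set_conv_nth by blast
  have TD: "e.diagonal T (\<lambda>k. Ts ! k)" using diag[OF sqT refl] w(3) by simp
  obtain e where e: "\<And>k. k < length ps \<Longrightarrow> char_poly (Ts ! k) = (ps ! k) ^ e k" using cp by metis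
  have irr: "Factorial_Ring.irreducible (ps ! k)" "Polynomial.lead_coeff (ps ! k) = 1" if "k < length ps" for k
    using sps nth_mem[OF that] unfolding irreducible_factors_def by auto
  have pb: "primary_blocks n (length ps) ?d ?R ?C T ((!) Ts) (\<lambda>k. (ps ! k) ^ e k)"
  proof
    show "e.diagonal T ((!) Ts)" by (rule TD)
    show "pmat (Ts ! k) ((ps ! k) ^ e k) = 0\<^sub>m (?d k) (?d k)" if "k < length ps" for k
      unfolding e[OF that, symmetric] by (rule cayley_hamilton) (use sq[OF that] in auto)
    show "Rings.coprime ((ps ! j) ^ e j) ((ps ! k) ^ e k)" if "j < length ps" "k < length ps" "j \<noteq> k" for j k
    proof -
      have "ps ! j \<noteq> ps ! k" using nth_eq_iff_index_eq[OF dist that(1,2)] that(3) by blast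
      then show ?thesis using irr that by (intro coprime_poly_power monic_irreducible_coprime) blast+
    qed
  qed
  have io: "e.diagonal (P * diag_block_mat (map (\<lambda>j. if j = k then B else 0\<^sub>m (?d j) (?d j)) [0..<length Ts]) * Q)
        (\<lambda>j. if j = k then B else 0\<^sub>m (?d j) (?d j))"
    if k: "k < length ps" and B: "B \<in> carrier_mat (?d k) (?d k)" for k B
  proof -
    let ?Bs = "map (\<lambda>j. if j = k then B else 0\<^sub>m (?d j) (?d j)) [0..<length Ts]"
    have "map dim_row ?Bs = map dim_row Ts" by (rule nth_equalityI) (use B in auto)
    moreover have "square_mat M" if "M \<in> set ?Bs" for M using that B by (auto split: if_splits)
    ultimately have "e.diagonal (P * diag_block_mat ?Bs * Q) (\<lambda>j. ?Bs ! j)" by (intro diag)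
    then show ?thesis by (rule e.diagonal_cong) (simp add: len)
  qed
  show thesis by (rule that[OF pb _ io]) blast+
qed

text \<open>If block \<open>k\<close> were empty, the product of the other annihilators would kill
  \<open>T\<close>. The characteristic polynomial, and with it \<open>ps ! k\<close>, would then
  divide a power of that product, to which \<open>ps ! k\<close> is coprime. Positivity is what
  makes the associated partition nonempty.\<close>

lemma primary_block_positive:
  fixes T :: "'k::field mat"
  assumes Tc: "T \<in> carrier_mat n n" and dec: "primary_decomposition T ps Ts P Q" and k: "k < length ps"
  shows "0 < dim_row (Ts ! k)"
proof (rule ccontr)
  assume "\<not> 0 < dim_row (Ts ! k)"
  then have d0: "dim_row (Ts ! k) = 0" by simp
  obtain R C f where pb: "primary_blocks n (length ps) (\<lambda>k. dim_row (Ts ! k)) R C T ((!) Ts) f"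
    and f: "\<And>k. k < length ps \<Longrightarrow> \<exists>N. f k = (ps ! k) ^ N"
    using primary_decomposition_blocks[OF Tc dec] by metis
  interpret primary_blocks n "length ps" "\<lambda>k. dim_row (Ts ! k)" R C T "(!) Ts" f by (rule pb)
  have dist: "distinct ps" and sps: "set ps = irreducible_factors (char_poly T)"
    using dec unfolding primary_decomposition_def by blast+
  have irr: "Factorial_Ring.irreducible (ps ! j)" "Polynomial.lead_coeff (ps ! j) = 1" "ps ! j dvd char_poly T"
    if "j < length ps" for j
    using sps nth_mem[OF that] unfolding irreducible_factors_def by auto
  let ?S = "{..<length ps} - {k}"
  have "pmat T (\<Prod>j\<in>?S. f j) = 0\<^sub>m n n"
  proof (rule pmat_zero_if_blocks_zero)
    fix j assume j: "j < length ps"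
    note Sj = S_carrier[OF j]
    show "pmat (Ts ! j) (\<Prod>j\<in>?S. f j) = 0\<^sub>m (dim_row (Ts ! j)) (dim_row (Ts ! j))"
    proof (cases "j = k")
      case True
      then show ?thesis using pmat_carrier[OF Sj] d0 by (intro eq_matI) auto
    next
      case False
      then show ?thesis using j by (intro pmat_dvd_zero[OF Sj _ ann[OF j]] dvd_prodI) auto
    qed
  qed
  then have "char_poly T dvd (\<Prod>j\<in>?S. f j) ^ n" by (rule char_poly_dvd_power[OF Tc])
  then have d: "ps ! k dvd (\<Prod>j\<in>?S. f j) ^ n" using irr(3)[OF k] dvd_trans by blast
  have "Rings.coprime ((\<Prod>j\<in>?S. f j) ^ n) ((ps ! k) ^ 1)"
  proof (intro coprime_poly_power coprime_poly_prod_left)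
    fix j assume j: "j \<in> ?S"
    then have "ps ! j \<noteq> ps ! k" using nth_eq_iff_index_eq[OF dist _ k] by auto
    then have "Rings.coprime (ps ! j) (ps ! k)" using irr j k by (intro monic_irreducible_coprime) auto
    then have "Rings.coprime ((ps ! j) ^ N) ((ps ! k) ^ 1)" for N by (rule coprime_poly_power)
    then show "Rings.coprime (f j) (ps ! k)" using f j by fastforce
  qed
  then have "is_unit (ps ! k)" using d unfolding Rings.coprime_def by simp
  then show False using irr(1)[OF k] unfolding Factorial_Ring.irreducible_def by blast
qed

section \<open>Cartan matrices and blocks\<close>

context
  fixes T :: "'k::field mat" and n ps Ts P Q
  assumes perfect: "perfect_field TYPE('k)"
    and Tc: "T \<in> carrier_mat n n" and dec: "primary_decomposition T ps Ts P Q"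
begin

lemma primary_block_facts:
  assumes k: "k < length ps"
  shows "separable_irreducible (ps ! k)" "Ts ! k \<in> carrier_mat (dim_row (Ts ! k)) (dim_row (Ts ! k))"
    "\<exists>lam. associated_partition (ps ! k) (Ts ! k) lam"
proof -
  have irr: "Factorial_Ring.irreducible (ps ! k)"
    using dec nth_mem[OF k] unfolding primary_decomposition_def irreducible_factors_def by auto
  show si: "separable_irreducible (ps ! k)"
    using irr perfect_not_dvd_pderiv[OF perfect irr]
    by (intro separable_irreducible.intro irreducible_poly.intro separable_irreducible_axioms.intro)
  show c: "Ts ! k \<in> carrier_mat (dim_row (Ts ! k)) (dim_row (Ts ! k))"
    using dec k unfolding primary_decomposition_def by auto
  obtain e where "char_poly (Ts ! k) = (ps ! k) ^ e" using dec k unfolding primary_decomposition_def by blast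
  then have "pmat (Ts ! k) ((ps ! k) ^ e) = 0\<^sub>m (dim_row (Ts ! k)) (dim_row (Ts ! k))"
    using cayley_hamilton[OF c] by simp
  then show "\<exists>lam. associated_partition (ps ! k) (Ts ! k) lam"
    by (rule separable_irreducible.associated_partition_exists[OF si c primary_block_positive[OF Tc dec k]])
qed

lemma primary_block_centralizer:
  assumes "k < length ps" "associated_partition (ps ! k) (Ts ! k) lam"
  shows "is_cartan_matrix (centralizer_algebra (Ts ! k)) (min_matrix lam)"
    "is_block (centralizer_algebra (Ts ! k)) (carrier (centralizer_algebra (Ts ! k)))"
    "principal_indecomposable (centralizer_algebra (Ts ! k)) L \<Longrightarrow>
      \<exists>Ns. composition_series (centralizer_algebra (Ts ! k)) (left_ideal_module (centralizer_algebra (Ts ! k)) L) Ns"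
  using separable_irreducible.centralizer_of_associated_partition[OF primary_block_facts(1,2)[OF assms(1)] assms(2)]
  by blast+

lemma primary_ring_family:
  obtains \<pi> where "ring_family (centralizer_algebra T) (length ps) (\<lambda>k. centralizer_algebra (Ts ! k)) \<pi>
    (\<lambda>k B. P * diag_block_mat (map (\<lambda>j. if j = k then B else 0\<^sub>m (dim_row (Ts ! j)) (dim_row (Ts ! j))) [0..<length Ts]) * Q)"
proof (rule primary_decomposition_blocks[OF Tc dec])
  fix R C f
  assume pb: "primary_blocks n (length ps) (\<lambda>k. dim_row (Ts ! k)) R C T ((!) Ts) f"
    and io: "\<And>k B. k < length ps \<Longrightarrow> B \<in> carrier_mat (dim_row (Ts ! k)) (dim_row (Ts ! k)) \<Longrightarrow>
      block_embedding.diagonal n (length ps) (\<lambda>k. dim_row (Ts ! k)) R C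
        (P * diag_block_mat (map (\<lambda>j. if j = k then B else 0\<^sub>m (dim_row (Ts ! j)) (dim_row (Ts ! j))) [0..<length Ts]) * Q)
        (\<lambda>j. if j = k then B else 0\<^sub>m (dim_row (Ts ! j)) (dim_row (Ts ! j)))"
  show thesis
  proof (rule that, rule primary_blocks.ring_family_centralizer[OF pb], rule io)
    fix k B assume k: "k < length ps" and B: "B \<in> carrier (centralizer_algebra (Ts ! k))"
    show "B \<in> carrier_mat (dim_row (Ts ! k)) (dim_row (Ts ! k))"
      using B unfolding centralizer_algebra_simps[OF primary_block_facts(2)[OF k]] by blast
  qed
qed

lemma primary_ideals_are_blocks:
  "bij_betw (primary_ideal Ts P Q) {..<length ps} {B. is_block (centralizer_algebra T) B}"
proof -
  obtain \<pi> where fam: "ring_family (centralizer_algebra T) (length ps) (\<lambda>k. centralizer_algebra (Ts ! k)) \<pi>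
    (\<lambda>k B. P * diag_block_mat (map (\<lambda>j. if j = k then B else 0\<^sub>m (dim_row (Ts ! j)) (dim_row (Ts ! j))) [0..<length Ts]) * Q)"
    using primary_ring_family .
  have "primary_ideal Ts P Q = (\<lambda>k. (\<lambda>B. P * diag_block_mat (map (\<lambda>j. if j = k then B else 0\<^sub>m (dim_row (Ts ! j)) (dim_row (Ts ! j)))
      [0..<length Ts]) * Q) ` carrier (centralizer_algebra (Ts ! k)))"
    unfolding primary_ideal_def by (rule ext) blast
  moreover have "is_block (centralizer_algebra (Ts ! k)) (carrier (centralizer_algebra (Ts ! k)))" if k: "k < length ps" for k
    using primary_block_centralizer(2)[OF k] primary_block_facts(3)[OF k] by blast
  ultimately show ?thesis using ring_family.blocks_bij_betw[OF fam] by simp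
qed

lemma cartan_matrix_direct_sum:
  assumes len: "length Cs = length ps"
    and Cs: "\<And>k. k < length ps \<Longrightarrow> is_cartan_matrix (centralizer_algebra (Ts ! k)) (Cs ! k)"
  shows "is_cartan_matrix (centralizer_algebra T) (diag_block_mat Cs)"
proof -
  define \<iota> where "\<iota> = (\<lambda>k B. P * diag_block_mat (map (\<lambda>j. if j = k then B else 0\<^sub>m (dim_row (Ts ! j)) (dim_row (Ts ! j)))
    [0..<length Ts]) * Q)"
  obtain \<pi> where fam: "ring_family (centralizer_algebra T) (length ps) (\<lambda>k. centralizer_algebra (Ts ! k)) \<pi> \<iota>"
    using primary_ring_family unfolding \<iota>_def .
  obtain Pss where Pss: "\<And>k. k < length ps \<Longrightarrow> pim_representatives (centralizer_algebra (Ts ! k)) (Pss k)"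
    "\<And>k. k < length ps \<Longrightarrow> Cs ! k = cartan_matrix (centralizer_algebra (Ts ! k)) (Pss k)"
    using Cs unfolding is_cartan_matrix_def by metis
  have pim: "principal_indecomposable (centralizer_algebra (Ts ! k)) P" if "k < length ps" "P \<in> set (Pss k)" for k P
    using Pss(1)[OF that(1)] that(2) unfolding pim_representatives_def by blast
  have "Cs = map (\<lambda>k. cartan_matrix (centralizer_algebra (Ts ! k)) (Pss k)) [0..<length ps]"
    by (rule nth_equalityI) (use len Pss(2) in auto)
  moreover have "cartan_matrix (centralizer_algebra T) (concat (map (\<lambda>k. map (image (\<iota> k)) (Pss k)) [0..<length ps])) =
      diag_block_mat (map (\<lambda>k. cartan_matrix (centralizer_algebra (Ts ! k)) (Pss k)) [0..<length ps])"
  proof (rule ring_family.cartan_matrix_concat[OF fam])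
    fix k P assume k: "k < length ps" and P: "P \<in> set (Pss k)"
    show "submodule P (centralizer_algebra (Ts ! k)) (regular_module (centralizer_algebra (Ts ! k)))"
      using pim[OF k P] unfolding principal_indecomposable_def by blast
    show "\<exists>Ns. composition_series (centralizer_algebra (Ts ! k)) (left_ideal_module (centralizer_algebra (Ts ! k)) P) Ns"
      using primary_block_centralizer(3)[OF k _ pim[OF k P]] primary_block_facts(3)[OF k] by blast
  qed
  ultimately have "diag_block_mat Cs = cartan_matrix (centralizer_algebra T) (concat (map (\<lambda>k. map (image (\<iota> k)) (Pss k)) [0..<length ps]))"
    by simp
  then show ?thesis
    unfolding is_cartan_matrix_def
    using ring_family.pim_representatives_concat[OF fam, of Pss, OF Pss(1)] by blast
qed

end

theorem mainTheorem2:
  assumes perfect: "perfect_field TYPE('k::field)"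
  shows
    "(\<forall>(p::'k poly) lam. Factorial_Ring.irreducible p \<and> exp_partition lam \<longrightarrow>
       (let M = M_lam (residue_field p) lam;
            Ps = map (pim_lam (residue_field p) lam) [0..<length lam]
        in pim_representatives M Ps \<and>
           cartan_matrix M Ps = min_matrix lam \<and>
           (\<exists>!B. is_block M B)))
     \<and>
     (\<forall>n. \<forall>T\<in>carrier_mat n n.
       (\<exists>(ps::'k poly list) Ts P Q. primary_decomposition T ps Ts P Q) \<and>
       (\<forall>ps Ts P Q. primary_decomposition T ps Ts P Q \<longrightarrow>
          bij_betw (primary_ideal Ts P Q) {..<length ps} {B. is_block (centralizer_algebra T) B} \<and>
          (\<forall>Cs. length Cs = length ps \<and>
             (\<forall>k<length ps. is_cartan_matrix (centralizer_algebra (Ts ! k)) (Cs ! k)) \<longrightarrow>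
             is_cartan_matrix (centralizer_algebra T) (diag_block_mat Cs)) \<and>
          (\<forall>k<length ps.
             (\<exists>lam. associated_partition (ps ! k) (Ts ! k) lam) \<and>
             (\<forall>lam. associated_partition (ps ! k) (Ts ! k) lam \<longrightarrow>
                is_cartan_matrix (centralizer_algebra (Ts ! k)) (min_matrix lam)))))"
proof (intro conjI allI impI ballI)
  fix p :: "'k poly" and lam
  assume "Factorial_Ring.irreducible p \<and> exp_partition lam"
  then have irr: "Factorial_Ring.irreducible p" and lam: "exp_partition lam" by blast+
  interpret lam_algebra p lam
    by (intro lam_algebra.intro separable_irreducible.intro irreducible_poly.intro separable_irreducible_axioms.intro
      lam_algebra_axioms.intro irr perfect_not_dvd_pderiv[OF perfect irr] lam)
  show "let M = M_lam (residue_field p) lam; Ps = map (pim_lam (residue_field p) lam) [0..<length lam]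
    in pim_representatives M Ps \<and> cartan_matrix M Ps = min_matrix lam \<and> (\<exists>!B. is_block M B)"
    unfolding Let_def using M_lam_cartan unique_block[OF R_ring M_lam_cartan(3)] by blast
next
  fix n and T :: "'k mat"
  assume T: "T \<in> carrier_mat n n"
  show "\<exists>(ps::'k poly list) Ts P Q. primary_decomposition T ps Ts P Q" by (rule primary_decomposition_exists[OF T])
  fix ps :: "'k poly list" and Ts P Q
  assume dec: "primary_decomposition T ps Ts P Q"
  show "bij_betw (primary_ideal Ts P Q) {..<length ps} {B. is_block (centralizer_algebra T) B}"
    by (rule primary_ideals_are_blocks[OF perfect T dec])
  show "is_cartan_matrix (centralizer_algebra T) (diag_block_mat Cs)"
    if "length Cs = length ps \<and> (\<forall>k<length ps. is_cartan_matrix (centralizer_algebra (Ts ! k)) (Cs ! k))" for Cs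
    by (rule cartan_matrix_direct_sum[OF perfect T dec]) (use that in blast)+
  fix k assume k: "k < length ps"
  show "\<exists>lam. associated_partition (ps ! k) (Ts ! k) lam" by (rule primary_block_facts(3)[OF perfect T dec k])
  show "is_cartan_matrix (centralizer_algebra (Ts ! k)) (min_matrix lam)"
    if "associated_partition (ps ! k) (Ts ! k) lam" for lam
    by (rule primary_block_centralizer(1)[OF perfect T dec k that])
qed

end
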